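(* Let $f$ be a real rational map of degree $d\geq2$ with $h_{\mathbb R}(f)=\log(d)$. Then the Julia set $\mathcal J(f)$ is contained in $\hat{\mathbb R}$ and either coincides with $\hat{\mathbb R}$, or is a subinterval of it, or is a Cantor subset of it. Moreover, in terms of Blaschke products $$B(z)=e^{2\pi i c}\prod_{i=1}^d\frac{z-a_i}{1-\bar a_i z}\qquad(|a_1|,\dots,|a_d|<1,\ c\in\mathbb R/\mathbb Z),$$ which preserve the unit circle instead of $\hat{\mathbb R}$: (i) The map $B$ is hyperbolic with Julia set a Cantor subset of the unit circle if and only if there is $\theta_0\in\mathbb R/\mathbb Z$ with $$\sum_{i=1}^d\frac{1-|a_i|^2}{|e^{2\pi i\theta_0}-a_i|^2}<1$$ for which $$c\equiv (d+1)\theta_0-\frac1\pi\sum_{i=1}^d\arg(e^{2\pi i\theta_0}-a_i)\pmod{\mathbb Z}.$$ (ii) Up to conjugation with the Cayley transform $z\mapsto\frac{z-i}{z+i}$ and a biholomorphism of the unit disk, hyperbolic degree $d$ maps $f$ with $\mathcal J(f)=\hat{\mathbb R}$ are the same as Blaschke products $z\prod_{i=1}^{d-1}\frac{z-a_i}{1-\bar a_i z}$ ($|a_1|,\dots,|a_{d-1}|<1$) or their post-compositions with $z\mapsto 1/z$. (iii) Every non-hyperbolic degree $d$ map with $\mathcal J(f)=\hat{\mathbb R}$, after conjugation with a suitable real Möbius map, is of the form $\epsilon\big(z+\frac{P(z)}{Q(z)}\big)$ with non-real critical points, where $\epsilon\in\{\pm1\}$ and $P,Q$ are coprime real polynomials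 with $\deg P\leq d-1$ and $\deg Q=d-1$, the inequality being strict when $\epsilon=+1$. (iv) Every degree $d$ map $f$ whose Julia set is a subinterval of $\hat{\mathbb R}$ is, up to a real Möbius conjugacy, either the quotient of a map $$\pm z\prod_{i=1}^{d-1}\frac{z-a_i}{1-\bar a_i z}\qquad(|a_1|,\dots,|a_{d-1}|<1,\ \{a_1,\dots,a_{d-1}\}=\{\bar a_1,\dots,\bar a_{d-1}\})$$ by the action of $z\mapsto 1/z$ (which commutes with it), or the quotient of a map $\epsilon\big(z+\frac{P(z)}{Q(z)}\big)$ as in (iii) by the action of $z\mapsto -z$, provided this involution commutes with $\epsilon\big(z+\frac{P(z)}{Q(z)}\big)$, i.e. either $P$ is odd and $Q$ is even or vice versa.
   Context: $\hat{\mathbb R}=\mathbb R\cup\{\infty\}$. For $f\in\mathbb R(z)$, $h_{\mathbb R}(f):=h_{\rm top}(f\restriction_{\hat{\mathbb R}}:\hat{\mathbb R}\to\hat{\mathbb R})$. $\mathcal J(f)$ denotes the Julia set. A rational map is hyperbolic if every critical orbit converges to an attracting periodic orbit. A Cantor set is a compact, perfect, totally disconnected metric space. *)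

theory Defs
  imports "HOL-Complex_Analysis.Complex_Analysis" "HOL-Computational_Algebra.Polynomial"
begin

section \<open>The Riemann sphere as complex option (None = infinity)\<close>

text \<open>Stereographic embedding of the extended plane onto the unit sphere of R^3;
  the chordal metric and the topology of the Riemann sphere are transported from it.\<close>

definition stereo :: "complex option \<Rightarrow> real \<times> real \<times> real" where
  "stereo z = (case z of None \<Rightarrow> (0, 0, 1)
     | Some w \<Rightarrow> (2 * Re w / ((cmod w)\<^sup>2 + 1), 2 * Im w / ((cmod w)\<^sup>2 + 1),
                   ((cmod w)\<^sup>2 - 1) / ((cmod w)\<^sup>2 + 1)))"

definition cdist :: "complex option \<Rightarrow> complex option \<Rightarrow> real" where
  "cdist a b = dist (stereo a) (stereo b)"

definition sopen :: "complex option set \<Rightarrow> bool" where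
  "sopen U \<longleftrightarrow> openin (top_of_set (range stereo)) (stereo ` U)"

definition scompact :: "complex option set \<Rightarrow> bool" where
  "scompact K \<longleftrightarrow> compact (stereo ` K)"

definition sconnected :: "complex option set \<Rightarrow> bool" where
  "sconnected S \<longleftrightarrow> connected (stereo ` S)"

definition cantor_set :: "'a::metric_space set \<Rightarrow> bool" where
  "cantor_set S \<longleftrightarrow> compact S \<and> S \<noteq> {} \<and> (\<forall>x\<in>S. x islimpt S)
     \<and> (\<forall>C. C \<subseteq> S \<longrightarrow> connected C \<longrightarrow> (\<exists>a. C \<subseteq> {a}))"

definition scantor :: "complex option set \<Rightarrow> bool" where
  "scantor S \<longleftrightarrow> cantor_set (stereo ` S)"

definition Rhat :: "complex option set" where
  "Rhat = insert None (Some ` \<real>)"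

definition unit_circle :: "complex option set" where
  "unit_circle = Some ` sphere 0 1"

definition rat_eval :: "complex poly \<Rightarrow> complex poly \<Rightarrow> complex option \<Rightarrow> complex option" where
  "rat_eval p q z = (case z of
      Some w \<Rightarrow> (if poly q w = 0 then None else Some (poly p w / poly q w))
    | None \<Rightarrow> (if degree p > degree q then None
               else if degree p = degree q then Some (lead_coeff p / lead_coeff q)
               else Some 0))"

definition cpoly :: "real poly \<Rightarrow> complex poly" where
  "cpoly p = map_poly complex_of_real p"

definition real_rational_map :: "(complex option \<Rightarrow> complex option) \<Rightarrow> nat \<Rightarrow> bool" where
  "real_rational_map F d \<longleftrightarrow> (\<exists>p q :: real poly. q \<noteq> 0 \<and> coprime p q \<and>
      max (degree p) (degree q) = d \<and> F = rat_eval (cpoly p) (cpoly q))"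

definition real_mobius :: "(complex option \<Rightarrow> complex option) \<Rightarrow> bool" where
  "real_mobius M \<longleftrightarrow> (\<exists>\<alpha> \<beta> \<gamma> \<delta> :: real. \<alpha> * \<delta> - \<beta> * \<gamma> \<noteq> 0 \<and>
      M = rat_eval (cpoly [:\<beta>, \<alpha>:]) (cpoly [:\<delta>, \<gamma>:]))"

definition disk_aut :: "(complex option \<Rightarrow> complex option) \<Rightarrow> bool" where
  "disk_aut \<phi> \<longleftrightarrow> (\<exists>t b. cmod b < 1 \<and>
      \<phi> = rat_eval [:- cis t * b, cis t:] [:1, - cnj b:])"

definition cayley :: "complex option \<Rightarrow> complex option" where
  "cayley = rat_eval [:- \<i>, 1:] [:\<i>, 1:]"

definition inv_s :: "complex option \<Rightarrow> complex option" where
  "inv_s = rat_eval 1 [:0, 1:]"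

definition normal_iterates :: "(complex option \<Rightarrow> complex option) \<Rightarrow> complex option set \<Rightarrow> bool" where
  "normal_iterates F U \<longleftrightarrow> (\<forall>r :: nat \<Rightarrow> nat. \<exists>s g. strict_mono s \<and>
      (\<forall>K. K \<subseteq> U \<longrightarrow> scompact K \<longrightarrow>
         (\<forall>e>0. eventually (\<lambda>k. \<forall>x\<in>K. cdist ((F ^^ r (s k)) x) (g x) < e) sequentially)))"

definition fatou :: "(complex option \<Rightarrow> complex option) \<Rightarrow> complex option set" where
  "fatou F = {z. \<exists>U. z \<in> U \<and> sopen U \<and> normal_iterates F U}"

definition julia :: "(complex option \<Rightarrow> complex option) \<Rightarrow> complex option set" where
  "julia F = UNIV - fatou F"

definition chart :: "complex option \<Rightarrow> complex option \<Rightarrow> complex" where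
  "chart a = (case a of Some _ \<Rightarrow> (\<lambda>z. case z of Some w \<Rightarrow> w | None \<Rightarrow> 0)
                      | None \<Rightarrow> (\<lambda>z. case z of Some w \<Rightarrow> inverse w | None \<Rightarrow> 0))"

definition ichart :: "complex option \<Rightarrow> complex \<Rightarrow> complex option" where
  "ichart a = (case a of Some _ \<Rightarrow> Some
                       | None \<Rightarrow> (\<lambda>w. if w = 0 then None else Some (inverse w)))"

definition local_rep :: "(complex option \<Rightarrow> complex option) \<Rightarrow> complex option \<Rightarrow> complex \<Rightarrow> complex" where
  "local_rep F z = chart (F z) \<circ> F \<circ> ichart z"

definition critical :: "(complex option \<Rightarrow> complex option) \<Rightarrow> complex option \<Rightarrow> bool" where
  "critical F z \<longleftrightarrow> deriv (local_rep F z) (chart z z) = 0"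

definition multiplier :: "(complex option \<Rightarrow> complex option) \<Rightarrow> nat \<Rightarrow> complex option \<Rightarrow> complex" where
  "multiplier F n z = deriv (local_rep (F ^^ n) z) (chart z z)"

definition hyperbolic :: "(complex option \<Rightarrow> complex option) \<Rightarrow> bool" where
  "hyperbolic F \<longleftrightarrow> (\<forall>c. critical F c \<longrightarrow>
     (\<exists>z n. n > 0 \<and> (F ^^ n) z = z \<and> cmod (multiplier F n z) < 1 \<and>
        ((\<lambda>k. infdist (stereo ((F ^^ k) c)) (stereo ` {(F ^^ j) z | j. True})) \<longlonglongrightarrow> 0)))"

definition separated :: "(complex option \<Rightarrow> complex option) \<Rightarrow> complex option set \<Rightarrow> nat \<Rightarrow> real
    \<Rightarrow> complex option set \<Rightarrow> bool" where
  "separated F X n e E \<longleftrightarrow> E \<subseteq> X \<and> (\<forall>x\<in>E. \<forall>y\<in>E. x \<noteq> y \<longrightarrow>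
      (\<exists>k<n. cdist ((F ^^ k) x) ((F ^^ k) y) > e))"

definition sep_num :: "(complex option \<Rightarrow> complex option) \<Rightarrow> complex option set \<Rightarrow> nat \<Rightarrow> real \<Rightarrow> nat" where
  "sep_num F X n e = Sup {card E | E. finite E \<and> separated F X n e E}"

definition htop :: "(complex option \<Rightarrow> complex option) \<Rightarrow> complex option set \<Rightarrow> ereal" where
  "htop F X = (SUP e\<in>{0<..}. limsup (\<lambda>n. ereal (ln (real (sep_num F X n e)) / real n)))"

definition blaschke :: "real \<Rightarrow> (nat \<Rightarrow> complex) \<Rightarrow> nat \<Rightarrow> complex option \<Rightarrow> complex option" where
  "blaschke c a d = rat_eval (smult (cis (2 * pi * c)) (\<Prod>i<d. [:- a i, 1:]))
                            (\<Prod>i<d. [:1, - cnj (a i):])"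

definition zblaschke :: "complex \<Rightarrow> (nat \<Rightarrow> complex) \<Rightarrow> nat \<Rightarrow> complex option \<Rightarrow> complex option" where
  "zblaschke s a d = rat_eval (smult s ([:0, 1:] * (\<Prod>i<d-1. [:- a i, 1:])))
                             (\<Prod>i<d-1. [:1, - cnj (a i):])"

definition gmap :: "real \<Rightarrow> real poly \<Rightarrow> real poly \<Rightarrow> complex option \<Rightarrow> complex option" where
  "gmap \<epsilon> P Q = rat_eval (cpoly (smult \<epsilon> ([:0, 1:] * Q + P))) (cpoly Q)"

definition gform :: "nat \<Rightarrow> real \<Rightarrow> real poly \<Rightarrow> real poly \<Rightarrow> bool" where
  "gform d \<epsilon> P Q \<longleftrightarrow> \<epsilon> \<in> {1, -1} \<and> coprime P Q \<and> degree Q = d - 1 \<and>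
     (if \<epsilon> = 1 then degree P < d - 1 else degree P \<le> d - 1) \<and>
     (\<forall>c. critical (gmap \<epsilon> P Q) c \<longrightarrow> c \<notin> Rhat)"

definition odd_poly :: "real poly \<Rightarrow> bool" where
  "odd_poly P \<longleftrightarrow> (\<forall>x. poly P (- x) = - poly P x)"

definition even_poly :: "real poly \<Rightarrow> bool" where
  "even_poly P \<longleftrightarrow> (\<forall>x. poly P (- x) = poly P x)"

text \<open>Quotient maps for the involutions z \<mapsto> 1/z and z \<mapsto> -z.\<close>
definition quot_inv :: "complex option \<Rightarrow> complex option" where
  "quot_inv = rat_eval [:1, 0, 1:] [:0, 1:]"

definition quot_neg :: "complex option \<Rightarrow> complex option" where
  "quot_neg = rat_eval [:0, 0, 1:] 1"

end

theory Submission
  imports Defs "HOL-Computational_Algebra.Computational_Algebra"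
begin

text \<open>If the Julia set of a real map is not contained in the real circle, only finitely many real points have
  all their iterated preimages real; hence the number of real preimages of order \<open>n\<close> grows strictly more
  slowly than \<open>d ^ n\<close>, and the real entropy is less than \<open>log d\<close>. A Julia set contained in a circle is
  perfect, and as soon as it contains a nontrivial arc without being the whole circle, the expansion of small
  arcs makes it connected.

  A rational map leaving a circle completely invariant is conjugate to a Blaschke product or to the
  post-composition of one with \<open>1/z\<close>. By the Denjoy--Wolff alternative it has either a fixed point (up to
  reflection) in the disk, and then the Julia set is the full circle and the map is hyperbolic, or a fixed
  point on the circle of multiplier at most \<open>1\<close> in modulus attracting everything off the circle. In the
  second case the modulus of the multiplier is the sum in (i), and it is \<open>< 1\<close> exactly when the map is
  hyperbolic. The normal forms arise by moving the fixed point to \<open>0\<close> or \<open>\<infinity>\<close>.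

  An interval Julia set is normalised to \<open>[0, \<infinity>]\<close>; the map then lifts through
  \<open>z \<mapsto> z ^ 2\<close> to an odd map with full real Julia set, to which the same alternative applies.\<close>

section \<open>The Riemann sphere as a metric space\<close>

text \<open>Infinity is kept from being a special case by homogeneous coordinates, and normality is
  traded for equicontinuity of the iterates, which passes along conjugacies, semiconjugacies and
  open maps. Schottky's theorem enters once, to give equicontinuity when three values are omitted;
  nearly every inclusion in a Fatou set is then the exhibition of three avoided points.

  The loss of real preimages has no evident uniform rate near the finite exceptional set; but this
  set is superattracting, so backward orbits of all other points leave its neighbourhood.

  Maps exchanging the two sides of the circle are treated together with those preserving them, since
  conjugating the values changes no modulus. Strictness in Julia's lemma for at least two factors
  makes the parabolic and the attracting boundary point one case.

  For an interval, the lift commutes with the reflection in the imaginary axis, so its attracting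
  point is on that axis or is one of the ends 0 and infinity. The end 0 gives no normal form
  directly; but inversion exchanges the ends, and one orbit cannot converge to both.\<close>

lemma cdist_Some_Some:
  "cdist (Some a) (Some b) = 2 * cmod (a - b) / (sqrt (1 + (cmod a)\<^sup>2) * sqrt (1 + (cmod b)\<^sup>2))"
proof -
  define x y x' y' where "x = Re a" "y = Im a" "x' = Re b" "y' = Im b"
  define P Q where "P = x\<^sup>2 + y\<^sup>2 + 1" "Q = x'\<^sup>2 + y'\<^sup>2 + 1"
  have A: "(cmod a)\<^sup>2 = P - 1" "(cmod b)\<^sup>2 = Q - 1" "(cmod (a - b))\<^sup>2 = (x - x')\<^sup>2 + (y - y')\<^sup>2"
    by (simp_all add: cmod_power2 x_y_x'_y'_def P_Q_def)
  have pos: "P > 0" "Q > 0"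
    by (simp_all add: P_Q_def add_nonneg_pos)
  have "(cdist (Some a) (Some b))\<^sup>2 =
      (2 * x / P - 2 * x' / Q)\<^sup>2 + (2 * y / P - 2 * y' / Q)\<^sup>2 + ((P - 2) / P - (Q - 2) / Q)\<^sup>2"
    by (simp add: cdist_def stereo_def dist_prod_def dist_real_def A x_y_x'_y'_def)
  also have "\<dots> = 4 * ((x * Q - x' * P)\<^sup>2 + (y * Q - y' * P)\<^sup>2 + (P - Q)\<^sup>2) / (P * Q)\<^sup>2"
    using pos by (simp add: divide_simps; simp add: algebra_simps power2_eq_square)
  also have "(x * Q - x' * P)\<^sup>2 + (y * Q - y' * P)\<^sup>2 + (P - Q)\<^sup>2 = P * Q * ((x - x')\<^sup>2 + (y - y')\<^sup>2)"
    unfolding P_Q_def by algebra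
  also have "4 * (P * Q * ((x - x')\<^sup>2 + (y - y')\<^sup>2)) / (P * Q)\<^sup>2 = 4 * ((x - x')\<^sup>2 + (y - y')\<^sup>2) / (P * Q)"
    using pos by (simp add: power2_eq_square[of "P * Q"])
  also have "\<dots> = (2 * cmod (a - b) / (sqrt P * sqrt Q))\<^sup>2"
    using pos unfolding power_divide power_mult_distrib A by simp
  finally have "cdist (Some a) (Some b) = 2 * cmod (a - b) / (sqrt P * sqrt Q)"
    using pos by (intro power2_eq_imp_eq[where x="cdist _ _"]) (auto simp: cdist_def)
  then show ?thesis
    by (simp add: A)
qed

lemma cdist_Some_None: "cdist (Some a) None = 2 / sqrt (1 + (cmod a)\<^sup>2)"
proof -
  define x y where "x = Re a" "y = Im a"
  define P where "P = x\<^sup>2 + y\<^sup>2 + 1"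
  have A: "(cmod a)\<^sup>2 = P - 1"
    by (simp_all add: cmod_power2 x_y_def P_def)
  have pos: "P > 0"
    by (simp add: P_def add_nonneg_pos)
  have "(cdist (Some a) None)\<^sup>2 = (2 * x / P)\<^sup>2 + (2 * y / P)\<^sup>2 + ((P - 2) / P - 1)\<^sup>2"
    by (simp add: cdist_def stereo_def dist_prod_def dist_real_def A x_y_def power_divide)
  also have "\<dots> = 4 * (x\<^sup>2 + y\<^sup>2 + 1) / P\<^sup>2"
    using pos by (simp add: divide_simps; simp add: algebra_simps power2_eq_square)
  also have "\<dots> = (2 / sqrt P)\<^sup>2"
    using pos unfolding P_def[symmetric] power_divide by (simp add: power2_eq_square)
  finally have "cdist (Some a) None = 2 / sqrt P"
    using pos by (intro power2_eq_imp_eq[where x="cdist _ _"]) (auto simp: cdist_def)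
  then show ?thesis
    by (simp add: A)
qed

lemma one_plus_sq_pos: "1 + (cmod a)\<^sup>2 > 0"
  by (simp add: add_pos_nonneg)

lemma stereo_inj: "inj stereo"
proof (rule injI)
  fix x y assume "stereo x = stereo y"
  then have 0: "cdist x y = 0" "cdist y x = 0" by (auto simp: cdist_def)
  have *: "sqrt (1 + (cmod a)\<^sup>2) ~= 0" for a
    using one_plus_sq_pos[of a] by simp
  show "x = y"
    using 0 * by (cases x; cases y) (auto simp: cdist_Some_Some cdist_Some_None)
qed

text \<open>The distribution puts no topology on \<open>option\<close>; giving \<open>complex option\<close> the chordal
  metric makes the whole topology library available for the Riemann sphere.\<close>

class sphere_chart =
  fixes stereo_of :: "'a option => real \<times> real \<times> real"
  assumes inj_stereo_of: "inj stereo_of"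

instantiation complex :: sphere_chart
begin
definition "stereo_of = stereo"
instance by standard (simp add: stereo_of_complex_def stereo_inj)
end

instantiation option :: (sphere_chart) metric_space
begin
definition dist_option :: "'a option => 'a option => real" where
  "dist_option x y = dist (stereo_of x) (stereo_of y)"
definition uniformity_option :: "('a option \<times> 'a option) filter" where
  "uniformity_option = (INF e\<in>{0 <..}. principal {(x, y). dist x y < e})"
definition open_option :: "'a option set => bool" where
  "open_option S = (\<forall>x\<in>S. \<forall>\<^sub>F (x', y) in uniformity. x' = x --> y \<in> S)"
instance
  by standard (auto simp: dist_option_def uniformity_option_def open_option_def
      inj_stereo_of[THEN inj_eq] dist_triangle2)
end

type_synonym sphere = "complex option"

lemma cdist_eq_dist: "cdist = dist"
  by (intro ext) (simp add: dist_option_def stereo_of_complex_def cdist_def)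

lemma dist_stereo [simp]: "dist (stereo x) (stereo y) = dist x y"
  by (simp add: dist_option_def stereo_of_complex_def)

lemmas dist_Some_Some = cdist_Some_Some[unfolded cdist_eq_dist]
lemmas dist_Some_None = cdist_Some_None[unfolded cdist_eq_dist]

lemma sopen_iff_open: "sopen U \<longleftrightarrow> open U"
proof -
  have "sopen U \<longleftrightarrow> (\<forall>x\<in>U. \<exists>e>0. \<forall>y. dist (stereo y) (stereo x) < e --> stereo y \<in> stereo ` U)"
    unfolding sopen_def openin_euclidean_subtopology_iff by auto
  also have "\<dots> \<longleftrightarrow> open U"
    unfolding open_dist using stereo_inj by (simp add: inj_image_mem_iff)
  finally show ?thesis .
qed

lemma homeomorphism_stereo: "homeomorphism K (stereo ` K) stereo (inv stereo)"
proof -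
  have "continuous_on K stereo"
    unfolding continuous_on_iff by auto
  moreover have "continuous_on (stereo ` K) (inv stereo)"
    unfolding continuous_on_iff by (auto simp: stereo_inj)
  ultimately show ?thesis
    by (auto simp: homeomorphism_def stereo_inj image_iff)
qed

lemma homeomorphic_stereo: "K homeomorphic stereo ` K"
  using homeomorphism_stereo homeomorphic_def by blast

lemma scompact_iff_compact: "scompact K \<longleftrightarrow> compact K"
  using homeomorphic_compactness[OF homeomorphic_stereo] by (simp add: scompact_def)

lemma sconnected_iff_connected: "sconnected K \<longleftrightarrow> connected K"
  using homeomorphic_connectedness[OF homeomorphic_stereo] by (simp add: sconnected_def)

lemma scantor_iff: "scantor K \<longleftrightarrow> cantor_set K"
proof -
  have 1: "(stereo x islimpt stereo ` K) \<longleftrightarrow> (x islimpt K)" for x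
    unfolding islimpt_approachable by (auto simp: inj_eq[OF stereo_inj])
  have 2: "connected (stereo ` C) \<longleftrightarrow> connected C" for C
    using homeomorphic_connectedness[OF homeomorphic_stereo] by metis
  have 3: "stereo ` C \<subseteq> {stereo a} \<longleftrightarrow> C \<subseteq> {a}" for C a
    by (auto simp: inj_eq[OF stereo_inj])
  have "(\<forall>C. C \<subseteq> stereo ` K --> connected C --> (\<exists>a. C \<subseteq> {a})) \<longleftrightarrow>
     (\<forall>C. C \<subseteq> K --> connected C --> (\<exists>a. C \<subseteq> {a}))" (is "?L = ?R")
  proof
    assume L: ?L
    show ?R
    proof (intro allI impI)
      fix C assume C: "C \<subseteq> K" "connected C"
      then obtain b where b: "stereo ` C \<subseteq> {b}"
        using L[rule_format, of "stereo ` C"] 2[of C] by (auto simp: image_mono)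
      have "x = y" if "x \<in> C" "y \<in> C" for x y
        using that b inj_eq[OF stereo_inj, of x y] by auto
      then show "\<exists>a. C \<subseteq> {a}" by blast
    qed
  next
    assume R: ?R
    show ?L
    proof (intro allI impI)
      fix C assume C: "C \<subseteq> stereo ` K" "connected C"
      then obtain C' where C': "C' \<subseteq> K" "C = stereo ` C'" by (auto simp: subset_image_iff)
      then have "connected C'" using C(2) 2 by simp
      with R C'(1) obtain a where "C' \<subseteq> {a}" by meson
      then have "C \<subseteq> {stereo a}" using C' by auto
      then show "\<exists>a. C \<subseteq> {a}" ..
    qed
  qed
  then show ?thesis
    unfolding scantor_def cantor_set_def
    using scompact_iff_compact[of K] by (auto simp: 1 scompact_def)
qed

text \<open>The point [u : v] of the projective line. It has a meaning only if \<open>u\<close> and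
  \<open>v\<close> are not both 0, whence the side condition \<open>u ~= 0 \<or> v ~= 0\<close> that
  accompanies it throughout.\<close>

definition hpt :: "complex => complex => sphere" where
  "hpt u v = (if v = 0 then None else Some (u / v))"

lemma hpt_1 [simp]: "hpt w 1 = Some w" and hpt_0 [simp]: "hpt u 0 = None"
  by (auto simp: hpt_def)

lemma hpt_cases: obtains u v where "z = hpt u v" "u ~= 0 \<or> v ~= 0"
  by (cases z) (metis hpt_0 hpt_1 zero_neq_one)+

lemma hpt_eq_iff:
  "u ~= 0 \<or> v ~= 0 ==> u' ~= 0 \<or> v' ~= 0 ==> hpt u v = hpt u' v' \<longleftrightarrow> u * v' = u' * v"
  by (auto simp: hpt_def field_simps)

lemma hpt_scale: "k ~= 0 ==> hpt (k * u) (k * v) = hpt u v"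
  by (auto simp: hpt_def)

text \<open>The finite formula and the one for infinity become one: the determinant of the two
  coordinate vectors over their Hermitian norms. Exchanging the coordinates changes only the sign of
  the determinant, so 1/z is an isometry.\<close>

lemma dist_hpt:
  assumes "u ~= 0 \<or> v ~= 0" "u' ~= 0 \<or> v' ~= 0"
  shows "dist (hpt u v) (hpt u' v') =
    2 * cmod (u * v' - u' * v) / (sqrt ((cmod u)\<^sup>2 + (cmod v)\<^sup>2) * sqrt ((cmod u')\<^sup>2 + (cmod v')\<^sup>2))"
proof -
  have *: "sqrt (1 + (cmod (u / v))\<^sup>2) = sqrt ((cmod u)\<^sup>2 + (cmod v)\<^sup>2) / cmod v" if "v ~= 0" for u v
  proof -
    have "1 + (cmod (u / v))\<^sup>2 = ((cmod u)\<^sup>2 + (cmod v)\<^sup>2) / (cmod v)\<^sup>2"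
      using that by (simp add: norm_divide power_divide field_simps)
    then show ?thesis
      by (simp add: real_sqrt_divide)
  qed
  have **: "dist (hpt u v) None = 2 * cmod v / sqrt ((cmod u)\<^sup>2 + (cmod v)\<^sup>2)" for u v
    by (cases "v = 0") (simp_all add: hpt_def dist_Some_None *)
  show ?thesis
  proof (cases "v = 0 \<or> v' = 0")
    case True
    then show ?thesis
      using assms **[of u v] **[of u' v'] by (auto simp: norm_mult dist_commute)
  next
    case False
    have e: "u / v - u' / v' = (u * v' - u' * v) / (v * v')"
      using False by (simp add: field_simps)
    have h: "hpt u v = Some (u / v)" "hpt u' v' = Some (u' / v')"
      using False by (auto simp: hpt_def)
    have nz: "v ~= 0" "v' ~= 0" using False by auto
    show ?thesis
      unfolding h dist_Some_Some *[OF nz(1)] *[OF nz(2)] e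
        norm_divide[of "_ - _"] norm_mult[of v]
      using nz by (simp add: field_simps)
  qed
qed

lemma dist_hpt_swap:
  assumes "u ~= 0 \<or> v ~= 0" "u' ~= 0 \<or> v' ~= 0"
  shows "dist (hpt v u) (hpt v' u') = dist (hpt u v) (hpt u' v')"
  using assms by (simp add: dist_hpt disj_commute norm_minus_commute add.commute mult.commute)

lemma dist_sphere_le_2: "dist (x::sphere) y \<le> 2"
proof -
  have n: "norm (stereo z) = 1" for z
  proof (cases z)
    case (Some w)
    define x y where "x = Re w" "y = Im w"
    define P where "P = x\<^sup>2 + y\<^sup>2 + 1"
    have A: "(cmod w)\<^sup>2 = P - 1" by (simp add: cmod_power2 x_y_def P_def)
    have pos: "P > 0"
      by (simp add: P_def add_nonneg_pos)
    have "(norm (stereo z))\<^sup>2 = (2 * x / P)\<^sup>2 + (2 * y / P)\<^sup>2 + ((P - 2) / P)\<^sup>2"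
      by (simp add: Some stereo_def norm_prod_def A x_y_def power_divide)
    also have "\<dots> = (4 * (x\<^sup>2 + y\<^sup>2 + 1) + P * (P - 4)) / P\<^sup>2"
      using pos by (simp add: divide_simps; simp add: algebra_simps power2_eq_square)
    also have "4 * (x\<^sup>2 + y\<^sup>2 + 1) + P * (P - 4) = P\<^sup>2"
      by (simp add: P_def algebra_simps power2_eq_square)
    also have "P\<^sup>2 / P\<^sup>2 = 1" using pos by simp
    finally show ?thesis
      by (simp add: power2_eq_1_iff) (metis norm_ge_zero neg_0_le_iff_le not_one_le_zero)
  qed (simp add: stereo_def norm_prod_def)
  have "dist x y \<le> norm (stereo x) + norm (stereo y)"
    by (metis dist_stereo dist_norm norm_triangle_ineq4)
  then show ?thesis by (simp add: n)
qed

section \<open>Affine charts of the sphere\<close>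

lemma dist_ichart:
  "dist (ichart a x) (ichart a y) = 2 * cmod (x - y) / (sqrt (1 + (cmod x)\<^sup>2) * sqrt (1 + (cmod y)\<^sup>2))"
proof (cases a)
  case None
  have "ichart a x = hpt 1 x" for x
    by (simp add: None ichart_def hpt_def field_simps)
  then show ?thesis
    by (simp add: dist_hpt norm_minus_commute)
qed (simp add: ichart_def dist_Some_Some)

lemma dist_ichart_le: "dist (ichart a x) (ichart a y) \<le> 2 * cmod (x - y)"
proof -
  have "1 \<le> sqrt (1 + (cmod x)\<^sup>2) * sqrt (1 + (cmod y)\<^sup>2)"
    using mult_mono[of 1 "sqrt (1 + (cmod x)\<^sup>2)" 1 "sqrt (1 + (cmod y)\<^sup>2)"] by simp
  then show ?thesis
    unfolding dist_ichart by (auto simp: divide_le_eq intro: mult_left_le[of "1"] order_trans[OF _ mult_left_mono[of 1]])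
qed

lemma continuous_on_ichart: "continuous_on S (ichart a)"
  unfolding continuous_on_iff
proof (intro ballI allI impI)
  fix x e assume "x \<in> S" "(e::real) > 0"
  then show "\<exists>d>0. \<forall>y\<in>S. dist y x < d --> dist (ichart a y) (ichart a x) < e"
    by (intro exI[of _ "e/2"]) (auto simp: dist_norm intro: le_less_trans[OF dist_ichart_le])
qed

lemma compact_sphere_UNIV: "compact (UNIV :: sphere set)"
proof -
  have "compact (ichart (Some 0) ` cball 0 1 \<union> ichart None ` cball 0 1)"
    by (intro compact_Un compact_continuous_image continuous_on_ichart compact_cball)
  moreover have "x \<in> ichart (Some 0) ` cball 0 1 \<union> ichart None ` cball 0 1" for x :: sphere
  proof (cases x)
    case None
    then have "x = ichart None 0" by (simp add: ichart_def)
    then show ?thesis by auto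
  next
    case (Some w)
    show ?thesis
    proof (cases "cmod w \<le> 1")
      case True
      then have "x \<in> ichart (Some 0) ` cball 0 1" by (simp add: ichart_def Some)
      then show ?thesis ..
    next
      case False
      then have "x = ichart None (inverse w)" "cmod (inverse w) \<le> 1"
        by (auto simp: ichart_def Some norm_inverse inverse_le_1_iff)
      then show ?thesis by auto
    qed
  qed
  ultimately show ?thesis
    by (metis UNIV_eq_I)
qed

lemma continuous_on_Some: "continuous_on S (Some :: complex => sphere)"
  using continuous_on_ichart[of S "Some 0"] by (simp add: ichart_def)

lemma chart_ichart [simp]: "chart a (ichart a x) = x"
  by (cases a) (auto simp: chart_def ichart_def)

lemma ichart_chart_self [simp]: "ichart a (chart a a) = a"
  by (cases a) (auto simp: chart_def ichart_def)

text \<open>The one point not covered by the chart at \<open>a\<close>.\<close>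
definition antip :: "sphere => sphere" where
  "antip a = (case a of Some _ => None | None => Some 0)"

lemma antip_neq [simp]: "antip a ~= a" "a ~= antip a"
  by (auto simp: antip_def split: option.splits)

lemma ichart_chart: "y ~= antip a ==> ichart a (chart a y) = y"
  by (auto simp: chart_def ichart_def antip_def split: option.splits)

lemma isCont_chart:
  assumes "y ~= antip a"
  shows "isCont (chart a) y"
proof (rule continuous_at_sequentiallyI)
  fix u assume u: "u \<longlonglongrightarrow> y"
  define x where "x = chart a y"
  define X where "X = (\<lambda>n. chart a (u n))"
  have y: "y = ichart a x"
    using assms by (simp add: x_def ichart_chart)
  have "eventually (\<lambda>n. dist (u n) y < dist (antip a) y) sequentially"
    using u assms by (intro tendstoD) auto
  then have ev: "eventually (\<lambda>n. u n = ichart a (X n)) sequentially"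
    unfolding X_def by eventually_elim (metis ichart_chart less_irrefl)
  define S where "S = sqrt (1 + (cmod x)\<^sup>2)"
  have S: "S \<ge> 1" by (simp add: S_def)
  define k where "k = (\<lambda>n. dist (u n) y * S / 2)"
  have k: "k \<longlonglongrightarrow> 0"
    using tendsto_mult_right[OF tendsto_divide[OF iffD1[OF tendsto_dist_iff u] tendsto_const[of "2::real"]], of S]
    by (simp add: k_def mult.commute)
  \<comment> \<open>With \<open>t\<close> the Euclidean distance, the chordal formula reads t = k *
    sqrt (1 + |X|^2), which is at most k * (1 + |x| + t); once k \<le> 1/2, the term with
    \<open>t\<close> on the right is absorbed by the left side.\<close>
  have "eventually (\<lambda>n. cmod (X n - x) \<le> 2 * k n * (1 + cmod x)) sequentially"
    using ev order_tendstoD(2)[OF k, of "1/2", simplified]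
  proof eventually_elim
    case (elim n)
    define t where "t = cmod (X n - x)"
    have "sqrt (1 + (cmod (X n))\<^sup>2) \<le> 1 + cmod (X n)"
      by (intro real_le_lsqrt) (auto simp: power2_eq_square algebra_simps)
    also have "\<dots> \<le> 1 + cmod x + t"
      unfolding t_def using norm_triangle_sub[of "X n" x] by simp
    finally have r: "sqrt (1 + (cmod (X n))\<^sup>2) \<le> 1 + cmod x + t" .
    have d: "dist (u n) y = 2 * t / (sqrt (1 + (cmod (X n))\<^sup>2) * S)"
      by (simp only: elim(1) y dist_ichart t_def S_def)
    have sp: "sqrt (1 + (cmod (X n))\<^sup>2) > 0"
      using one_plus_sq_pos by simp
    have "t = k n * sqrt (1 + (cmod (X n))\<^sup>2)"
      using sp S unfolding k_def d by (simp add: field_simps)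
    also have "\<dots> \<le> k n * (1 + cmod x + t)"
      using r S by (intro mult_left_mono) (auto simp: k_def)
    finally have 1: "t \<le> k n * (1 + cmod x + t)" .
    have "k n \<ge> 0" using S by (simp add: k_def)
    then have "k n * t \<le> t / 2"
      using elim(2) mult_right_mono[of "k n" "1/2" t] by (simp add: t_def)
    with 1 show ?case
      by (simp add: t_def algebra_simps)
  qed
  then have "(\<lambda>n. X n - x) \<longlonglongrightarrow> 0"
    by (rule Lim_null_comparison) (use tendsto_mult_left_zero[OF tendsto_mult_right_zero[OF k, of 2]] in \<open>simp\<close>)
  then show "(\<lambda>n. chart a (u n)) \<longlonglongrightarrow> chart a y"
    by (simp add: X_def x_def LIM_zero_iff)
qed

lemma continuous_on_chart: "antip a \<notin> S ==> continuous_on S (chart a)"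
  by (auto intro!: continuous_at_imp_continuous_on isCont_chart)

lemma open_ichart_image:
  assumes "open U"
  shows "open (ichart a ` U)"
proof -
  have "ichart a ` U = (- {antip a}) \<inter> chart a -` U"
  proof safe
    fix x y assume "x \<in> U" "ichart a x = antip a"
    then show False
      by (auto simp: ichart_def antip_def split: option.splits if_splits)
  next
    fix x assume "x \<notin> ichart a ` U" "chart a x \<in> U"
    then show "x = antip a"
      using ichart_chart by (metis imageI)
  qed auto
  moreover have "open ((- {antip a}) \<inter> chart a -` U)"
    using assms by (intro continuous_open_preimage continuous_on_chart) auto
  ultimately show ?thesis by simp
qed

lemma infinite_open_sphere:
  assumes "open (U::sphere set)" "U ~= {}"
  shows "infinite U"
proof
  assume "finite U"
  obtain a where a: "a \<in> U" using assms by auto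
  have "open (ichart a -` U)"
    using assms continuous_on_ichart[of UNIV a] by (simp add: continuous_on_open_vimage)
  moreover have "chart a a \<in> ichart a -` U" using a by simp
  moreover have "finite (ichart a -` U)"
    using \<open>finite U\<close> by (intro finite_vimageI) (auto intro: inj_on_inverseI[of _ "chart a"])
  ultimately show False
    by (metis empty_iff finite_imp_not_open)
qed

section \<open>Rational maps in homogeneous coordinates\<close>

text \<open>The degree \<open>n\<close> is a parameter because the binary form, not the polynomial,
  determines the zeros on the sphere: \<open>degree p < n\<close> means a zero at infinity.\<close>

definition hpoly :: "complex poly => nat => complex => complex => complex" where
  "hpoly p n u v = (\<Sum>i\<le>n. coeff p i * u ^ i * v ^ (n - i))"

lemma hpoly_0: "hpoly p n u 0 = coeff p n * u ^ n"
proof -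
  have "hpoly p n u 0 = (\<Sum>i\<le>n. if i = n then coeff p n * u ^ n else 0)"
    unfolding hpoly_def by (intro sum.cong) (auto simp: power_0_left)
  then show ?thesis by simp
qed

lemma hpoly_nonzero:
  assumes "degree p \<le> n" "v ~= 0"
  shows "hpoly p n u v = v ^ n * poly p (u / v)"
proof -
  have "poly p (u / v) = (\<Sum>i\<le>n. coeff p i * (u / v) ^ i)"
    unfolding poly_altdef using assms(1) by (intro sum.mono_neutral_left) (auto simp: coeff_eq_0)
  then show ?thesis
    unfolding hpoly_def using assms(2)
    by (auto simp: sum_distrib_left power_divide power_diff field_simps intro!: sum.cong)
qed

lemma hpoly_1 [simp]: "degree p \<le> n ==> hpoly p n u 1 = poly p u"
  by (simp add: hpoly_nonzero)

lemma hpoly_add: "hpoly (p + q) n u v = hpoly p n u v + hpoly q n u v"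
  by (simp add: hpoly_def sum.distrib algebra_simps)

lemma hpoly_diff: "hpoly (p - q) n u v = hpoly p n u v - hpoly q n u v"
  by (simp add: hpoly_def sum_subtractf algebra_simps)

lemma hpoly_smult: "hpoly (smult c p) n u v = c * hpoly p n u v"
  by (simp add: hpoly_def sum_distrib_left algebra_simps)

lemma hpoly_sum: "hpoly (\<Sum>i\<in>A. f i) n u v = (\<Sum>i\<in>A. hpoly (f i) n u v)"
  by (induction A rule: infinite_finite_induct) (auto simp: hpoly_add, auto simp: hpoly_def)

lemma hpoly_linear [simp]: "hpoly [:b, a:] (Suc 0) u v = a * u + b * v"
  by (simp add: hpoly_def)

lemma coeff_mult_top:
  assumes "degree p \<le> m" "degree q \<le> n"
  shows "coeff (p * q) (m + n) = coeff p m * coeff q n"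
proof -
  have "coeff (p * q) (m + n) = (\<Sum>i\<le>m + n. if i = m then coeff p m * coeff q n else 0)"
    unfolding coeff_mult
  proof (intro sum.cong refl)
    fix i assume "i \<in> {..m + n}"
    show "coeff p i * coeff q (m + n - i) = (if i = m then coeff p m * coeff q n else 0)"
    proof (cases i m rule: linorder_cases)
      case less
      then have "coeff q (m + n - i) = 0" using assms by (intro coeff_eq_0) auto
      then show ?thesis using less by simp
    next
      case greater
      then have "coeff p i = 0" using assms by (intro coeff_eq_0) auto
      then show ?thesis using greater by simp
    qed auto
  qed
  then show ?thesis by simp
qed

lemma hpoly_mult:
  assumes "degree p \<le> m" "degree q \<le> n"
  shows "hpoly (p * q) (m + n) u v = hpoly p m u v * hpoly q n u v"
proof (cases "v = 0")
  case True
  then show ?thesis using coeff_mult_top[OF assms] by (simp add: hpoly_0 power_add)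
next
  case False
  have "degree (p * q) \<le> m + n"
    using degree_mult_le[of p q] assms by linarith
  then show ?thesis using assms False by (simp add: hpoly_nonzero power_add)
qed

lemma hpoly_prod_linear:
  "degree (\<Prod>i<n. [:b i, a i:]) \<le> n \<and>
   hpoly (\<Prod>i<n. [:b i, a i:]) n u v = (\<Prod>i<n. a i * u + b i * v)"
proof (induction n)
  case (Suc n)
  have "hpoly ((\<Prod>i<n. [:b i, a i:]) * [:b n, a n:]) (n + 1) u v =
      hpoly (\<Prod>i<n. [:b i, a i:]) n u v * hpoly [:b n, a n:] 1 u v"
    using Suc by (intro hpoly_mult) auto
  moreover have "degree ((\<Prod>i<n. [:b i, a i:]) * [:b n, a n:]) \<le> n + 1"
    using Suc degree_mult_le[of "\<Prod>i<n. [:b i, a i:]" "[:b n, a n:]"] degree_pCons_le[of "b n" "[:a n:]"]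
    by (auto intro: order_trans)
  ultimately show ?case using Suc by (simp add: mult.commute)
qed (auto simp: hpoly_def)

lemma hpoly_power_linear:
  "degree ([:b, a:] ^ n) \<le> n \<and> hpoly ([:b, a:] ^ n) n u v = (a * u + b * v) ^ n"
  using hpoly_prod_linear[where n=n and b="\<lambda>_. b" and a="\<lambda>_. a" and u=u and v=v] by simp

text \<open>Coprimality as the absence of a common zero on the projective line: the coefficient
  clause excludes one at infinity. This makes \<open>d\<close> the degree of the map and is stable
  under Moebius substitutions on both sides.\<close>

definition ratpair :: "complex poly => complex poly => nat => bool" where
  "ratpair p q d \<longleftrightarrow> d > 0 \<and> degree p \<le> d \<and> degree q \<le> d \<and> (coeff p d ~= 0 \<or> coeff q d ~= 0)
     \<and> (\<forall>z. poly p z ~= 0 \<or> poly q z ~= 0)"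

definition ratmap :: "nat => (sphere => sphere) => bool" where
  "ratmap d F \<longleftrightarrow> (\<exists>p q. ratpair p q d \<and> F = rat_eval p q)"

lemma ratpair_hpoly_nonzero:
  assumes "ratpair p q d" "u ~= 0 \<or> v ~= 0"
  shows "hpoly p d u v ~= 0 \<or> hpoly q d u v ~= 0"
  using assms by (cases "v = 0") (auto simp: ratpair_def hpoly_0 hpoly_nonzero)

lemma nonconst_root:
  fixes p :: "complex poly"
  assumes "degree p > 0"
  shows "\<exists>z. poly p z = 0"
  using Fundamental_Theorem_Algebra.fundamental_theorem_of_algebra[of p] assms
  by (metis constant_degree neq0_conv)

lemma rat_eval_hpt:
  assumes "ratpair p q d" "u ~= 0 \<or> v ~= 0"
  shows "rat_eval p q (hpt u v) = hpt (hpoly p d u v) (hpoly q d u v)"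
proof (cases "v = 0")
  case False
  then show ?thesis using assms by (auto simp: ratpair_def hpoly_nonzero rat_eval_def hpt_def)
next
  case True
  have d: "d > 0" "degree p \<le> d" "degree q \<le> d" "coeff p d ~= 0 \<or> coeff q d ~= 0"
    using assms by (auto simp: ratpair_def)
  consider "degree p > degree q" | "degree p = degree q" | "degree p < degree q" by linarith
  then show ?thesis
  proof cases
    case 1
    then have "coeff q d = 0" using d by (intro coeff_eq_0) auto
    then show ?thesis using True 1 by (simp add: rat_eval_def hpoly_0)
  next
    case 2
    then have "degree p = d" "degree q = d"
      using d by (metis coeff_eq_0 le_neq_implies_less)+
    then show ?thesis using True 2 assms d by (auto simp: rat_eval_def hpoly_0 hpt_def)
  next
    case 3
    then have "coeff p d = 0" "degree q = d"
      using d by (metis coeff_eq_0 le_neq_implies_less less_le_trans)+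
    then show ?thesis using True 3 assms d by (auto simp: rat_eval_def hpoly_0 hpt_def)
  qed
qed

lemma ratmap_eqI:
  assumes "\<And>u v. u ~= 0 \<or> v ~= 0 ==> F (hpt u v) = G (hpt u v)"
  shows "F = G"
  using assms by (intro ext) (metis hpt_cases)

subsection \<open>Moebius transformations\<close>

definition mob :: "complex => complex => complex => complex => sphere => sphere" where
  "mob a b c e = rat_eval [:b, a:] [:e, c:]"

lemma ratpair_mob:
  assumes "a * e - b * c ~= 0"
  shows "ratpair [:b, a:] [:e, c:] 1"
proof -
  have "b + z * a ~= 0 \<or> e + z * c ~= 0" for z
  proof (rule ccontr)
    assume "\<not> ?thesis"
    then have "b = - (z * a)" "e = - (z * c)" by (auto simp: eq_neg_iff_add_eq_0)
    then show False using assms by simp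
  qed
  moreover have "a ~= 0 \<or> c ~= 0" using assms by auto
  ultimately show ?thesis by (simp add: ratpair_def)
qed

lemma ratmap_mob: "a * e - b * c ~= 0 ==> ratmap 1 (mob a b c e)"
  unfolding ratmap_def mob_def using ratpair_mob by blast

lemma mob_hpt:
  assumes "a * e - b * c ~= 0" "u ~= 0 \<or> v ~= 0"
  shows "mob a b c e (hpt u v) = hpt (a * u + b * v) (c * u + e * v)"
  using rat_eval_hpt[OF ratpair_mob[OF assms(1)] assms(2)] by (simp add: mob_def)

lemma mob_nonzero:
  fixes a :: complex
  assumes "a * e - b * c ~= 0" "u ~= 0 \<or> v ~= 0"
  shows "a * u + b * v ~= 0 \<or> c * u + e * v ~= 0"
  using ratpair_hpoly_nonzero[OF ratpair_mob[OF assms(1)] assms(2)] by simp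

lemma mob_compose:
  assumes "a * e - b * c ~= 0" "a' * e' - b' * c' ~= 0"
  shows "mob a b c e \<circ> mob a' b' c' e' = mob (a * a' + b * c') (a * b' + b * e') (c * a' + e * c') (c * b' + e * e')"
proof (rule ratmap_eqI)
  fix u v :: complex assume uv: "u ~= 0 \<or> v ~= 0"
  have det: "(a * a' + b * c') * (c * b' + e * e') - (a * b' + b * e') * (c * a' + e * c') =
      (a * e - b * c) * (a' * e' - b' * c')" by algebra
  show "(mob a b c e \<circ> mob a' b' c' e') (hpt u v) =
     mob (a * a' + b * c') (a * b' + b * e') (c * a' + e * c') (c * b' + e * e') (hpt u v)"
    using assms uv mob_nonzero[OF assms(2) uv]
    by (simp add: mob_hpt det) (simp add: algebra_simps)
qed

lemma mob_scalar: "k ~= 0 ==> mob k 0 0 k = id"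
  by (rule ratmap_eqI) (simp add: mob_hpt hpt_scale)

lemma mob_inverse:
  assumes "a * e - b * c ~= 0"
  shows "mob e (-b) (-c) a \<circ> mob a b c e = id" "mob a b c e \<circ> mob e (-b) (-c) a = id"
proof -
  have *: "e * a - (-b) * (-c) ~= 0" using assms by (simp add: mult.commute)
  have "mob e (-b) (-c) a \<circ> mob a b c e = mob (a * e - b * c) 0 0 (a * e - b * c)"
    by (simp add: mob_compose[OF * assms]) (simp add: algebra_simps)
  moreover have "mob a b c e \<circ> mob e (-b) (-c) a = mob (a * e - b * c) 0 0 (a * e - b * c)"
    by (simp add: mob_compose[OF assms *]) (simp add: algebra_simps)
  ultimately show "mob e (-b) (-c) a \<circ> mob a b c e = id" "mob a b c e \<circ> mob e (-b) (-c) a = id"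
    by (simp_all add: mob_scalar[OF assms])
qed

lemma ratpair_post_mob:
  assumes "ratpair p q d" "a * e - b * c ~= 0"
  shows "ratpair (smult a p + smult b q) (smult c p + smult e q) d"
proof -
  have "degree (smult x p + smult y q) \<le> d" for x y
    using assms by (auto simp: ratpair_def intro!: degree_add_le order_trans[OF degree_smult_le])
  moreover have "a * coeff p d + b * coeff q d ~= 0 \<or> c * coeff p d + e * coeff q d ~= 0"
    using assms by (intro mob_nonzero) (auto simp: ratpair_def)
  moreover have "a * poly p z + b * poly q z ~= 0 \<or> c * poly p z + e * poly q z ~= 0" for z
    using assms by (intro mob_nonzero) (auto simp: ratpair_def)
  ultimately show ?thesis
    using assms by (auto simp: ratpair_def)
qed

lemma rat_eval_post_mob:
  assumes "ratpair p q d" "a * e - b * c ~= 0"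
  shows "mob a b c e \<circ> rat_eval p q = rat_eval (smult a p + smult b q) (smult c p + smult e q)"
proof (rule ratmap_eqI)
  fix u v :: complex assume uv: "u ~= 0 \<or> v ~= 0"
  show "(mob a b c e \<circ> rat_eval p q) (hpt u v) =
    rat_eval (smult a p + smult b q) (smult c p + smult e q) (hpt u v)"
    using rat_eval_hpt[OF assms(1) uv] rat_eval_hpt[OF ratpair_post_mob[OF assms] uv]
      mob_hpt[OF assms(2) ratpair_hpoly_nonzero[OF assms(1) uv]]
    by (simp add: hpoly_add hpoly_smult)
qed

text \<open>The polynomial (c z + e)^d p((a z + b) / (c z + e)), written without division so that it
  makes sense at the pole as well.\<close>

definition psub :: "complex => complex => complex => complex => nat => complex poly => complex poly" where
  "psub a b c e d p = (\<Sum>i\<le>d. smult (coeff p i) ([:b, a:] ^ i * [:e, c:] ^ (d - i)))"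

lemma degree_psub: "degree (psub a b c e d p) \<le> d"
  unfolding psub_def
proof (intro degree_sum_le finite_atMost)
  fix i assume "i \<in> {..d}"
  have "degree ([:b, a:] ^ i * [:e, c:] ^ (d - i)) \<le> i + (d - i)"
    using degree_mult_le hpoly_power_linear by (meson add_mono order_trans)
  then show "degree (smult (coeff p i) ([:b, a:] ^ i * [:e, c:] ^ (d - i))) \<le> d"
    using \<open>i \<in> {..d}\<close> by (auto intro: order_trans[OF degree_smult_le])
qed

lemma hpoly_psub:
  "hpoly (psub a b c e d p) d u v = hpoly p d (a * u + b * v) (c * u + e * v)"
proof -
  have "hpoly ([:b, a:] ^ i * [:e, c:] ^ (d - i)) d u v = (a * u + b * v) ^ i * (c * u + e * v) ^ (d - i)"
    if "i \<le> d" for i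
    using hpoly_mult[of "[:b, a:] ^ i" i "[:e, c:] ^ (d - i)" "d - i" u v] hpoly_power_linear that by simp
  then show ?thesis
    by (simp add: psub_def hpoly_sum hpoly_smult hpoly_def[of p] mult.assoc)
qed

lemma ratpair_pre_mob:
  assumes "ratpair p q d" "a * e - b * c ~= 0"
  shows "ratpair (psub a b c e d p) (psub a b c e d q) d"
proof -
  have *: "hpoly (psub a b c e d p) d u v ~= 0 \<or> hpoly (psub a b c e d q) d u v ~= 0" if "u ~= 0 \<or> v ~= 0" for u v
    unfolding hpoly_psub using ratpair_hpoly_nonzero[OF assms(1) mob_nonzero[OF assms(2) that]] .
  from *[of _ 1] *[of 1 0] show ?thesis
    using assms by (auto simp: ratpair_def degree_psub hpoly_0)
qed

lemma rat_eval_pre_mob: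
  assumes "ratpair p q d" "a * e - b * c ~= 0"
  shows "rat_eval p q \<circ> mob a b c e = rat_eval (psub a b c e d p) (psub a b c e d q)"
proof (rule ratmap_eqI)
  fix u v :: complex assume uv: "u ~= 0 \<or> v ~= 0"
  show "(rat_eval p q \<circ> mob a b c e) (hpt u v) =
    rat_eval (psub a b c e d p) (psub a b c e d q) (hpt u v)"
    using rat_eval_hpt[OF ratpair_pre_mob[OF assms] uv] mob_hpt[OF assms(2) uv]
      rat_eval_hpt[OF assms(1) mob_nonzero[OF assms(2) uv]]
    by (simp add: hpoly_psub)
qed

lemma ratmap_post_mob: "ratmap d F ==> a * e - b * c ~= 0 ==> ratmap d (mob a b c e \<circ> F)"
  unfolding ratmap_def using ratpair_post_mob rat_eval_post_mob by metis

lemma ratmap_pre_mob: "ratmap d F ==> a * e - b * c ~= 0 ==> ratmap d (F \<circ> mob a b c e)"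
  unfolding ratmap_def using ratpair_pre_mob rat_eval_pre_mob by metis

subsection \<open>Preimages\<close>

lemma rat_eval_eq_iff:
  assumes "ratpair p q d" "u ~= 0 \<or> v ~= 0" "y1 ~= 0 \<or> y2 ~= 0"
  shows "rat_eval p q (hpt u v) = hpt y1 y2 \<longleftrightarrow> hpoly (smult y2 p - smult y1 q) d u v = 0"
  unfolding rat_eval_hpt[OF assms(1,2)] hpt_eq_iff[OF ratpair_hpoly_nonzero[OF assms(1,2)] assms(3)]
  by (simp add: hpoly_diff hpoly_smult mult.commute)

text \<open>If the combination vanished, \<open>p\<close> and \<open>q\<close> would be multiples of
  one polynomial \<open>r\<close> of degree at least \<open>d > 0\<close>, and a root of
  \<open>r\<close> would be a common zero.\<close>

lemma preimage_poly_nonzero: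
  assumes "ratpair p q d" "y1 ~= 0 \<or> y2 ~= 0"
  shows "smult y2 p - smult y1 q ~= 0"
proof
  assume 0: "smult y2 p - smult y1 q = 0"
  obtain r where r: "p = smult y1 r" "q = smult y2 r"
  proof (cases "y2 = 0")
    case True
    with 0 assms(2) have "q = 0" by simp
    then show ?thesis using that[of "smult (1 / y1) p"] True assms(2) by simp
  next
    case False
    with 0 have "p = smult (1 / y2) (smult y1 q)"
      by (metis (no_types, lifting) eq_iff_diff_eq_0 nonzero_eq_divide_eq smult_1_left smult_smult)
    then show ?thesis using that[of "smult (1 / y2) q"] False by (simp add: mult.commute)
  qed
  have "coeff r d ~= 0" using assms r by (auto simp: ratpair_def)
  then have "d \<le> degree r" by (rule le_degree)
  then have "degree r > 0" using assms by (simp add: ratpair_def)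
  then obtain z where "poly r z = 0" using nonconst_root by blast
  then show False using assms r by (auto simp: ratpair_def)
qed

lemma preimage_eq:
  assumes "ratpair p q d" "y1 ~= 0 \<or> y2 ~= 0"
  defines "P \<equiv> smult y2 p - smult y1 q"
  shows "{z. rat_eval p q z = hpt y1 y2} =
    Some ` {z. poly P z = 0} \<union> (if coeff P d = 0 then {None} else {})"
proof -
  have dP: "degree P \<le> d"
    using assms by (auto simp: ratpair_def P_def intro!: degree_diff_le order_trans[OF degree_smult_le])
  have "rat_eval p q (Some z) = hpt y1 y2 \<longleftrightarrow> poly P z = 0" for z
    using rat_eval_eq_iff[OF assms(1), of z 1 y1 y2] assms(2) dP by (simp add: P_def)
  moreover have "rat_eval p q None = hpt y1 y2 \<longleftrightarrow> coeff P d = 0"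
    using rat_eval_eq_iff[OF assms(1), of 1 0 y1 y2] assms(2) by (simp add: P_def hpoly_0)
  ultimately show ?thesis
    by (auto simp: image_iff) (metis option.exhaust)+
qed

lemma preimage_finite_card:
  assumes "ratmap d F"
  shows "finite {z. F z = y} \<and> card {z. F z = y} \<le> d"
proof -
  obtain p q where F: "ratpair p q d" "F = rat_eval p q" using assms by (auto simp: ratmap_def)
  obtain y1 y2 where y: "y = hpt y1 y2" "y1 ~= 0 \<or> y2 ~= 0" by (rule hpt_cases)
  define P where "P = smult y2 p - smult y1 q"
  have P0: "P ~= 0" using preimage_poly_nonzero[OF F(1) y(2)] by (simp add: P_def)
  have dP: "degree P \<le> d"
    using F by (auto simp: ratpair_def P_def intro!: degree_diff_le order_trans[OF degree_smult_le])
  have fin: "finite {z. poly P z = 0}" using P0 by (rule poly_roots_finite)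
  have c: "card (Some ` {z. poly P z = 0}) \<le> degree P"
    using card_poly_roots_bound[OF P0] card_image_le[OF fin, of Some] by linarith
  \<comment> \<open>Infinity is a preimage exactly when the degree drops, so the additional point is
    paid for by a missing root.\<close>
  have "coeff P d = 0 ==> degree P < d"
    using dP P0 by (metis le_neq_implies_less leading_coeff_0_iff)
  then have "card (Some ` {z. poly P z = 0} \<union> (if coeff P d = 0 then {None} else {})) \<le> d"
    using c dP card_Un_le[of "Some ` {z. poly P z = 0}" "{None}"] by auto
  then show ?thesis
    using preimage_eq[OF F(1) y(2)] F(2) y(1) fin by (simp add: P_def)
qed

lemma ratmap_surj:
  assumes "ratmap d F"
  shows "\<exists>z. F z = y"
proof -
  obtain p q where F: "ratpair p q d" "F = rat_eval p q" using assms by (auto simp: ratmap_def)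
  obtain y1 y2 where y: "y = hpt y1 y2" "y1 ~= 0 \<or> y2 ~= 0" by (rule hpt_cases)
  define P where "P = smult y2 p - smult y1 q"
  have "{z. F z = y} ~= {}"
  proof (cases "degree P > 0")
    case True
    then show ?thesis
      using nonconst_root[OF True] preimage_eq[OF F(1) y(2)] F(2) y(1) by (auto simp: P_def)
  next
    case False
    then have "coeff P d = 0" using F by (intro coeff_eq_0) (auto simp: ratpair_def)
    then show ?thesis
      using preimage_eq[OF F(1) y(2)] F(2) y(1) by (auto simp: P_def)
  qed
  then show ?thesis by auto
qed

subsection \<open>Holomorphic maps into the sphere\<close>

text \<open>Numerator and denominator without common zeros make poles ordinary points. The
  description is local and only asks for existence, so it is preserved by composition with any
  rational map.\<close>

definition sholo :: "(complex => sphere) => bool" where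
  "sholo f \<longleftrightarrow> (\<forall>w. \<exists>e>0. \<exists>A B. A holomorphic_on ball w e \<and> B holomorphic_on ball w e \<and>
     (\<forall>x\<in>ball w e. (A x ~= 0 \<or> B x ~= 0) \<and> f x = hpt (A x) (B x)))"

lemma sholo_ichart: "sholo (ichart a)"
  unfolding sholo_def
proof (intro allI)
  fix w
  show "\<exists>e>0. \<exists>A B. A holomorphic_on ball w e \<and> B holomorphic_on ball w e \<and>
     (\<forall>x\<in>ball w e. (A x ~= 0 \<or> B x ~= 0) \<and> ichart a x = hpt (A x) (B x))"
  proof (cases a)
    case None
    then show ?thesis
      by (intro exI[of _ 1] conjI zero_less_one exI[of _ "\<lambda>_. 1"] exI[of _ "\<lambda>x. x"])
        (auto simp: ichart_def hpt_def field_simps)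
  next
    case Some
    then show ?thesis
      by (intro exI[of _ 1] conjI zero_less_one exI[of _ "\<lambda>x. x"] exI[of _ "\<lambda>_. 1"])
        (auto simp: ichart_def)
  qed
qed

lemma sholo_ratmap:
  assumes "ratmap d F" "sholo f"
  shows "sholo (F \<circ> f)"
  unfolding sholo_def
proof (intro allI)
  fix w
  obtain p q where F: "ratpair p q d" "F = rat_eval p q" using assms by (auto simp: ratmap_def)
  obtain e A B where e: "e > 0" "A holomorphic_on ball w e" "B holomorphic_on ball w e"
     "\<And>x. x \<in> ball w e ==> (A x ~= 0 \<or> B x ~= 0) \<and> f x = hpt (A x) (B x)"
    using assms(2) unfolding sholo_def by metis
  have "(\<lambda>x. hpoly r d (A x) (B x)) holomorphic_on ball w e" for r
    unfolding hpoly_def using e(2,3) by (intro holomorphic_intros)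
  then show "\<exists>e>0. \<exists>A B. A holomorphic_on ball w e \<and> B holomorphic_on ball w e \<and>
     (\<forall>x\<in>ball w e. (A x ~= 0 \<or> B x ~= 0) \<and> (F \<circ> f) x = hpt (A x) (B x))"
    using e F rat_eval_hpt[OF F(1)] ratpair_hpoly_nonzero[OF F(1)]
    by (intro exI[of _ e] conjI exI[of _ "\<lambda>x. hpoly p d (A x) (B x)"] exI[of _ "\<lambda>x. hpoly q d (A x) (B x)"])
      auto
qed

lemma sholo_affine:
  assumes "sholo f"
  shows "sholo (\<lambda>x. f (c + of_real r * x))"
  unfolding sholo_def
proof (intro allI)
  fix w :: complex
  obtain e A B where e: "e > 0" "A holomorphic_on ball (c + of_real r * w) e" "B holomorphic_on ball (c + of_real r * w) e"
     "\<And>x. x \<in> ball (c + of_real r * w) e ==> (A x ~= 0 \<or> B x ~= 0) \<and> f x = hpt (A x) (B x)"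
    using assms unfolding sholo_def by metis
  define \<epsilon> where "\<epsilon> = e / (\<bar>r\<bar> + 1)"
  have "c + of_real r * x \<in> ball (c + of_real r * w) e" if "x \<in> ball w \<epsilon>" for x
  proof -
    have "cmod (of_real r * w - of_real r * x) = \<bar>r\<bar> * cmod (w - x)"
      by (simp add: norm_mult flip: right_diff_distrib)
    also have "\<dots> \<le> (\<bar>r\<bar> + 1) * cmod (w - x)"
      by (intro mult_right_mono) auto
    also have "\<dots> < (\<bar>r\<bar> + 1) * \<epsilon>"
      using that by (intro mult_strict_left_mono) (auto simp: dist_norm)
    also have "\<dots> = e" by (simp add: \<epsilon>_def add_nonneg_eq_0_iff)
    finally show ?thesis
      by (simp add: dist_norm)
  qed
  note * = this
  have "(\<lambda>x. G (c + of_real r * x)) holomorphic_on ball w \<epsilon>" if "G holomorphic_on ball (c + of_real r * w) e" for G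
  proof -
    have "(G \<circ> (\<lambda>x. c + of_real r * x)) holomorphic_on ball w \<epsilon>"
      using * by (intro holomorphic_on_compose_gen[OF _ that] holomorphic_intros) auto
    then show ?thesis by (simp add: o_def)
  qed
  then show "\<exists>e>0. \<exists>A B. A holomorphic_on ball w e \<and> B holomorphic_on ball w e \<and>
     (\<forall>x\<in>ball w e. (A x ~= 0 \<or> B x ~= 0) \<and> f (c + of_real r * x) = hpt (A x) (B x))"
    using e * by (intro exI[of _ \<epsilon>] conjI exI[of _ "\<lambda>x. A (c + of_real r * x)"] exI[of _ "\<lambda>x. B (c + of_real r * x)"])
      (auto simp: \<epsilon>_def)
qed

lemma isCont_hpt:
  assumes "isCont A w" "isCont B w" "A w ~= 0 \<or> B w ~= 0"
  shows "isCont (\<lambda>x. hpt (A x) (B x)) w"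
proof -
  have "isCont (\<lambda>x. (cmod (A x))\<^sup>2 + (cmod (B x))\<^sup>2) w"
    using assms by (intro continuous_intros)
  moreover have pos: "(cmod (A w))\<^sup>2 + (cmod (B w))\<^sup>2 > 0"
    using assms(3) by (auto simp: add_pos_nonneg add_nonneg_pos)
  ultimately have "\<forall>\<^sub>F x in at w. (cmod (A x))\<^sup>2 + (cmod (B x))\<^sup>2 > 0"
    using order_tendstoD(1) isCont_def by blast
  then have ev: "\<forall>\<^sub>F x in at w. dist (hpt (A x) (B x)) (hpt (A w) (B w)) =
     2 * cmod (A x * B w - A w * B x) / (sqrt ((cmod (A x))\<^sup>2 + (cmod (B x))\<^sup>2) * sqrt ((cmod (A w))\<^sup>2 + (cmod (B w))\<^sup>2))"
    by eventually_elim (use assms(3) in \<open>auto intro!: dist_hpt\<close>)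
  have "((\<lambda>x. 2 * cmod (A x * B w - A w * B x) / (sqrt ((cmod (A x))\<^sup>2 + (cmod (B x))\<^sup>2) * sqrt ((cmod (A w))\<^sup>2 + (cmod (B w))\<^sup>2)))
     \<longlongrightarrow> 2 * cmod (A w * B w - A w * B w) / (sqrt ((cmod (A w))\<^sup>2 + (cmod (B w))\<^sup>2) * sqrt ((cmod (A w))\<^sup>2 + (cmod (B w))\<^sup>2))) (at w)"
    using assms pos by (intro tendsto_intros) (auto simp: isCont_def)
  then have "((\<lambda>x. dist (hpt (A x) (B x)) (hpt (A w) (B w))) \<longlongrightarrow> 0) (at w)"
    unfolding tendsto_cong[OF ev] by simp
  then show ?thesis
    unfolding isCont_def by (subst tendsto_dist_iff)
qed

lemma sholo_isCont:
  assumes "sholo f"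
  shows "isCont f w"
proof -
  obtain e A B where e: "e > 0" "A holomorphic_on ball w e" "B holomorphic_on ball w e"
     "\<And>x. x \<in> ball w e ==> (A x ~= 0 \<or> B x ~= 0) \<and> f x = hpt (A x) (B x)"
    using assms unfolding sholo_def by metis
  have "isCont A w" "isCont B w"
    using e holomorphic_on_imp_differentiable_at[OF _ open_ball, of _ w e w]
    by (auto intro: field_differentiable_imp_continuous_at)
  then have "isCont (\<lambda>x. hpt (A x) (B x)) w"
    using e by (intro isCont_hpt) auto
  moreover have "\<forall>\<^sub>F x in nhds w. f x = hpt (A x) (B x)"
    using e(1,4) by (intro eventually_nhds_in_open[THEN eventually_mono, of "ball w e"]) auto
  ultimately show ?thesis
    using isCont_cong[of f "\<lambda>x. hpt (A x) (B x)" w] by simp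
qed

lemma sholo_chart:
  assumes "sholo f" "f w ~= antip a"
  shows "\<exists>e>0. (chart a \<circ> f) holomorphic_on ball w e"
proof -
  obtain e A B where e: "e > 0" "A holomorphic_on ball w e" "B holomorphic_on ball w e"
     "\<And>x. x \<in> ball w e ==> (A x ~= 0 \<or> B x ~= 0) \<and> f x = hpt (A x) (B x)"
    using assms unfolding sholo_def by metis
  have "isCont f w" using assms by (simp add: sholo_isCont)
  then obtain \<delta> where \<delta>: "\<delta> > 0" "\<And>x. dist w x < \<delta> ==> f x ~= antip a"
    using continuous_at_avoid[of w f "antip a"] assms(2) by blast
  define r where "r = min e \<delta>"
  have r: "r > 0" "ball w r \<subseteq> ball w e" using e \<delta> by (auto simp: r_def)
  have hol: "A holomorphic_on ball w r" "B holomorphic_on ball w r"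
    using e(2,3) r(2) holomorphic_on_subset by blast+
  have ne: "f x ~= antip a" "A x ~= 0 \<or> B x ~= 0" "f x = hpt (A x) (B x)" if "x \<in> ball w r" for x
    using that e(4)[of x] \<delta>(2)[of x] by (auto simp: r_def)
  show ?thesis
  proof (cases a)
    case None
    have "A x ~= 0" "(chart a \<circ> f) x = B x / A x" if "x \<in> ball w r" for x
      using ne[OF that] None by (auto simp: antip_def chart_def hpt_def split: if_splits)
    then have "(chart a \<circ> f) holomorphic_on ball w r"
      using hol by (subst holomorphic_cong[OF refl, of _ _ "\<lambda>x. B x / A x"]) (auto intro!: holomorphic_intros)
    then show ?thesis using r by blast
  next
    case Some
    have "B x ~= 0" "(chart a \<circ> f) x = A x / B x" if "x \<in> ball w r" for x
      using ne[OF that] Some by (auto simp: antip_def chart_def hpt_def split: if_splits)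
    then have "(chart a \<circ> f) holomorphic_on ball w r"
      using hol by (subst holomorphic_cong[OF refl, of _ _ "\<lambda>x. A x / B x"]) (auto intro!: holomorphic_intros)
    then show ?thesis using r by blast
  qed
qed

lemma isCont_via_ichart:
  fixes F :: "sphere => 'b::topological_space"
  assumes "isCont (F \<circ> ichart a) (chart a a)"
  shows "isCont F a"
proof -
  have "isCont ((F \<circ> ichart a) \<circ> chart a) a"
    by (rule continuous_at_compose[OF isCont_chart[OF antip_neq(2)] assms])
  moreover have "\<forall>\<^sub>F y in nhds a. F y = ((F \<circ> ichart a) \<circ> chart a) y"
    by (rule eventually_nhds_in_open[of "- {antip a}", THEN eventually_mono]) (auto simp: ichart_chart)
  ultimately show ?thesis
    using isCont_cong[of F "(F \<circ> ichart a) \<circ> chart a" a] by simp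
qed

lemma ratmap_isCont: "ratmap d F ==> isCont F a"
  by (intro isCont_via_ichart sholo_isCont sholo_ratmap sholo_ichart)

lemma ratmap_continuous_on: "ratmap d F ==> continuous_on S F"
  by (simp add: continuous_at_imp_continuous_on ratmap_isCont)

lemma local_rep_holomorphic:
  assumes "ratmap d F"
  shows "\<exists>e>0. local_rep F z holomorphic_on ball (chart z z) e"
proof -
  have "\<exists>e>0. (chart (F z) \<circ> (F \<circ> ichart z)) holomorphic_on ball (chart z z) e"
    by (intro sholo_chart sholo_ratmap[OF assms] sholo_ichart) simp
  then show ?thesis by (simp add: local_rep_def o_assoc)
qed

text \<open>The open mapping theorem in charts. The local representation cannot be constant, since
  fibres are finite while nonempty open subsets of the sphere are infinite.\<close>

lemma ratmap_open_map:
  assumes "ratmap d F" "open U"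
  shows "open (F ` U)"
proof (subst open_subopen, safe)
  fix z assume z: "z \<in> U"
  define x0 where "x0 = chart z z"
  obtain e where e: "e > 0" "local_rep F z holomorphic_on ball x0 e"
    using local_rep_holomorphic[OF assms(1)] x0_def by blast
  have "open (ichart z -` (U \<inter> F -` (- {antip (F z)})))"
    using assms(2) by (intro open_vimage continuous_on_ichart open_Int ratmap_continuous_on[OF assms(1)]) auto
  moreover have "x0 \<in> ichart z -` (U \<inter> F -` (- {antip (F z)}))" using z by (simp add: x0_def)
  ultimately obtain r where r: "r > 0" "ball x0 r \<subseteq> ichart z -` (U \<inter> F -` (- {antip (F z)}))"
    using open_contains_ball by blast
  define s where "s = min r e"
  have s: "s > 0" "local_rep F z holomorphic_on ball x0 s" "ball x0 s \<subseteq> ichart z -` (U \<inter> F -` (- {antip (F z)}))"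
    using e r by (auto simp: s_def intro: holomorphic_on_subset)
  have bk: "ichart (F z) (local_rep F z x) = F (ichart z x)" if "x \<in> ball x0 s" for x
  proof -
    have "F (ichart z x) ~= antip (F z)" using s(3) that by blast
    then show ?thesis by (simp add: local_rep_def ichart_chart)
  qed
  have "\<not> local_rep F z constant_on ball x0 s"
  proof
    assume "local_rep F z constant_on ball x0 s"
    then obtain c where c: "\<And>x. x \<in> ball x0 s ==> local_rep F z x = c" by (auto simp: constant_on_def)
    have "ichart z ` ball x0 s \<subseteq> {w. F w = ichart (F z) c}"
      using bk c by auto
    then have "finite (ichart z ` ball x0 s)"
      using preimage_finite_card[OF assms(1)] finite_subset by blast
    then show False
      using infinite_open_sphere[OF open_ichart_image[OF open_ball]] s(1) by auto
  qed
  then have "open (local_rep F z ` ball x0 s)"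
    using s by (intro open_mapping_thm[of _ "ball x0 s"]) auto
  then have "open (ichart (F z) ` local_rep F z ` ball x0 s)"
    by (rule open_ichart_image)
  moreover have "ichart (F z) ` local_rep F z ` ball x0 s \<subseteq> F ` U"
    using bk s(3) by auto
  moreover have "F z \<in> ichart (F z) ` local_rep F z ` ball x0 s"
    using bk[of x0] s(1) by (auto simp: x0_def image_iff intro!: bexI[of _ "chart z z"])
  ultimately show "\<exists>T. open T \<and> F z \<in> T \<and> T \<subseteq> F ` U" by blast
qed

subsection \<open>Montel's theorem\<close>

text \<open>Schottky's theorem bounds a function \<open>g\<close> omitting 0 and 1 with |g 0| \<le>
  1 by \<open>K\<close> on the disk of radius 1/2; the 16 is 2 + 2 * 1 + 12 * (1/2) / (1 - 1/2).
  Cauchy's inequality on circles of radius 1/4 bounds the derivative by 4 K, and passing to the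
  chordal metric costs a factor 2. If |g 0| > 1, the function 1/g omits the same values and has the
  same chordal distances.\<close>

lemma montel_special:
  assumes "sholo f" "\<And>w. w \<in> cball 0 1 ==> f w ~= None \<and> f w ~= Some 0 \<and> f w ~= Some 1" "cmod w \<le> 1/4"
  shows "dist (f w) (f 0) \<le> 8 * exp (pi * exp (pi * 16)) * cmod w"
proof -
  define K where "K = exp (pi * exp (pi * 16))"
  have key: "dist (Some (g w)) (Some (g 0) :: sphere) \<le> 8 * K * cmod w"
    if g: "g holomorphic_on cball 0 1" "cmod (g 0) \<le> 1" "\<And>w. w \<in> cball 0 1 ==> \<not> (g w = 0 \<or> g w = 1)" for g
  proof -
    have bd: "cmod (g x) \<le> K" if "cmod x \<le> 1/2" for x
    proof -
      have "cmod (g x) \<le> exp (pi * exp (pi * (2 + 2 * 1 + 12 * (1/2) / (1 - 1/2))))"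
        using Schottky[OF g(1) g(2) g(3), of "1/2" x] that by auto
      then show ?thesis by (simp add: K_def)
    qed
    have "cmod (g w - g 0) \<le> (4 * K) * cmod (w - 0)"
    proof (rule field_differentiable_bound[of "cball 0 (1/4)" g "deriv g"])
      show "(g has_field_derivative deriv g x) (at x within cball 0 (1/4))" if "x \<in> cball 0 (1/4)" for x
      proof -
        have "g holomorphic_on ball 0 1" using g(1) by (meson ball_subset_cball holomorphic_on_subset)
        then have "(g has_field_derivative deriv g x) (at x)"
          using that by (intro holomorphic_derivI[of g "ball 0 1"]) auto
        then show ?thesis by (rule has_field_derivative_at_within)
      qed
      show "cmod (deriv g x) \<le> 4 * K" if "x \<in> cball 0 (1/4)" for x
      proof -
        have sub: "cball x (1/4) \<subseteq> ball 0 1"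
        proof
          fix y assume "y \<in> cball x (1/4)"
          then show "y \<in> ball 0 1"
            using that norm_triangle_ineq[of x "y - x"] by (auto simp: dist_norm norm_minus_commute)
        qed
        have "cmod ((deriv ^^ 1) g x) \<le> fact 1 * K / (1/4) ^ 1"
        proof (rule Cauchy_inequality)
          show "g holomorphic_on ball x (1/4)"
            using g(1) sub by (meson ball_subset_cball holomorphic_on_subset order_trans)
          show "continuous_on (cball x (1/4)) g"
            using g(1) sub by (meson ball_subset_cball holomorphic_on_imp_continuous_on holomorphic_on_subset order_trans)
          fix y assume "cmod (x - y) = 1/4"
          then show "cmod (g y) \<le> K"
            using that norm_triangle_ineq4[of x "x - y"] by (intro bd) auto
        qed auto
        then show ?thesis by simp
      qed
    qed (use assms(3) in auto)
    then show ?thesis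
      using dist_ichart_le[of "Some 0" "g w" "g 0"] by (simp add: ichart_def)
  qed
  define g where "g = chart (Some 0) \<circ> f"
  have fg: "f x = Some (g x)" if "x \<in> cball 0 1" for x
    using assms(2)[OF that] by (auto simp: g_def chart_def)
  have gh: "g holomorphic_on cball 0 1"
  proof (unfold holomorphic_on_def, intro ballI)
    fix x :: complex assume x: "x \<in> cball 0 1"
    then have "f x ~= antip (Some 0)" using assms(2) by (auto simp: antip_def)
    then obtain e where "e > 0" "g holomorphic_on ball x e"
      using sholo_chart[OF assms(1)] g_def by blast
    then have "g field_differentiable (at x)"
      by (meson centre_in_ball holomorphic_on_imp_differentiable_at open_ball)
    then show "g field_differentiable (at x within cball 0 1)"
      by (rule field_differentiable_at_within)
  qed
  have g01: "\<not> (g x = 0 \<or> g x = 1)" if "x \<in> cball 0 1" for x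
    using assms(2)[OF that] fg[OF that] by auto
  have w: "w \<in> cball 0 1" "0 \<in> cball 0 (1::real)" using assms(3) by auto
  show ?thesis
  proof (cases "cmod (g 0) \<le> 1")
    case True
    then show ?thesis using key[OF gh True g01] fg w by (simp add: K_def)
  next
    case False
    have "dist (Some (1 / g w)) (Some (1 / g 0) :: sphere) \<le> 8 * K * cmod w"
      using g01 False gh by (intro key) (auto intro!: holomorphic_intros simp: norm_divide)
    moreover have "dist (hpt (g w) 1) (hpt (g 0) 1) = dist (hpt 1 (g w)) (hpt 1 (g 0))"
      by (intro dist_hpt_swap) auto
    moreover have "hpt 1 (g w) = Some (1 / g w)" "hpt 1 (g 0) = Some (1 / g 0)"
      using g01[of w] g01[of 0] w by (auto simp: hpt_def)
    ultimately show ?thesis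
      using fg[of w] fg[of 0] w by (simp add: K_def)
  qed
qed

text \<open>The cross ratio in homogeneous coordinates: the numerator is the linear form vanishing
  at \<open>a\<close>, the denominator the one vanishing at \<open>c\<close>, and the factors
  \<alpha> and \<gamma> equalise them at \<open>b\<close>.\<close>

lemma three_points_mob:
  assumes "a ~= b" "b ~= c" "a ~= c"
  obtains k l m n where "k * n - l * m ~= 0"
    "mob k l m n a = Some 0" "mob k l m n b = Some 1" "mob k l m n c = None"
proof -
  obtain a1 a2 where a: "a = hpt a1 a2" "a1 ~= 0 \<or> a2 ~= 0" by (rule hpt_cases)
  obtain b1 b2 where b: "b = hpt b1 b2" "b1 ~= 0 \<or> b2 ~= 0" by (rule hpt_cases)
  obtain c1 c2 where c: "c = hpt c1 c2" "c1 ~= 0 \<or> c2 ~= 0" by (rule hpt_cases)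
  define \<alpha> \<gamma> \<beta> where "\<alpha> = b1 * c2 - c1 * b2" "\<gamma> = b1 * a2 - a1 * b2" "\<beta> = a1 * c2 - c1 * a2"
  have nz: "\<alpha> ~= 0" "\<gamma> ~= 0" "\<beta> ~= 0"
    using assms a b c by (auto simp: hpt_eq_iff \<alpha>_\<gamma>_\<beta>_def)
  have det: "(\<alpha> * a2) * (- \<gamma> * c1) - (- \<alpha> * a1) * (\<gamma> * c2) = \<alpha> * \<gamma> * \<beta>"
    by (simp add: \<alpha>_\<gamma>_\<beta>_def) algebra
  show thesis
  proof (rule that[of "\<alpha> * a2" "- \<gamma> * c1" "- \<alpha> * a1" "\<gamma> * c2"])
    show d: "(\<alpha> * a2) * (- \<gamma> * c1) - (- \<alpha> * a1) * (\<gamma> * c2) ~= 0" using det nz by simp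
    have "\<alpha> * a2 * a1 + - \<alpha> * a1 * a2 = 0" "\<gamma> * c2 * a1 + - \<gamma> * c1 * a2 = \<gamma> * \<beta>"
      by (simp_all add: \<alpha>_\<gamma>_\<beta>_def algebra_simps)
    then show "mob (\<alpha> * a2) (- \<alpha> * a1) (\<gamma> * c2) (- \<gamma> * c1) a = Some 0"
      using mob_hpt[OF d a(2)] a(1) nz by (simp add: hpt_def)
    have "\<alpha> * a2 * b1 + - \<alpha> * a1 * b2 = \<alpha> * \<gamma>" "\<gamma> * c2 * b1 + - \<gamma> * c1 * b2 = \<alpha> * \<gamma>"
      by (simp_all add: \<alpha>_\<gamma>_\<beta>_def algebra_simps)
    then show "mob (\<alpha> * a2) (- \<alpha> * a1) (\<gamma> * c2) (- \<gamma> * c1) b = Some 1"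
      using mob_hpt[OF d b(2)] b(1) nz by (simp add: hpt_def)
    have "\<gamma> * c2 * c1 + - \<gamma> * c1 * c2 = 0"
      by (simp add: algebra_simps)
    then show "mob (\<alpha> * a2) (- \<alpha> * a1) (\<gamma> * c2) (- \<gamma> * c1) c = None"
      using mob_hpt[OF d c(2)] c(1) by (simp add: hpt_def)
  qed
qed

text \<open>After the three values are moved to 0, 1 and infinity, the Lipschitz bound of
  \<open>montel_special\<close> is the same for all \<open>i\<close>; uniform continuity of the
  inverse Moebius map carries it back.\<close>

theorem montel_three_points:
  assumes "\<And>i. i \<in> I ==> sholo (f i)"
    and "\<And>i w. i \<in> I ==> w \<in> cball 0 1 ==> f i w \<notin> {a, b, c}"
    and "a ~= b" "b ~= c" "a ~= c" "0 < e"
  shows "\<exists>\<delta>>0. \<forall>i\<in>I. \<forall>w. cmod w < \<delta> --> dist (f i w) (f i 0) < e"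
proof -
  obtain k l m n where T: "k * n - l * m ~= 0"
    "mob k l m n a = Some 0" "mob k l m n b = Some 1" "mob k l m n c = None"
    using three_points_mob[OF assms(3-5)] .
  have det': "n * k - (-l) * (-m) ~= 0" using T by (simp add: mult.commute)
  have "uniformly_continuous_on UNIV (mob n (-l) (-m) k)"
    by (intro compact_uniformly_continuous ratmap_continuous_on[OF ratmap_mob[OF det']] compact_sphere_UNIV)
  then obtain \<eta> where \<eta>: "\<eta> > 0" "\<And>x y. dist x y < \<eta> ==> dist (mob n (-l) (-m) k x) (mob n (-l) (-m) k y) < e"
    using assms(6) unfolding uniformly_continuous_on_def by (metis UNIV_I dist_commute)
  define K where "K = 8 * exp (pi * exp (pi * 16))"
  have K: "K > 0" by (simp add: K_def)
  have inv: "mob n (-l) (-m) k (mob k l m n x) = x" for x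
    using mob_inverse(1)[OF T(1)] by (simp add: fun_eq_iff)
  show ?thesis
  proof (intro exI[of _ "min (1/4) (\<eta> / K)"] conjI ballI allI impI)
    show "min (1/4) (\<eta> / K) > 0" using K \<eta> by simp
    fix i w assume i: "i \<in> I" and w: "cmod w < min (1/4) (\<eta> / K)"
    have "dist ((mob k l m n \<circ> f i) w) ((mob k l m n \<circ> f i) 0) \<le> K * cmod w"
      unfolding K_def
    proof (rule montel_special)
      show "sholo (mob k l m n \<circ> f i)" by (intro sholo_ratmap[OF ratmap_mob[OF T(1)]] assms i)
      fix x :: complex assume "x \<in> cball 0 1"
      then have "f i x \<notin> {a, b, c}" using assms(2) i by blast
      then show "(mob k l m n \<circ> f i) x ~= None \<and> (mob k l m n \<circ> f i) x ~= Some 0 \<and> (mob k l m n \<circ> f i) x ~= Some 1"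
        using inv T by (metis comp_apply insert_iff)
    qed (use w in auto)
    also have "\<dots> < \<eta>" using w K by (simp add: field_simps)
    finally show "dist (f i w) (f i 0) < e"
      using \<eta>(2) inv by fastforce
  qed
qed

section \<open>Fatou and Julia sets\<close>

text \<open>Montel's bound yields equicontinuity directly, and pointwise equicontinuity is easy to
  transport along maps; by \<open>fatou_iff_eqc\<close> it may replace normality on open
  sets.\<close>

definition eqc :: "(sphere => sphere) => sphere => bool" where
  "eqc F z \<longleftrightarrow> (\<forall>e>0. \<exists>\<delta>>0. \<forall>w n. dist z w < \<delta> --> dist ((F ^^ n) z) ((F ^^ n) w) < e)"

lemma isCont_funpow:
  fixes F :: "'a::t2_space => 'a"
  assumes "\<And>x. isCont F x"
  shows "isCont (F ^^ n) x"
proof (induction n)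
  case 0
  then show ?case by (simp add: id_def)
next
  case (Suc n)
  have "isCont (F \<circ> (F ^^ n)) x" by (rule continuous_at_compose[OF Suc assms])
  then show ?case by (simp add: o_def)
qed

lemma compact_cball_sphere: "compact (cball (z::sphere) r)"
  using compact_Int_closed[OF compact_sphere_UNIV closed_cball] by simp

text \<open>Otherwise there are points \<open>w k\<close> tending to \<open>z\<close> and times
  \<open>r k\<close> at which the orbits are apart. Along a uniformly convergent subsequence the
  iterate at a late time is compared, through the limit \<open>g\<close>, with the iterate at one
  fixed time, whose continuity at \<open>z\<close> closes a chain of five distances.\<close>

lemma normal_imp_eqc:
  assumes cont: "\<And>x. isCont F x" and U: "open U" "z \<in> U" "normal_iterates F U"
  shows "eqc F z"
proof (rule ccontr)
  assume "\<not> eqc F z"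
  then obtain e where e: "e > 0" "\<And>\<delta>. \<delta> > 0 ==> \<exists>w n. dist z w < \<delta> \<and> \<not> dist ((F ^^ n) z) ((F ^^ n) w) < e"
    unfolding eqc_def by blast
  have "\<exists>w n. dist z w < inverse (real (Suc k)) \<and> \<not> dist ((F ^^ n) z) ((F ^^ n) w) < e" for k
    by (intro e(2)) simp
  then obtain w r where w: "\<And>k. dist z (w k) < inverse (real (Suc k))"
    "\<And>k. \<not> dist ((F ^^ r k) z) ((F ^^ r k) (w k)) < e" by metis
  have "\<exists>s g. strict_mono s \<and> (\<forall>K. K \<subseteq> U --> compact K -->
      (\<forall>e>0. eventually (\<lambda>k. \<forall>x\<in>K. dist ((F ^^ r (s k)) x) (g x) < e) sequentially))"
    using U(3) unfolding normal_iterates_def cdist_eq_dist scompact_iff_compact by (rule spec)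
  then obtain s g where s0: "strict_mono (s :: nat => nat)"
    "\<forall>K. K \<subseteq> U --> compact K -->
      (\<forall>e>0. eventually (\<lambda>k. \<forall>x\<in>K. dist ((F ^^ r (s k)) x) (g x) < e) sequentially)"
    by blast
  note s = s0(1) s0(2)[rule_format]
  obtain \<rho> where \<rho>: "\<rho> > 0" "cball z \<rho> \<subseteq> U"
    using U open_contains_cball by blast
  have "eventually (\<lambda>k. \<forall>x\<in>cball z \<rho>. dist ((F ^^ r (s k)) x) (g x) < e / 8) sequentially"
    using e(1) by (intro s(2)[OF \<rho>(2) compact_cball_sphere]) simp
  then obtain k0 where "\<forall>k\<ge>k0. \<forall>x\<in>cball z \<rho>. dist ((F ^^ r (s k)) x) (g x) < e / 8"
    unfolding eventually_sequentially by blast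
  then have k0: "dist ((F ^^ r (s k)) x) (g x) < e / 8" if "k \<ge> k0" "x \<in> cball z \<rho>" for k x
    using that by blast
  have "isCont (F ^^ r (s k0)) z" by (rule isCont_funpow[OF cont])
  then obtain \<delta> where \<delta>: "\<delta> > 0" "\<And>x. dist x z < \<delta> ==> dist ((F ^^ r (s k0)) x) ((F ^^ r (s k0)) z) < e / 8"
    using e(1) unfolding continuous_at_eps_delta by (metis divide_pos_pos zero_less_numeral)
  obtain N where N: "inverse (real (Suc N)) < min \<delta> \<rho>"
    using reals_Archimedean[of "min \<delta> \<rho>"] \<delta> \<rho> by auto
  define k where "k = max k0 N"
  have "s k \<ge> N" using seq_suble[OF s(1), of k] by (simp add: k_def)
  then have "inverse (real (Suc (s k))) \<le> inverse (real (Suc N))" by (simp add: field_simps)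
  then have "dist z (w (s k)) < min \<delta> \<rho>" using w(1)[of "s k"] N by linarith
  then have d: "dist z (w (s k)) < \<delta>" "dist z (w (s k)) < \<rho>" by simp_all
  let ?x = "w (s k)" and ?f = "F ^^ r (s k)" and ?h = "F ^^ r (s k0)"
  have "dist (?f ?x) (g ?x) < e / 8" "dist (?f z) (g z) < e / 8" "dist (?h ?x) (g ?x) < e / 8" "dist (?h z) (g z) < e / 8"
    using k0 d(2) \<rho>(1) by (auto simp: k_def)
  moreover have "dist (?h ?x) (?h z) < e / 8" using \<delta>(2)[of ?x] d(1) unfolding dist_commute[of z ?x] by blast
  ultimately have "dist (?f z) (?f ?x) < e"
    using dist_triangle[of "?f z" "?f ?x" "g z"] dist_triangle[of "g z" "?f ?x" "?h z"]
      dist_triangle[of "?h z" "?f ?x" "?h ?x"] dist_triangle[of "?h ?x" "?f ?x" "g ?x"] e(1)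
    by (simp add: dist_commute)
  then show False using w(2)[of "s k"] by simp
qed

text \<open>Arzela-Ascoli for the iterates viewed, via \<open>stereo\<close>, as maps between
  subsets of Euclidean space. The limit has values in the closed set \<open>range stereo\<close>, so
  it can be pulled back to the sphere.\<close>

lemma eqc_imp_normal:
  assumes U: "open U" "z \<in> U" "\<And>x. x \<in> U ==> eqc F x"
  shows "\<exists>V. open V \<and> z \<in> V \<and> normal_iterates F V"
proof -
  obtain \<rho> where \<rho>: "\<rho> > 0" "cball z \<rho> \<subseteq> U"
    using U open_contains_cball by blast
  let ?S = "stereo ` cball z \<rho>"
  have inv: "inv stereo (stereo x) = x" for x by (simp add: stereo_inj)
  have closed_range: "closed (range stereo)"
    using scompact_iff_compact[of UNIV] compact_sphere_UNIV by (simp add: scompact_def compact_imp_closed)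
  have "normal_iterates F (ball z \<rho>)"
    unfolding normal_iterates_def cdist_eq_dist scompact_iff_compact
  proof (intro allI)
    fix r :: "nat => nat"
    define H where "H = (\<lambda>k v. stereo ((F ^^ r k) (inv stereo v)))"
    have "\<exists>g s. strict_mono (s :: nat => nat) \<and>
      (\<forall>e>0. \<exists>N. \<forall>n x. n \<ge> N \<and> x \<in> ?S --> norm (H (s n) x - g x) < e)"
    proof (rule Arzela_Ascoli[of ?S H "norm (stereo z) + 2"])
      show "compact ?S"
        using compact_cball_sphere[of z \<rho>] scompact_iff_compact by (simp add: scompact_def)
      fix n x
      have "norm (stereo y) \<le> norm (stereo z) + 2" for y
        using norm_triangle_sub[of "stereo y" "stereo z"] dist_sphere_le_2[of y z]
        by (simp flip: dist_stereo add: dist_norm)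
      then show "norm (H n x) \<le> norm (stereo z) + 2" by (simp add: H_def)
    next
      fix v and e :: real assume v: "v \<in> ?S" and e: "0 < e"
      then obtain x where x: "x \<in> cball z \<rho>" "v = stereo x" by auto
      then have "eqc F x" using \<rho> U by blast
      then obtain \<delta> where \<delta>: "\<delta> > 0" "\<And>w n. dist x w < \<delta> ==> dist ((F ^^ n) x) ((F ^^ n) w) < e"
        using e unfolding eqc_def by blast
      show "\<exists>d. 0 < d \<and> (\<forall>n y. y \<in> ?S \<and> norm (v - y) < d --> norm (H n v - H n y) < e)"
      proof (intro exI[of _ \<delta>] conjI allI impI \<delta>(1))
        fix n y assume "y \<in> ?S \<and> norm (v - y) < \<delta>"
        then obtain w where w: "y = stereo w" "dist x w < \<delta>" using x(2) by (auto simp flip: dist_norm)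
        then show "norm (H n v - H n y) < e"
          using \<delta>(2) by (simp add: H_def x(2) inv flip: dist_norm)
      qed
    next
      fix g and s :: "nat => nat"
      assume "strict_mono s" "\<And>e. 0 < e ==> \<exists>N. \<forall>n x. n \<ge> N \<and> x \<in> ?S --> norm (H (s n) x - g x) < e"
      then show ?thesis by blast
    qed
    then obtain g s where g: "strict_mono (s :: nat => nat)"
      "\<And>e. 0 < e ==> \<exists>N. \<forall>n x. n \<ge> N \<and> x \<in> ?S --> norm (H (s n) x - g x) < e"
      by auto
    have conv: "(\<lambda>n. H (s n) (stereo x)) \<longlonglongrightarrow> g (stereo x)" if "x \<in> cball z \<rho>" for x
      unfolding LIMSEQ_iff using g(2) that by blast
    have "g (stereo x) \<in> range stereo" if "x \<in> cball z \<rho>" for x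
      by (rule closed_sequentially[OF closed_range _ conv[OF that]]) (simp add: H_def)
    then have gi: "stereo (inv stereo (g (stereo x))) = g (stereo x)" if "x \<in> cball z \<rho>" for x
      using that by (meson f_inv_into_f)
    show "\<exists>s g. strict_mono s \<and> (\<forall>K\<subseteq>ball z \<rho>. compact K -->
        (\<forall>e>0. \<forall>\<^sub>F k in sequentially. \<forall>x\<in>K. dist ((F ^^ r (s k)) x) (g x) < e))"
    proof (intro exI[of _ s] exI[of _ "\<lambda>x. inv stereo (g (stereo x))"] conjI g(1) allI impI)
      fix K and e :: real assume K: "K \<subseteq> ball z \<rho>" and e: "e > 0"
      obtain N where N: "\<And>n x. n \<ge> N ==> x \<in> ?S ==> norm (H (s n) x - g x) < e" using g(2)[OF e] by blast
      have "dist ((F ^^ r (s n)) x) (inv stereo (g (stereo x))) < e" if "n \<ge> N" "x \<in> K" for n x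
      proof -
        have x: "x \<in> cball z \<rho>" using K that by auto
        have "dist ((F ^^ r (s n)) x) (inv stereo (g (stereo x))) = norm (H (s n) (stereo x) - g (stereo x))"
          by (simp flip: dist_stereo add: gi[OF x] H_def inv dist_norm)
        then show ?thesis using N[OF that(1), of "stereo x"] x by simp
      qed
      then show "\<forall>\<^sub>F k in sequentially. \<forall>x\<in>K. dist ((F ^^ r (s k)) x) (inv stereo (g (stereo x))) < e"
        unfolding eventually_sequentially by blast
    qed
  qed
  then show ?thesis using \<rho> by (intro exI[of _ "ball z \<rho>"]) auto
qed

lemma fatou_iff_eqc:
  assumes "\<And>x. isCont F x"
  shows "z \<in> fatou F \<longleftrightarrow> (\<exists>U. open U \<and> z \<in> U \<and> (\<forall>x\<in>U. eqc F x))"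
proof
  assume "z \<in> fatou F"
  then obtain U where "z \<in> U" "open U" "normal_iterates F U"
    by (auto simp: fatou_def sopen_iff_open)
  then show "\<exists>U. open U \<and> z \<in> U \<and> (\<forall>x\<in>U. eqc F x)"
    using normal_imp_eqc[of F U, OF assms] by blast
next
  assume "\<exists>U. open U \<and> z \<in> U \<and> (\<forall>x\<in>U. eqc F x)"
  then obtain U where "open U" "z \<in> U" "\<And>x. x \<in> U ==> eqc F x" by blast
  then show "z \<in> fatou F"
    using eqc_imp_normal[of U z F] by (auto simp: fatou_def sopen_iff_open)
qed

lemma julia_iff: "z \<in> julia F \<longleftrightarrow> z \<notin> fatou F"
  by (simp add: julia_def)

lemma open_fatou: "open (fatou F)"
proof (subst open_subopen, safe)
  fix z assume "z \<in> fatou F"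
  then obtain U where "z \<in> U" "open U" "normal_iterates F U"
    by (auto simp: fatou_def sopen_iff_open)
  then show "\<exists>T. open T \<and> z \<in> T \<and> T \<subseteq> fatou F"
    by (intro exI[of _ U]) (auto simp: fatou_def sopen_iff_open)
qed

lemma closed_julia: "closed (julia F)"
  unfolding julia_def using open_fatou by (simp add: Compl_eq_Diff_UNIV[symmetric] closed_def)

lemma compact_julia: "compact (julia F)"
  using compact_Int_closed[OF compact_sphere_UNIV closed_julia] by simp

lemma julia_backward:
  assumes "ratmap d F" "F z \<in> fatou F"
  shows "z \<in> fatou F"
proof -
  have cont: "isCont F x" for x using assms by (simp add: ratmap_isCont)
  obtain U where U: "open U" "F z \<in> U" "\<And>x. x \<in> U ==> eqc F x"
    using assms(2) fatou_iff_eqc[OF cont] by blast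
  have "eqc F x" if x: "F x \<in> U" for x
    unfolding eqc_def
  proof (intro allI impI)
    fix e :: real assume e: "e > 0"
    then obtain \<delta> where \<delta>: "\<delta> > 0" "\<And>w n. dist (F x) w < \<delta> ==> dist ((F ^^ n) (F x)) ((F ^^ n) w) < e"
      using U(3)[OF x] unfolding eqc_def by blast
    obtain \<eta> where \<eta>: "\<eta> > 0" "\<And>w. dist w x < \<eta> ==> dist (F w) (F x) < \<delta>"
      using cont[of x] \<delta>(1) unfolding continuous_at_eps_delta by blast
    \<comment> \<open>The \<open>e\<close> in the minimum takes care of the iterate n = 0, which
      does not factor through \<open>F\<close>.\<close>
    show "\<exists>\<delta>>0. \<forall>w n. dist x w < \<delta> --> dist ((F ^^ n) x) ((F ^^ n) w) < e"
    proof (intro exI[of _ "min \<eta> e"] conjI allI impI)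
      fix w n assume w: "dist x w < min \<eta> e"
      show "dist ((F ^^ n) x) ((F ^^ n) w) < e"
      proof (cases n)
        case (Suc m)
        have "dist (F x) (F w) < \<delta>" using \<eta>(2)[of w] w by (simp add: dist_commute)
        then show ?thesis using \<delta>(2)[of "F w" m] by (simp add: Suc funpow_swap1)
      qed (use w in simp)
    qed (use \<eta> e in simp)
  qed
  moreover have "open (F -` U)" by (intro open_vimage U ratmap_continuous_on[OF assms(1)])
  ultimately show ?thesis
    unfolding fatou_iff_eqc[OF cont] using U(2) by (intro exI[of _ "F -` U"]) auto
qed

text \<open>Openness of \<open>F\<close> is what pushes equicontinuity forward: every point close to
  \<open>F x\<close> is the image of a point close to \<open>x\<close>.\<close>

lemma julia_forward:
  assumes "ratmap d F" "z \<in> fatou F"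
  shows "F z \<in> fatou F"
proof -
  have cont: "isCont F x" for x using assms by (simp add: ratmap_isCont)
  obtain U where U: "open U" "z \<in> U" "\<And>x. x \<in> U ==> eqc F x"
    using assms(2) fatou_iff_eqc[OF cont] by blast
  have "eqc F (F x)" if x: "x \<in> U" for x
    unfolding eqc_def
  proof (intro allI impI)
    fix e :: real assume e: "e > 0"
    then obtain \<delta> where \<delta>: "\<delta> > 0" "\<And>w n. dist x w < \<delta> ==> dist ((F ^^ n) x) ((F ^^ n) w) < e"
      using U(3)[OF x] unfolding eqc_def by blast
    have "open (F ` ball x \<delta>)" by (intro ratmap_open_map[OF assms(1)]) simp
    moreover have "F x \<in> F ` ball x \<delta>" using \<delta>(1) by simp
    ultimately obtain \<eta> where \<eta>: "\<eta> > 0" "ball (F x) \<eta> \<subseteq> F ` ball x \<delta>"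
      using open_contains_ball by blast
    show "\<exists>\<delta>>0. \<forall>w n. dist (F x) w < \<delta> --> dist ((F ^^ n) (F x)) ((F ^^ n) w) < e"
    proof (intro exI[of _ \<eta>] conjI allI impI \<eta>(1))
      fix w n assume "dist (F x) w < \<eta>"
      then obtain v where "w = F v" "dist x v < \<delta>" using \<eta>(2) by auto
      then show "dist ((F ^^ n) (F x)) ((F ^^ n) w) < e"
        using \<delta>(2)[of v "Suc n"] by (simp add: funpow_swap1)
    qed
  qed
  moreover have "open (F ` U)" by (intro ratmap_open_map[OF assms(1)] U)
  ultimately show ?thesis
    unfolding fatou_iff_eqc[OF cont] using U(2) by (intro exI[of _ "F ` U"]) auto
qed

lemma julia_invariant: "ratmap d F ==> F z \<in> julia F \<longleftrightarrow> z \<in> julia F"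
  unfolding julia_iff using julia_backward[of d F z] julia_forward[of d F z] by blast

section \<open>Julia sets and conjugacy\<close>

lemma funpow_conj:
  assumes "M \<circ> F = G \<circ> M"
  shows "M ((F ^^ n) x) = (G ^^ n) (M x)"
proof (induction n)
  case (Suc n)
  then show ?case using fun_cong[OF assms, of "(F ^^ n) x"] by simp
qed simp

lemma fatou_conj:
  assumes F: "\<And>x. isCont F x" and G: "\<And>x. isCont G x"
    and M: "continuous_on UNIV M" and M': "continuous_on UNIV M'" "M' \<circ> M = id" "M \<circ> M' = id"
    and conj: "M \<circ> F = G \<circ> M" and z: "z \<in> fatou F"
  shows "M z \<in> fatou G"
proof -
  have inv: "M' (M x) = x" "M (M' x) = x" for x
    using M' by (simp_all add: fun_eq_iff)
  obtain U where U: "open U" "z \<in> U" "\<And>x. x \<in> U ==> eqc F x"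
    using z fatou_iff_eqc[OF F] by blast
  have uc: "uniformly_continuous_on UNIV M"
    by (rule compact_uniformly_continuous[OF M compact_sphere_UNIV])
  have "eqc G y" if y: "M' y \<in> U" for y
    unfolding eqc_def
  proof (intro allI impI)
    fix e :: real assume e: "e > 0"
    then obtain \<epsilon> where \<epsilon>: "\<epsilon> > 0" "\<And>x y. dist x y < \<epsilon> ==> dist (M x) (M y) < e"
      using uc unfolding uniformly_continuous_on_def by (metis UNIV_I dist_commute)
    obtain \<delta> where \<delta>: "\<delta> > 0" "\<And>w n. dist (M' y) w < \<delta> ==> dist ((F ^^ n) (M' y)) ((F ^^ n) w) < \<epsilon>"
      using U(3)[OF y] \<epsilon>(1) unfolding eqc_def by blast
    have "isCont M' y" using M'(1) by (simp add: continuous_on_eq_continuous_at)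
    then obtain \<eta> where \<eta>: "\<eta> > 0" "\<And>w. dist w y < \<eta> ==> dist (M' w) (M' y) < \<delta>"
      using \<delta>(1) unfolding continuous_at_eps_delta by blast
    show "\<exists>\<delta>>0. \<forall>w n. dist y w < \<delta> --> dist ((G ^^ n) y) ((G ^^ n) w) < e"
    proof (intro exI[of _ \<eta>] conjI allI impI \<eta>(1))
      fix w n assume "dist y w < \<eta>"
      then have "dist (M' y) (M' w) < \<delta>" using \<eta>(2)[of w] by (simp add: dist_commute)
      then have "dist (M ((F ^^ n) (M' y))) (M ((F ^^ n) (M' w))) < e" using \<delta>(2) \<epsilon>(2) by blast
      then show "dist ((G ^^ n) y) ((G ^^ n) w) < e" by (simp add: funpow_conj[OF conj] inv)
    qed
  qed
  moreover have "open (M' -` U)" by (intro open_vimage U M')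
  moreover have "M z \<in> M' -` U" using U(2) inv by simp
  ultimately have "open (M' -` U) \<and> M z \<in> M' -` U \<and> (\<forall>x\<in>M' -` U. eqc G x)" by blast
  then show ?thesis
    unfolding fatou_iff_eqc[OF G] by (rule exI)
qed

lemma julia_conj:
  assumes F: "\<And>x. isCont F x" and G: "\<And>x. isCont G x"
    and M: "continuous_on UNIV M" and M': "continuous_on UNIV M'" "M' \<circ> M = id" "M \<circ> M' = id"
    and conj: "M \<circ> F = G \<circ> M"
  shows "M z \<in> julia G \<longleftrightarrow> z \<in> julia F"
proof -
  have inv: "M' (M x) = x" "M (M' x) = x" for x
    using M' by (simp_all add: fun_eq_iff)
  have conj': "M' \<circ> G = F \<circ> M'"
  proof
    fix x
    show "(M' \<circ> G) x = (F \<circ> M') x"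
      using arg_cong[OF fun_cong[OF conj, of "M' x"], of M'] by (simp add: inv)
  qed
  have "z \<in> fatou F" if "M z \<in> fatou G"
    using fatou_conj[OF G F M'(1) M M'(3) M'(2) conj' that] by (simp only: inv)
  moreover have "M z \<in> fatou G" if "z \<in> fatou F"
    using fatou_conj[OF F G M M' conj that] .
  ultimately show ?thesis unfolding julia_iff by blast
qed

lemma julia_conj_image:
  assumes "\<And>x. isCont F x" "\<And>x. isCont G x"
    and "continuous_on UNIV M" and "continuous_on UNIV M'" "M' \<circ> M = id" "M \<circ> M' = id"
    and "M \<circ> F = G \<circ> M"
  shows "julia G = M ` julia F"
proof (intro set_eqI)
  fix y
  have inv: "M' (M x) = x" "M (M' x) = x" for x
    using assms(5,6) by (simp_all add: fun_eq_iff)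
  have *: "y \<in> julia G \<longleftrightarrow> M' y \<in> julia F"
    using julia_conj[OF assms, of "M' y"] by (simp add: inv)
  have "y \<in> M ` julia F \<longleftrightarrow> M' y \<in> julia F"
  proof
    assume "M' y \<in> julia F"
    then have "M (M' y) \<in> M ` julia F" by (rule imageI)
    then show "y \<in> M ` julia F" by (simp add: inv)
  qed (auto simp: inv)
  with * show "y \<in> julia G \<longleftrightarrow> y \<in> M ` julia F" by simp
qed

section \<open>Three omitted values along the iterates\<close>

lemma sholo_funpow: "ratmap d F ==> sholo f ==> sholo ((F ^^ n) \<circ> f)"
proof (induction n)
  case (Suc n)
  have "sholo (F \<circ> ((F ^^ n) \<circ> f))"
    by (rule sholo_ratmap[OF Suc.prems(1) Suc.IH[OF Suc.prems]])
  then show ?case by (simp add: o_def)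
qed (simp add: o_def)

lemma funpow_uniformly:
  assumes "ratmap d F" "e > 0"
  shows "\<exists>\<epsilon>>0. \<forall>j<m. \<forall>x y. dist x y < \<epsilon> --> dist ((F ^^ j) x) ((F ^^ j) y) < (e::real)"
proof (induction m)
  case 0
  then show ?case by (auto intro: exI[of _ 1])
next
  case (Suc m)
  then obtain \<epsilon> where \<epsilon>: "\<epsilon> > 0" "\<And>j x y. j < m ==> dist x y < \<epsilon> ==> dist ((F ^^ j) x) ((F ^^ j) y) < e" by blast
  have "uniformly_continuous_on UNIV (F ^^ m)"
    by (intro compact_uniformly_continuous compact_sphere_UNIV continuous_at_imp_continuous_on
        ballI isCont_funpow ratmap_isCont[OF assms(1)])
  then obtain \<epsilon>' where \<epsilon>': "\<epsilon>' > 0" "\<And>x y. dist x y < \<epsilon>' ==> dist ((F ^^ m) x) ((F ^^ m) y) < e"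
    using assms(2) unfolding uniformly_continuous_on_def by (metis UNIV_I dist_commute)
  show ?case
    using \<epsilon> \<epsilon>' by (intro exI[of _ "min \<epsilon> \<epsilon>'"]) (auto simp: less_Suc_eq)
qed

text \<open>Only every m-th iterate has to omit the three points, as happens near a periodic
  component; the other iterates differ from these by one of finitely many uniformly continuous maps.
  A chart disk about each point is rescaled to the unit disk.\<close>

theorem omit_three_fatou:
  assumes F: "ratmap d F" and U: "open U" and m: "m > 0"
    and abc: "a ~= b" "b ~= c" "a ~= c"
    and omit: "\<And>k x. x \<in> U ==> (F ^^ (m * k)) x \<notin> {a, b, c}"
  shows "U \<subseteq> fatou F"
proof -
  have cont: "isCont F x" for x using F by (simp add: ratmap_isCont)
  have "eqc F z" if z: "z \<in> U" for z
    unfolding eqc_def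
  proof (intro allI impI)
    fix e :: real assume e: "e > 0"
    define x0 where "x0 = chart z z"
    have "open (ichart z -` U)" by (intro open_vimage U continuous_on_ichart)
    moreover have "x0 \<in> ichart z -` U" using z by (simp add: x0_def)
    ultimately obtain r where r: "r > 0" "cball x0 r \<subseteq> ichart z -` U"
      using open_contains_cball by blast
    obtain \<epsilon> where \<epsilon>: "\<epsilon> > 0" "\<And>j x y. j < m ==> dist x y < \<epsilon> ==> dist ((F ^^ j) x) ((F ^^ j) y) < e"
      using funpow_uniformly[OF F e, of m] by blast
    define f where "f = (\<lambda>k w. (F ^^ (m * k)) (ichart z (x0 + of_real r * w)))"
    have sh: "sholo (f k)" for k
      using sholo_funpow[OF F sholo_affine[OF sholo_ichart[of z], of x0 r], of "m * k"]
      by (simp add: f_def o_def)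
    have om: "f k w \<notin> {a, b, c}" if "w \<in> cball 0 1" for k w
    proof -
      have "cmod (of_real r * w) \<le> r * 1"
        unfolding norm_mult using that r(1) by (intro mult_mono) auto
      then have "x0 + of_real r * w \<in> cball x0 r" by (simp add: dist_norm)
      then show ?thesis unfolding f_def using r(2) omit by blast
    qed
    obtain \<delta> where \<delta>: "\<delta> > 0" "\<And>k w. cmod w < \<delta> ==> dist (f k w) (f k 0) < \<epsilon>"
      using montel_three_points[of UNIV f a b c \<epsilon>] sh om abc \<epsilon>(1) by auto
    have "open (ichart z ` ball x0 (r * \<delta>))" by (intro open_ichart_image open_ball)
    moreover have "z \<in> ichart z ` ball x0 (r * \<delta>)"
      using r(1) \<delta>(1) by (auto simp: x0_def image_iff intro!: bexI[of _ "chart z z"])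
    ultimately obtain \<eta> where \<eta>: "\<eta> > 0" "ball z \<eta> \<subseteq> ichart z ` ball x0 (r * \<delta>)"
      using open_contains_ball by blast
    show "\<exists>\<delta>>0. \<forall>w n. dist z w < \<delta> --> dist ((F ^^ n) z) ((F ^^ n) w) < e"
    proof (intro exI[of _ \<eta>] conjI allI impI \<eta>(1))
      fix w n assume "dist z w < \<eta>"
      then obtain x where x: "w = ichart z x" "x \<in> ball x0 (r * \<delta>)" using \<eta>(2) by auto
      define u where "u = (x - x0) / of_real r"
      have u: "x = x0 + of_real r * u" "cmod u < \<delta>"
        using x(2) r(1) by (auto simp: u_def norm_divide dist_norm norm_minus_commute field_simps)
      define k j where "k = n div m" "j = n mod m"
      have n: "F ^^ n = (F ^^ j) \<circ> (F ^^ (m * k))" "j < m"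
        using m by (simp_all add: k_j_def flip: funpow_add)
      have "dist (f k u) (f k 0) < \<epsilon>" using \<delta>(2) u(2) by blast
      then have "dist ((F ^^ (m * k)) z) ((F ^^ (m * k)) w) < \<epsilon>"
        by (simp add: f_def x(1) u(1)[symmetric] dist_commute) (simp add: x0_def)
      then show "dist ((F ^^ n) z) ((F ^^ n) w) < e"
        using \<epsilon>(2)[OF n(2)] by (simp add: n(1))
    qed
  qed
  then show ?thesis using fatou_iff_eqc[OF cont] U by blast
qed

corollary omit_three_fatou':
  assumes "ratmap d F" "open U" "F ` U \<subseteq> U" "a ~= b" "b ~= c" "a ~= c" "a \<notin> U" "b \<notin> U" "c \<notin> U"
  shows "U \<subseteq> fatou F"
proof (rule omit_three_fatou[OF assms(1,2) _ assms(4-6), of 1])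
  have "(F ^^ k) x \<in> U" if "x \<in> U" for k x
    using that assms(3) by (induction k) auto
  then show "(F ^^ (1 * k)) x \<notin> {a, b, c}" if "x \<in> U" for k x
    using that assms(7-9) by (metis empty_iff insert_iff mult_1)
qed simp

lemma infinite_three:
  assumes "infinite S"
  obtains a b c where "a \<in> S" "b \<in> S" "c \<in> S" "a ~= b" "b ~= c" "a ~= c"
proof -
  obtain T where T: "T \<subseteq> S" "card T = 3" using infinite_arbitrarily_large[OF assms, of 3] by blast
  then obtain a b c where abc: "T = {a, b, c}" "a ~= b" "b ~= c" "a ~= c"
    unfolding card_3_iff by metis
  show thesis using that[of a b c] abc T(1) by simp
qed

subsection \<open>Derivatives in charts\<close>

definition sdiff :: "(sphere => sphere) => sphere => bool" where
  "sdiff F z \<longleftrightarrow> isCont F z \<and> local_rep F z field_differentiable at (chart z z)"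

definition sder :: "(sphere => sphere) => sphere => complex" where
  "sder F z = deriv (local_rep F z) (chart z z)"

lemma critical_iff_sder: "critical F z \<longleftrightarrow> sder F z = 0"
  by (simp add: critical_def sder_def)

lemma multiplier_eq_sder: "multiplier F n z = sder (F ^^ n) z"
  by (simp add: multiplier_def sder_def)

lemma local_rep_self: "local_rep F z (chart z z) = chart (F z) (F z)"
  by (simp add: local_rep_def)

lemma ratmap_sdiff: "ratmap d F ==> sdiff F z"
  unfolding sdiff_def using ratmap_isCont[of d F z] local_rep_holomorphic[of d F z]
  by (meson centre_in_ball holomorphic_on_imp_differentiable_at open_ball)

lemma isCont_ichart: "isCont (ichart a) x"
  using continuous_on_ichart[of UNIV a] by (simp add: continuous_on_eq_continuous_at)

lemma eventually_avoids_antip: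
  fixes F :: "sphere => sphere"
  assumes "isCont F z"
  shows "\<forall>\<^sub>F w in nhds z. F w ~= antip (F z)"
proof -
  obtain \<epsilon> where "\<epsilon> > 0" "\<forall>y. dist z y < \<epsilon> --> F y ~= antip (F z)"
    using continuous_at_avoid[OF assms, of "antip (F z)"] antip_neq(2) by blast
  then show ?thesis
    unfolding eventually_nhds_metric by (intro exI[of _ \<epsilon>]) (simp add: dist_commute)
qed

lemma filterlim_ichart_chart: "filterlim (ichart z) (nhds z) (nhds (chart z z))"
  using isCont_ichart[where a=z and x="chart z z"]
  unfolding isCont_def tendsto_at_iff_tendsto_nhds by simp

lemma eventually_ichart:
  assumes "\<forall>\<^sub>F w in nhds z. P w"
  shows "\<forall>\<^sub>F x in nhds (chart z z). P (ichart z x)"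
  by (rule eventually_compose_filterlim[OF assms filterlim_ichart_chart])

lemma sdiff_compose:
  assumes "sdiff G z" "sdiff F (G z)"
  shows "sdiff (F \<circ> G) z" "sder (F \<circ> G) z = sder F (G z) * sder G z"
proof -
  have ev: "\<forall>\<^sub>F x in nhds (chart z z). (local_rep F (G z) \<circ> local_rep G z) x = local_rep (F \<circ> G) z x"
  proof -
    have "isCont G z" using assms(1) by (simp add: sdiff_def)
    from eventually_ichart[OF eventually_avoids_antip[OF this]] show ?thesis
      by eventually_elim (simp add: local_rep_def ichart_chart)
  qed
  have G: "(local_rep G z has_field_derivative sder G z) (at (chart z z))"
    using assms(1) by (simp add: sdiff_def sder_def field_differentiable_derivI)
  have F: "(local_rep F (G z) has_field_derivative sder F (G z)) (at (local_rep G z (chart z z)))"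
    using assms(2) by (simp add: sdiff_def sder_def field_differentiable_derivI local_rep_self)
  have "((local_rep F (G z) \<circ> local_rep G z) has_field_derivative sder F (G z) * sder G z) (at (chart z z))"
    by (rule DERIV_chain[OF F G])
  then have D: "(local_rep (F \<circ> G) z has_field_derivative sder F (G z) * sder G z) (at (chart z z))"
    using DERIV_cong_ev[OF refl ev refl] by blast
  have "isCont (F \<circ> G) z"
    using assms by (intro continuous_at_compose) (auto simp: sdiff_def)
  then show "sdiff (F \<circ> G) z"
    using D unfolding sdiff_def by (auto simp: field_differentiable_def)
  show "sder (F \<circ> G) z = sder F (G z) * sder G z"
    using DERIV_imp_deriv[OF D] by (simp add: sder_def)
qed

lemma sdiff_id: "sdiff id z" "sder id z = 1"
proof -
  have "local_rep id z = (\<lambda>x. x)" by (auto simp: local_rep_def fun_eq_iff)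
  then show "sdiff id z" "sder id z = 1" by (simp_all add: sdiff_def sder_def)
qed

lemma sdiff_funpow:
  assumes "ratmap d F"
  shows "sdiff (F ^^ n) z"
proof (induction n)
  case 0
  then show ?case by (simp add: sdiff_id id_def[symmetric])
next
  case (Suc n)
  then show ?case using sdiff_compose(1)[OF Suc ratmap_sdiff[OF assms]] by (simp add: o_def)
qed

lemma sder_funpow_fixed:
  assumes "ratmap d F" "F z = z"
  shows "sder (F ^^ n) z = sder F z ^ n"
proof (induction n)
  case 0
  then show ?case by (simp add: sdiff_id id_def[symmetric])
next
  case (Suc n)
  have "(F ^^ n) z = z" using assms(2) by (induction n) auto
  then show ?case
    using sdiff_compose(2)[OF sdiff_funpow[OF assms(1), of n z] ratmap_sdiff[OF assms(1)]] Suc by (simp add: o_def)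
qed

lemma sder_inverse_nonzero:
  assumes "sdiff M z" "sdiff M' (M z)" "M' \<circ> M = id"
  shows "sder M z ~= 0"
  using sdiff_compose(2)[OF assms(1,2)] sdiff_id(2)[of z] by (auto simp: assms(3))

lemma sder_mob_nonzero:
  assumes "a * e - b * c ~= 0"
  shows "sder (mob a b c e) z ~= 0"
proof (rule sder_inverse_nonzero)
  have *: "e * a - (-b) * (-c) ~= 0" using assms by (simp add: mult.commute)
  show "sdiff (mob a b c e) z" by (rule ratmap_sdiff[OF ratmap_mob[OF assms]])
  show "sdiff (mob e (-b) (-c) a) (mob a b c e z)" by (rule ratmap_sdiff[OF ratmap_mob[OF *]])
  show "mob e (-b) (-c) a \<circ> mob a b c e = id" by (rule mob_inverse[OF assms])
qed

lemma sder_Some: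
  assumes "\<forall>\<^sub>F x in nhds w. F (Some x) = Some (f x)" "(f has_field_derivative D) (at w)"
  shows "sder F (Some w) = D"
proof -
  have "F (Some w) = Some (f w)" using eventually_nhds_x_imp_x[OF assms(1)] .
  then have ev: "\<forall>\<^sub>F x in nhds w. local_rep F (Some w) x = f x"
    using assms(1) by (auto elim!: eventually_mono simp: local_rep_def chart_def ichart_def)
  then have "(local_rep F (Some w) has_field_derivative D) (at w)"
    using assms(2) DERIV_cong_ev[OF refl ev refl] by blast
  then show ?thesis by (simp add: sder_def chart_def DERIV_imp_deriv)
qed

text \<open>\<open>ichart\<close> scales lengths infinitesimally by 2 / (1 + |x|^2), so the product
  in the hypothesis is the derivative measured in the chordal metric, and any larger \<kappa> serves
  as a Lipschitz constant at \<open>z\<close>.\<close>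

lemma sdiff_lipschitz:
  assumes "sdiff F z"
    and \<kappa>: "cmod (sder F z) * ((1 + (cmod (chart z z))\<^sup>2) / (1 + (cmod (chart (F z) (F z)))\<^sup>2)) < \<kappa>"
  shows "\<exists>\<delta>>0. \<forall>w. dist w z < \<delta> --> dist (F w) (F z) \<le> \<kappa> * dist w z"
proof -
  define f x0 y0 where "f = local_rep F z" "x0 = chart z z" "y0 = chart (F z) (F z)"
  define S where "S = (\<lambda>x. sqrt (1 + (cmod x)\<^sup>2))"
  have S: "S x > 0" "(S x)\<^sup>2 = 1 + (cmod x)\<^sup>2" for x
    by (simp_all add: S_def add_pos_nonneg)
  have fx0: "f x0 = y0" by (simp add: f_x0_y0_def local_rep_self)
  have D: "(f has_field_derivative sder F z) (at x0)"
    using assms(1) by (simp add: sdiff_def sder_def field_differentiable_derivI f_x0_y0_def)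
  have cf: "isCont f x0" using D by (rule DERIV_isCont)
  have lim1: "((\<lambda>x. cmod ((f x - y0) / (x - x0))) \<longlongrightarrow> cmod (sder F z)) (at x0)"
    using D unfolding has_field_derivative_iff fx0 by (rule tendsto_norm)
  have cS: "isCont S x" for x unfolding S_def by (intro continuous_intros)
  have lim2: "((\<lambda>x. S x * S x0 / (S (f x) * S y0)) \<longlongrightarrow> S x0 * S x0 / (S (f x0) * S y0)) (at x0)"
    using S(1)[of y0] cS[of x0] isCont_o2[OF cf cS]
    by (intro tendsto_intros) (auto simp: isCont_def fx0)
  have lim: "((\<lambda>x. cmod ((f x - y0) / (x - x0)) * (S x * S x0 / (S (f x) * S y0))) \<longlongrightarrow>
      cmod (sder F z) * (S x0 * S x0 / (S (f x0) * S y0))) (at x0)"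
    by (rule tendsto_mult[OF lim1 lim2])
  have "cmod (sder F z) * (S x0 * S x0 / (S (f x0) * S y0)) < \<kappa>"
  proof -
    have "S x * S x = 1 + (cmod x)\<^sup>2" for x using S(2)[of x] by (simp add: power2_eq_square)
    then show ?thesis using \<kappa> unfolding fx0 by (simp only: f_x0_y0_def)
  qed
  then have "\<forall>\<^sub>F x in at x0. cmod ((f x - y0) / (x - x0)) * (S x * S x0 / (S (f x) * S y0)) < \<kappa>"
    by (rule order_tendstoD(2)[OF lim])
  then have ev1: "\<forall>\<^sub>F x in nhds x0. x ~= x0 --> cmod ((f x - y0) / (x - x0)) * (S x * S x0 / (S (f x) * S y0)) < \<kappa>"
    by (simp add: eventually_at_filter)
  have key: "dist (ichart (F z) (f x)) (ichart (F z) y0) \<le> \<kappa> * dist (ichart z x) (ichart z x0)"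
    if "x ~= x0 --> cmod ((f x - y0) / (x - x0)) * (S x * S x0 / (S (f x) * S y0)) < \<kappa>" for x
  proof (cases "x = x0")
    case False
    define t where "t = cmod (x - x0)"
    have t: "t > 0" using False by (simp add: t_def)
    have "cmod ((f x - y0) / (x - x0)) * (S x * S x0 / (S (f x) * S y0)) \<le> \<kappa>" using that False by simp
    then have "cmod ((f x - y0) / (x - x0)) * (S x * S x0 / (S (f x) * S y0)) * (2 * t / (S x * S x0)) \<le> \<kappa> * (2 * t / (S x * S x0))"
      using t S(1)[of x] S(1)[of x0] by (intro mult_right_mono) auto
    moreover have "cmod ((f x - y0) / (x - x0)) * (S x * S x0 / (S (f x) * S y0)) * (2 * t / (S x * S x0)) =
        2 * cmod (f x - y0) / (S (f x) * S y0)"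
      using t S(1)[of x] S(1)[of x0] unfolding norm_divide t_def[symmetric] by (simp add: field_simps)
    ultimately show ?thesis unfolding dist_ichart S_def t_def by simp
  qed (simp add: fx0)
  have "\<forall>\<^sub>F w in nhds z. chart z w ~= x0 --> cmod ((f (chart z w) - y0) / (chart z w - x0)) * (S (chart z w) * S x0 / (S (f (chart z w)) * S y0)) < \<kappa>"
  proof -
    have "isCont (chart z) z" by (rule isCont_chart) simp
    then have "filterlim (chart z) (nhds x0) (nhds z)"
      unfolding isCont_def tendsto_at_iff_tendsto_nhds f_x0_y0_def by simp
    from eventually_compose_filterlim[OF ev1 this] show ?thesis .
  qed
  moreover have "\<forall>\<^sub>F w in nhds z. w ~= antip z"
    by (rule eventually_nhds_in_open[of "- {antip z}", THEN eventually_mono]) auto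
  moreover have "\<forall>\<^sub>F w in nhds z. F w ~= antip (F z)"
    using assms(1) by (intro eventually_avoids_antip) (simp add: sdiff_def)
  ultimately have "\<forall>\<^sub>F w in nhds z. dist (F w) (F z) \<le> \<kappa> * dist w z"
  proof eventually_elim
    case (elim w)
    have w: "ichart z (chart z w) = w" using elim(2) by (rule ichart_chart)
    have Fw: "ichart (F z) (f (chart z w)) = F w"
      using ichart_chart[OF elim(3)] by (simp add: f_x0_y0_def local_rep_def w)
    have "ichart (F z) y0 = F z" "ichart z x0 = z" by (simp_all add: f_x0_y0_def)
    then show ?case using key[OF elim(1)] by (simp add: w Fw)
  qed
  then show ?thesis by (simp add: eventually_nhds_metric)
qed

text \<open>Small balls about \<open>E\<close> form a forward invariant open set, and since
  \<open>E\<close> is finite they can be shrunk to miss three given points off \<open>E\<close>. One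
  radius for all of \<open>E\<close> is recorded because the entropy estimate needs a uniform
  basin.\<close>

lemma finite_attracting_fatou:
  assumes F: "ratmap d F" and E: "finite E" "F ` E \<subseteq> E" and \<kappa>: "0 \<le> \<kappa>" "\<kappa> < 1"
    and att: "\<And>e. e \<in> E ==> \<exists>\<delta>>0. \<forall>w. dist w e < \<delta> --> dist (F w) (F e) \<le> \<kappa> * dist w e"
  shows "\<exists>\<delta>>0. (\<forall>e\<in>E. \<forall>w. dist w e < \<delta> --> dist (F w) (F e) \<le> \<kappa> * dist w e)"
    and "E \<inter> julia F = {}"
proof -
  have "\<exists>\<delta>>0. \<forall>e\<in>E'. \<forall>w. dist w e < \<delta> --> dist (F w) (F e) \<le> \<kappa> * dist w e" if "E' \<subseteq> E" for E'
    using finite_subset[OF that E(1)] that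
  proof (induction E' rule: finite_induct)
    case empty
    then show ?case by (auto intro: exI[of _ 1])
  next
    case (insert e E')
    then obtain \<delta>1 where 1: "\<delta>1 > 0" "\<forall>e\<in>E'. \<forall>w. dist w e < \<delta>1 --> dist (F w) (F e) \<le> \<kappa> * dist w e" by blast
    obtain \<delta>2 where 2: "\<delta>2 > 0" "\<forall>w. dist w e < \<delta>2 --> dist (F w) (F e) \<le> \<kappa> * dist w e"
      using att[of e] insert.prems by blast
    show ?case using 1 2 by (intro exI[of _ "min \<delta>1 \<delta>2"]) simp
  qed
  from this[OF subset_refl] show ex: "\<exists>\<delta>>0. (\<forall>e\<in>E. \<forall>w. dist w e < \<delta> --> dist (F w) (F e) \<le> \<kappa> * dist w e)" .
  then obtain \<delta> where \<delta>: "\<delta> > 0" "\<And>e w. e \<in> E ==> dist w e < \<delta> ==> dist (F w) (F e) \<le> \<kappa> * dist w e" by blast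
  have "infinite (UNIV - E :: sphere set)"
    using E(1) infinite_open_sphere[OF open_UNIV] by simp
  then obtain a b c where abc: "a \<notin> E" "b \<notin> E" "c \<notin> E" "a ~= b" "b ~= c" "a ~= c"
    using infinite_three[of "UNIV - E"] by auto
  have "\<exists>\<rho>>0. \<forall>e\<in>E. \<not> dist a e < \<rho> \<and> \<not> dist b e < \<rho> \<and> \<not> dist c e < \<rho>"
  proof (cases "E = {}")
    case False
    define \<rho> where "\<rho> = Min ((\<lambda>e. min (dist a e) (min (dist b e) (dist c e))) ` E)"
    have "\<rho> > 0" unfolding \<rho>_def using E(1) False abc by (subst Min_gr_iff) auto
    moreover have "\<rho> \<le> min (dist a e) (min (dist b e) (dist c e))" if "e \<in> E" for e
      unfolding \<rho>_def using E(1) that by (intro Min_le) auto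
    ultimately show ?thesis by (intro exI[of _ \<rho>]) fastforce
  qed (auto intro: exI[of _ 1])
  then obtain \<rho> where \<rho>: "\<rho> > 0" "\<And>e. e \<in> E ==> \<not> dist a e < \<rho> \<and> \<not> dist b e < \<rho> \<and> \<not> dist c e < \<rho>" by blast
  define r where "r = min \<delta> \<rho>"
  have r: "r > 0" "r \<le> \<delta>" "r \<le> \<rho>" using \<delta>(1) \<rho>(1) by (auto simp: r_def)
  define U where "U = (\<Union>e\<in>E. ball e r)"
  have "U \<subseteq> fatou F"
  proof (rule omit_three_fatou'[OF F _ _ abc(4-6)])
    show "open U" unfolding U_def by (intro open_UN ballI open_ball)
    show "F ` U \<subseteq> U"
    proof safe
      fix w assume "w \<in> U"
      then obtain e where e: "e \<in> E" "dist w e < r" by (auto simp: U_def dist_commute)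
      have "dist (F w) (F e) \<le> \<kappa> * dist w e" using \<delta>(2) e r by auto
      also have "\<dots> \<le> 1 * dist w e" using \<kappa> by (intro mult_right_mono) auto
      also have "\<dots> < r" using e by simp
      finally show "F w \<in> U" using e(1) E(2) by (auto simp: U_def dist_commute)
    qed
    have "\<not> dist x e < r" if "e \<in> E" "x \<in> {a, b, c}" for e x
      using \<rho>(2)[OF that(1)] that(2) r(3) by auto
    then show "a \<notin> U" "b \<notin> U" "c \<notin> U" unfolding U_def by (auto simp: dist_commute)
  qed
  moreover have "E \<subseteq> U" using r(1) by (auto simp: U_def)
  ultimately show "E \<inter> julia F = {}" by (auto simp: julia_iff)
qed

lemma attracting_fixed_point_fatou:
  assumes "ratmap d F" "F z = z" "cmod (sder F z) < 1"
  shows "z \<notin> julia F"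
proof -
  have "1 + (cmod (chart z z))\<^sup>2 > 0" by (simp add: add_pos_nonneg)
  \<comment> \<open>At a fixed point source and target chart coincide, so the chordal correction
    factor is 1; the contraction factor is the midpoint between the modulus of the multiplier and
    1.\<close>
  then have "\<exists>\<delta>>0. \<forall>w. dist w z < \<delta> --> dist (F w) (F z) \<le> (1 + cmod (sder F z)) / 2 * dist w z"
    using assms by (intro sdiff_lipschitz ratmap_sdiff[OF assms(1)]) (simp add: field_simps)
  then have "{z} \<inter> julia F = {}"
    using assms by (intro finite_attracting_fatou(2)[of d F "{z}" "(1 + cmod (sder F z)) / 2"]) auto
  then show ?thesis by auto
qed

lemma mob_to_zero:
  obtains a b c e where "a * e - b * c ~= 0" "mob a b c e z = Some 0"
proof -
  have "infinite (UNIV - {z} :: sphere set)"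
    using infinite_open_sphere[OF open_UNIV] by simp
  then obtain x y w where "x \<in> UNIV - {z}" "y \<in> UNIV - {z}" "x ~= y"
    by (rule infinite_three)
  then have "z ~= x" "x ~= y" "z ~= y" by auto
  then obtain k l m n where "k * n - l * m ~= 0" "mob k l m n z = Some 0"
    by (rule three_points_mob)
  then show thesis by (rule that)
qed

text \<open>After \<open>e\<close> and \<open>F e\<close> have been moved to 0, the numerator has
  degree \<open>d\<close> and 0 as its only root; with d \<ge> 2 the root is multiple, so the
  derivative vanishes.\<close>

lemma totally_ramified_sder:
  assumes F: "ratmap d F" "d \<ge> 2" and single: "{z. F z = F e} = {e}"
  shows "sder F e = 0"
proof -
  obtain a b c k where T: "a * k - b * c ~= 0" "mob a b c k e = Some 0" by (rule mob_to_zero)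
  obtain a' b' c' k' where T': "a' * k' - b' * c' ~= 0" "mob a' b' c' k' (F e) = Some 0" by (rule mob_to_zero)
  have T2: "k * a - (-b) * (-c) ~= 0" using T(1) by (simp add: mult.commute)
  define S where "S = mob k (-b) (-c) a"
  define R where "R = mob a' b' c' k'"
  have S: "S (mob a b c k x) = x" "mob a b c k (S x) = x" for x
    using mob_inverse[OF T(1)] by (simp_all add: S_def fun_eq_iff)
  have S0: "S (Some 0) = e" using S(1)[of e] T(2) by simp
  have injR: "R x = R y ==> x = y" for x y
    using mob_inverse(1)[OF T'(1)] unfolding R_def by (metis comp_apply id_apply)
  define G where "G = R \<circ> F \<circ> S"
  have G: "ratmap d G"
    unfolding G_def R_def S_def by (intro ratmap_pre_mob[OF ratmap_post_mob[OF F(1) T'(1)] T2])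
  have G0: "G (Some 0) = Some 0" using T'(2) by (simp add: G_def R_def S0)
  have Guniq: "z = Some 0" if "G z = Some 0" for z
  proof -
    have "R (F (S z)) = R (F e)" using that G0 by (simp add: G_def S0)
    then have "F (S z) = F e" by (rule injR)
    then have "S z = e" using single by blast
    then show ?thesis using S(2)[of z] T(2) by simp
  qed
  obtain p q where pq: "ratpair p q d" "G = rat_eval p q" using G by (auto simp: ratmap_def)
  have pre: "{z. G z = Some 0} = Some ` {z. poly p z = 0} \<union> (if coeff p d = 0 then {None} else {})"
    using preimage_eq[OF pq(1), of 0 1] pq(2) by simp
  have root: "poly p z = 0 ==> z = 0" for z using pre Guniq by blast
  have pd: "coeff p d ~= 0"
  proof
    assume "coeff p d = 0"
    then have "None \<in> {z. G z = Some 0}" unfolding pre by simp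
    then show False using Guniq by blast
  qed
  have dp: "d \<le> degree p" using pd by (rule le_degree)
  have "Some 0 \<in> {z. G z = Some 0}" using G0 by simp
  then have p0: "poly p 0 = 0" unfolding pre by (auto split: if_splits)
  then have "[:0, 1:] dvd p" using poly_eq_0_iff_dvd[of p 0] by simp
  then obtain r where r: "p = [:0, 1:] * r" by blast
  have "r ~= 0" using r pd by auto
  then have "degree p = Suc (degree r)" unfolding r by (subst degree_mult_eq) auto
  then have "degree r > 0" using dp F(2) by simp
  then obtain w where w: "poly r w = 0" using nonconst_root by blast
  then have "w = 0" using root[of w] by (simp add: r)
  then have dp0: "poly (pderiv p) 0 = 0" using w by (simp add: r pderiv_mult pderiv_pCons)
  have q0: "poly q 0 ~= 0" using pq(1) p0 by (auto simp: ratpair_def)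
  have "\<forall>\<^sub>F x in nhds 0. poly q x ~= 0"
    using q0 by (intro eventually_nhds_in_open[of "{x. poly q x ~= 0}", THEN eventually_mono])
      (auto intro!: open_Collect_neq continuous_intros)
  then have "\<forall>\<^sub>F x in nhds 0. G (Some x) = Some (poly p x / poly q x)"
    by eventually_elim (simp add: pq(2) rat_eval_def)
  moreover have "((\<lambda>x. poly p x / poly q x) has_field_derivative 0) (at 0)"
    by (rule derivative_eq_intros poly_DERIV refl q0)+ (simp add: dp0 p0)
  ultimately have "sder G (Some 0) = 0" by (rule sder_Some)
  moreover have "sder G (Some 0) = sder R (F e) * sder F e * sder S (Some 0)"
  proof -
    have dS: "sdiff S (Some 0)" unfolding S_def by (rule ratmap_sdiff[OF ratmap_mob[OF T2]])
    have dF: "sdiff F (S (Some 0))" by (rule ratmap_sdiff[OF F(1)])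
    have dR: "sdiff R (F (S (Some 0)))" unfolding R_def by (rule ratmap_sdiff[OF ratmap_mob[OF T'(1)]])
    have "sder (R \<circ> F) (S (Some 0)) = sder R (F (S (Some 0))) * sder F (S (Some 0))"
      by (rule sdiff_compose(2)[OF dF dR])
    moreover have "sder ((R \<circ> F) \<circ> S) (Some 0) = sder (R \<circ> F) (S (Some 0)) * sder S (Some 0)"
      by (rule sdiff_compose(2)[OF dS sdiff_compose(1)[OF dF dR]])
    ultimately show ?thesis by (simp add: G_def S0)
  qed
  moreover have "sder S (Some 0) ~= 0" unfolding S_def by (rule sder_mob_nonzero[OF T2])
  moreover have "sder R (F e) ~= 0" unfolding R_def by (rule sder_mob_nonzero[OF T'(1)])
  ultimately show ?thesis by simp
qed

text \<open>The preimage of \<open>E\<close> is a subset of \<open>E\<close> and is mapped onto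
  \<open>E\<close>; by counting, the two sets coincide and \<open>F\<close> permutes
  \<open>E\<close>. The fibre over \<open>F e\<close> then lies in \<open>E\<close> and has a single
  point.\<close>

lemma finite_backward_invariant:
  assumes F: "ratmap d F" and E: "finite E" "\<And>z. F z \<in> E ==> z \<in> E" and e: "e \<in> E"
  shows "F e \<in> E" "{z. F z = F e} = {e}"
proof -
  define A where "A = {z. F z \<in> E}"
  have A: "A \<subseteq> E" using E(2) by (auto simp: A_def)
  have A': "finite A" using A E(1) by (rule finite_subset)
  have img: "F ` A = E"
  proof
    show "E \<subseteq> F ` A"
    proof
      fix y assume "y \<in> E"
      moreover obtain z where "F z = y" using ratmap_surj[OF F] by blast
      ultimately show "y \<in> F ` A" by (auto simp: A_def)
    qed
  qed (auto simp: A_def)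
  then have "card E \<le> card A" using card_image_le[OF A', of F] by simp
  then have AE: "A = E" by (rule card_seteq[OF E(1) A])
  then have "F ` E = E" using img by simp
  then have inj: "inj_on F E" using E(1) by (simp add: eq_card_imp_inj_on)
  show Fe: "F e \<in> E" using \<open>F ` E = E\<close> e by auto
  show "{z. F z = F e} = {e}"
  proof safe
    fix z assume z: "F z = F e"
    then have "z \<in> E" using Fe E(2) by simp
    from inj_onD[OF inj z this e] show "z = e" .
  qed
qed

text \<open>Each point of \<open>E\<close> is the only preimage of its image, hence critical, so the
  cycles in \<open>E\<close> are superattracting; 1/2 is an arbitrary factor below 1.\<close>

lemma exceptional_attracting:
  assumes F: "ratmap d F" "d \<ge> 2" and E: "finite E" "\<And>z. F z \<in> E ==> z \<in> E"
  shows "\<exists>\<delta>>0. \<forall>e\<in>E. \<forall>w. dist w e < \<delta> --> dist (F w) (F e) \<le> 1/2 * dist w e"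
    and "E \<inter> julia F = {}"
proof -
  have *: "F e \<in> E" "{z. F z = F e} = {e}" if "e \<in> E" for e
    using finite_backward_invariant[of d F E e] F(1) E that by blast+
  have sub: "F ` E \<subseteq> E" using *(1) by blast
  have att: "\<exists>\<delta>>0. \<forall>w. dist w e < \<delta> --> dist (F w) (F e) \<le> 1/2 * dist w e" if "e \<in> E" for e
    by (rule sdiff_lipschitz[OF ratmap_sdiff[OF F(1)]])
      (simp add: totally_ramified_sder[OF F *(2)[OF that]])
  show "\<exists>\<delta>>0. \<forall>e\<in>E. \<forall>w. dist w e < \<delta> --> dist (F w) (F e) \<le> 1/2 * dist w e" "E \<inter> julia F = {}"
    using finite_attracting_fatou[OF F(1) E(1) sub, of "1/2"] att by auto
qed

subsection \<open>The Julia set is nonempty and perfect\<close>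

text \<open>An injective map would be totally ramified everywhere, so its derivative would vanish
  identically and the map would be locally constant.\<close>

lemma ratmap_not_injective:
  assumes F: "ratmap d F" "d \<ge> 2"
  shows "\<exists>x y. x ~= y \<and> F x = F y"
proof (rule ccontr)
  assume inj: "\<not> (\<exists>x y. x ~= y \<and> F x = F y)"
  then have "{z. F z = F e} = {e}" for e by blast
  then have zero: "sder F e = 0" for e by (rule totally_ramified_sder[OF F])
  obtain p q where pq: "ratpair p q d" "F = rat_eval p q" using F by (auto simp: ratmap_def)
  have "finite {z. F z = None}" using preimage_finite_card[OF F(1)] by blast
  moreover have "infinite (range (Some :: complex => sphere))"
    by (simp add: finite_image_iff infinite_UNIV_char_0)
  ultimately obtain w where "F (Some w) ~= None"
    by (metis (mono_tags, lifting) finite_subset mem_Collect_eq rangeE subsetI)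
  then have w: "poly q w ~= 0" by (auto simp: pq(2) rat_eval_def)
  define D where "D = {x. poly q x ~= 0}"
  have D: "open D" "w \<in> D" using w by (auto simp: D_def intro!: open_Collect_neq continuous_intros)
  then obtain r where r: "r > 0" "ball w r \<subseteq> D" using open_contains_ball by blast
  define f where "f = (\<lambda>x. poly p x / poly q x)"
  have Ff: "F (Some x) = Some (f x)" if "x \<in> D" for x
    using that by (simp add: pq(2) rat_eval_def D_def f_def)
  have dz: "(f has_field_derivative 0) (at x)" if x: "x \<in> D" for x
  proof -
    have "\<forall>\<^sub>F y in nhds x. F (Some y) = Some (f y)"
      using eventually_nhds_in_open[OF D(1) x] by eventually_elim (rule Ff)
    moreover have "f field_differentiable at x"
      using DERIV_divide[OF poly_DERIV[of p x] poly_DERIV[of q x]] x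
      unfolding f_def D_def field_differentiable_def by auto
    then have der: "(f has_field_derivative deriv f x) (at x)" by (rule field_differentiable_derivI)
    ultimately have "sder F (Some x) = deriv f x" by (intro sder_Some)
    then show ?thesis using der zero by simp
  qed
  have "(f has_field_derivative 0) (at x within ball w r)" if "x \<in> ball w r" for x
    by (rule has_field_derivative_at_within[OF dz]) (use that r(2) in blast)
  then obtain c where c: "\<And>x. x \<in> ball w r ==> f x = c"
    using has_field_derivative_zero_constant[OF convex_ball, of w r f] by blast
  define v where "v = w + of_real (r / 2)"
  have "dist w v < r" using r(1) by (simp add: v_def dist_norm)
  then have v: "v \<in> ball w r" "w \<in> ball w r" "v ~= w" using r(1) by (auto simp: v_def)
  then have "F (Some v) = F (Some w)" using Ff c r(2) by (metis subsetD)
  then show False using inj v(3) by blast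
qed

lemma sphere_convergent_subseq:
  fixes u :: "nat => sphere"
  obtains l r where "strict_mono (r :: nat => nat)" "(u \<circ> r) \<longlonglongrightarrow> l"
  using compact_imp_seq_compact[OF compact_sphere_UNIV] unfolding seq_compact_def by blast

lemma uniformly_eqc:
  assumes "\<And>z. eqc F z" "e > 0"
  shows "\<exists>\<delta>>0. \<forall>u v n. dist u v < \<delta> --> dist ((F ^^ n) u) ((F ^^ n) v) < e"
proof (rule ccontr)
  assume neg: "\<not> ?thesis"
  have "\<exists>u v n. dist u v < inverse (real (Suc k)) \<and> \<not> dist ((F ^^ n) u) ((F ^^ n) v) < e" for k
  proof -
    have "inverse (real (Suc k)) > 0" by simp
    then show ?thesis using neg by blast
  qed
  then obtain u v n where uv: "\<And>k. dist (u k) (v k) < inverse (real (Suc k))"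
    "\<And>k. \<not> dist ((F ^^ n k) (u k)) ((F ^^ n k) (v k)) < e" by metis
  obtain l r where r: "strict_mono r" "(u \<circ> r) \<longlonglongrightarrow> l" by (rule sphere_convergent_subseq)
  obtain \<delta> where \<delta>: "\<delta> > 0" "\<And>w n. dist l w < \<delta> ==> dist ((F ^^ n) l) ((F ^^ n) w) < e / 2"
    using assms(1)[of l] half_gt_zero[OF assms(2)] unfolding eqc_def by blast
  have "eventually (\<lambda>k. dist ((u \<circ> r) k) l < \<delta> / 2) sequentially"
    using tendstoD[OF r(2), of "\<delta> / 2"] \<delta>(1) by simp
  then obtain k0 where k0: "\<And>k. k \<ge> k0 ==> dist (u (r k)) l < \<delta> / 2"
    unfolding eventually_sequentially by auto
  obtain N where N: "inverse (real (Suc N)) < \<delta> / 2"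
    using reals_Archimedean[of "\<delta> / 2"] \<delta>(1) by auto
  define k where "k = max k0 N"
  have "r k \<ge> N" using seq_suble[OF r(1), of k] by (simp add: k_def)
  then have "inverse (real (Suc (r k))) \<le> inverse (real (Suc N))" by (simp add: field_simps)
  then have "dist (u (r k)) (v (r k)) < \<delta> / 2" using uv(1)[of "r k"] N by linarith
  moreover have "dist (u (r k)) l < \<delta> / 2" using k0 by (simp add: k_def)
  ultimately have "dist l (u (r k)) < \<delta>" "dist l (v (r k)) < \<delta>"
    using dist_triangle[of l "v (r k)" "u (r k)"] \<delta>(1) dist_commute[of l "u (r k)"] by linarith+
  then have "dist ((F ^^ n (r k)) l) ((F ^^ n (r k)) (u (r k))) < e / 2"
    "dist ((F ^^ n (r k)) l) ((F ^^ n (r k)) (v (r k))) < e / 2" using \<delta>(2) by blast+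
  then have "dist ((F ^^ n (r k)) (u (r k))) ((F ^^ n (r k)) (v (r k))) < e"
    by (metis dist_commute dist_triangle_half_l)
  then show False using uv(2) by blast
qed

text \<open>A surjective map with equicontinuous iterates on a compact space is injective: compare two
  points with a common image along their backward orbits, which return close to that image.\<close>

lemma julia_nonempty:
  assumes F: "ratmap d F" "d \<ge> 2"
  shows "julia F ~= {}"
proof
  assume J: "julia F = {}"
  have cont: "isCont F x" for x using F by (simp add: ratmap_isCont)
  have eqc: "eqc F z" for z
  proof -
    have "z \<in> fatou F" using J julia_iff by blast
    then show ?thesis unfolding fatou_iff_eqc[OF cont] by blast
  qed
  obtain x y where xy: "x ~= y" "F x = F y" using ratmap_not_injective[OF F] by blast
  obtain g where g: "\<And>z. F (g z) = z" using ratmap_surj[OF F(1)] by metis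
  define X where "X = (\<lambda>n. (g ^^ n) x)"
  define Y where "Y = (\<lambda>n. (g ^^ n) y)"
  have Fg: "(F ^^ m) ((g ^^ (m + k)) z) = (g ^^ k) z" for m k z
  proof (induction m)
    case (Suc m)
    then show ?case using funpow_swap1[of F m "g ((g ^^ (m + k)) z)"] by (simp add: g)
  qed simp
  obtain \<delta>1 where \<delta>1: "\<delta>1 > 0" "\<And>u v n. dist u v < \<delta>1 ==> dist ((F ^^ n) u) ((F ^^ n) v) < dist x y"
    using uniformly_eqc[of F "dist x y"] eqc xy(1) by auto
  obtain \<delta>2 where \<delta>2: "\<delta>2 > 0" "\<And>u v n. dist u v < \<delta>2 ==> dist ((F ^^ n) u) ((F ^^ n) v) < \<delta>1 / 2"
    using uniformly_eqc[of F "\<delta>1 / 2"] eqc \<delta>1(1) by auto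
  obtain l r1 where r1: "strict_mono r1" "(X \<circ> r1) \<longlonglongrightarrow> l" by (rule sphere_convergent_subseq)
  obtain l' r2 where r2: "strict_mono r2" "((Y \<circ> r1) \<circ> r2) \<longlonglongrightarrow> l'" by (rule sphere_convergent_subseq)
  define r where "r = r1 \<circ> r2"
  have r: "strict_mono r" unfolding r_def by (rule strict_mono_o[OF r1(1) r2(1)])
  have "((X \<circ> r1) \<circ> r2) \<longlonglongrightarrow> l" by (rule LIMSEQ_subseq_LIMSEQ[OF r1(2) r2(1)])
  then have "eventually (\<lambda>k. dist (X (r k)) l < \<delta>2 / 2 \<and> dist (Y (r k)) l' < \<delta>2 / 2) sequentially"
    using tendstoD[of "(X \<circ> r1) \<circ> r2" l sequentially "\<delta>2/2"] tendstoD[OF r2(2), of "\<delta>2/2"] \<delta>2(1)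
    by (intro eventually_conj) (simp_all add: r_def)
  then obtain k where k: "\<And>i. i \<ge> k ==> dist (X (r i)) l < \<delta>2 / 2 \<and> dist (Y (r i)) l' < \<delta>2 / 2"
    unfolding eventually_sequentially by blast
  define m n where "m = r k" "n = r (Suc k)"
  have "m < n" using r by (simp add: m_n_def strict_mono_Suc_iff)
  then obtain j where j: "n = Suc m + j" using less_iff_Suc_add by auto
  have "dist (X m) (X n) < \<delta>2" "dist (Y m) (Y n) < \<delta>2"
    using k[of k] k[of "Suc k"] by (auto simp: m_n_def intro: dist_triangle_half_l)
  then have "dist ((F ^^ Suc m) (X m)) ((F ^^ Suc m) (X n)) < \<delta>1 / 2"
    "dist ((F ^^ Suc m) (Y m)) ((F ^^ Suc m) (Y n)) < \<delta>1 / 2" using \<delta>2(2) by blast+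
  moreover have "(F ^^ Suc m) (X m) = F x" "(F ^^ Suc m) (Y m) = F x"
    using Fg[of m 0 x] Fg[of m 0 y] xy(2) by (simp_all add: X_def Y_def)
  moreover have "(F ^^ Suc m) (X n) = X j" "(F ^^ Suc m) (Y n) = Y j"
    unfolding X_def Y_def j by (rule Fg)+
  ultimately have "dist (F x) (X j) < \<delta>1 / 2" "dist (F x) (Y j) < \<delta>1 / 2" by simp_all
  then have "dist (X j) (Y j) < \<delta>1" by (metis dist_commute dist_triangle_half_l)
  then have "dist ((F ^^ j) (X j)) ((F ^^ j) (Y j)) < dist x y" by (rule \<delta>1(2))
  moreover have "(F ^^ j) (X j) = x" "(F ^^ j) (Y j) = y"
    using Fg[of j 0 x] Fg[of j 0 y] by (simp_all add: X_def Y_def)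
  ultimately show False by simp
qed

text \<open>The Julia set is backward invariant; if finite, it would be an exceptional set and thus
  disjoint from itself.\<close>

lemma infinite_julia:
  assumes F: "ratmap d F" "d \<ge> 2"
  shows "infinite (julia F)"
proof
  assume "finite (julia F)"
  then have "julia F \<inter> julia F = {}"
    using julia_invariant[OF F(1)] by (intro exceptional_attracting(2)[OF F]) blast+
  then show False using julia_nonempty[OF F] by simp
qed

text \<open>The limit points of the Julia set form a closed, backward invariant set. If it were
  finite it would be exceptional, hence outside the Julia set; so it contains three points, which
  its forward invariant complement avoids.\<close>

lemma julia_perfect:
  assumes F: "ratmap d F" "d \<ge> 2" and z: "z \<in> julia F"
  shows "z islimpt julia F"
proof -
  define L where "L = {x. x islimpt julia F}"
  have closedL: "closed L" unfolding L_def by (rule closed_limpts)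
  have sub: "L \<subseteq> julia F" using closed_julia[of F] by (auto simp: L_def closed_limpt)
  have "L ~= {}"
  proof -
    have "\<exists>x\<in>UNIV. x islimpt julia F"
      using compact_sphere_UNIV infinite_julia[OF F] unfolding compact_eq_Bolzano_Weierstrass by blast
    then show ?thesis by (auto simp: L_def)
  qed
  have bk: "x \<in> L" if Fx: "F x \<in> L" for x
    unfolding L_def mem_Collect_eq islimpt_def
  proof (intro allI impI)
    fix V assume V: "x \<in> V" "open V"
    have "open (F ` V)" by (rule ratmap_open_map[OF F(1) V(2)])
    moreover have "F x \<in> F ` V" using V(1) by simp
    ultimately obtain j where j: "j \<in> julia F" "j \<in> F ` V" "j ~= F x"
      using Fx unfolding L_def mem_Collect_eq islimpt_def by blast
    then obtain v where "j = F v" "v \<in> V" by blast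
    then show "\<exists>y\<in>julia F. y \<in> V \<and> y ~= x" using j julia_invariant[OF F(1)] by auto
  qed
  have "infinite L"
  proof
    assume "finite L"
    then have "L \<inter> julia F = {}" using bk by (intro exceptional_attracting(2)[OF F])
    then show False using sub \<open>L ~= {}\<close> by blast
  qed
  then obtain a b c where abc: "a \<in> L" "b \<in> L" "c \<in> L" "a ~= b" "b ~= c" "a ~= c" by (rule infinite_three)
  have "- L \<subseteq> fatou F"
  proof (rule omit_three_fatou'[OF F(1) _ _ abc(4-6)])
    show "open (- L)" by (rule open_Compl[OF closedL])
    show "F ` (- L) \<subseteq> - L" using bk by blast
  qed (use abc in auto)
  then show ?thesis using z by (auto simp: julia_iff L_def)
qed

subsection \<open>Connected components of Julia sets on a circle\<close>

text \<open>Covers circles and arcs at once: away from any one of its points there is a continuous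
  injection into the line. That suffices for arguments with intervals and passes to Moebius images
  by mere composition.\<close>

definition arclike :: "sphere set => bool" where
  "arclike X \<longleftrightarrow> (\<forall>y\<in>X. \<exists>h::sphere => real. continuous_on (X - {y}) h \<and> inj_on h (X - {y}))"

text \<open>A point of \<open>X\<close> near \<open>x\<close> has its coordinate in the interval
  covered by \<open>C\<close>, and injectivity of \<open>h\<close> identifies it with the point of
  \<open>C\<close> having this coordinate.\<close>

lemma arc_nbhd:
  fixes h :: "sphere => real"
  assumes h: "continuous_on (X - {y}) h" "inj_on h (X - {y})"
    and C: "C \<subseteq> X - {y}" "{\<alpha>..\<beta>} \<subseteq> h ` C" and x: "x \<in> X - {y}" "\<alpha> < h x" "h x < \<beta>"
  shows "\<exists>U. open U \<and> x \<in> U \<and> U \<inter> X \<subseteq> C"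
proof -
  define \<epsilon> where "\<epsilon> = min (h x - \<alpha>) (\<beta> - h x)"
  have "\<epsilon> > 0" using x by (simp add: \<epsilon>_def)
  then obtain r where r: "r > 0" "\<And>x'. x' \<in> X - {y} ==> dist x' x < r ==> dist (h x') (h x) < \<epsilon>"
    using h(1) x(1) unfolding continuous_on_iff by blast
  have "x' \<in> C" if x': "x' \<in> ball x r - {y}" "x' \<in> X" for x'
  proof -
    have "dist (h x') (h x) < \<epsilon>" using x' by (intro r(2)) (auto simp: dist_commute)
    then have "h x' \<in> {\<alpha>..\<beta>}" by (auto simp: \<epsilon>_def dist_real_def)
    then obtain c where c: "c \<in> C" "h x' = h c" using C(2) by blast
    have "x' = c" using inj_onD[OF h(2) c(2)] x' c(1) C(1) by blast
    then show ?thesis using c(1) by simp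
  qed
  moreover have "open (ball x r - {y})" by (intro open_Diff) auto
  moreover have "x \<in> ball x r - {y}" using x r by auto
  ultimately show ?thesis by blast
qed

lemma arc_interior:
  assumes X: "arclike X" "y \<in> X" and C: "C \<subseteq> X - {y}" "connected C" "a \<in> C" "b \<in> C" "a ~= b"
  shows "\<exists>x\<in>C. \<exists>U. open U \<and> x \<in> U \<and> U \<inter> X \<subseteq> C"
proof -
  obtain h :: "sphere => real" where h: "continuous_on (X - {y}) h" "inj_on h (X - {y})"
    using X unfolding arclike_def by blast
  have "connected (h ` C)" using C h continuous_on_subset connected_continuous_image by blast
  moreover have "h a ~= h b" using h(2) C by (auto dest: inj_onD)
  ultimately obtain \<alpha> \<beta> where ab: "\<alpha> < \<beta>" "{\<alpha>..\<beta>} \<subseteq> h ` C"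
    using connected_contains_Icc[of "h ` C" "h a" "h b"] connected_contains_Icc[of "h ` C" "h b" "h a"] C(3,4)
    by (metis imageI linorder_neqE_linordered_idom)
  then have "(\<alpha> + \<beta>) / 2 \<in> h ` C" by auto
  then obtain x where x: "x \<in> C" "h x = (\<alpha> + \<beta>) / 2" by auto
  have "\<exists>U. open U \<and> x \<in> U \<and> U \<inter> X \<subseteq> C"
    by (rule arc_nbhd[OF h C(1) ab(2)]) (use x ab C in auto)
  then show ?thesis using x(1) by blast
qed

lemma infinite_funpow_image:
  assumes "ratmap d F" "infinite C"
  shows "infinite ((F ^^ n) ` C)"
proof (induction n)
  case (Suc n)
  have "infinite (F ` ((F ^^ n) ` C))"
  proof
    assume "finite (F ` ((F ^^ n) ` C))"
    then have "finite ((F ^^ n) ` C)"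
    proof (rule finite_finite_vimage_IntI[where h = F and A = "(F ^^ n) ` C", THEN rev_finite_subset])
      show "finite (F -` {y} \<inter> (F ^^ n) ` C)" for y
        using preimage_finite_card[OF assms(1), of y] by (auto simp: vimage_def)
    qed auto
    then show False using Suc by simp
  qed
  then show ?case by (simp add: image_image)
qed (use assms in simp)

text \<open>Suppose the Julia set is disconnected, and let \<open>K n\<close> be its component
  containing the n-th image of \<open>a\<close>. Every \<open>K n\<close> is infinite and hence has
  interior points relative to \<open>X\<close>. If two of them coincide, the iterates of a
  neighbourhood \<open>U\<close> along the period meet the Julia set in one component only, so they
  omit three points of the rest, which is infinite by perfectness. If all are distinct, the iterates
  of \<open>U\<close> from the first on never return to \<open>K 0\<close>. Either way Montel's
  theorem contradicts the presence of Julia points in \<open>U\<close>.\<close>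

lemma julia_connected_on_arc:
  assumes F: "ratmap d F" "d \<ge> 2" and X: "arclike X" "julia F \<subseteq> X" "julia F ~= X"
    and C: "C \<subseteq> julia F" "connected C" "a \<in> C" "b \<in> C" "a ~= b"
  shows "connected (julia F)"
proof (rule ccontr)
  let ?J = "julia F"
  assume nc: "\<not> connected ?J"
  obtain y where y: "y \<in> X" "y \<notin> ?J" using X by blast
  have inv: "(F ^^ n) z \<in> ?J \<longleftrightarrow> z \<in> ?J" for n z
    by (induction n) (simp_all add: julia_invariant[OF F(1)])
  have infC: "infinite C" using connected_finite_iff_sing[OF C(2)] C(3-5) by auto
  define K where "K = (\<lambda>n. connected_component_set ?J ((F ^^ n) a))"
  have Kn: "K n = connected_component_set ?J ((F ^^ n) a)" for n by (simp add: K_def)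
  have aJ: "(F ^^ n) a \<in> ?J" for n using C inv by blast
  have K: "K n \<subseteq> ?J" "connected (K n)" "closed (K n)" "(F ^^ n) a \<in> K n" for n
    unfolding K_def using closed_julia[of F] aJ[of n]
    by (auto simp: connected_component_subset closed_connected_component connected_component_refl)
  have cont: "continuous_on S (F ^^ n)" for S n
    by (intro continuous_at_imp_continuous_on ballI isCont_funpow ratmap_isCont[OF F(1)])
  have step: "(F ^^ n) ` K m \<subseteq> K (n + m)" for n m
    unfolding Kn[of "n + m"]
  proof (rule connected_component_maximal)
    show "(F ^^ (n + m)) a \<in> (F ^^ n) ` K m" using K(4)[of m] by (simp add: funpow_add)
    show "connected ((F ^^ n) ` K m)" by (rule connected_continuous_image[OF cont K(2)])
    show "(F ^^ n) ` K m \<subseteq> ?J" using K(1) inv by blast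
  qed
  have "C \<subseteq> K 0" unfolding K_def using C by (intro connected_component_maximal) auto
  then have infK: "infinite (K n)" for n
    using infinite_funpow_image[OF F(1) infC, of n] step[of n 0]
    by (metis add.right_neutral finite_subset image_mono order_trans)
  have int: "\<exists>x\<in>K n. \<exists>U. open U \<and> x \<in> U \<and> U \<inter> X \<subseteq> K n" for n
  proof -
    obtain u v w where "u \<in> K n" "v \<in> K n" "u ~= v" using infinite_three[OF infK[of n]] by metis
    then show ?thesis using arc_interior[OF X(1) y(1), of "K n" u v] K(1,2)[of n] X(2) y(2) by blast
  qed
  have KeqI: "K n = K m" if "z \<in> K n" "z \<in> K m" for n m z
    using that unfolding K_def by (metis connected_component_eq)
  show False
  proof (cases "\<exists>m n. n > 0 \<and> K m = K (n + m)")
    case True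
    then obtain m n where n: "n > 0" "K m = K (n + m)" by blast
    have stay: "(F ^^ (n * k)) ` K m \<subseteq> K m" for k
    proof (induction k)
      case (Suc k)
      have "(F ^^ (n * Suc k)) ` K m = (F ^^ n) ` ((F ^^ (n * k)) ` K m)"
        by (simp add: funpow_add image_comp)
      also have "\<dots> \<subseteq> (F ^^ n) ` K m" using Suc by (rule image_mono)
      also have "\<dots> \<subseteq> K m" using step[of n m] n(2) by simp
      finally show ?case .
    qed simp
    obtain x U where U: "x \<in> K m" "open U" "x \<in> U" "U \<inter> X \<subseteq> K m" using int by blast
    have "K m ~= ?J" using K(2) nc by metis
    then obtain j where j: "j \<in> ?J" "j \<notin> K m" using K(1) by blast
    have "infinite (?J \<inter> - K m)"
      using julia_perfect[OF F j(1)] K(3)[of m] j(2)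
      unfolding islimpt_eq_acc_point by (metis Int_commute Compl_iff open_Compl)
    then obtain p q s where pqs: "p \<in> ?J \<inter> - K m" "q \<in> ?J \<inter> - K m" "s \<in> ?J \<inter> - K m" "p ~= q" "q ~= s" "p ~= s"
      by (rule infinite_three)
    have "U \<subseteq> fatou F"
    proof (rule omit_three_fatou[OF F(1) U(2) n(1) pqs(4-6)])
      fix k z assume z: "z \<in> U"
      have "(F ^^ (n * k)) z \<in> K m" if "(F ^^ (n * k)) z \<in> ?J"
        using that z inv U(4) X(2) stay by blast
      then show "(F ^^ (n * k)) z \<notin> {p, q, s}" using pqs by blast
    qed
    then have "x \<in> fatou F" using U(3) by blast
    moreover have "x \<in> ?J" using U(1) K(1) by blast
    ultimately show False by (simp add: julia_iff)
  next
    case False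
    obtain x U where U: "x \<in> K 0" "open U" "x \<in> U" "U \<inter> X \<subseteq> K 0" using int by blast
    obtain p q s where pqs: "p \<in> K 0" "q \<in> K 0" "s \<in> K 0" "p ~= q" "q ~= s" "p ~= s"
      by (rule infinite_three[OF infK])
    \<comment> \<open>\<open>U\<close> itself meets \<open>K 0\<close>, so the omission starts with
      the first image of \<open>U\<close>.\<close>
    have "F ` U \<subseteq> fatou F"
    proof (rule omit_three_fatou[OF F(1) ratmap_open_map[OF F(1) U(2)] zero_less_one pqs(4-6)])
      fix k z assume "z \<in> F ` U"
      then obtain u where u: "u \<in> U" "z = F u" by blast
      have z: "(F ^^ k) z = (F ^^ Suc k) u" by (simp add: u(2) funpow_swap1)
      have "(F ^^ k) z \<notin> K 0"
      proof
        assume K0: "(F ^^ k) z \<in> K 0"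
        then have "u \<in> ?J" using K(1) inv unfolding z by blast
        then have "u \<in> K 0" using u U(4) X(2) by blast
        then have "(F ^^ Suc k) u \<in> K (Suc k + 0)" using step by blast
        then have "K 0 = K (Suc k + 0)" using K0 KeqI unfolding z by blast
        then show False using False by blast
      qed
      then show "(F ^^ (1 * k)) z \<notin> {p, q, s}" using pqs by auto
    qed
    then have "F x \<in> fatou F" using U(3) by blast
    then have "x \<in> fatou F" by (rule julia_backward[OF F(1)])
    moreover have "x \<in> ?J" using U(1) K(1) by blast
    ultimately show False by (simp add: julia_iff)
  qed
qed

text \<open>If the circle is completely invariant, the endpoints of an interval Julia set would form a
  finite backward invariant set, hence would be attracting.\<close>

lemma julia_totally_disconnected_on_arc:
  assumes F: "ratmap d F" "d \<ge> 2" and X: "arclike X" "connected X" "julia F \<subseteq> X" "julia F ~= X"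
    and inv: "\<And>z. F z \<in> X \<longleftrightarrow> z \<in> X"
    and C: "C \<subseteq> julia F" "connected C"
  shows "\<exists>a. C \<subseteq> {a}"
proof (rule ccontr)
  let ?J = "julia F"
  assume "\<not> ?thesis"
  then obtain a b where ab: "a \<in> C" "b \<in> C" "a ~= b" by blast
  have cJ: "connected ?J" by (rule julia_connected_on_arc[OF F X(1,3,4) C ab])
  obtain y where y: "y \<in> X" "y \<notin> ?J" using X by blast
  obtain h :: "sphere => real" where h: "continuous_on (X - {y}) h" "inj_on h (X - {y})"
    using X(1) y(1) unfolding arclike_def by blast
  have J: "?J \<subseteq> X - {y}" using X(3) y(2) by blast
  have "compact (h ` ?J)" "connected (h ` ?J)"
    using compact_continuous_image connected_continuous_image compact_julia cJ continuous_on_subset[OF h(1) J] by blast+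
  then obtain \<alpha> \<beta> where hJ: "h ` ?J = {\<alpha>..\<beta>}"
    by (metis connected_compact_interval_1 box_real(2))
  define E where "E = {x\<in>?J. \<not> (\<exists>U. open U \<and> x \<in> U \<and> U \<inter> X \<subseteq> ?J)}"
  have "h x \<in> {\<alpha>, \<beta>}" if "x \<in> E" for x
  proof -
    have "x \<in> ?J" using that by (simp add: E_def)
    then have "\<alpha> \<le> h x" "h x \<le> \<beta>" using hJ by (metis atLeastAtMost_iff imageI)+
    moreover have "\<not> (\<alpha> < h x \<and> h x < \<beta>)"
      using arc_nbhd[OF h J, of \<alpha> \<beta> x] hJ that J by (auto simp: E_def)
    ultimately show ?thesis by auto
  qed
  then have "finite (h ` E)" by (intro finite_subset[of "h ` E" "{\<alpha>, \<beta>}"]) auto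
  moreover have "inj_on h E" using h(2) J by (auto simp: E_def intro: inj_on_subset)
  ultimately have finE: "finite E" by (rule finite_imageD)
  have backE: "x \<in> E" if "F x \<in> E" for x
    unfolding E_def
  proof (intro CollectI conjI notI)
    show "x \<in> ?J" using that julia_invariant[OF F(1)] by (simp add: E_def)
    assume "\<exists>U. open U \<and> x \<in> U \<and> U \<inter> X \<subseteq> ?J"
    then obtain U where U: "open U" "x \<in> U" "U \<inter> X \<subseteq> ?J" by blast
    have "F ` U \<inter> X \<subseteq> ?J"
    proof safe
      fix u assume "u \<in> U" "F u \<in> X"
      then have "u \<in> ?J" using inv U(3) by blast
      then show "F u \<in> ?J" using julia_invariant[OF F(1)] by blast
    qed
    moreover have "open (F ` U)" by (rule ratmap_open_map[OF F(1) U(1)])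
    ultimately show False using that U(2) unfolding E_def by blast
  qed
  have "E \<inter> ?J = {}" using finE backE by (rule exceptional_attracting(2)[OF F])
  then have "E = {}" by (auto simp: E_def)
  have "openin (top_of_set X) ?J"
    unfolding openin_contains_ball
  proof (intro conjI X(3) ballI)
    fix x assume "x \<in> ?J"
    then obtain U where U: "open U" "x \<in> U" "U \<inter> X \<subseteq> ?J" using \<open>E = {}\<close> unfolding E_def by blast
    then obtain e where "e > 0" "ball x e \<subseteq> U" using open_contains_ball by blast
    then show "\<exists>e>0. ball x e \<inter> X \<subseteq> ?J" using U(3) by blast
  qed
  moreover have "closedin (top_of_set X) ?J" using closed_julia X(3) by (simp add: closed_subset)
  ultimately have "?J = {} \<or> ?J = X" using X(2) unfolding connected_clopen by blast
  then show False using X(4) julia_nonempty[OF F] by blast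
qed

section \<open>Real rational maps\<close>

definition scnj :: "sphere => sphere" where
  "scnj = map_option cnj"

lemma scnj_hpt: "scnj (hpt u v) = hpt (cnj u) (cnj v)"
  by (simp add: scnj_def hpt_def)

lemma scnj_scnj [simp]: "scnj (scnj z) = z"
  by (cases z) (simp_all add: scnj_def)

lemma Rhat_iff: "z \<in> Rhat \<longleftrightarrow> scnj z = z"
  by (cases z) (auto simp: Rhat_def scnj_def Reals_cnj_iff)

lemma Some_Rhat_iff: "Some w \<in> Rhat \<longleftrightarrow> w \<in> \<real>"
  by (auto simp: Rhat_def)

lemma None_Rhat [simp]: "None \<in> Rhat"
  by (simp add: Rhat_def)

lemma dist_scnj [simp]: "dist (scnj x) (scnj y) = dist x y"
proof -
  have "dist (Some (cnj a)) (Some (cnj b) :: sphere) = dist (Some a) (Some b)" for a b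
    unfolding dist_Some_Some by (simp flip: complex_cnj_diff)
  moreover have "dist (Some (cnj a)) (None :: sphere) = dist (Some a) None" for a
    unfolding dist_Some_None by simp
  ultimately show ?thesis
    by (cases x; cases y) (simp_all add: scnj_def dist_commute[of None])
qed

lemma continuous_on_scnj: "continuous_on S scnj"
  unfolding continuous_on_iff by auto

lemma closed_Rhat: "closed Rhat"
proof -
  have "closed {z. scnj z = z}"
    by (intro closed_Collect_eq continuous_on_scnj continuous_on_id)
  moreover have "{z. scnj z = z} = Rhat" by (auto simp: Rhat_iff)
  ultimately show ?thesis by simp
qed

lemma compact_Rhat: "compact Rhat"
  using compact_Int_closed[OF compact_sphere_UNIV closed_Rhat] by simp

section \<open>Polynomials and rational maps with real coefficients\<close>

definition real_coeffs :: "complex poly => bool" where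
  "real_coeffs p \<longleftrightarrow> (\<forall>i. coeff p i \<in> \<real>)"

definition rrat :: "nat => (sphere => sphere) => bool" where
  "rrat d F \<longleftrightarrow> (\<exists>p q. ratpair p q d \<and> real_coeffs p \<and> real_coeffs q \<and> F = rat_eval p q)"

lemma rrat_ratmap: "rrat d F ==> ratmap d F"
  by (auto simp: rrat_def ratmap_def)

lemma coeff_cpoly [simp]: "coeff (cpoly p) i = of_real (coeff p i)"
  by (simp add: cpoly_def coeff_map_poly)

lemma degree_cpoly [simp]: "degree (cpoly p) = degree p"
  unfolding cpoly_def by (rule degree_map_poly) simp

lemma real_coeffs_cpoly: "real_coeffs (cpoly p)"
  by (simp add: real_coeffs_def)

lemma cpoly_add: "cpoly (p + q) = cpoly p + cpoly q"
  and cpoly_diff: "cpoly (p - q) = cpoly p - cpoly q"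
  and cpoly_mult: "cpoly (p * q) = cpoly p * cpoly q"
  and cpoly_smult: "cpoly (smult c p) = smult (of_real c) (cpoly p)"
  and cpoly_1: "cpoly 1 = 1"
  and cpoly_0: "cpoly 0 = 0"
  and cpoly_pCons: "cpoly (pCons c p) = pCons (of_real c) (cpoly p)"
  by (auto intro!: poly_eqI simp: coeff_mult coeff_pCons split: nat.splits)

lemma poly_cpoly_of_real: "poly (cpoly p) (of_real x) = of_real (poly p x)"
  by (induction p) (simp_all add: cpoly_0 cpoly_pCons)

lemma real_coeffs_imp_cpoly:
  assumes "real_coeffs p"
  shows "\<exists>r. p = cpoly r"
proof -
  have "p = cpoly (map_poly Re p)"
    using assms by (intro poly_eqI) (simp add: coeff_map_poly real_coeffs_def)
  then show ?thesis ..
qed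

lemma ratpair_cpoly_iff:
  assumes "d > 0"
  shows "ratpair (cpoly p) (cpoly q) d \<longleftrightarrow> coprime p q \<and> max (degree p) (degree q) = d"
proof
  assume R: "ratpair (cpoly p) (cpoly q) d"
  have "coprime p q"
  proof (rule coprimeI)
    fix c assume c: "c dvd p" "c dvd q"
    have c0: "c ~= 0" using c R by (auto simp: ratpair_def cpoly_0)
    have "degree c = 0"
    proof (rule ccontr)
      assume "degree c ~= 0"
      then have "degree (cpoly c) > 0" by simp
      then obtain z where "poly (cpoly c) z = 0" using nonconst_root by blast
      then have "poly (cpoly p) z = 0" "poly (cpoly q) z = 0"
        using c by (auto simp: dvd_def cpoly_mult)
      then show False using R by (auto simp: ratpair_def)
    qed
    then show "is_unit c" using c0 by (simp add: is_unit_iff_degree)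
  qed
  moreover have "max (degree p) (degree q) = d"
    using R by (auto simp: ratpair_def max_def dest!: le_degree)
  ultimately show "coprime p q \<and> max (degree p) (degree q) = d" ..
next
  assume A: "coprime p q \<and> max (degree p) (degree q) = d"
  have "poly (cpoly p) z ~= 0 \<or> poly (cpoly q) z ~= 0" for z
  proof (rule ccontr)
    assume z: "\<not> ?thesis"
    have "p ~= 0 \<or> q ~= 0" using A assms by auto
    then obtain r where r: "r ~= 0" "poly (cpoly r) z = 0" using z by blast
    \<comment> \<open>Up to a constant this is the minimal polynomial of \<open>z\<close> over the
      reals; it divides every real polynomial vanishing at \<open>z\<close>, in particular both
      \<open>p\<close> and \<open>q\<close>.\<close>
    define m where "m = (ARG_MIN degree r. r ~= 0 \<and> poly (cpoly r) z = 0)"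
    have m: "m ~= 0" "poly (cpoly m) z = 0"
      and min: "\<And>r. r ~= 0 ==> poly (cpoly r) z = 0 ==> degree m \<le> degree r"
      using arg_min_nat_lemma[of "\<lambda>r. r ~= 0 \<and> poly (cpoly r) z = 0" r degree] r
      unfolding m_def by auto
    have dvd: "m dvd f" if "poly (cpoly f) z = 0" for f
    proof (rule ccontr)
      assume "\<not> m dvd f"
      then have nz: "f mod m ~= 0" by (simp add: dvd_eq_mod_eq_0)
      have "cpoly f = cpoly (f div m) * cpoly m + cpoly (f mod m)"
        by (simp flip: cpoly_mult cpoly_add)
      then have "poly (cpoly (f mod m)) z = 0" using that m(2) by simp
      then show False using min[OF nz] degree_mod_less'[OF m(1) nz] by simp
    qed
    have "is_unit m"
      using coprime_common_divisor[of p q m] A dvd[of p] dvd[of q] z by blast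
    then have "degree m = 0" using m(1) by (simp add: is_unit_iff_degree)
    then obtain k where "m = [:k:]" by (rule degree_eq_zeroE)
    then show False using m by (simp add: cpoly_pCons cpoly_0)
  qed
  moreover have "coeff p d ~= 0 \<or> coeff q d ~= 0"
    using A assms by (metis leading_coeff_0_iff max_def degree_0 less_irrefl)
  ultimately show "ratpair (cpoly p) (cpoly q) d"
    using A assms by (auto simp: ratpair_def)
qed

lemma real_rational_map_rrat:
  assumes "real_rational_map F d" "d > 0"
  shows "rrat d F"
proof -
  obtain p q :: "real poly" where pq: "coprime p q" "max (degree p) (degree q) = d"
    "F = rat_eval (cpoly p) (cpoly q)"
    using assms(1) unfolding real_rational_map_def by blast
  then have "ratpair (cpoly p) (cpoly q) d" using ratpair_cpoly_iff[OF assms(2)] by simp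
  then show ?thesis unfolding rrat_def using pq(3) real_coeffs_cpoly by blast
qed

lemma rrat_real_polys:
  assumes "rrat d F"
  obtains p q :: "real poly" where "ratpair (cpoly p) (cpoly q) d" "F = rat_eval (cpoly p) (cpoly q)"
proof -
  obtain P Q where PQ: "ratpair P Q d" "real_coeffs P" "real_coeffs Q" "F = rat_eval P Q"
    using assms unfolding rrat_def by blast
  obtain p q where "P = cpoly p" "Q = cpoly q"
    using real_coeffs_imp_cpoly[OF PQ(2)] real_coeffs_imp_cpoly[OF PQ(3)] by blast
  then show thesis using that[of p q] PQ by simp
qed

lemma hpoly_cnj: "real_coeffs p ==> hpoly p d (cnj u) (cnj v) = cnj (hpoly p d u v)"
  unfolding hpoly_def real_coeffs_def by (simp add: Reals_cnj_iff)

lemma rrat_scnj: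
  assumes "rrat d F"
  shows "F (scnj z) = scnj (F z)"
proof -
  obtain p q where F: "ratpair p q d" "real_coeffs p" "real_coeffs q" "F = rat_eval p q"
    using assms by (auto simp: rrat_def)
  obtain u v where z: "z = hpt u v" "u ~= 0 \<or> v ~= 0" by (rule hpt_cases)
  have "cnj u ~= 0 \<or> cnj v ~= 0" using z(2) by simp
  then show ?thesis
    using rat_eval_hpt[OF F(1)] z F by (simp add: scnj_hpt hpoly_cnj)
qed

lemma rrat_Rhat: "rrat d F ==> z \<in> Rhat ==> F z \<in> Rhat"
  using rrat_scnj[of d F z] by (simp add: Rhat_iff)

lemma real_coeffs_ops:
  "real_coeffs p ==> real_coeffs q ==> real_coeffs (p + q)"
  "c \<in> \<real> ==> real_coeffs p ==> real_coeffs (smult c p)"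
  "real_coeffs p ==> real_coeffs q ==> real_coeffs (p * q)"
  "real_coeffs 1" "real_coeffs 0"
  "c \<in> \<real> ==> real_coeffs p ==> real_coeffs (pCons c p)"
  by (auto simp: real_coeffs_def coeff_mult coeff_pCons split: nat.splits intro!: sum_in_Reals)

lemma real_coeffs_power: "real_coeffs p ==> real_coeffs (p ^ n)"
  by (induction n) (auto intro: real_coeffs_ops)

lemma real_coeffs_sum: "(\<And>i. i \<in> A ==> real_coeffs (f i)) ==> real_coeffs (\<Sum>i\<in>A. f i)"
  by (induction A rule: infinite_finite_induct) (auto intro: real_coeffs_ops)

lemma real_coeffs_psub:
  assumes "a \<in> \<real>" "b \<in> \<real>" "c \<in> \<real>" "e \<in> \<real>" "real_coeffs p"
  shows "real_coeffs (psub a b c e d p)"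
  unfolding psub_def using assms
  by (intro real_coeffs_sum real_coeffs_ops real_coeffs_power) (auto simp: real_coeffs_def)

text \<open>Real Moebius transformations with explicit coefficients.\<close>
definition rmob :: "real => real => real => real => sphere => sphere" where
  "rmob a b c e = mob (of_real a) (of_real b) (of_real c) (of_real e)"

lemma rmob_det: "a * e - b * c ~= 0 ==> complex_of_real a * of_real e - of_real b * of_real c ~= 0"
  by (metis of_real_diff of_real_eq_0_iff of_real_mult)

lemma rrat_rmob: "a * e - b * c ~= 0 ==> rrat 1 (rmob a b c e)"
  unfolding rrat_def rmob_def mob_def
  using ratpair_mob[OF rmob_det[of a e b c]] by (blast intro: real_coeffs_ops Reals_of_real)

lemma real_mobius_rmob: "a * e - b * c ~= 0 ==> real_mobius (rmob a b c e)"
  unfolding real_mobius_def rmob_def mob_def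
  by (intro exI[of _ a] exI[of _ b] exI[of _ c] exI[of _ e]) (simp add: cpoly_pCons cpoly_0)

lemma rmob_hpt:
  "a * e - b * c ~= 0 ==> u ~= 0 \<or> v ~= 0 ==> rmob a b c e (hpt u v) = hpt (of_real a * u + of_real b * v) (of_real c * u + of_real e * v)"
  unfolding rmob_def by (intro mob_hpt rmob_det)

lemma rmob_inverse:
  assumes "a * e - b * c ~= 0"
  shows "rmob e (-b) (-c) a \<circ> rmob a b c e = id" "rmob a b c e \<circ> rmob e (-b) (-c) a = id"
  using mob_inverse[OF rmob_det[OF assms]] by (simp_all add: rmob_def)

lemma rmob_det_inverse: "(a::real) * e - b * c ~= 0 ==> e * a - (-b) * (-c) ~= 0"
  by (simp add: mult.commute)

lemma rmob_Rhat_iff: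
  assumes "a * e - b * c ~= 0"
  shows "rmob a b c e z \<in> Rhat \<longleftrightarrow> z \<in> Rhat"
proof
  assume "rmob a b c e z \<in> Rhat"
  then have "rmob e (-b) (-c) a (rmob a b c e z) \<in> Rhat"
    by (rule rrat_Rhat[OF rrat_rmob[OF rmob_det_inverse[OF assms]]])
  then show "z \<in> Rhat" using rmob_inverse(1)[OF assms] by (simp add: fun_eq_iff)
qed (rule rrat_Rhat[OF rrat_rmob[OF assms]])

lemma rmob_compose:
  assumes "a * e - b * c ~= 0" "a' * e' - b' * c' ~= 0"
  shows "rmob a b c e \<circ> rmob a' b' c' e' = rmob (a * a' + b * c') (a * b' + b * e') (c * a' + e * c') (c * b' + e * e')"
    and "(a * a' + b * c') * (c * b' + e * e') - (a * b' + b * e') * (c * a' + e * c') ~= 0"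
proof -
  show "rmob a b c e \<circ> rmob a' b' c' e' = rmob (a * a' + b * c') (a * b' + b * e') (c * a' + e * c') (c * b' + e * e')"
    unfolding rmob_def by (subst mob_compose[OF rmob_det[OF assms(1)] rmob_det[OF assms(2)]]) simp
  have "(a * a' + b * c') * (c * b' + e * e') - (a * b' + b * e') * (c * a' + e * c') =
      (a * e - b * c) * (a' * e' - b' * c')" by algebra
  then show "(a * a' + b * c') * (c * b' + e * e') - (a * b' + b * e') * (c * a' + e * c') ~= 0"
    using assms by simp
qed

lemma rrat_conj:
  assumes "rrat d F" "a * e - b * c ~= 0"
  shows "rrat d (rmob a b c e \<circ> F \<circ> rmob e (-b) (-c) a)"
proof -
  obtain p q where F: "ratpair p q d" "real_coeffs p" "real_coeffs q" "F = rat_eval p q"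
    using assms by (auto simp: rrat_def)
  note D = rmob_det[OF assms(2)] and D' = rmob_det[OF rmob_det_inverse[OF assms(2)]]
  let ?p = "smult (of_real a) p + smult (of_real b) q" and ?q = "smult (of_real c) p + smult (of_real e) q"
  let ?s = "psub (of_real e) (of_real (-b)) (of_real (-c)) (of_real a) d"
  have R: "ratpair ?p ?q d" by (rule ratpair_post_mob[OF F(1) D])
  have "rmob a b c e \<circ> F = rat_eval ?p ?q"
    unfolding rmob_def F(4) by (rule rat_eval_post_mob[OF F(1) D])
  then have "rmob a b c e \<circ> F \<circ> rmob e (-b) (-c) a = rat_eval (?s ?p) (?s ?q)"
    using rat_eval_pre_mob[OF R D'] by (simp add: rmob_def)
  moreover have "ratpair (?s ?p) (?s ?q) d" by (rule ratpair_pre_mob[OF R D'])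
  moreover have "real_coeffs (?s ?p)" "real_coeffs (?s ?q)"
    using F(2,3) by (auto intro!: real_coeffs_psub real_coeffs_ops)
  ultimately show ?thesis unfolding rrat_def by blast
qed

lemma rmob_to_infinity:
  assumes "y \<in> Rhat"
  obtains a b c e where "a * e - b * c ~= 0" "rmob a b c e y = None"
proof (cases y)
  case None
  have d: "(1::real) * 1 - 0 * 0 ~= 0" by simp
  have "rmob 1 0 0 1 (hpt 1 0) = None" by (subst rmob_hpt[OF d]) auto
  then show thesis using that[OF d] None by simp
next
  case (Some w)
  then obtain r where r: "w = of_real r" using assms by (auto simp: Rhat_def elim: Reals_cases)
  have d: "(0::real) * (-r) - 1 * 1 ~= 0" by simp
  have "rmob 0 1 1 (-r) (hpt w 1) = None" by (subst rmob_hpt[OF d]) (auto simp: r)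
  then show thesis using that[OF d] Some by simp
qed

text \<open>The removed point is sent to infinity, after which the real coordinate is the required
  injection.\<close>

lemma arclike_Rhat: "arclike Rhat"
  unfolding arclike_def
proof
  fix y assume "y \<in> Rhat"
  then obtain a b c e where d: "a * e - b * c ~= 0" and y: "rmob a b c e y = None" by (rule rmob_to_infinity)
  let ?M = "rmob a b c e"
  have inj: "u = v" if "?M u = ?M v" for u v
    using that rmob_inverse(1)[OF d] by (metis comp_apply id_apply)
  define h where "h = (\<lambda>z. Re (chart (Some 0) (?M z)))"
  have ne: "?M z ~= antip (Some 0)" if "z ~= y" for z
    using that inj[of z y] y by (auto simp: antip_def)
  have cM: "continuous_on (Rhat - {y}) ?M"
    by (rule ratmap_continuous_on[OF rrat_ratmap[OF rrat_rmob[OF d]]])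
  have "continuous_on (?M ` (Rhat - {y})) (chart (Some 0))"
  proof (intro continuous_on_chart notI)
    assume "antip (Some 0) \<in> ?M ` (Rhat - {y})"
    then obtain z where z: "antip (Some 0) = ?M z" "z \<in> Rhat - {y}" by (rule imageE)
    then have "z ~= y" by blast
    from ne[OF this] show False using z(1) by simp
  qed
  from continuous_on_compose[OF cM this] have "continuous_on (Rhat - {y}) h"
    unfolding h_def by (auto simp: o_def intro!: continuous_intros)
  moreover have "inj_on h (Rhat - {y})"
  proof (rule inj_onI)
    fix u v assume uv: "u \<in> Rhat - {y}" "v \<in> Rhat - {y}" "h u = h v"
    have M: "?M z = Some (of_real (h z))" if "z \<in> Rhat - {y}" for z
    proof -
      have "?M z \<in> Rhat" using that rmob_Rhat_iff[OF d] by blast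
      moreover have "?M z ~= None" using ne[of z] that by (auto simp: antip_def)
      ultimately obtain t where "?M z = Some (of_real t)" by (auto simp: Rhat_def elim: Reals_cases)
      then show ?thesis by (simp add: h_def chart_def)
    qed
    show "u = v" using M[OF uv(1)] M[OF uv(2)] uv(3) inj by metis
  qed
  ultimately show "\<exists>h::sphere => real. continuous_on (Rhat - {y}) h \<and> inj_on h (Rhat - {y})" by blast
qed

section \<open>Topological entropy on the real circle\<close>

lemma connected_real_segment: "connected ((\<lambda>r. Some (complex_of_real r) :: sphere) ` {x..y})"
proof -
  have "continuous_on {x..y} (\<lambda>r. Some (complex_of_real r) :: sphere)"
    by (intro continuous_on_compose2[OF continuous_on_Some[of UNIV]] continuous_intros) auto
  then show ?thesis by (rule connected_continuous_image) simp
qed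

definition orbit_preimages :: "(sphere => sphere) => sphere set => nat => sphere set" where
  "orbit_preimages F A n = (\<Union>k<n. \<Union>a\<in>A. {x\<in>Rhat. (F ^^ k) x = a})"

text \<open>Two points of \<open>S\<close> with no orbit preimage between them have, at every time
  below \<open>n\<close>, images in one connected subset of the complement of \<open>A\<close>,
  hence at distance at most \<open>e\<close>. So the number of preimages to the left is injective on
  the remaining finite points of \<open>S\<close>: at most card + 1 values, to which the card
  preimages and the point infinity are added.\<close>

lemma separated_card_le:
  assumes cont: "\<And>x. isCont F x" and A: "\<And>C x y. connected C ==> C \<subseteq> Rhat - A ==> x \<in> C ==> y \<in> C ==> dist x y \<le> e"
    and inv: "\<And>z. z \<in> Rhat ==> F z \<in> Rhat"
    and P: "finite (orbit_preimages F A n)" and S: "finite S" "separated F Rhat n e S"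
  shows "card S \<le> 2 * card (orbit_preimages F A n) + 2"
proof -
  let ?P = "orbit_preimages F A n"
  define re where "re = (\<lambda>z::sphere. Re (the z))"
  define r where "r = (\<lambda>z. card {t \<in> ?P - {None}. re t < re z})"
  define S' where "S' = S - ?P - {None}"
  have S'R: "z = Some (complex_of_real (re z))" if "z \<in> S'" for z
    using that S(2) by (auto simp: S'_def separated_def re_def Rhat_def elim!: Reals_cases)
  have le: "\<not> re z < re w" if zw: "z \<in> S'" "w \<in> S'" "r z = r w" for z w
  proof
    assume lt: "re z < re w"
    define C where "C = (\<lambda>t. Some (complex_of_real t) :: sphere) ` {re z..re w}"
    have sub: "{t \<in> ?P - {None}. re t < re z} \<subseteq> {t \<in> ?P - {None}. re t < re w}" using lt by auto
    have eq: "{t \<in> ?P - {None}. re t < re z} = {t \<in> ?P - {None}. re t < re w}"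
      using card_subset_eq[OF _ sub] P zw(3) by (simp add: r_def)
    have CP: "C \<subseteq> Rhat - ?P"
    proof
      fix t assume t: "t \<in> C"
      then obtain s where s: "t = Some (complex_of_real s)" "re z \<le> s" "s \<le> re w" by (auto simp: C_def)
      have "t \<notin> ?P"
      proof
        assume tP: "t \<in> ?P"
        have "t ~= w" using tP zw(2) by (auto simp: S'_def)
        then have "s < re w" using s S'R[OF zw(2)] by (metis less_eq_real_def)
        then have "t \<in> {t \<in> ?P - {None}. re t < re w}" using tP s by (auto simp: re_def)
        then have "re t < re z" using eq by blast
        then show False using s by (simp add: re_def)
      qed
      then show "t \<in> Rhat - ?P" using s by (simp add: Some_Rhat_iff)
    qed
    have zC: "z \<in> C" "w \<in> C" using S'R[OF zw(1)] S'R[OF zw(2)] lt unfolding C_def by (metis atLeastAtMost_iff imageI less_imp_le order_refl)+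
    have "z ~= w" using lt by auto
    then obtain k where k: "k < n" "dist ((F ^^ k) z) ((F ^^ k) w) > e"
      using S(2) zw(1,2) unfolding separated_def cdist_eq_dist S'_def by blast
    have "connected ((F ^^ k) ` C)"
      unfolding C_def
      by (intro connected_continuous_image[OF _ connected_real_segment] continuous_at_imp_continuous_on ballI isCont_funpow cont)
    moreover have "(F ^^ k) ` C \<subseteq> Rhat - A"
    proof
      fix y assume "y \<in> (F ^^ k) ` C"
      then obtain t where t: "t \<in> C" "y = (F ^^ k) t" by blast
      have tR: "t \<in> Rhat" "t \<notin> ?P" using CP t(1) by auto
      have "(F ^^ j) t \<in> Rhat" for j using tR(1) inv by (induction j) auto
      moreover have "y \<notin> A" using tR k(1) t(2) unfolding orbit_preimages_def by blast
      ultimately show "y \<in> Rhat - A" using t(2) by simp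
    qed
    ultimately have "dist ((F ^^ k) z) ((F ^^ k) w) \<le> e"
      using A[of "(F ^^ k) ` C"] zC by blast
    then show False using k(2) by simp
  qed
  have "inj_on r S'"
  proof (rule inj_onI)
    fix z w assume zw: "z \<in> S'" "w \<in> S'" "r z = r w"
    then have "re z = re w" using le[of z w] le[of w z] by (simp add: not_less)
    then show "z = w" using S'R zw(1,2) by metis
  qed
  moreover have "r ` S' \<subseteq> {..card ?P}"
    using P by (auto simp: r_def intro!: card_mono)
  ultimately have "card S' \<le> card {..card ?P}"
    by (intro card_inj_on_le) auto
  moreover have "S \<subseteq> S' \<union> ?P \<union> {None}" by (auto simp: S'_def)
  then have "card S \<le> card (S' \<union> ?P \<union> {None})"
    using P S(1) by (intro card_mono) (auto simp: S'_def)
  moreover have "card (S' \<union> ?P \<union> {None}) \<le> card S' + card ?P + 1"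
    using card_Un_le[of "S' \<union> ?P" "{None}"] card_Un_le[of S' ?P] by simp
  ultimately show ?thesis by simp
qed

lemma connected_avoids_two:
  assumes C: "connected C" "C \<subseteq> Rhat" and ab: "Some (complex_of_real a) \<notin> C" "Some (complex_of_real b) \<notin> C"
    and x: "Some (complex_of_real x) \<in> C" "a < x" "x < b"
  shows "C \<subseteq> (\<lambda>t. Some (complex_of_real t)) ` {a<..<b}"
proof -
  \<comment> \<open>A vertical strip and the complement of a compact box separate the interval from
    the rest of the real circle; compactness of the box leaves a neighbourhood of infinity in
    \<open>V\<close>.\<close>
  define U :: "sphere set" where "U = ichart (Some 0) ` {w. a < Re w \<and> Re w < b}"
  define V :: "sphere set" where "V = - (Some ` cbox (Complex a (-1)) (Complex b 1))"
  have "open {w. a < Re w \<and> Re w < b}"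
    by (intro open_Collect_conj open_Collect_less continuous_intros)
  then have U: "open U" unfolding U_def by (rule open_ichart_image)
  have "compact (Some ` cbox (Complex a (-1)) (Complex b 1) :: sphere set)"
    by (intro compact_continuous_image continuous_on_Some compact_cbox)
  then have V: "open V" unfolding V_def by (simp add: open_Compl compact_imp_closed)
  have real: "\<exists>t. z = None \<or> z = Some (complex_of_real t)" if "z \<in> C" for z
    using that C(2) by (auto simp: Rhat_def elim!: Reals_cases)
  have inU: "Some (complex_of_real t) \<in> U \<longleftrightarrow> a < t \<and> t < b" for t
    by (auto simp: U_def ichart_def image_iff)
  have inV: "Some (complex_of_real t) \<in> V \<longleftrightarrow> \<not> (a \<le> t \<and> t \<le> b)" for t
    by (auto simp: V_def in_cbox_complex_iff image_iff)
  have NU: "None \<notin> U" "None \<in> V" by (auto simp: U_def V_def ichart_def)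
  have "U \<inter> V \<inter> C = {}"
  proof safe
    fix z assume z: "z \<in> U" "z \<in> V" "z \<in> C"
    then obtain t where "z = Some (complex_of_real t)" using real NU by metis
    then show "z \<in> {}" using z inU inV by auto
  qed
  moreover have "C \<subseteq> U \<union> V"
  proof
    fix z assume z: "z \<in> C"
    show "z \<in> U \<union> V"
    proof (cases z)
      case (Some w)
      then obtain t where t: "z = Some (complex_of_real t)" using real[OF z] by auto
      then have "t ~= a" "t ~= b" using ab z by auto
      then show ?thesis using inU[of t] inV[of t] t by auto
    qed (use NU in auto)
  qed
  ultimately have "U \<inter> C = {} \<or> V \<inter> C = {}" using connectedD[OF C(1) U V] by blast
  moreover have "Some (complex_of_real x) \<in> U \<inter> C" using x inU by simp
  ultimately have VC: "V \<inter> C = {}" by blast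
  show ?thesis
  proof
    fix z assume z: "z \<in> C"
    then have "z \<in> U" using VC \<open>C \<subseteq> U \<union> V\<close> by blast
    moreover obtain t where "z = Some (complex_of_real t)" using real[OF z] NU calculation by metis
    ultimately show "z \<in> (\<lambda>t. Some (complex_of_real t)) ` {a<..<b}" using inU by auto
  qed
qed

lemma dist_Some_real_le: "dist (Some (complex_of_real s)) (Some (complex_of_real t) :: sphere) \<le> 2 * \<bar>s - t\<bar>"
  using dist_ichart_le[of "Some 0" "complex_of_real s" "complex_of_real t"]
  by (simp add: ichart_def norm_of_real flip: of_real_diff)

lemma dist_Some_None_le: "x ~= 0 ==> dist (Some (complex_of_real x)) (None :: sphere) \<le> 2 / \<bar>x\<bar>"
proof -
  assume x: "x ~= 0"
  have "\<bar>x\<bar> \<le> sqrt (1 + x\<^sup>2)" by (metis real_sqrt_abs real_sqrt_le_iff le_add_same_cancel2 zero_le_one)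
  moreover have "sqrt (1 + x\<^sup>2) > 0" by (simp add: add_pos_nonneg)
  ultimately show ?thesis using x by (auto simp: dist_Some_None intro!: divide_left_mono)
qed

text \<open>One point is chosen in each of finitely many cells of length \<eta> = e/4: neighbours
  are at most 2 \<eta> apart, and the chordal metric is at most twice the Euclidean one. There are
  so many cells that everything beyond them has modulus at least 4/e, hence distance at most e/2
  from infinity. Each cell offers infinitely many candidates, so \<open>E\<close> can be
  avoided.\<close>

lemma fine_partition:
  assumes e: "e > 0" and E: "finite E"
  obtains A where "finite A" "A \<subseteq> Rhat - E"
    "\<And>C x y. connected C ==> C \<subseteq> Rhat - A ==> x \<in> C ==> y \<in> C ==> dist x y \<le> e"
proof -
  define \<eta> where "\<eta> = e / 4"
  have \<eta>: "\<eta> > 0" using e by (simp add: \<eta>_def)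
  have "\<exists>r. of_int k * \<eta> < r \<and> r < of_int (k + 1) * \<eta> \<and> Some (complex_of_real r) \<notin> E" for k :: int
  proof -
    have lt: "of_int k * \<eta> < of_int (k + 1) * \<eta>" using \<eta> by (simp add: algebra_simps)
    have "finite ((\<lambda>r. Some (complex_of_real r)) -` E)"
      using E by (intro finite_vimageI) (auto simp: inj_def)
    then have "infinite ({of_int k * \<eta> <..< of_int (k + 1) * \<eta>} - (\<lambda>r. Some (complex_of_real r)) -` E)"
      using infinite_Ioo[OF lt] by (metis Diff_infinite_finite)
    then obtain r where "r \<in> {of_int k * \<eta> <..< of_int (k + 1) * \<eta>} - (\<lambda>r. Some (complex_of_real r)) -` E"
      using infinite_imp_nonempty by blast
    then show ?thesis by auto
  qed
  then obtain a where a: "\<And>k. of_int k * \<eta> < a k" "\<And>k. a k < of_int (k + 1) * \<eta>"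
    "\<And>k::int. Some (complex_of_real (a k)) \<notin> E" by metis
  have mono: "a k \<le> a l" if "k \<le> l" for k l
  proof (cases "k = l")
    case False
    then have "of_int (k + 1) * \<eta> \<le> of_int l * \<eta>" using that \<eta> by (intro mult_right_mono) auto
    then show ?thesis using a(1)[of l] a(2)[of k] by linarith
  qed simp
  obtain m0 :: nat where m0: "real m0 > 4 / e / \<eta> + 1" using reals_Archimedean2 by blast
  define m where "m = int m0"
  have m: "(of_int m - 1) * \<eta> \<ge> 4 / e"
  proof -
    have "4 / e / \<eta> * \<eta> \<le> (real m0 - 1) * \<eta>" using m0 \<eta> by (intro mult_right_mono) auto
    then show ?thesis using \<eta> by (simp add: m_def)
  qed
  define A where "A = (\<lambda>k. Some (complex_of_real (a k))) ` {-m..m}"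
  show thesis
  proof (rule that[of A])
    show "finite A" by (simp add: A_def)
    show "A \<subseteq> Rhat - E" using a(3) by (auto simp: A_def Some_Rhat_iff)
    fix C and x y :: sphere assume C: "connected C" "C \<subseteq> Rhat - A" and xy: "x \<in> C" "y \<in> C"
    have nA: "Some (complex_of_real (a k)) \<notin> C" if "-m \<le> k" "k \<le> m" for k
      using C(2) that by (auto simp: A_def)
    have CR: "C \<subseteq> Rhat" using C(2) by blast
    show "dist x y \<le> e"
    proof (cases "\<exists>r. Some (complex_of_real r) \<in> C \<and> a (-m) \<le> r \<and> r \<le> a m")
      case True
      then obtain r where r: "Some (complex_of_real r) \<in> C" "a (-m) \<le> r" "r \<le> a m" by blast
      have m0': "m \<ge> 0" by (simp add: m_def)
      have rne: "r ~= a k" if "-m \<le> k" "k \<le> m" for k using nA[OF that] r(1) by auto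
      have r': "a (-m) < r" "r < a m" using r(2,3) rne[of "-m"] rne[of m] m0' by auto
      define k where "k = \<lfloor>r / \<eta>\<rfloor>"
      have k: "of_int k * \<eta> \<le> r" "r < of_int (k + 1) * \<eta>"
        using \<eta> by (simp_all add: k_def flip: pos_le_divide_eq pos_divide_less_eq)
      have "\<exists>l. a l < r \<and> r < a (l + 1)"
      proof (cases "r < a k")
        case True
        have "a (k - 1) < of_int k * \<eta>" using a(2)[of "k - 1"] by simp
        then show ?thesis using True k(1) by (intro exI[of _ "k - 1"]) simp
      next
        case False
        have "r < a (k + 1)" using a(1)[of "k + 1"] k(2) by linarith
        moreover have "r ~= a k"
        proof
          assume "r = a k"
          then have "\<not> (-m \<le> k \<and> k \<le> m)" using rne by blast
          then show False using mono[of k "-m"] mono[of m k] r' \<open>r = a k\<close> by linarith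
        qed
        ultimately show ?thesis using False by (intro exI[of _ k]) simp
      qed
      then obtain l where l: "a l < r" "r < a (l + 1)" by blast
      have lm: "-m \<le> l" "l + 1 \<le> m"
      proof -
        show "-m \<le> l"
        proof (rule ccontr)
          assume "\<not> -m \<le> l"
          then show False using mono[of "l + 1" "-m"] l(2) r'(1) by simp
        qed
        show "l + 1 \<le> m"
        proof (rule ccontr)
          assume "\<not> l + 1 \<le> m"
          then show False using mono[of m l] l(1) r'(2) by simp
        qed
      qed
      have "C \<subseteq> (\<lambda>t. Some (complex_of_real t)) ` {a l<..<a (l + 1)}"
        using connected_avoids_two[OF C(1) CR nA nA r(1) l] lm by simp
      then have "x \<in> (\<lambda>t. Some (complex_of_real t)) ` {a l<..<a (l + 1)}"
        "y \<in> (\<lambda>t. Some (complex_of_real t)) ` {a l<..<a (l + 1)}" using xy by blast+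
      then obtain s t where st: "x = Some (complex_of_real s)" "y = Some (complex_of_real t)"
        "a l < s" "s < a (l + 1)" "a l < t" "t < a (l + 1)" by auto
      have "a (l + 1) - a l \<le> 2 * \<eta>" using a(1)[of l] a(2)[of "l + 1"] by (simp add: algebra_simps)
      then have "\<bar>s - t\<bar> \<le> 2 * \<eta>" using st by linarith
      then show ?thesis using dist_Some_real_le[of s t] st(1,2) by (simp add: \<eta>_def)
    next
      case False
      have far: "dist z None \<le> e / 2" if z: "z \<in> C" for z
      proof (cases z)
        case (Some w)
        then obtain t where t: "z = Some (complex_of_real t)"
          using z CR by (auto simp: Rhat_def elim!: Reals_cases)
        then have "t < a (-m) \<or> t > a m" using False z by (meson not_le)
        then have "\<bar>t\<bar> \<ge> (of_int m - 1) * \<eta>"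
        proof
          assume "t < a (-m)"
          then have "t < - ((of_int m - 1) * \<eta>)" using a(2)[of "-m"] by (simp add: algebra_simps)
          then show ?thesis by linarith
        next
          assume "t > a m"
          then show ?thesis using a(1)[of m] \<eta> by (simp add: algebra_simps)
        qed
        then have t4: "\<bar>t\<bar> \<ge> 4 / e" using m by linarith
        then have t0: "t ~= 0" using e by auto
        have "dist z None \<le> 2 / \<bar>t\<bar>" unfolding t by (rule dist_Some_None_le[OF t0])
        also have "\<dots> \<le> 2 / (4 / e)" using t4 e by (intro divide_left_mono mult_pos_pos) auto
        finally show ?thesis using e by simp
      qed (use e in simp)
      show ?thesis using far[OF xy(1)] far[OF xy(2)] dist_triangle2[of x y None] by linarith
    qed
  qed
qed

section \<open>Growth of the number of real preimages\<close>

lemma funpow_preimage_card: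
  assumes "ratmap d F"
  shows "finite {z. (F ^^ n) z = a} \<and> card {z. (F ^^ n) z = a} \<le> d ^ n"
proof (induction n arbitrary: a)
  case 0
  then show ?case by simp
next
  case (Suc n)
  have eq: "{z. (F ^^ Suc n) z = a} = (\<Union>b\<in>{b. F b = a}. {z. (F ^^ n) z = b})" by auto
  note pre = preimage_finite_card[OF assms, of a]
  have "card (\<Union>b\<in>{b. F b = a}. {z. (F ^^ n) z = b}) \<le> (\<Sum>b\<in>{b. F b = a}. card {z. (F ^^ n) z = b})"
    using pre by (intro card_UN_le) simp
  also have "\<dots> \<le> (\<Sum>b\<in>{b. F b = a}. d ^ n)" using Suc by (intro sum_mono) simp
  also have "\<dots> = card {b. F b = a} * d ^ n" by simp
  also have "\<dots> \<le> d * d ^ n" using pre by (intro mult_right_mono) auto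
  finally show ?case unfolding eq using pre Suc by simp
qed

definition rpre :: "(sphere => sphere) => nat => sphere => sphere set" where
  "rpre F n a = {x\<in>Rhat. (F ^^ n) x = a}"

lemma rpre_finite: "ratmap d F ==> finite (rpre F n a)"
  using funpow_preimage_card[of d F n a] by (auto simp: rpre_def intro: finite_subset)

lemma rpre_card: "ratmap d F ==> card (rpre F n a) \<le> d ^ n"
  by (rule order_trans[OF card_mono]) (use funpow_preimage_card[of d F n a] in \<open>auto simp: rpre_def\<close>)

lemma rpre_add:
  assumes F: "ratmap d F" and inv: "\<And>z. z \<in> Rhat ==> F z \<in> Rhat"
    and B: "\<And>b. b \<in> rpre F m a ==> card (rpre F n b) \<le> B"
  shows "card (rpre F (m + n) a) \<le> card (rpre F m a) * B"
proof -
  have inv': "(F ^^ n) z \<in> Rhat" if "z \<in> Rhat" for z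
    using that inv by (induction n) auto
  have sub: "rpre F (m + n) a \<subseteq> (\<Union>b\<in>rpre F m a. rpre F n b)"
    using inv' by (auto simp: rpre_def funpow_add)
  have "card (rpre F (m + n) a) \<le> card (\<Union>b\<in>rpre F m a. rpre F n b)"
    using rpre_finite[OF F] by (intro card_mono sub) auto
  also have "\<dots> \<le> (\<Sum>b\<in>rpre F m a. card (rpre F n b))"
    by (intro card_UN_le rpre_finite[OF F])
  also have "\<dots> \<le> (\<Sum>b\<in>rpre F m a. B)" using B by (intro sum_mono)
  finally show ?thesis by simp
qed

text \<open>Real points all of whose preimages stay real: three of them would make the upper and the
  lower half-plane normal.\<close>

definition trapped :: "(sphere => sphere) => sphere set" where
  "trapped F = {a\<in>Rhat. \<forall>n z. (F ^^ n) z = a --> z \<in> Rhat}"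

lemma finite_trapped:
  assumes F: "ratmap d F" and J: "\<not> julia F \<subseteq> Rhat"
  shows "finite (trapped F)"
proof (rule ccontr)
  assume "infinite (trapped F)"
  then obtain a b c where abc: "a \<in> trapped F" "b \<in> trapped F" "c \<in> trapped F" "a ~= b" "b ~= c" "a ~= c"
    by (rule infinite_three)
  have "- Rhat \<subseteq> fatou F"
  proof (rule omit_three_fatou[OF F _ zero_less_one abc(4-6)])
    show "open (- Rhat)" by (rule open_Compl[OF closed_Rhat])
    fix k x assume "x \<in> - Rhat"
    then show "(F ^^ (1 * k)) x \<notin> {a, b, c}" using abc(1-3) unfolding trapped_def by blast
  qed
  then show False using J by (auto simp: julia_iff)
qed

lemma trapped_backward: "F z \<in> trapped F ==> z \<in> trapped F"
proof -
  assume A: "F z \<in> trapped F"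
  have n: "w \<in> Rhat" if "(F ^^ n) w = F z" for n w using A that unfolding trapped_def by blast
  have "z \<in> Rhat" using n[of 1 z] by simp
  moreover have "w \<in> Rhat" if "(F ^^ n) w = z" for n w using n[of "Suc n" w] that by simp
  ultimately show "z \<in> trapped F" by (simp add: trapped_def)
qed

text \<open>The trapped set \<open>E\<close> is superattracting with invariant neighbourhood
  \<open>U\<close>. Off \<open>U\<close>, compactness gives one order \<open>N\<close> at which
  every real point has a nonreal preimage, so that it has at most \<mu> = d^N - 1 real ones.
  Preimages of points outside \<open>U\<close> stay outside \<open>U\<close>, so the bound
  multiplies. For points of \<open>U\<close> off \<open>E\<close>, some further steps backwards lead
  out of \<open>U\<close>; their number depends on the point, and so does \<open>D\<close>.\<close>

lemma real_preimage_growth: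
  assumes F: "ratmap d F" "d \<ge> 2" and inv: "\<And>z. z \<in> Rhat ==> F z \<in> Rhat"
    and J: "\<not> julia F \<subseteq> Rhat"
  shows "\<exists>N \<mu>. N > 0 \<and> \<mu> \<ge> 1 \<and> \<mu> < d ^ N \<and>
    (\<forall>a\<in>Rhat - trapped F. \<exists>D. \<forall>n. card (rpre F n a) \<le> D * \<mu> ^ (n div N))"
proof -
  define E where "E = trapped F"
  have finE: "finite E" unfolding E_def by (rule finite_trapped[OF F(1) J])
  have bE: "z \<in> E" if "F z \<in> E" for z using that trapped_backward by (simp add: E_def)
  have fE: "F e \<in> E" if "e \<in> E" for e
    using finite_backward_invariant(1)[of d F E e] F(1) finE bE that by blast
  obtain \<delta> where \<delta>: "\<delta> > 0" "\<And>e w. e \<in> E ==> dist w e < \<delta> ==> dist (F w) (F e) \<le> 1/2 * dist w e"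
    using exceptional_attracting(1)[of d F E] F finE bE by blast
  define U where "U = (\<Union>e\<in>E. ball e \<delta>)"
  have att: "(F ^^ m) e \<in> E \<and> dist ((F ^^ m) w) ((F ^^ m) e) \<le> (1/2) ^ m * dist w e"
    if "e \<in> E" "dist w e < \<delta>" for e w m
  proof (induction m)
    case (Suc m)
    then have IH: "(F ^^ m) e \<in> E" "dist ((F ^^ m) w) ((F ^^ m) e) \<le> (1/2) ^ m * dist w e" by auto
    have "(1/2) ^ m * dist w e \<le> 1 * dist w e" by (intro mult_right_mono power_le_one) auto
    then have "dist ((F ^^ m) w) ((F ^^ m) e) < \<delta>" using IH(2) that(2) by linarith
    from \<delta>(2)[OF IH(1) this] IH(2) fE[OF IH(1)] show ?case by simp
  qed (use that in simp)
  have Uf: "F w \<in> U" if "w \<in> U" for w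
  proof -
    obtain e where e: "e \<in> E" "dist w e < \<delta>" using \<open>w \<in> U\<close> by (auto simp: U_def dist_commute)
    have "dist (F w) (F e) < \<delta>" using \<delta>(2)[OF e] e(2) zero_le_dist[of w e] by linarith
    then show ?thesis using fE[OF e(1)] by (auto simp: U_def dist_commute)
  qed
  have Uf': "(F ^^ m) w \<in> U" if "w \<in> U" for m w using that Uf by (induction m) auto
  define K where "K = Rhat - U"
  have "open U" unfolding U_def by (intro open_UN ballI open_ball)
  then have compK: "compact K" unfolding K_def Diff_eq by (intro compact_Int_closed compact_Rhat) auto
  have EU: "E \<subseteq> U" using \<delta>(1) by (auto simp: U_def)
  define Q where "Q = (\<lambda>n. (F ^^ n) ` (- Rhat))"
  have openO: "open (Q n)" for n
  proof (induction n)
    case 0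
    then show ?case using closed_Rhat by (simp add: Q_def open_Compl)
  next
    case (Suc n)
    have "Q (Suc n) = F ` Q n" by (simp add: Q_def image_image)
    then show ?case using ratmap_open_map[OF F(1) Suc] by simp
  qed
  \<comment> \<open>The real circle is mapped into itself, so preimages of nonreal points are
    nonreal and the open sets increase; a finite subcover then reduces to a single one.\<close>
  have Ostep: "Q n \<subseteq> Q (Suc n)" for n
  proof
    fix y assume "y \<in> Q n"
    then obtain x where x: "x \<notin> Rhat" "y = (F ^^ n) x" by (auto simp: Q_def)
    obtain x' where x': "F x' = x" using ratmap_surj[OF F(1)] by blast
    then have "x' \<notin> Rhat" using x(1) inv by blast
    then show "y \<in> Q (Suc n)" using x(2) x' unfolding Q_def by (intro image_eqI[of _ _ x']) (simp_all add: funpow_swap1)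
  qed
  have Omono: "Q n \<subseteq> Q m" if "n \<le> m" for n m
    using lift_Suc_mono_le[of Q, OF Ostep that] .
  have cov: "K \<subseteq> (\<Union>n\<in>UNIV. Q n)"
  proof
    fix a assume "a \<in> K"
    then have "a \<in> Rhat" "a \<notin> E" using EU by (auto simp: K_def)
    then obtain n z where "(F ^^ n) z = a" "z \<notin> Rhat" unfolding E_def trapped_def by blast
    then show "a \<in> (\<Union>n\<in>UNIV. Q n)" unfolding Q_def by blast
  qed
  obtain S where S: "finite S" "K \<subseteq> (\<Union>n\<in>S. Q n)"
    by (rule compactE_image[OF compK openO cov])
  define N where "N = Suc (Max (insert 0 S))"
  have KO: "K \<subseteq> Q N"
  proof
    fix a assume "a \<in> K"
    then obtain n where n: "n \<in> S" "a \<in> Q n" using S(2) by blast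
    have "n \<le> Max (insert 0 S)" using S(1) n(1) by (intro Max_ge) auto
    then show "a \<in> Q N" using Omono[of n N] n(2) by (auto simp: N_def)
  qed
  define \<mu> where "\<mu> = d ^ N - 1"
  have "d \<le> d ^ N" using F(2) by (intro self_le_power) (auto simp: N_def)
  then have \<mu>: "\<mu> \<ge> 1" "\<mu> < d ^ N" unfolding \<mu>_def using F(2) by linarith+
  have KN: "card (rpre F N a) \<le> \<mu>" if "a \<in> K" for a
  proof -
    obtain z where z: "z \<notin> Rhat" "(F ^^ N) z = a" using KO \<open>a \<in> K\<close> unfolding Q_def by blast
    have "rpre F N a \<subseteq> {z. (F ^^ N) z = a} - {z}" using z by (auto simp: rpre_def)
    then have "card (rpre F N a) \<le> card ({z. (F ^^ N) z = a} - {z})"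
      using funpow_preimage_card[OF F(1), of N a] by (intro card_mono) auto
    also have "\<dots> = card {z. (F ^^ N) z = a} - 1" using z by (subst card_Diff_singleton) auto
    also have "\<dots> \<le> \<mu>" unfolding \<mu>_def using funpow_preimage_card[OF F(1), of N a] by (intro diff_le_mono) simp
    finally show ?thesis .
  qed
  have Kback: "b \<in> K" if "a \<notin> U" "b \<in> rpre F m a" for a b m
    using that Uf'[of b m] by (auto simp: K_def rpre_def)
  have KN': "card (rpre F (N * j) a) \<le> \<mu> ^ j" if "a \<in> K" for a j
    using that
  proof (induction j arbitrary: a)
    case 0
    have "rpre F 0 a \<subseteq> {a}" by (auto simp: rpre_def)
    then have "card (rpre F 0 a) \<le> card {a}" by (intro card_mono) auto
    then show ?case by simp
  next
    case (Suc j)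
    have "card (rpre F (N + N * j) a) \<le> card (rpre F N a) * \<mu> ^ j"
      using Suc.prems Kback[of a] by (intro rpre_add[OF F(1) inv] Suc.IH) (auto simp: K_def)
    also have "\<dots> \<le> \<mu> * \<mu> ^ j" using KN[OF Suc.prems] by (intro mult_right_mono) auto
    finally show ?case by simp
  qed
  have Kn: "card (rpre F n a) \<le> d ^ N * \<mu> ^ (n div N)" if "a \<in> K" for a n
  proof -
    \<comment> \<open>The remaining n mod N steps cost only the constant factor d^N.\<close>
    have "card (rpre F (N * (n div N) + n mod N) a) \<le> card (rpre F (N * (n div N)) a) * d ^ N"
    proof (rule rpre_add[OF F(1) inv])
      fix b
      have "card (rpre F (n mod N) b) \<le> d ^ (n mod N)" by (rule rpre_card[OF F(1)])
      also have "\<dots> \<le> d ^ N" using F(2) by (intro power_increasing) (auto simp: N_def less_imp_le)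
      finally show "card (rpre F (n mod N) b) \<le> d ^ N" .
    qed
    also have "\<dots> \<le> \<mu> ^ (n div N) * d ^ N" using KN'[OF that] by (intro mult_right_mono) auto
    finally show ?thesis by (simp add: mult.commute)
  qed
  have "\<exists>D. \<forall>n. card (rpre F n a) \<le> D * \<mu> ^ (n div N)" if a: "a \<in> Rhat - E" for a
  proof -
    \<comment> \<open>Forward orbits in \<open>U\<close> approach \<open>E\<close> at the rate
      2^(-m). A preimage of order \<open>m\<close> of \<open>a\<close> can therefore not lie in
      \<open>U\<close> once 2^(-m) \<delta> is below the distance from \<open>a\<close> to
      \<open>E\<close>.\<close>
    have "\<exists>m. \<forall>b. b \<in> rpre F m a --> b \<notin> U"
    proof (cases "E = {}")
      case False
      have "closed E" using finE by (rule finite_imp_closed)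
      then have \<eta>: "infdist a E > 0" using a False by (intro infdist_pos_not_in_closed) auto
      obtain m where m: "(1/2) ^ m * \<delta> < infdist a E"
        using real_arch_pow_inv[of "infdist a E / \<delta>" "1/2"] \<eta> \<delta>(1) by (auto simp: field_simps)
      have "b \<notin> U" if b: "b \<in> rpre F m a" for b
      proof
        assume "b \<in> U"
        then obtain e where e: "e \<in> E" "dist b e < \<delta>" by (auto simp: U_def dist_commute)
        have "infdist a E \<le> dist ((F ^^ m) b) ((F ^^ m) e)"
          using att[OF e, of m] b by (auto simp: rpre_def intro: infdist_le)
        also have "\<dots> \<le> (1/2) ^ m * dist b e" using att[OF e] by blast
        also have "\<dots> \<le> (1/2) ^ m * \<delta>" using e(2) by (intro mult_left_mono) auto
        finally show False using m by simp
      qed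
      then show ?thesis by blast
    qed (simp add: U_def)
    then obtain m where m: "\<And>b. b \<in> rpre F m a ==> b \<notin> U" by blast
    have "card (rpre F n a) \<le> d ^ (m + N) * \<mu> ^ (n div N)" for n
    proof (cases "m \<le> n")
      case True
      have "card (rpre F (m + (n - m)) a) \<le> card (rpre F m a) * (d ^ N * \<mu> ^ ((n - m) div N))"
      proof (rule rpre_add[OF F(1) inv])
        fix b assume "b \<in> rpre F m a"
        then have "b \<in> K" using m by (auto simp: K_def rpre_def)
        then show "card (rpre F (n - m) b) \<le> d ^ N * \<mu> ^ ((n - m) div N)" by (rule Kn)
      qed
      also have "\<dots> \<le> d ^ m * (d ^ N * \<mu> ^ (n div N))"
        using \<mu>(1) F(2) by (intro mult_mono rpre_card[OF F(1)] power_increasing div_le_mono) auto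
      finally show ?thesis using True by (simp add: power_add mult.assoc)
    next
      case False
      have "card (rpre F n a) \<le> d ^ n" by (rule rpre_card[OF F(1)])
      also have "\<dots> \<le> d ^ (m + N)" using F(2) False by (intro power_increasing) auto
      also have "\<dots> \<le> d ^ (m + N) * \<mu> ^ (n div N)" using \<mu>(1) by simp
      finally show ?thesis .
    qed
    then show ?thesis by blast
  qed
  then show ?thesis
    using \<mu> unfolding E_def by (intro exI[of _ N] exI[of _ \<mu>]) (auto simp: N_def)
qed

section \<open>From preimage counts to entropy\<close>

lemma htop_le_of_sep_num:
  assumes N: "N > 0" and \<mu>: "\<mu> \<ge> 1"
    and sep: "\<And>e. e > 0 ==> \<exists>D. \<forall>n>0. sep_num F X n e \<le> D * n * \<mu> ^ (n div N)"
  shows "htop F X \<le> ereal (ln (real \<mu>) / real N)"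
  unfolding htop_def
proof (rule SUP_least)
  fix e :: real assume "e \<in> {0<..}"
  then obtain D0 where D0: "\<And>n. n > 0 ==> sep_num F X n e \<le> D0 * n * \<mu> ^ (n div N)"
    using sep by auto
  \<comment> \<open>The successor keeps the constant positive, so that its logarithm can be split
    off.\<close>
  define D where "D = Suc D0"
  define g where "g = (\<lambda>n. ln (real D) / real n + ln (real n) / real n + ln (real \<mu>) / real N)"
  have "g \<longlonglongrightarrow> 0 + 0 + ln (real \<mu>) / real N"
    unfolding g_def by (intro tendsto_intros lim_const_over_n lim_ln_over_n)
  then have lim: "(\<lambda>n. ereal (g n)) \<longlonglongrightarrow> ereal (ln (real \<mu>) / real N)" by simp
  have "ln (real (sep_num F X n e)) / real n \<le> g n" if n: "n > 0" for n
  proof -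
    let ?s = "sep_num F X n e"
    have "?s \<le> D0 * n * \<mu> ^ (n div N)" by (rule D0[OF n])
    also have "\<dots> \<le> D * n * \<mu> ^ (n div N)" by (simp add: D_def)
    finally have s: "real ?s \<le> real D * real n * real \<mu> ^ (n div N)"
      by (metis of_nat_le_iff of_nat_mult of_nat_power)
    have pos: "real D * real n * real \<mu> ^ (n div N) \<ge> 1"
    proof -
      have "1 \<le> D * n * \<mu> ^ (n div N)" using n \<mu> by (simp add: D_def Suc_le_eq)
      then show ?thesis by (metis of_nat_1 of_nat_le_iff of_nat_mult of_nat_power)
    qed
    \<comment> \<open>For \<open>?s = 0\<close> the convention ln 0 = 0 applies, and the right side
      is nonnegative by \<open>pos\<close>.\<close>
    have "ln (real ?s) \<le> ln (real D * real n * real \<mu> ^ (n div N))"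
    proof (cases "?s = 0")
      case False
      then show ?thesis using s by (intro ln_mono) auto
    qed (use pos in simp)
    also have "\<dots> = ln (real D) + ln (real n) + real (n div N) * ln (real \<mu>)"
      using n \<mu> by (simp add: ln_mult ln_realpow D_def)
    also have "\<dots> \<le> ln (real D) + ln (real n) + (real n / real N) * ln (real \<mu>)"
      using \<mu> by (intro add_left_mono mult_right_mono of_nat_div_le_of_nat) auto
    finally have "ln (real ?s) \<le> ln (real D) + ln (real n) + (real n / real N) * ln (real \<mu>)" .
    then have "ln (real ?s) / real n \<le> (ln (real D) + ln (real n) + (real n / real N) * ln (real \<mu>)) / real n"
      by (rule divide_right_mono) simp
    also have "\<dots> = g n" using n by (simp add: g_def add_divide_distrib)
    finally show ?thesis .
  qed
  then have "\<forall>\<^sub>F n in sequentially. ereal (ln (real (sep_num F X n e)) / real n) \<le> ereal (g n)"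
    unfolding eventually_sequentially by (intro exI[of _ 1]) auto
  then have "limsup (\<lambda>n. ereal (ln (real (sep_num F X n e)) / real n)) \<le> limsup (\<lambda>n. ereal (g n))"
    by (rule Limsup_mono)
  also have "\<dots> = ereal (ln (real \<mu>) / real N)"
    using lim by (intro lim_imp_Limsup) auto
  finally show "limsup (\<lambda>n. ereal (ln (real (sep_num F X n e)) / real n)) \<le> ereal (ln (real \<mu>) / real N)" .
qed

text \<open>The finitely many partition points are taken off the trapped set, so at each order below
  \<open>n\<close> they have at most a constant times \<mu>^(n div N) real preimages. The entropy is
  then at most ln \<mu> / N, and this is below ln d because \<mu> < d^N.\<close>

theorem julia_real_of_max_entropy:
  assumes F: "rrat d F" "d \<ge> 2" and h: "htop F Rhat = ereal (ln (real d))"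
  shows "julia F \<subseteq> Rhat"
proof (rule ccontr)
  assume J: "\<not> julia F \<subseteq> Rhat"
  note R = rrat_ratmap[OF F(1)]
  have inv: "F z \<in> Rhat" if "z \<in> Rhat" for z using rrat_Rhat[OF F(1) that] .
  obtain N \<mu> where N: "N > 0" "\<mu> \<ge> 1" "\<mu> < d ^ N"
    "\<forall>a\<in>Rhat - trapped F. \<exists>D. \<forall>n. card (rpre F n a) \<le> D * \<mu> ^ (n div N)"
    using real_preimage_growth[OF R F(2) inv J] by auto
  have cont: "isCont F x" for x by (rule ratmap_isCont[OF R])
  have "htop F Rhat \<le> ereal (ln (real \<mu>) / real N)"
  proof (rule htop_le_of_sep_num[OF N(1,2)])
    fix e :: real assume e: "e > 0"
    obtain A where A: "finite A" "A \<subseteq> Rhat - trapped F"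
      "\<And>C x y. connected C ==> C \<subseteq> Rhat - A ==> x \<in> C ==> y \<in> C ==> dist x y \<le> e"
      using fine_partition[OF e finite_trapped[OF R J]] by blast
    have "\<forall>a\<in>A. \<exists>D. \<forall>n. card (rpre F n a) \<le> D * \<mu> ^ (n div N)" using N(4) A(2) by blast
    then obtain D where D: "\<And>a n. a \<in> A ==> card (rpre F n a) \<le> D a * \<mu> ^ (n div N)" by metis
    define DA where "DA = (\<Sum>a\<in>A. D a)"
    have op: "orbit_preimages F A n = (\<Union>k<n. \<Union>a\<in>A. rpre F k a)" for n
      by (simp add: orbit_preimages_def rpre_def)
    have fin: "finite (orbit_preimages F A n)" for n
      unfolding op using A(1) rpre_finite[OF R] by blast
    have card: "card (orbit_preimages F A n) \<le> n * (DA * \<mu> ^ (n div N))" for n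
    proof -
      have "card (orbit_preimages F A n) \<le> (\<Sum>k<n. card (\<Union>a\<in>A. rpre F k a))"
        unfolding op by (intro card_UN_le) simp
      also have "\<dots> \<le> (\<Sum>k<n. DA * \<mu> ^ (n div N))"
      proof (rule sum_mono)
        fix k assume k: "k \<in> {..<n}"
        have "card (\<Union>a\<in>A. rpre F k a) \<le> (\<Sum>a\<in>A. card (rpre F k a))"
          by (intro card_UN_le A)
        also have "\<dots> \<le> (\<Sum>a\<in>A. D a * \<mu> ^ (n div N))"
        proof (rule sum_mono)
          fix a assume "a \<in> A"
          then have "card (rpre F k a) \<le> D a * \<mu> ^ (k div N)" by (rule D)
          also have "\<dots> \<le> D a * \<mu> ^ (n div N)"
            using k N(2) by (intro mult_left_mono power_increasing div_le_mono) auto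
          finally show "card (rpre F k a) \<le> D a * \<mu> ^ (n div N)" .
        qed
        finally show "card (\<Union>a\<in>A. rpre F k a) \<le> DA * \<mu> ^ (n div N)"
          by (simp add: DA_def sum_distrib_right)
      qed
      finally show ?thesis by simp
    qed
    have "sep_num F Rhat n e \<le> (2 * DA + 2) * n * \<mu> ^ (n div N)" if n: "n > 0" for n
      unfolding sep_num_def
    proof (rule cSup_least)
      have "separated F Rhat n e {}" by (simp add: separated_def)
      then show "{card E |E. finite E \<and> separated F Rhat n e E} ~= {}" by blast
      fix s assume "s \<in> {card E |E. finite E \<and> separated F Rhat n e E}"
      then obtain S where S: "s = card S" "finite S" "separated F Rhat n e S" by blast
      have n1: "1 \<le> n * \<mu> ^ (n div N)" using n N(2) by (simp add: Suc_le_eq)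
      have "s \<le> 2 * card (orbit_preimages F A n) + 2"
        unfolding S(1) by (rule separated_card_le[OF cont A(3) inv fin S(2,3)])
      also have "\<dots> \<le> 2 * (n * (DA * \<mu> ^ (n div N))) + 2" using card[of n] by simp
      also have "\<dots> \<le> 2 * (n * (DA * \<mu> ^ (n div N))) + 2 * (n * \<mu> ^ (n div N))"
        using n1 by linarith
      also have "\<dots> = (2 * DA + 2) * n * \<mu> ^ (n div N)" by (simp add: algebra_simps)
      finally show "s \<le> (2 * DA + 2) * n * \<mu> ^ (n div N)" .
    qed
    then show "\<exists>D. \<forall>n>0. sep_num F Rhat n e \<le> D * n * \<mu> ^ (n div N)" by blast
  qed
  moreover have "ln (real \<mu>) < real N * ln (real d)"
  proof -
    have "ln (real \<mu>) < ln (real (d ^ N))" using N(2,3) F(2) by (subst ln_less_cancel_iff) auto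
    then show ?thesis using F(2) by (simp add: ln_realpow)
  qed
  then have "ln (real \<mu>) / real N < ln (real d)" using N(1) by (simp add: field_simps)
  ultimately show False using h by simp
qed

text \<open>Total disconnectedness is the contrapositive of \<open>julia_connected_on_arc\<close>: a
  nondegenerate connected piece would make the whole Julia set connected.\<close>

theorem max_entropy_trichotomy:
  assumes F: "rrat d F" "d \<ge> 2" and h: "htop F Rhat = ereal (ln (real d))"
  shows "julia F \<subseteq> Rhat \<and> (julia F = Rhat \<or> (sconnected (julia F) \<and> julia F ~= Rhat) \<or> scantor (julia F))"
proof -
  note R = rrat_ratmap[OF F(1)]
  have J: "julia F \<subseteq> Rhat" by (rule julia_real_of_max_entropy[OF assms])
  have "scantor (julia F)" if ne: "julia F ~= Rhat" and nc: "\<not> connected (julia F)"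
    unfolding scantor_iff cantor_set_def
  proof (intro conjI allI impI ballI compact_julia julia_nonempty[OF R F(2)])
    fix x assume "x \<in> julia F"
    then show "x islimpt julia F" by (rule julia_perfect[OF R F(2)])
  next
    fix C assume C: "C \<subseteq> julia F" "connected C"
    show "\<exists>a. C \<subseteq> {a}"
    proof (rule ccontr)
      assume "\<not> ?thesis"
      then obtain a b where "a \<in> C" "b \<in> C" "a ~= b" by blast
      then show False
        using julia_connected_on_arc[OF R F(2) arclike_Rhat J ne C] nc by blast
    qed
  qed
  then show ?thesis using J by (auto simp: sconnected_iff_connected)
qed

section \<open>Blaschke products\<close>

definition bfac :: "complex => complex => complex" where
  "bfac a z = (z - a) / (1 - cnj a * z)"

definition bprod :: "complex => (nat => complex) => nat => complex => complex" where
  "bprod s a d z = s * (\<Prod>i<d. bfac (a i) z)"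

lemma bfac_identity:
  "(cmod (1 - cnj a * z))\<^sup>2 - (cmod (z - a))\<^sup>2 = (1 - (cmod a)\<^sup>2) * (1 - (cmod z)\<^sup>2)"
  unfolding cmod_power2 by (simp add: algebra_simps power2_eq_square)

lemma bfac_denom_nonzero: "cmod a < 1 ==> cmod z \<le> 1 ==> 1 - cnj a * z ~= 0"
proof
  assume A: "cmod a < 1" "cmod z \<le> 1" "1 - cnj a * z = 0"
  then have "cmod (cnj a * z) = 1" by simp
  moreover have "cmod (cnj a * z) \<le> cmod a * 1"
    unfolding norm_mult using A by (intro mult_mono) auto
  ultimately show False using A by simp
qed

lemma one_minus_sq_bfac:
  assumes "cmod a < 1" "cmod z \<le> 1"
  shows "1 - (cmod (bfac a z))\<^sup>2 = (1 - (cmod a)\<^sup>2) * (1 - (cmod z)\<^sup>2) / (cmod (1 - cnj a * z))\<^sup>2"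
proof -
  have "(cmod (1 - cnj a * z))\<^sup>2 ~= 0" using bfac_denom_nonzero[OF assms] by simp
  then show ?thesis
    unfolding bfac_identity[symmetric] bfac_def norm_divide power_divide by (simp add: diff_divide_distrib)
qed

lemma sq_less_1: "cmod a < 1 ==> (cmod a)\<^sup>2 < 1"
  by (simp add: abs_square_less_1)

lemma cmod_bfac_less_1: "cmod a < 1 ==> cmod z < 1 ==> cmod (bfac a z) < 1"
proof -
  assume A: "cmod a < 1" "cmod z < 1"
  have "(1 - (cmod a)\<^sup>2) * (1 - (cmod z)\<^sup>2) / (cmod (1 - cnj a * z))\<^sup>2 > 0"
    using sq_less_1[OF A(1)] sq_less_1[OF A(2)] bfac_denom_nonzero[of a z] A by (intro divide_pos_pos mult_pos_pos) auto
  then have "(cmod (bfac a z))\<^sup>2 < 1" using one_minus_sq_bfac[of a z] A by linarith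
  then show ?thesis by (simp add: abs_square_less_1)
qed

lemma cmod_bfac_eq_1: "cmod a < 1 ==> cmod z = 1 ==> cmod (bfac a z) = 1"
proof -
  assume A: "cmod a < 1" "cmod z = 1"
  then have "(cmod (bfac a z))\<^sup>2 = 1" using one_minus_sq_bfac[of a z] by simp
  then show ?thesis by (simp add: power2_eq_1_iff) (metis norm_ge_zero neg_0_le_iff_le not_one_le_zero)
qed

lemma cmod_denom_circle: "cmod w = 1 ==> cmod (1 - cnj a * w) = cmod (w - a)"
proof -
  assume "cmod w = 1"
  then have "(cmod (1 - cnj a * w))\<^sup>2 = (cmod (w - a))\<^sup>2" using bfac_identity[of a w] by simp
  then show ?thesis by (simp add: power2_eq_iff_nonneg)
qed

lemma prod_cmod_less_1:
  fixes n :: nat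
  assumes "\<And>i. i < n ==> cmod (f i) < 1" "n > 0"
  shows "cmod (\<Prod>i<n. f i) < 1"
  using assms
proof (induction n)
  case (Suc n)
  show ?case
  proof (cases "n = 0")
    case True
    then show ?thesis using Suc.prems by simp
  next
    case False
    then have "cmod (\<Prod>i<n. f i) < 1" using Suc by simp
    then have "cmod (\<Prod>i<n. f i) * cmod (f n) < 1 * 1"
      using Suc.prems(1)[of n] by (intro mult_strict_mono') auto
    then show ?thesis by (simp add: norm_mult)
  qed
qed simp

lemma cmod_bprod_less_1:
  assumes "cmod s = 1" "\<And>i. i < d ==> cmod (a i) < 1" "d > 0" "cmod z < 1"
  shows "cmod (bprod s a d z) < 1"
proof -
  have "cmod (\<Prod>i<d. bfac (a i) z) < 1"
    using assms by (intro prod_cmod_less_1 cmod_bfac_less_1) auto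
  then show ?thesis using assms(1) by (simp add: bprod_def norm_mult)
qed

lemma cmod_bprod_eq_1:
  assumes "cmod s = 1" "\<And>i. i < d ==> cmod (a i) < 1" "cmod z = 1"
  shows "cmod (bprod s a d z) = 1"
  using assms by (simp add: bprod_def norm_mult prod_norm[symmetric] cmod_bfac_eq_1)

lemma continuous_on_bprod:
  assumes "\<And>i. i < d ==> cmod (a i) < 1"
  shows "continuous_on (cball 0 1) (bprod s a d)"
  unfolding bprod_def bfac_def
  using assms bfac_denom_nonzero by (intro continuous_intros) (simp add: dist_norm)

text \<open>The sum in (i). On the unit circle it is the modulus of the derivative of the Blaschke
  product, each summand being the Poisson kernel of one zero.\<close>

definition blam :: "(nat => complex) => nat => complex => real" where
  "blam a d w = (\<Sum>i<d. (1 - (cmod (a i))\<^sup>2) / (cmod (w - a i))\<^sup>2)"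

lemma blam_pos:
  assumes "\<And>i. i < d ==> cmod (a i) < 1" "d > 0" "cmod w = 1"
  shows "blam a d w > 0"
  unfolding blam_def
proof (rule sum_pos)
  fix i assume "i \<in> {..<d}"
  then have "cmod (a i) < 1" using assms by simp
  moreover from this have "w ~= a i" using assms(3) by auto
  ultimately show "(1 - (cmod (a i))\<^sup>2) / (cmod (w - a i))\<^sup>2 > 0"
    using sq_less_1[of "a i"] by (intro divide_pos_pos) auto
qed (use assms in auto)

text \<open>Logarithmic derivatives add up over the factors. On the circle 1 - cnj a * w = w * cnj
  (w - a), which turns the contribution of one factor to w B'(w) / B(w) into its Poisson
  kernel.\<close>

lemma bprod_derivative_circle:
  assumes "\<And>i. i < d ==> cmod (a i) < 1" "cmod w = 1"
  shows "(bprod s a d has_field_derivative bprod s a d w * of_real (blam a d w) / w) (at w)"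
  using assms(1)
proof (induction d)
  case 0
  have "bprod s a 0 = (\<lambda>z. s)" by (simp add: bprod_def fun_eq_iff)
  then show ?case by (simp add: blam_def)
next
  case (Suc d)
  let ?a = "a d"
  have IH: "(bprod s a d has_field_derivative bprod s a d w * of_real (blam a d w) / w) (at w)"
    using Suc by simp
  have a: "cmod ?a < 1" using Suc.prems by simp
  have w0: "w ~= 0" using assms(2) by auto
  have den: "1 - cnj ?a * w ~= 0" using bfac_denom_nonzero[OF a] assms(2) by simp
  have ww: "w * cnj w = 1" using assms(2) by (simp add: complex_norm_square[symmetric])
  have dw: "1 - cnj ?a * w = w * cnj (w - ?a)" using ww by (simp add: algebra_simps)
  have wa: "w ~= ?a" using a assms(2) by auto
  define l where "l = (1 - (cmod ?a)\<^sup>2) / (cmod (w - ?a))\<^sup>2"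
  have "(bfac ?a has_field_derivative (1 * (1 - cnj ?a * w) - (w - ?a) * (- cnj ?a)) / ((1 - cnj ?a * w) * (1 - cnj ?a * w))) (at w)"
    unfolding bfac_def using den by (auto intro!: derivative_eq_intros)
  moreover have "(1 * (1 - cnj ?a * w) - (w - ?a) * (- cnj ?a)) / ((1 - cnj ?a * w) * (1 - cnj ?a * w)) = bfac ?a w * of_real l / w"
  proof -
    have num: "1 * (1 - cnj ?a * w) - (w - ?a) * (- cnj ?a) = of_real (1 - (cmod ?a)\<^sup>2)"
      by (simp add: algebra_simps complex_norm_square[symmetric] del: of_real_power)
    have l: "of_real l = of_real (1 - (cmod ?a)\<^sup>2) / ((w - ?a) * cnj (w - ?a))"
      unfolding l_def of_real_divide complex_norm_square[symmetric] ..
    have *: "R / ((w * c) * (w * c)) = (u / (w * c)) * (R / (u * c)) / w" if "u ~= 0" "c ~= 0" for R u c :: complex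
      using that w0 by (simp add: field_simps)
    have "w - ?a ~= 0" "cnj (w - ?a) ~= 0" using wa by auto
    then show ?thesis
      unfolding num unfolding l bfac_def unfolding dw by (rule *)
  qed
  ultimately have D: "(bfac ?a has_field_derivative bfac ?a w * of_real l / w) (at w)" by simp
  have eq: "bprod s a (Suc d) = (\<lambda>z. bprod s a d z * bfac ?a z)"
    by (simp add: bprod_def fun_eq_iff mult.assoc)
  have "((\<lambda>z. bprod s a d z * bfac ?a z) has_field_derivative
      bprod s a d w * of_real (blam a d w) / w * bfac ?a w + bfac ?a w * of_real l / w * bprod s a d w) (at w)"
    by (rule DERIV_mult[OF IH D])
  moreover have "blam a (Suc d) w = blam a d w + l" by (simp add: blam_def l_def)
  ultimately show ?case
    unfolding eq by (simp add: algebra_simps add_divide_distrib)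
qed

text \<open>The horocyclic function at a boundary point \<open>w\<close> (reciprocal of the Poisson kernel).\<close>
definition horo :: "complex => complex => real" where
  "horo w z = (cmod (w - z))\<^sup>2 / (1 - (cmod z)\<^sup>2)"

lemma horo_pos: "cmod w = 1 ==> cmod z < 1 ==> horo w z > 0"
proof -
  assume A: "cmod w = 1" "cmod z < 1"
  then have "w ~= z" by auto
  then show ?thesis unfolding horo_def using sq_less_1[OF A(2)] by (intro divide_pos_pos) auto
qed

text \<open>Cauchy-Schwarz in Engel form: the difference of the two sides is (x B - y A)^2 / (A B (A
  + B)), so the inequality is strict unless the pairs are proportional.\<close>

lemma titu_strict:
  fixes x y A B :: real
  assumes "A > 0" "B > 0" "x * B ~= y * A"
  shows "(x + y)\<^sup>2 / (A + B) < x\<^sup>2 / A + y\<^sup>2 / B"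
proof -
  have "x\<^sup>2 / A + y\<^sup>2 / B - (x + y)\<^sup>2 / (A + B) = (x * B - y * A)\<^sup>2 / (A * B * (A + B))"
    using assms(1,2) by (simp add: divide_simps) (simp add: algebra_simps power2_eq_square)
  moreover have "(x * B - y * A)\<^sup>2 / (A * B * (A + B)) > 0"
    using assms by (intro divide_pos_pos mult_pos_pos) auto
  ultimately show ?thesis by linarith
qed

text \<open>The splittings 1 - u v = (1 - u) + u (1 - v) of the numerator and 1 - |u v|^2 = (1 -
  |u|^2) + |u|^2 (1 - |v|^2) of the denominator reduce this to \<open>titu_strict\<close>, whose
  case of equality is excluded by \<open>ne\<close>.\<close>

lemma horo_mult_aux:
  assumes u: "cmod u < 1" "u ~= 0" and v: "cmod v < 1"
    and ne: "cmod (1 - u) * ((cmod u)\<^sup>2 * (1 - (cmod v)\<^sup>2)) ~= cmod u * cmod (1 - v) * (1 - (cmod u)\<^sup>2)"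
  shows "horo 1 (u * v) < horo 1 u + horo 1 v"
proof -
  define x y A B where "x = cmod (1 - u)" "y = cmod u * cmod (1 - v)"
    "A = 1 - (cmod u)\<^sup>2" "B = (cmod u)\<^sup>2 * (1 - (cmod v)\<^sup>2)"
  have pos: "A > 0" "B > 0" using sq_less_1[OF u(1)] sq_less_1[OF v] u(2) by (auto simp: x_y_A_B_def)
  have "cmod (1 - u * v) \<le> x + y"
  proof -
    have "1 - u * v = (1 - u) + u * (1 - v)" by (simp add: algebra_simps)
    then show ?thesis unfolding x_y_A_B_def norm_mult[symmetric] by (metis norm_triangle_ineq)
  qed
  then have "(cmod (1 - u * v))\<^sup>2 \<le> (x + y)\<^sup>2" by (intro power_mono) auto
  moreover have "1 - (cmod (u * v))\<^sup>2 = A + B"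
    by (simp add: x_y_A_B_def norm_mult power_mult_distrib algebra_simps)
  ultimately have "horo 1 (u * v) \<le> (x + y)\<^sup>2 / (A + B)"
    unfolding horo_def using pos by (simp add: divide_right_mono)
  also have "\<dots> < x\<^sup>2 / A + y\<^sup>2 / B" using ne by (intro titu_strict pos) (simp add: x_y_A_B_def)
  also have "x\<^sup>2 / A = horo 1 u" by (simp add: horo_def x_y_A_B_def)
  also have "y\<^sup>2 / B = horo 1 v" using u(2) by (simp add: horo_def x_y_A_B_def power_mult_distrib)
  finally show ?thesis .
qed

text \<open>The splitting of \<open>horo_mult_aux\<close> can start with either factor. Equality in
  both versions would combine to |u| |v| = 1, which is impossible in the disk; a zero factor is
  immediate since \<open>horo 1 0\<close> is 1.\<close>

lemma horo_mult_less:
  assumes u: "cmod u < 1" and v: "cmod v < 1"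
  shows "horo 1 (u * v) < horo 1 u + horo 1 v"
proof -
  have pos: "horo 1 u > 0" "horo 1 v > 0" using horo_pos[of 1] u v by simp_all
  consider "u = 0" | "v = 0" | "u ~= 0" "v ~= 0" by blast
  then show ?thesis
  proof cases
    case 3
    define x y A B where "x = cmod (1 - u)" "y = cmod (1 - v)" "A = 1 - (cmod u)\<^sup>2" "B = 1 - (cmod v)\<^sup>2"
    have p: "A > 0" "B > 0" "x > 0" "y > 0"
      using sq_less_1[OF u] sq_less_1[OF v] u v by (auto simp: x_y_A_B_def)
    have nn: "cmod u > 0" "cmod v > 0" using 3 by auto
    show ?thesis
    proof (rule ccontr)
      assume neg: "\<not> ?thesis"
      have "x * ((cmod u)\<^sup>2 * B) = cmod u * y * A"
        using horo_mult_aux[OF u 3(1) v] neg unfolding x_y_A_B_def by blast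
      then have 1: "x * (cmod u * B) = y * A"
        using nn by (simp add: power2_eq_square algebra_simps)
      have "horo 1 (v * u) < horo 1 v + horo 1 u \<longleftrightarrow> horo 1 (u * v) < horo 1 u + horo 1 v"
        by (simp add: mult.commute add.commute)
      then have "y * ((cmod v)\<^sup>2 * A) = cmod v * x * B"
        using horo_mult_aux[OF v 3(2) u] neg unfolding x_y_A_B_def by blast
      then have 2: "y * (cmod v * A) = x * B"
        using nn by (simp add: power2_eq_square algebra_simps)
      have "x * B = cmod v * (y * A)" using 2 by (simp add: algebra_simps)
      also have "\<dots> = cmod v * (x * (cmod u * B))" using 1 by simp
      also have "\<dots> = (cmod u * cmod v) * (x * B)" by (simp add: algebra_simps)
      finally have "(1 - cmod u * cmod v) * (x * B) = 0" by (simp add: algebra_simps)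
      then have "cmod u * cmod v = 1" using p by simp
      moreover have "cmod u * cmod v < 1 * 1" using u v by (intro mult_strict_mono') auto
      ultimately show False by simp
    qed
  qed (use pos in \<open>simp_all add: horo_def\<close>)
qed

text \<open>Strictness requires at least two factors; this is where a degree above 1 matters at a
  boundary point with multiplier of modulus 1.\<close>

lemma horo_prod_le:
  fixes f :: "nat => complex"
  assumes "\<And>k. k \<le> n ==> cmod (f k) < 1"
  shows "horo 1 (\<Prod>k<Suc n. f k) \<le> (\<Sum>k<Suc n. horo 1 (f k))"
    and "n > 0 ==> horo 1 (\<Prod>k<Suc n. f k) < (\<Sum>k<Suc n. horo 1 (f k))"
proof -
  have "horo 1 (\<Prod>k<Suc n. f k) \<le> (\<Sum>k<Suc n. horo 1 (f k)) \<and>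
    (n > 0 --> horo 1 (\<Prod>k<Suc n. f k) < (\<Sum>k<Suc n. horo 1 (f k)))"
    using assms
  proof (induction n)
    case (Suc n)
    have "cmod (\<Prod>k<Suc n. f k) < 1" using Suc.prems by (intro prod_cmod_less_1) auto
    then have "horo 1 ((\<Prod>k<Suc n. f k) * f (Suc n)) < horo 1 (\<Prod>k<Suc n. f k) + horo 1 (f (Suc n))"
      using Suc.prems by (intro horo_mult_less) auto
    moreover have "horo 1 (\<Prod>k<Suc n. f k) \<le> (\<Sum>k<Suc n. horo 1 (f k))" using Suc by simp
    ultimately show ?case by simp
  qed simp
  then show "horo 1 (\<Prod>k<Suc n. f k) \<le> (\<Sum>k<Suc n. horo 1 (f k))"
    "n > 0 ==> horo 1 (\<Prod>k<Suc n. f k) < (\<Sum>k<Suc n. horo 1 (f k))" by auto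
qed

text \<open>For a single factor Julia's lemma is an equality: a disk automorphism multiplies the
  horocyclic function by the modulus of its boundary derivative. Division by \<open>bfac a w\<close>
  moves the image of \<open>w\<close> to 1.\<close>

lemma horo_bfac:
  assumes a: "cmod a < 1" and w: "cmod w = 1" and z: "cmod z < 1"
  shows "horo 1 (bfac a z / bfac a w) = (1 - (cmod a)\<^sup>2) / (cmod (w - a))\<^sup>2 * horo w z"
proof -
  have fw: "cmod (bfac a w) = 1" by (rule cmod_bfac_eq_1[OF a w])
  then have fw0: "bfac a w ~= 0" by auto
  have dw: "1 - cnj a * w ~= 0" and dz: "1 - cnj a * z ~= 0"
    using bfac_denom_nonzero[OF a] w z by auto
  have "cmod (1 - bfac a z / bfac a w) = cmod (bfac a w - bfac a z)"
  proof -
    have "1 - bfac a z / bfac a w = (bfac a w - bfac a z) / bfac a w" using fw0 by (simp add: field_simps)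
    then show ?thesis using fw by (simp add: norm_divide)
  qed
  also have "bfac a w - bfac a z = of_real (1 - (cmod a)\<^sup>2) * (w - z) / ((1 - cnj a * w) * (1 - cnj a * z))"
  proof -
    have e: "complex_of_real (1 - (cmod a)\<^sup>2) = 1 - a * cnj a"
      using complex_norm_square[of a] by simp
    show ?thesis unfolding e bfac_def using dw dz by (simp add: divide_simps) (simp add: algebra_simps)
  qed
  finally have n: "cmod (1 - bfac a z / bfac a w) =
      (1 - (cmod a)\<^sup>2) * cmod (w - z) / (cmod (w - a) * cmod (1 - cnj a * z))"
    using sq_less_1[OF a] unfolding norm_divide norm_mult norm_of_real cmod_denom_circle[OF w] by simp
  have m: "1 - (cmod (bfac a z / bfac a w))\<^sup>2 = (1 - (cmod a)\<^sup>2) * (1 - (cmod z)\<^sup>2) / (cmod (1 - cnj a * z))\<^sup>2"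
    using one_minus_sq_bfac[OF a, of z] z fw by (simp add: norm_divide)
  have "1 - (cmod a)\<^sup>2 > 0" "1 - (cmod z)\<^sup>2 > 0" "cmod (1 - cnj a * z) > 0"
    using sq_less_1[OF a] sq_less_1[OF z] dz by auto
  moreover have "cmod (w - a) > 0" using a w by auto
  ultimately show ?thesis
    unfolding horo_def n m by (simp add: power_divide power_mult_distrib divide_simps)
      (simp add: power2_eq_square)
qed

text \<open>Julia's lemma with strict inequality: the product is compared with the sum over its
  factors, whose constants add up to \<open>blam a d w\<close>. The presence of two factors makes it
  strict even when this sum equals 1.\<close>

lemma horo_bprod_less:
  assumes s: "cmod s = 1" and a: "\<And>i. i < d ==> cmod (a i) < 1" and d: "d \<ge> 2"
    and w: "cmod w = 1" and lam: "blam a d w \<le> 1" and z: "cmod z < 1"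
  shows "horo (bprod s a d w) (bprod s a d z) < horo w z"
proof -
  define f where "f = (\<lambda>k. bfac (a k) z / bfac (a k) w)"
  define P where "P = (\<Prod>k<d. f k)"
  have fw: "cmod (bfac (a k) w) = 1" if "k < d" for k by (rule cmod_bfac_eq_1[OF a[OF that] w])
  have f1: "cmod (f k) < 1" if "k < d" for k
    using cmod_bfac_less_1[OF a[OF that] z] fw[OF that] by (simp add: f_def norm_divide)
  have bw: "cmod (bprod s a d w) = 1" by (rule cmod_bprod_eq_1[OF s a w])
  have "bprod s a d z = bprod s a d w * P"
  proof -
    have "(\<Prod>k<d. bfac (a k) z) = (\<Prod>k<d. bfac (a k) w * f k)"
      using fw by (intro prod.cong) (force simp: f_def)+
    then show ?thesis by (simp add: bprod_def P_def prod.distrib)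
  qed
  then have "bprod s a d w - bprod s a d z = bprod s a d w * (1 - P)" "cmod (bprod s a d z) = cmod P"
    using bw by (simp_all add: norm_mult algebra_simps)
  then have "horo (bprod s a d w) (bprod s a d z) = horo 1 P"
    using bw by (simp add: horo_def norm_mult)
  also have "\<dots> < (\<Sum>k<d. horo 1 (f k))"
  proof -
    obtain n where n: "d = Suc n" "n > 0" using d by (cases d) auto
    show ?thesis unfolding P_def n(1) using f1 n by (intro horo_prod_le(2)) auto
  qed
  also have "\<dots> = (\<Sum>k<d. (1 - (cmod (a k))\<^sup>2) / (cmod (w - a k))\<^sup>2 * horo w z)"
    using a by (intro sum.cong refl) (simp add: f_def horo_bfac[OF _ w z])
  also have "\<dots> = blam a d w * horo w z" by (simp add: blam_def sum_distrib_right)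
  also have "\<dots> \<le> 1 * horo w z" using lam horo_pos[OF w z] by (intro mult_right_mono) auto
  finally show ?thesis by simp
qed

text \<open>A Lyapunov argument: \<open>V\<close> decreases along the orbit to one limit, so an
  accumulation point where \<open>V\<close> would have different limits before and after one step is
  impossible. Limits along subsequences are asked for instead of continuity because
  \<open>horo w\<close> is singular on the circle.\<close>

lemma orbit_tendsto:
  fixes x :: "nat => 'a::metric_space" and V :: "'a => real"
  assumes K: "compact K" "\<And>n. x n \<in> K"
    and V: "\<And>n. V (x (Suc n)) \<le> V (x n)" "\<And>n. 0 \<le> V (x n)"
    and lim: "\<And>r y. strict_mono (r :: nat => nat) ==> (\<lambda>k. x (r k)) \<longlonglongrightarrow> y ==> y \<in> K ==> y ~= p ==>
       \<exists>A B. A ~= B \<and> (\<lambda>k. V (x (r k))) \<longlonglongrightarrow> A \<and> (\<lambda>k. V (x (Suc (r k)))) \<longlonglongrightarrow> B"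
  shows "x \<longlonglongrightarrow> p"
proof (rule ccontr)
  assume "\<not> x \<longlonglongrightarrow> p"
  then obtain e where e: "e > 0" "\<not> (\<forall>\<^sub>F n in sequentially. dist (x n) p < e)"
    unfolding tendsto_iff by blast
  then have "infinite {n. \<not> dist (x n) p < e}"
    by (simp add: not_eventually frequently_cofinite flip: cofinite_eq_sequentially)
  then obtain r where r: "strict_mono (r :: nat => nat)" "\<And>k. r k \<in> {n. \<not> dist (x n) p < e}"
    using infinite_enumerate by blast
  have "\<forall>k. (x \<circ> r) k \<in> K" using K(2) by simp
  then obtain l s where s: "l \<in> K" "strict_mono s" "((x \<circ> r) \<circ> s) \<longlonglongrightarrow> l"
    using compact_imp_seq_compact[OF K(1)] unfolding seq_compact_def by blast
  define q where "q = r \<circ> s"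
  have q: "strict_mono q" unfolding q_def by (rule strict_mono_o[OF r(1) s(2)])
  have xl: "(\<lambda>k. x (q k)) \<longlonglongrightarrow> l" using s(3) by (simp add: q_def o_def)
  have "l ~= p"
  proof
    assume "l = p"
    then have "\<forall>\<^sub>F k in sequentially. dist (x (q k)) p < e" using tendstoD[OF xl e(1)] by simp
    then obtain k where "dist (x (q k)) p < e" by (auto simp: eventually_sequentially)
    then show False using r(2)[of "s k"] by (simp add: q_def)
  qed
  then obtain A B where AB: "A ~= B" "(\<lambda>k. V (x (q k))) \<longlonglongrightarrow> A" "(\<lambda>k. V (x (Suc (q k)))) \<longlonglongrightarrow> B"
    using lim[OF q xl s(1)] by blast
  have "decseq (\<lambda>n. V (x n))" by (rule decseq_SucI) (rule V(1))
  then obtain L where L: "(\<lambda>n. V (x n)) \<longlonglongrightarrow> L"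
    using decseq_convergent[of "\<lambda>n. V (x n)" 0] V(2) by blast
  have "(\<lambda>k. V (x (q k))) \<longlonglongrightarrow> L" using LIMSEQ_subseq_LIMSEQ[OF L q] by (simp add: o_def)
  moreover have "(\<lambda>k. V (x (Suc (q k)))) \<longlonglongrightarrow> L"
    using LIMSEQ_subseq_LIMSEQ[OF LIMSEQ_Suc[OF L] q] by (simp add: o_def)
  ultimately show False using AB LIMSEQ_unique by blast
qed

text \<open>An accumulation point inside the disk would contradict the strict decrease of
  \<open>horo w\<close>. One on the circle other than \<open>w\<close> is impossible since the orbit
  stays in a horodisk, whose closure touches the circle only at \<open>w\<close>.\<close>

lemma boundary_attracts:
  assumes T: "continuous_on (cball 0 1) T" "\<And>z. cmod z < 1 ==> cmod (T z) < 1"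
    and w: "cmod w = 1" and less: "\<And>z. cmod z < 1 ==> horo w (T z) < horo w z"
    and z: "cmod z < 1"
  shows "(\<lambda>n. (T ^^ n) z) \<longlonglongrightarrow> w"
proof (rule orbit_tendsto[where V = "horo w" and K = "cball 0 1"])
  have in1: "cmod ((T ^^ n) z) < 1" for n using T(2) z by (induction n) auto
  show "(T ^^ n) z \<in> cball 0 1" for n using in1[of n] by simp
  show "horo w ((T ^^ Suc n) z) \<le> horo w ((T ^^ n) z)" for n using less[OF in1[of n]] by simp
  show "0 \<le> horo w ((T ^^ n) z)" for n using horo_pos[OF w in1[of n]] by simp
  have bound: "horo w ((T ^^ n) z) \<le> horo w z" for n
  proof (induction n)
    case (Suc n)
    then show ?case using less[OF in1[of n]] by simp
  qed simp
  fix r :: "nat => nat" and y assume r: "strict_mono r" "(\<lambda>k. (T ^^ r k) z) \<longlonglongrightarrow> y" "y \<in> cball 0 1" "y ~= w"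
  show "\<exists>A B. A ~= B \<and> (\<lambda>k. horo w ((T ^^ r k) z)) \<longlonglongrightarrow> A \<and> (\<lambda>k. horo w ((T ^^ Suc (r k)) z)) \<longlonglongrightarrow> B"
  proof (cases "cmod y < 1")
    case True
    have ty: "(\<lambda>k. T ((T ^^ r k) z)) \<longlonglongrightarrow> T y"
    proof -
      have "continuous_on (ball 0 1) T" by (rule continuous_on_subset[OF T(1)]) auto
      then have "isCont T y" using True by (simp add: continuous_on_eq_continuous_at)
      then show ?thesis using r(2) by (rule isCont_tendsto_compose)
    qed
    have c: "(\<lambda>k. horo w (X k)) \<longlonglongrightarrow> horo w p" if "X \<longlonglongrightarrow> p" "cmod p < 1" for X :: "nat => complex" and p
      unfolding horo_def using that sq_less_1[OF that(2)] by (intro tendsto_intros) auto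
    have "horo w (T y) ~= horo w y" using less[OF True] by simp
    then show ?thesis using c[OF r(2) True] c[OF ty T(2)[OF True]]
      by (intro exI[of _ "horo w y"] exI[of _ "horo w (T y)"]) auto
  next
    case False
    then have y1: "cmod y = 1" using r(3) by simp
    have le: "(cmod (w - (T ^^ r k) z))\<^sup>2 \<le> horo w z * (1 - (cmod ((T ^^ r k) z))\<^sup>2)" for k
      using bound[of "r k"] sq_less_1[OF in1[of "r k"]] by (simp add: horo_def[of w "(T ^^ _) z"] divide_le_eq)
    have "(\<lambda>k. (cmod (w - (T ^^ r k) z))\<^sup>2) \<longlonglongrightarrow> (cmod (w - y))\<^sup>2"
      using r(2) by (intro tendsto_intros)
    moreover have "(\<lambda>k. horo w z * (1 - (cmod ((T ^^ r k) z))\<^sup>2)) \<longlonglongrightarrow> horo w z * (1 - (cmod y)\<^sup>2)"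
      using r(2) by (intro tendsto_intros)
    ultimately have "(cmod (w - y))\<^sup>2 \<le> horo w z * (1 - (cmod y)\<^sup>2)"
      using le by (intro LIMSEQ_le) auto
    then have "w = y" using y1 by simp
    then show ?thesis using r(4) by simp
  qed
qed (simp add: compact_cball)

lemma origin_attracts:
  assumes T: "continuous_on (cball 0 1) T"
    and less: "\<And>z. cmod z < 1 ==> z ~= 0 ==> cmod (T z) < cmod z" and T0: "T 0 = 0"
    and z: "cmod z < 1"
  shows "(\<lambda>n. (T ^^ n) z) \<longlonglongrightarrow> 0"
proof (rule orbit_tendsto[where V = cmod and K = "cball 0 (cmod z)"])
  have le: "cmod (T u) \<le> cmod u" if "cmod u < 1" for u using less[OF that] T0 by (cases "u = 0") auto
  have in1: "cmod ((T ^^ n) z) \<le> cmod z" for n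
  proof (induction n)
    case (Suc n)
    then show ?case using le[of "(T ^^ n) z"] z by simp
  qed simp
  show "(T ^^ n) z \<in> cball 0 (cmod z)" for n using in1[of n] by simp
  show "cmod ((T ^^ Suc n) z) \<le> cmod ((T ^^ n) z)" for n using le[of "(T ^^ n) z"] in1[of n] z by simp
  fix r :: "nat => nat" and y assume r: "strict_mono r" "(\<lambda>k. (T ^^ r k) z) \<longlonglongrightarrow> y" "y \<in> cball 0 (cmod z)" "y ~= 0"
  have y1: "cmod y < 1" using r(3) z by simp
  have "continuous_on (ball 0 1) T" by (rule continuous_on_subset[OF T(1)]) auto
  then have "isCont T y" using y1 by (simp add: continuous_on_eq_continuous_at)
  then have ty: "(\<lambda>k. T ((T ^^ r k) z)) \<longlonglongrightarrow> T y" using r(2) by (rule isCont_tendsto_compose)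
  have "cmod (T y) ~= cmod y" using less[OF y1 r(4)] by simp
  then show "\<exists>A B. A ~= B \<and> (\<lambda>k. cmod ((T ^^ r k) z)) \<longlonglongrightarrow> A \<and> (\<lambda>k. cmod ((T ^^ Suc (r k)) z)) \<longlonglongrightarrow> B"
    using tendsto_norm[OF r(2)] tendsto_norm[OF ty]
    by (intro exI[of _ "cmod y"] exI[of _ "cmod (T y)"]) auto
qed simp_all

section \<open>Blaschke products as maps of the sphere\<close>

definition srefl :: "sphere => sphere" where
  "srefl z = (case z of None => Some 0 | Some w => hpt 1 (cnj w))"

definition sdisk :: "sphere set" where
  "sdisk = Some ` ball 0 1"

definition Hplus :: "sphere set" where
  "Hplus = Some ` {w. Im w > 0}"

lemma srefl_hpt: "u ~= 0 \<or> v ~= 0 ==> srefl (hpt u v) = hpt (cnj v) (cnj u)"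
  by (auto simp: srefl_def hpt_def)

lemma srefl_srefl [simp]: "srefl (srefl z) = z"
proof -
  obtain u v where "z = hpt u v" "u ~= 0 \<or> v ~= 0" by (rule hpt_cases)
  then show ?thesis by (auto simp: srefl_hpt)
qed

lemma srefl_Some: "w ~= 0 ==> srefl (Some w) = Some (1 / cnj w)"
  and srefl_0 [simp]: "srefl (Some 0) = None" and srefl_None [simp]: "srefl None = Some 0"
  by (auto simp: srefl_def hpt_def)

lemma Some_sdisk [simp]: "Some w \<in> sdisk \<longleftrightarrow> cmod w < 1"
  and Some_circle [simp]: "Some w \<in> unit_circle \<longleftrightarrow> cmod w = 1"
  and Some_Hplus [simp]: "Some w \<in> Hplus \<longleftrightarrow> Im w > 0"
  and None_regions [simp]: "None \<notin> sdisk" "None \<notin> unit_circle" "None \<notin> Hplus"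
  by (auto simp: sdisk_def unit_circle_def Hplus_def dist_norm)

lemma sdisk_hpt: "u ~= 0 \<or> v ~= 0 ==> hpt u v \<in> sdisk \<longleftrightarrow> cmod u < cmod v"
  by (auto simp: hpt_def norm_divide divide_less_eq)

lemma circle_hpt: "u ~= 0 \<or> v ~= 0 ==> hpt u v \<in> unit_circle \<longleftrightarrow> cmod u = cmod v"
  by (auto simp: hpt_def norm_divide divide_eq_eq)

lemma Hplus_hpt: "u ~= 0 \<or> v ~= 0 ==> hpt u v \<in> Hplus \<longleftrightarrow> Im (u * cnj v) > 0"
proof -
  assume nz: "u ~= 0 \<or> v ~= 0"
  show ?thesis
  proof (cases "v = 0")
    case False
    have "u / v = u * cnj v / of_real ((cmod v)\<^sup>2)"
      using False unfolding complex_norm_square by (simp add: field_simps)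
    then have "Im (u / v) = Im (u * cnj v) / (cmod v)\<^sup>2" by (metis Im_divide_of_real)
    then show ?thesis using False by (simp add: hpt_def zero_less_divide_iff)
  qed simp
qed

lemma region_cases: "z \<in> sdisk \<or> z \<in> unit_circle \<or> srefl z \<in> sdisk"
proof -
  obtain u v where z: "z = hpt u v" "u ~= 0 \<or> v ~= 0" by (rule hpt_cases)
  then have "cnj v ~= 0 \<or> cnj u ~= 0" by auto
  then show ?thesis using z by (auto simp: srefl_hpt sdisk_hpt circle_hpt)
qed

lemma region_disjoint:
  "z \<in> sdisk ==> z \<notin> unit_circle" "z \<in> sdisk ==> srefl z \<notin> sdisk" "srefl z \<in> sdisk ==> z \<notin> unit_circle"
proof -
  obtain u v where z: "z = hpt u v" "u ~= 0 \<or> v ~= 0" by (rule hpt_cases)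
  then have "cnj v ~= 0 \<or> cnj u ~= 0" by auto
  then show "z \<in> sdisk ==> z \<notin> unit_circle" "z \<in> sdisk ==> srefl z \<notin> sdisk" "srefl z \<in> sdisk ==> z \<notin> unit_circle"
    using z by (auto simp: srefl_hpt sdisk_hpt circle_hpt)
qed

lemma srefl_circle: "z \<in> unit_circle ==> srefl z = z"
proof -
  assume A: "z \<in> unit_circle"
  obtain u v where z: "z = hpt u v" "u ~= 0 \<or> v ~= 0" by (rule hpt_cases)
  then have "cmod u = cmod v" using A circle_hpt by blast
  then have "cnj v * v = u * cnj u" by (metis complex_norm_square mult.commute)
  moreover have "cnj v ~= 0 \<or> cnj u ~= 0" using z(2) by auto
  ultimately show ?thesis using z by (simp add: srefl_hpt hpt_eq_iff)
qed

lemma closed_unit_circle: "closed unit_circle"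
  unfolding unit_circle_def
  by (intro compact_imp_closed compact_continuous_image continuous_on_Some compact_sphere)

lemma connected_unit_circle: "connected unit_circle"
  unfolding unit_circle_def
  by (intro connected_continuous_image continuous_on_Some connected_sphere) simp

section \<open>Numerator and denominator of a Blaschke product as binary forms\<close>

definition bnum :: "complex => (nat => complex) => nat => complex poly" where
  "bnum s a d = smult s (\<Prod>i<d. [:- a i, 1:])"

definition bden :: "(nat => complex) => nat => complex poly" where
  "bden a d = (\<Prod>i<d. [:1, - cnj (a i):])"

definition bmap :: "complex => (nat => complex) => nat => sphere => sphere" where
  "bmap s a d = rat_eval (bnum s a d) (bden a d)"

lemma hpoly_bnum: "hpoly (bnum s a d) d u v = s * (\<Prod>i<d. u - a i * v)"
  using hpoly_prod_linear[where b = "\<lambda>i. - a i" and a = "\<lambda>_. 1" and n = d and u = u and v = v]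
  by (simp add: bnum_def hpoly_smult)

lemma hpoly_bden: "hpoly (bden a d) d u v = (\<Prod>i<d. v - cnj (a i) * u)"
  using hpoly_prod_linear[where b = "\<lambda>_. 1" and a = "\<lambda>i. - cnj (a i)" and n = d and u = u and v = v]
  by (simp add: bden_def)

lemma degree_bnum: "degree (bnum s a d) \<le> d" and degree_bden: "degree (bden a d) \<le> d"
  using hpoly_prod_linear[where b = "\<lambda>i. - a i" and a = "\<lambda>_. 1" and n = d]
    hpoly_prod_linear[where b = "\<lambda>_. 1" and a = "\<lambda>i. - cnj (a i)" and n = d]
  by (auto simp: bnum_def bden_def intro: order_trans[OF degree_smult_le])

lemma poly_bnum: "poly (bnum s a d) z = s * (\<Prod>i<d. z - a i)"
  using hpoly_bnum[of s a d z 1] hpoly_1[OF degree_bnum] by simp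

lemma poly_bden: "poly (bden a d) z = (\<Prod>i<d. 1 - cnj (a i) * z)"
  using hpoly_bden[of a d z 1] hpoly_1[OF degree_bden] by simp

definition bdata :: "complex => (nat => complex) => nat => bool" where
  "bdata s a d \<longleftrightarrow> d > 0 \<and> cmod s = 1 \<and> (\<forall>i<d. cmod (a i) < 1)"

lemma ratpair_bmap:
  assumes "bdata s a d"
  shows "ratpair (bnum s a d) (bden a d) d"
proof -
  have assms: "d > 0" "cmod s = 1" "\<And>i. i < d ==> cmod (a i) < 1" using assms by (auto simp: bdata_def)
  have s0: "s ~= 0" using assms(2) by auto
  have "coeff (bnum s a d) d = s"
    using hpoly_bnum[of s a d 1 0] by (simp add: hpoly_0)
  moreover have "poly (bnum s a d) z ~= 0 \<or> poly (bden a d) z ~= 0" for z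
  proof (rule ccontr)
    assume "\<not> ?thesis"
    then obtain i j where ij: "i < d" "z = a i" "j < d" "1 - cnj (a j) * z = 0"
      using s0 by (auto simp: poly_bnum poly_bden)
    have "1 - cnj (a j) * z ~= 0"
      using assms(3)[OF ij(3)] assms(3)[OF ij(1)] ij(2) by (intro bfac_denom_nonzero) auto
    then show False using ij(4) by simp
  qed
  ultimately show ?thesis
    using assms(1) s0 degree_bnum degree_bden by (auto simp: ratpair_def)
qed

lemma ratmap_bmap: "bdata s a d ==> ratmap d (bmap s a d)"
  unfolding ratmap_def bmap_def using ratpair_bmap by blast

lemma bmap_hpt:
  assumes "bdata s a d" "u ~= 0 \<or> v ~= 0"
  shows "bmap s a d (hpt u v) = hpt (s * (\<Prod>i<d. u - a i * v)) (\<Prod>i<d. v - cnj (a i) * u)"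
    "s * (\<Prod>i<d. u - a i * v) ~= 0 \<or> (\<Prod>i<d. v - cnj (a i) * u) ~= 0"
  using rat_eval_hpt[OF ratpair_bmap[OF assms(1)] assms(2)]
    ratpair_hpoly_nonzero[OF ratpair_bmap[OF assms(1)] assms(2)]
  by (simp_all only: bmap_def hpoly_bnum hpoly_bden)

lemma bmap_Some:
  assumes "bdata s a d" "cmod z \<le> 1"
  shows "bmap s a d (Some z) = Some (bprod s a d z)"
proof -
  have "(\<Prod>i<d. 1 - cnj (a i) * z) ~= 0"
    using bfac_denom_nonzero[OF _ assms(2)] assms(1) by (simp add: bdata_def)
  then show ?thesis
    by (simp add: bmap_def rat_eval_def poly_bnum poly_bden bprod_def bfac_def prod_dividef)
qed

lemma bmap_srefl:
  assumes "bdata s a d"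
  shows "bmap s a d (srefl z) = srefl (bmap s a d z)"
proof -
  obtain u v where z: "z = hpt u v" "u ~= 0 \<or> v ~= 0" by (rule hpt_cases)
  have cz: "cnj v ~= 0 \<or> cnj u ~= 0" using z(2) by auto
  have ss: "s * cnj s = 1" using assms complex_norm_square[of s] by (simp add: bdata_def)
  then have s0: "s ~= 0" by auto
  let ?N = "\<Prod>i<d. u - a i * v" and ?D = "\<Prod>i<d. v - cnj (a i) * u"
  have "bmap s a d (srefl z) = hpt (s * (\<Prod>i<d. cnj v - a i * cnj u)) (\<Prod>i<d. cnj u - cnj (a i) * cnj v)"
    unfolding z(1) srefl_hpt[OF z(2)] by (rule bmap_hpt(1)[OF assms cz])
  also have "(\<Prod>i<d. cnj v - a i * cnj u) = cnj ?D" by simp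
  also have "(\<Prod>i<d. cnj u - cnj (a i) * cnj v) = cnj ?N" by simp
  also have "hpt (s * cnj ?D) (cnj ?N) = hpt (s * cnj ?D) (s * cnj (s * ?N))"
    using ss by (simp add: mult.assoc[symmetric])
  also have "\<dots> = hpt (cnj ?D) (cnj (s * ?N))" by (rule hpt_scale[OF s0])
  also have "\<dots> = srefl (bmap s a d z)"
    unfolding z(1) bmap_hpt(1)[OF assms z(2)] srefl_hpt[OF bmap_hpt(2)[OF assms z(2)]] ..
  finally show ?thesis .
qed

lemma bmap_regions:
  assumes "bdata s a d"
  shows "bmap s a d z \<in> sdisk \<longleftrightarrow> z \<in> sdisk" "bmap s a d z \<in> unit_circle \<longleftrightarrow> z \<in> unit_circle"
proof -
  let ?B = "bmap s a d"
  have A: "d > 0" "cmod s = 1" "\<And>i. i < d ==> cmod (a i) < 1" using assms by (auto simp: bdata_def)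
  have D: "?B z \<in> sdisk" if z: "z \<in> sdisk" for z
  proof -
    obtain w where "z = Some w" "cmod w < 1" using z by (cases z) auto
    then show ?thesis
      using cmod_bprod_less_1[of s d a w] bmap_Some[OF assms, of w] A by simp
  qed
  have C: "?B z \<in> unit_circle" if z: "z \<in> unit_circle" for z
  proof -
    obtain w where "z = Some w" "cmod w = 1" using z by (cases z) auto
    then show ?thesis
      using cmod_bprod_eq_1[of s d a w] bmap_Some[OF assms, of w] A by simp
  qed
  have E: "srefl (?B z) \<in> sdisk" if z: "srefl z \<in> sdisk" for z
    using D[OF z] bmap_srefl[OF assms] by simp
  show "?B z \<in> sdisk \<longleftrightarrow> z \<in> sdisk" "?B z \<in> unit_circle \<longleftrightarrow> z \<in> unit_circle"
    using D[of z] C[of z] E[of z] region_cases[of z] region_disjoint[of z] region_disjoint[of "?B z"] by blast+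
qed

lemma blaschke_bmap: "blaschke c a d = bmap (cis (2 * pi * c)) a d"
  by (simp add: blaschke_def bmap_def bnum_def bden_def)

lemma zblaschke_bmap:
  assumes "d > 0" "a (d - 1) = 0"
  shows "zblaschke s a d = bmap s a d"
proof -
  obtain n where n: "d = Suc n" using assms(1) gr0_implies_Suc by blast
  show ?thesis
    using assms(2) by (simp add: zblaschke_def bmap_def bnum_def bden_def n mult.commute)
qed

text \<open>The factor z is listed as the last Blaschke factor, so that having a zero at the centre
  becomes the condition \<open>a (d - 1) = 0\<close>.\<close>

lemma zblaschke_bmap': "d > 0 ==> zblaschke s a d = bmap s (a(d - 1 := 0)) d"
proof -
  assume "d > 0"
  then have "zblaschke s (a(d - 1 := 0)) d = bmap s (a(d - 1 := 0)) d" by (intro zblaschke_bmap) auto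
  moreover have "zblaschke s (a(d - 1 := 0)) d = zblaschke s a d" by (simp add: zblaschke_def)
  ultimately show ?thesis by simp
qed

subsection \<open>Characterisation of Blaschke products by symmetry\<close>

lemma complex_poly_factor:
  fixes p :: "complex poly"
  assumes "degree p = n"
  shows "\<exists>a. p = smult (lead_coeff p) (\<Prod>i<n. [:- a i, 1:])"
  using assms
proof (induction n arbitrary: p)
  case 0
  then obtain c where "p = [:c:]" by (auto elim: degree_eq_zeroE)
  then show ?case by simp
next
  case (Suc n)
  then obtain r where r: "poly p r = 0" using nonconst_root[of p] by auto
  then obtain p' where p': "p = [:- r, 1:] * p'" using poly_eq_0_iff_dvd by blast
  have "p' ~= 0" using Suc.prems p' by auto
  then have "degree p' = n" using Suc.prems unfolding p' by (subst (asm) degree_mult_eq) auto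
  then obtain a where a: "p' = smult (lead_coeff p') (\<Prod>i<n. [:- a i, 1:])" using Suc.IH by blast
  have "lead_coeff p = lead_coeff p'" unfolding p' lead_coeff_mult by simp
  have "(\<Prod>i<Suc n. [:- (a(n := r)) i, 1:]) = (\<Prod>i<n. [:- a i, 1:]) * [:- r, 1:]" by simp
  then have "p = smult (lead_coeff p) (\<Prod>i<Suc n. [:- (a(n := r)) i, 1:])"
    unfolding \<open>lead_coeff p = lead_coeff p'\<close> using p' a by (metis mult.commute mult_smult_left)
  then show ?case by blast
qed

lemma complex_poly_factor_root:
  fixes p :: "complex poly"
  assumes "degree p = Suc n" "poly p r = 0"
  shows "\<exists>a. p = smult (lead_coeff p) (\<Prod>i<Suc n. [:- a i, 1:]) \<and> a n = r"
proof -
  obtain p' where p': "p = [:- r, 1:] * p'" using assms(2) poly_eq_0_iff_dvd by blast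
  have "p' ~= 0" using assms p' by auto
  then have "degree p' = n" using assms(1) unfolding p' by (subst (asm) degree_mult_eq) auto
  then obtain a where a: "p' = smult (lead_coeff p') (\<Prod>i<n. [:- a i, 1:])" using complex_poly_factor by blast
  have "lead_coeff p = lead_coeff p'" unfolding p' lead_coeff_mult by simp
  have "(\<Prod>i<Suc n. [:- (a(n := r)) i, 1:]) = (\<Prod>i<n. [:- a i, 1:]) * [:- r, 1:]" by simp
  then have "p = smult (lead_coeff p) (\<Prod>i<Suc n. [:- (a(n := r)) i, 1:])"
    unfolding \<open>lead_coeff p = lead_coeff p'\<close> using p' a by (metis mult.commute mult_smult_left)
  then show ?thesis by (intro exI[of _ "a(n := r)"]) simp
qed

text \<open>Linear factors are cancelled one at a time, each step using only that \<open>q\<close>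
  does not vanish at the point concerned; repeated points therefore cause no bookkeeping.\<close>

lemma prod_linear_dvd_cancel:
  fixes q r :: "complex poly" and n :: nat
  assumes "\<And>i. i < n ==> poly q (a i) ~= 0" "(\<Prod>i<n. [:- a i, 1:]) dvd q * r"
  shows "(\<Prod>i<n. [:- a i, 1:]) dvd r"
  using assms
proof (induction n arbitrary: r)
  case (Suc n)
  let ?P = "\<Prod>i<n. [:- a i, 1:]"
  obtain k where k: "q * r = ?P * [:- a n, 1:] * k" using Suc.prems(2) by (auto simp: dvd_def)
  have "poly (q * r) (a n) = 0" unfolding k by simp
  then have "poly r (a n) = 0" using Suc.prems(1)[of n] by simp
  then obtain r' where r': "r = [:- a n, 1:] * r'" using poly_eq_0_iff_dvd by blast
  have "[:- a n, 1:] * (q * r') = [:- a n, 1:] * (?P * k)" using k unfolding r' by (simp only: ac_simps)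
  then have "q * r' = ?P * k" by (subst (asm) mult_left_cancel) auto
  then have "?P dvd q * r'" by simp
  then have "?P dvd r'" by (rule Suc.IH[rotated]) (use Suc.prems(1) in simp)
  then have "?P * [:- a n, 1:] dvd r' * [:- a n, 1:]" by (rule mult_dvd_mono) simp
  then show ?case unfolding r' by (simp only: prod.lessThan_Suc mult.commute)
qed simp

text \<open>The reciprocal polynomial z^d * cnj (q (1 / cnj z)), through which reflection in the
  unit circle acts on numerators and denominators. For real \<open>q\<close> it merely reverses the
  coefficients.\<close>

definition csharp :: "nat => complex poly => complex poly" where
  "csharp d q = (\<Sum>i\<le>d. monom (cnj (coeff q i)) (d - i))"

lemma poly_csharp: "poly (csharp d q) z = cnj (hpoly q d 1 (cnj z))"
  by (simp add: csharp_def poly_sum poly_monom hpoly_def)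

lemma degree_csharp: "degree (csharp d q) \<le> d"
  unfolding csharp_def
  by (intro degree_sum_le) (auto intro: order_trans[OF degree_monom_le])

lemma poly_eq_off_0:
  fixes p q :: "complex poly"
  assumes "\<And>z. z ~= 0 ==> poly p z = poly q z"
  shows "p = q"
proof (rule ccontr)
  assume "p ~= q"
  then have "finite {z. poly (p - q) z = 0}" by (intro poly_roots_finite) simp
  moreover have "UNIV - {0} \<subseteq> {z. poly (p - q) z = 0}" using assms by auto
  ultimately have "finite (UNIV - {0 :: complex})" by (rule rev_finite_subset)
  then show False using infinite_UNIV_char_0[where 'a = complex] by simp
qed

text \<open>With B = p/q, symmetry under reflection says p p# = q q#, where # stands for
  \<open>csharp d\<close>. As \<open>p\<close> and \<open>q\<close> have no common root,
  \<open>p\<close> divides q#, and comparison of degrees makes q# a constant multiple of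
  \<open>p\<close>; so the roots of \<open>q\<close> are the reflected roots of \<open>p\<close>.
  Comparing values at 1, where nothing vanishes, gives the leading constant modulus 1. The
  prescribed root is listed last.\<close>

theorem symmetric_ratmap_is_blaschke:
  assumes B: "ratmap d B" and sym: "\<And>z. B (srefl z) = srefl (B z)"
    and zeros: "\<And>z. B z = Some 0 ==> z \<in> sdisk" and root: "B (Some r) = Some 0"
  shows "\<exists>s a. bdata s a d \<and> a (d - 1) = r \<and> B = bmap s a d"
proof -
  obtain p q where pq: "ratpair p q d" "B = rat_eval p q" using B by (auto simp: ratmap_def)
  obtain n where n: "d = Suc n" using pq(1) by (auto simp: ratpair_def gr0_conv_Suc)
  have deg: "degree p \<le> d" "degree q \<le> d" using pq(1) by (auto simp: ratpair_def)
  have pre: "{z. B z = Some 0} = Some ` {z. poly p z = 0} \<union> (if coeff p d = 0 then {None} else {})"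
    using preimage_eq[OF pq(1), of 0 1] pq(2) by simp
  have pd: "coeff p d ~= 0"
  proof
    assume "coeff p d = 0"
    then have "None \<in> {z. B z = Some 0}" unfolding pre by simp
    then show False using zeros by (auto simp: sdisk_def)
  qed
  then have dp: "degree p = d" using deg by (intro antisym le_degree)
  have rts: "cmod z < 1" if "poly p z = 0" for z
  proof -
    have "Some z \<in> {z. B z = Some 0}" unfolding pre using that by simp
    then show ?thesis using zeros[of "Some z"] by (auto simp: sdisk_def)
  qed
  have "Some r \<in> {z. B z = Some 0}" using root by simp
  then have "poly p r = 0" unfolding pre by (auto split: if_splits)
  define \<alpha> where "\<alpha> = lead_coeff p"
  have "degree p = Suc n" using dp n by simp
  then obtain a where a0: "p = smult (lead_coeff p) (\<Prod>i<Suc n. [:- a i, 1:])" "a n = r"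
    using complex_poly_factor_root[of p n r] \<open>poly p r = 0\<close> by blast
  then have a: "p = smult \<alpha> (\<Prod>i<d. [:- a i, 1:])" "a n = r" by (simp_all add: \<alpha>_def n)
  have p: "p = bnum \<alpha> a d" using a(1) by (simp add: bnum_def)
  have \<alpha>0: "\<alpha> ~= 0" using pd by (auto simp: \<alpha>_def)
  have pa: "poly p (a i) = 0" if "i < d" for i
    unfolding p poly_bnum using that by (auto intro!: prod_zero bexI[of _ i])
  have a1: "cmod (a i) < 1" if "i < d" for i using rts[OF pa[OF that]] .
  have qa: "poly q (a i) ~= 0" if "i < d" for i using pa[OF that] pq(1) by (auto simp: ratpair_def)
  have id: "poly p z * poly (csharp d p) z = poly q z * poly (csharp d q) z" for z
  proof -
    have nz: "(1::complex) ~= 0 \<or> cnj z ~= 0" "z ~= 0 \<or> (1::complex) ~= 0" by auto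
    have "hpt (hpoly p d 1 (cnj z)) (hpoly q d 1 (cnj z)) = B (srefl (hpt z 1))"
      unfolding srefl_hpt[OF nz(2)] pq(2) using rat_eval_hpt[OF pq(1) nz(1)] by simp
    also have "\<dots> = srefl (B (hpt z 1))" by (rule sym)
    also have "\<dots> = srefl (hpt (hpoly p d z 1) (hpoly q d z 1))"
      unfolding pq(2) rat_eval_hpt[OF pq(1) nz(2)] ..
    also have "\<dots> = hpt (cnj (hpoly q d z 1)) (cnj (hpoly p d z 1))"
      by (rule srefl_hpt[OF ratpair_hpoly_nonzero[OF pq(1) nz(2)]])
    finally have e: "hpt (hpoly p d 1 (cnj z)) (hpoly q d 1 (cnj z)) = hpt (cnj (hpoly q d z 1)) (cnj (hpoly p d z 1))" .
    have "cnj (hpoly q d z 1) ~= 0 \<or> cnj (hpoly p d z 1) ~= 0"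
      using ratpair_hpoly_nonzero[OF pq(1) nz(2)] by auto
    with e have "hpoly p d 1 (cnj z) * cnj (hpoly p d z 1) = cnj (hpoly q d z 1) * hpoly q d 1 (cnj z)"
      using hpt_eq_iff[OF ratpair_hpoly_nonzero[OF pq(1) nz(1)]] by blast
    then have "cnj (hpoly p d 1 (cnj z)) * hpoly p d z 1 = hpoly q d z 1 * cnj (hpoly q d 1 (cnj z))"
      by (metis complex_cnj_cnj complex_cnj_mult)
    then show ?thesis using deg by (simp add: poly_csharp mult.commute)
  qed
  then have idp: "p * csharp d p = q * csharp d q"
    by (intro poly_eq_off_0) simp
  let ?P = "\<Prod>i<d. [:- a i, 1:]"
  have "?P dvd p" unfolding a(1) by (rule dvd_smult) simp
  then have "?P dvd q * csharp d q" unfolding idp[symmetric] by (rule dvd_mult2)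
  then have "?P dvd csharp d q" by (rule prod_linear_dvd_cancel[rotated]) (rule qa)
  then obtain \<kappa> where \<kappa>: "csharp d q = ?P * \<kappa>" by (auto simp: dvd_def)
  have sp1: "poly (csharp d p) 1 ~= 0"
  proof -
    have "cnj (hpoly p d 1 1) = cnj (poly p 1)" using deg by simp
    moreover have "poly p 1 ~= 0" using rts[of 1] by auto
    ultimately show ?thesis by (simp add: poly_csharp deg)
  qed
  have p1: "poly p 1 ~= 0" using rts[of 1] by auto
  have \<kappa>0: "\<kappa> ~= 0"
  proof
    assume "\<kappa> = 0"
    then have "poly p 1 * poly (csharp d p) 1 = 0" using id[of 1] \<kappa> by simp
    then show False using sp1 p1 by simp
  qed
  have dP: "degree ?P = d" using dp \<alpha>0 unfolding a(1) by simp
  have "?P ~= 0" by simp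
  then have "degree (csharp d q) = d + degree \<kappa>" unfolding \<kappa> using \<kappa>0 dP by (subst degree_mult_eq) auto
  then have "degree \<kappa> = 0" using degree_csharp[of d q] by simp
  then obtain k where k: "\<kappa> = [:k:]" by (rule degree_eq_zeroE)
  have k0: "k ~= 0" using \<kappa>0 k by auto
  have hq: "hpoly q d 1 w = cnj k * (\<Prod>i<d. w - cnj (a i))" for w
  proof -
    have "cnj (hpoly q d 1 w) = k * (\<Prod>i<d. cnj w - a i)"
      using poly_csharp[of d q "cnj w"] unfolding \<kappa> k by (simp add: poly_prod mult.commute)
    then have "cnj (cnj (hpoly q d 1 w)) = cnj (k * (\<Prod>i<d. cnj w - a i))" by simp
    then show ?thesis by simp
  qed
  have q: "q = smult (cnj k) (bden a d)"
  proof (rule poly_eq_off_0)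
    fix z :: complex assume z: "z ~= 0"
    have "poly q z = z ^ d * hpoly q d 1 (1 / z)"
    proof -
      have "hpoly q d 1 (1 / z) = (1 / z) ^ d * poly q z"
        using hpoly_nonzero[OF deg(2), of "1 / z" 1] z by simp
      then show ?thesis using z by (simp add: power_one_over)
    qed
    also have "\<dots> = cnj k * (\<Prod>i<d. z * (1 / z - cnj (a i)))"
      unfolding hq prod.distrib by simp
    also have "\<dots> = poly (smult (cnj k) (bden a d)) z"
      using z by (simp add: poly_bden right_diff_distrib mult.commute)
    finally show "poly q z = poly (smult (cnj k) (bden a d)) z" .
  qed
  define s where "s = \<alpha> / cnj k"
  have "cmod s = 1"
  proof -
    let ?X = "\<Prod>i<d. 1 - a i"
    have "?X ~= 0" using p1 unfolding p poly_bnum by auto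
    have "poly (csharp d p) 1 = cnj (\<alpha> * ?X)" using deg by (simp add: poly_csharp p poly_bnum)
    moreover have "poly p 1 = \<alpha> * ?X" by (simp add: p poly_bnum)
    moreover have "poly q 1 = cnj k * cnj ?X" by (simp add: q poly_bden)
    moreover have "poly (csharp d q) 1 = k * ?X" by (simp add: \<kappa> k poly_prod mult.commute)
    ultimately have "(\<alpha> * ?X) * cnj (\<alpha> * ?X) = (cnj k * cnj ?X) * (k * ?X)" using id[of 1] by simp
    then have "cmod ((\<alpha> * ?X) * cnj (\<alpha> * ?X)) = cmod ((cnj k * cnj ?X) * (k * ?X))"
      by (rule arg_cong)
    then have "(cmod \<alpha>)\<^sup>2 * (cmod ?X)\<^sup>2 = (cmod k)\<^sup>2 * (cmod ?X)\<^sup>2"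
      by (simp only: norm_mult complex_mod_cnj power2_eq_square) (simp only: ac_simps)
    then have "(cmod \<alpha>)\<^sup>2 = (cmod k)\<^sup>2" using \<open>?X ~= 0\<close> by simp
    then have "cmod \<alpha> = cmod k" by (simp add: power2_eq_iff_nonneg)
    then show ?thesis using k0 by (simp add: s_def norm_divide)
  qed
  then have bd: "bdata s a d" using n a1 by (simp add: bdata_def)
  have "B = bmap s a d"
  proof (rule ratmap_eqI)
    fix u v :: complex assume uv: "u ~= 0 \<or> v ~= 0"
    have "B (hpt u v) = hpt (\<alpha> * (\<Prod>i<d. u - a i * v)) (cnj k * (\<Prod>i<d. v - cnj (a i) * u))"
      unfolding pq(2) rat_eval_hpt[OF pq(1) uv] unfolding p q hpoly_smult hpoly_bnum hpoly_bden ..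
    also have "\<dots> = hpt (cnj k * (s * (\<Prod>i<d. u - a i * v))) (cnj k * (\<Prod>i<d. v - cnj (a i) * u))"
      using k0 by (simp add: s_def)
    also have "\<dots> = hpt (s * (\<Prod>i<d. u - a i * v)) (\<Prod>i<d. v - cnj (a i) * u)"
      using k0 by (intro hpt_scale) simp
    also have "\<dots> = bmap s a d (hpt u v)"
      by (rule bmap_hpt(1)[OF bd uv, symmetric])
    finally show "B (hpt u v) = bmap s a d (hpt u v)" .
  qed
  then show ?thesis using bd a(2) n by (intro exI[of _ s] exI[of _ a]) simp
qed

section \<open>Conjugation by Moebius transformations\<close>

definition mobius :: "(sphere => sphere) => bool" where
  "mobius \<psi> \<longleftrightarrow> (\<exists>a b c e. a * e - b * c ~= 0 \<and> \<psi> = mob a b c e)"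

lemma mobius_inverse:
  assumes "mobius \<psi>"
  obtains \<psi>' where "mobius \<psi>'" "\<psi>' \<circ> \<psi> = id" "\<psi> \<circ> \<psi>' = id"
proof -
  obtain a b c e where d: "a * e - b * c ~= 0" "\<psi> = mob a b c e" using assms by (auto simp: mobius_def)
  have "e * a - (-b) * (-c) ~= 0" using d(1) by (simp add: mult.commute)
  then have "mobius (mob e (-b) (-c) a)" unfolding mobius_def by blast
  then show thesis using that mobius_def mob_inverse[OF d(1)] d(2) by blast
qed

lemma mobius_compose: "mobius \<phi> ==> mobius \<psi> ==> mobius (\<phi> \<circ> \<psi>)"
proof -
  assume "mobius \<phi>" "mobius \<psi>"
  then obtain a b c e a' b' c' e' where d: "a * e - b * c ~= 0" "\<phi> = mob a b c e" "a' * e' - b' * c' ~= 0" "\<psi> = mob a' b' c' e'"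
    unfolding mobius_def by blast
  have "(a * a' + b * c') * (c * b' + e * e') - (a * b' + b * e') * (c * a' + e * c') =
      (a * e - b * c) * (a' * e' - b' * c')" by algebra
  then have "(a * a' + b * c') * (c * b' + e * e') - (a * b' + b * e') * (c * a' + e * c') ~= 0" using d by simp
  then show ?thesis unfolding mobius_def d mob_compose[OF d(1,3)] by blast
qed

lemma mobius_ratmap: "mobius \<psi> ==> ratmap 1 \<psi>"
  unfolding mobius_def using ratmap_mob by blast

lemma ratmap_post_mobius: "mobius \<psi> ==> ratmap d F ==> ratmap d (\<psi> \<circ> F)"
  unfolding mobius_def using ratmap_post_mob by blast

lemma ratmap_pre_mobius: "mobius \<psi> ==> ratmap d F ==> ratmap d (F \<circ> \<psi>)"
  unfolding mobius_def using ratmap_pre_mob by blast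

lemma mobius_sder_nonzero: "mobius \<psi> ==> sder \<psi> z ~= 0"
  unfolding mobius_def using sder_mob_nonzero by blast

lemma mobius_eq_iff: "mobius \<psi> ==> \<psi> x = \<psi> y \<longleftrightarrow> x = y"
  by (metis mobius_inverse comp_apply id_apply)

lemma rmob_mobius: "a * e - b * c ~= 0 ==> mobius (rmob a b c e)"
  unfolding rmob_def mobius_def using rmob_det by blast

lemma julia_mobius_conj:
  assumes "mobius \<psi>" "ratmap d F" "ratmap d' G" "\<psi> \<circ> F = G \<circ> \<psi>"
  shows "julia G = \<psi> ` julia F" "\<psi> z \<in> julia G \<longleftrightarrow> z \<in> julia F"
proof -
  obtain \<psi>' where \<psi>': "mobius \<psi>'" "\<psi>' \<circ> \<psi> = id" "\<psi> \<circ> \<psi>' = id" by (rule mobius_inverse[OF assms(1)])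
  have c: "continuous_on UNIV \<psi>" "continuous_on UNIV \<psi>'"
    using mobius_ratmap[OF assms(1)] mobius_ratmap[OF \<psi>'(1)] ratmap_continuous_on by blast+
  have i: "isCont F x" "isCont G x" for x using assms ratmap_isCont by blast+
  show "julia G = \<psi> ` julia F" by (rule julia_conj_image[OF i c \<psi>'(2,3) assms(4)])
  show "\<psi> z \<in> julia G \<longleftrightarrow> z \<in> julia F" by (rule julia_conj[OF i c \<psi>'(2,3) assms(4)])
qed

lemma sder_mobius_conj:
  assumes "mobius \<psi>" "ratmap d F" "ratmap d' G" "\<psi> \<circ> F = G \<circ> \<psi>"
  shows "sder G (\<psi> z) * sder \<psi> z = sder \<psi> (F z) * sder F z"
    and "sder (G ^^ n) (\<psi> z) * sder \<psi> z = sder \<psi> ((F ^^ n) z) * sder (F ^^ n) z"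
proof -
  have d\<psi>: "sdiff \<psi> z" for z by (rule ratmap_sdiff[OF mobius_ratmap[OF assms(1)]])
  show "sder G (\<psi> z) * sder \<psi> z = sder \<psi> (F z) * sder F z"
    using sdiff_compose(2)[OF ratmap_sdiff[OF assms(2)] d\<psi>, of z] sdiff_compose(2)[OF d\<psi> ratmap_sdiff[OF assms(3)], of z]
    by (simp add: assms(4))
  have "\<psi> \<circ> (F ^^ n) = (G ^^ n) \<circ> \<psi>" using funpow_conj[OF assms(4)] by auto
  then show "sder (G ^^ n) (\<psi> z) * sder \<psi> z = sder \<psi> ((F ^^ n) z) * sder (F ^^ n) z"
    using sdiff_compose(2)[OF sdiff_funpow[OF assms(2), of n z] d\<psi>] sdiff_compose(2)[OF d\<psi>[of z] sdiff_funpow[OF assms(3), of n]]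
    by simp
qed

lemma critical_mobius_conj:
  assumes "mobius \<psi>" "ratmap d F" "ratmap d' G" "\<psi> \<circ> F = G \<circ> \<psi>"
  shows "critical G (\<psi> z) \<longleftrightarrow> critical F z"
  using sder_mobius_conj(1)[OF assms, of z] mobius_sder_nonzero[OF assms(1), of z]
    mobius_sder_nonzero[OF assms(1), of "F z"]
  unfolding critical_iff_sder by (metis mult_eq_0_iff)

text \<open>The convergence demanded in hyperbolicity, in the metric of the sphere: the orbit of
  \<open>c\<close> approaches that of \<open>z\<close> as a set, with no phase prescribed.\<close>

definition orbit_conv :: "(sphere => sphere) => sphere => sphere => bool" where
  "orbit_conv F c z \<longleftrightarrow> (\<forall>e>0. \<exists>N. \<forall>k\<ge>N. \<exists>j. dist ((F ^^ k) c) ((F ^^ j) z) < e)"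

lemma infdist_orbit_iff:
  "((\<lambda>k. infdist (stereo ((F ^^ k) c)) (stereo ` {(F ^^ j) z | j. True})) \<longlonglongrightarrow> 0) \<longleftrightarrow> orbit_conv F c z"
proof -
  let ?A = "stereo ` {(F ^^ j) z | j. True}"
  have less: "infdist (stereo x) ?A < e \<longleftrightarrow> (\<exists>j. dist x ((F ^^ j) z) < e)" for x e
  proof
    assume "infdist (stereo x) ?A < e"
    have ne: "?A ~= {}" by blast
    from \<open>infdist (stereo x) ?A < e\<close>
    have "(INF a\<in>?A. dist (stereo x) a) < e" by (simp add: infdist_def split: if_splits) blast
    then have "\<exists>a\<in>?A. dist (stereo x) a < e"
      using cINF_greatest[OF ne, of e "dist (stereo x)"] by (meson linorder_not_less)
    then obtain j where "dist (stereo x) (stereo ((F ^^ j) z)) < e" by blast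
    then show "\<exists>j. dist x ((F ^^ j) z) < e" by (intro exI[of _ j]) simp
  next
    assume "\<exists>j. dist x ((F ^^ j) z) < e"
    then obtain j where j: "dist x ((F ^^ j) z) < e" by blast
    have "infdist (stereo x) ?A \<le> dist (stereo x) (stereo ((F ^^ j) z))" by (rule infdist_le) blast
    then show "infdist (stereo x) ?A < e" using j by simp
  qed
  show ?thesis
    unfolding orbit_conv_def LIMSEQ_iff real_norm_def diff_0_right abs_of_nonneg[OF infdist_nonneg] less ..
qed

section \<open>Hyperbolicity under conjugacy\<close>

lemma hyperbolic_iff:
  "hyperbolic F \<longleftrightarrow> (\<forall>c. sder F c = 0 -->
     (\<exists>z n. n > 0 \<and> (F ^^ n) z = z \<and> cmod (sder (F ^^ n) z) < 1 \<and> orbit_conv F c z))"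
  unfolding hyperbolic_def critical_iff_sder multiplier_eq_sder infdist_orbit_iff ..

lemma hyperbolic_mobius_imp:
  assumes "mobius \<psi>" "ratmap d F" "ratmap d' G" "\<psi> \<circ> F = G \<circ> \<psi>" "hyperbolic F"
  shows "hyperbolic G"
  unfolding hyperbolic_iff
proof (intro allI impI)
  fix c' assume c': "sder G c' = 0"
  obtain \<psi>' where \<psi>': "mobius \<psi>'" "\<psi>' \<circ> \<psi> = id" "\<psi> \<circ> \<psi>' = id" by (rule mobius_inverse[OF assms(1)])
  define c where "c = \<psi>' c'"
  have c: "\<psi> c = c'" using \<psi>'(3) by (simp add: c_def fun_eq_iff)
  have "sder F c = 0" using c' critical_mobius_conj[OF assms(1-4), of c] by (simp add: c critical_iff_sder)
  then obtain z n where zn: "n > 0" "(F ^^ n) z = z" "cmod (sder (F ^^ n) z) < 1" "orbit_conv F c z"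
    using assms(5) unfolding hyperbolic_iff by blast
  have "(G ^^ n) (\<psi> z) = \<psi> z" using funpow_conj[OF assms(4), of n z] zn(2) by simp
  moreover have "sder (G ^^ n) (\<psi> z) = sder (F ^^ n) z"
    using sder_mobius_conj(2)[OF assms(1-4), of n z] mobius_sder_nonzero[OF assms(1), of z] zn(2) by simp
  moreover have "orbit_conv G c' (\<psi> z)"
    unfolding orbit_conv_def
  proof (intro allI impI)
    fix e :: real assume e: "e > 0"
    have "uniformly_continuous_on UNIV \<psi>"
      by (rule compact_uniformly_continuous[OF ratmap_continuous_on[OF mobius_ratmap[OF assms(1)]] compact_sphere_UNIV])
    then obtain \<delta> where \<delta>: "\<delta> > 0" "\<And>x y. dist x y < \<delta> ==> dist (\<psi> x) (\<psi> y) < e"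
      using e unfolding uniformly_continuous_on_def by (metis UNIV_I dist_commute)
    obtain N where N: "\<forall>k\<ge>N. \<exists>j. dist ((F ^^ k) c) ((F ^^ j) z) < \<delta>"
      using zn(4) \<delta>(1) unfolding orbit_conv_def by blast
    have "\<exists>j. dist ((G ^^ k) c') ((G ^^ j) (\<psi> z)) < e" if k: "k \<ge> N" for k
    proof -
      obtain j where "dist ((F ^^ k) c) ((F ^^ j) z) < \<delta>" using N k by blast
      then have "dist (\<psi> ((F ^^ k) c)) (\<psi> ((F ^^ j) z)) < e" by (rule \<delta>(2))
      then show ?thesis by (auto simp: funpow_conj[OF assms(4)] c)
    qed
    then show "\<exists>N. \<forall>k\<ge>N. \<exists>j. dist ((G ^^ k) c') ((G ^^ j) (\<psi> z)) < e" by blast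
  qed
  ultimately show "\<exists>z n. n > 0 \<and> (G ^^ n) z = z \<and> cmod (sder (G ^^ n) z) < 1 \<and> orbit_conv G c' z"
    using zn by metis
qed

lemma conj_swap:
  assumes "\<psi>' \<circ> \<psi> = id" "\<psi> \<circ> \<psi>' = id" "\<psi> \<circ> F = G \<circ> \<psi>"
  shows "\<psi>' \<circ> G = F \<circ> \<psi>'" "G = \<psi> \<circ> F \<circ> \<psi>'"
proof -
  show G: "G = \<psi> \<circ> F \<circ> \<psi>'" unfolding assms(3) by (simp add: comp_assoc assms(2))
  show "\<psi>' \<circ> G = F \<circ> \<psi>'" unfolding G by (simp flip: comp_assoc add: assms(1))
qed

lemma hyperbolic_mobius_conj:
  assumes "mobius \<psi>" "ratmap d F" "ratmap d' G" "\<psi> \<circ> F = G \<circ> \<psi>"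
  shows "hyperbolic F \<longleftrightarrow> hyperbolic G"
proof -
  obtain \<psi>' where \<psi>': "mobius \<psi>'" "\<psi>' \<circ> \<psi> = id" "\<psi> \<circ> \<psi>' = id" by (rule mobius_inverse[OF assms(1)])
  show ?thesis
    using hyperbolic_mobius_imp[OF assms] hyperbolic_mobius_imp[OF \<psi>'(1) assms(3,2) conj_swap(1)[OF \<psi>'(2,3) assms(4)]]
    by blast
qed

subsection \<open>From the upper half-plane to the disk\<close>

lemma cayley_mob: "cayley = mob 1 (- \<i>) 1 \<i>"
  by (simp add: cayley_def mob_def)

lemma inv_s_mob: "inv_s = mob 0 1 1 0"
  by (simp add: inv_s_def mob_def one_pCons)

lemma mobius_cayley: "mobius cayley" and mobius_inv_s: "mobius inv_s"
proof -
  have "(1::complex) * \<i> - (- \<i>) * 1 ~= 0" "(0::complex) * 0 - 1 * 1 ~= 0" by (auto simp: complex_eq_iff)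
  then show "mobius cayley" "mobius inv_s" unfolding mobius_def cayley_mob inv_s_mob by blast+
qed

lemma cayley_hpt: "u ~= 0 \<or> v ~= 0 ==> cayley (hpt u v) = hpt (u - \<i> * v) (u + \<i> * v)"
  unfolding cayley_mob by (subst mob_hpt) (auto simp: complex_eq_iff)

lemma cayley_nonzero: "u ~= 0 \<or> v ~= 0 ==> u - \<i> * v ~= 0 \<or> u + \<i> * v ~= 0"
proof -
  assume "u ~= 0 \<or> v ~= 0"
  moreover have "2 * u = (u - \<i> * v) + (u + \<i> * v)" "2 * \<i> * v = (u + \<i> * v) - (u - \<i> * v)" by simp_all
  ultimately show ?thesis by (metis add.right_neutral diff_self i_times_eq_iff mult_eq_0_iff complex_i_not_zero zero_neq_numeral)
qed

lemma inv_s_hpt: "u ~= 0 \<or> v ~= 0 ==> inv_s (hpt u v) = hpt v u"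
  unfolding inv_s_mob by (subst mob_hpt) auto

text \<open>Compatibility with the two reflections makes the real circle and the unit circle
  correspond as their fixed sets, and lets symmetric maps be conjugated to symmetric maps.\<close>

definition upper_map :: "(sphere => sphere) => bool" where
  "upper_map \<psi> \<longleftrightarrow> mobius \<psi> \<and> (\<forall>z. \<psi> (scnj z) = srefl (\<psi> z)) \<and> (\<forall>z. \<psi> z \<in> sdisk \<longleftrightarrow> z \<in> Hplus)"

lemma norm_less_iff_square: "norm x < norm y \<longleftrightarrow> (norm x)\<^sup>2 < (norm y)\<^sup>2"
  by (meson norm_ge_zero power2_less_imp_less power_strict_mono zero_less_numeral)

lemma norm_eq_iff_square: "norm x = norm y \<longleftrightarrow> (norm x)\<^sup>2 = (norm y)\<^sup>2"
  by (simp add: power2_eq_iff_nonneg)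

lemma upper_map_cayley: "upper_map cayley"
  unfolding upper_map_def
proof (intro conjI allI mobius_cayley)
  fix z
  obtain u v where z: "z = hpt u v" "u ~= 0 \<or> v ~= 0" by (rule hpt_cases)
  have cz: "cnj u ~= 0 \<or> cnj v ~= 0" using z(2) by simp
  show "cayley (scnj z) = srefl (cayley z)"
    unfolding z(1) scnj_hpt cayley_hpt[OF cz] cayley_hpt[OF z(2)] srefl_hpt[OF cayley_nonzero[OF z(2)]] by simp
  have "(cmod (u + \<i> * v))\<^sup>2 - (cmod (u - \<i> * v))\<^sup>2 = 4 * Im (u * cnj v)"
    unfolding cmod_power2 by (simp add: algebra_simps power2_eq_square)
  then have "cmod (u - \<i> * v) < cmod (u + \<i> * v) \<longleftrightarrow> Im (u * cnj v) > 0"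
    by (simp only: norm_less_iff_square) auto
  then show "cayley z \<in> sdisk \<longleftrightarrow> z \<in> Hplus"
    unfolding z(1) cayley_hpt[OF z(2)] sdisk_hpt[OF cayley_nonzero[OF z(2)]] Hplus_hpt[OF z(2)] .
qed

lemma disk_aut_cases:
  assumes "disk_aut \<phi>"
  obtains t b where "cmod b < 1" "mobius \<phi>"
    "\<And>u v. u ~= 0 \<or> v ~= 0 ==> \<phi> (hpt u v) = hpt (cis t * (u - b * v)) (v - cnj b * u) \<and>
       (cis t * (u - b * v) ~= 0 \<or> v - cnj b * u ~= 0)"
proof -
  obtain t b where tb: "cmod b < 1" "\<phi> = mob (cis t) (- cis t * b) (- cnj b) 1"
    using assms unfolding disk_aut_def mob_def by blast
  have det: "cis t * 1 - (- cis t * b) * (- cnj b) = cis t * of_real (1 - (cmod b)\<^sup>2)"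
    using complex_norm_square[of b] by (simp add: algebra_simps)
  have "1 - (cmod b)\<^sup>2 ~= 0" using sq_less_1[OF tb(1)] by simp
  then have det0: "cis t * 1 - (- cis t * b) * (- cnj b) ~= 0" unfolding det mult_eq_0_iff of_real_eq_0_iff by (simp only: cis_neq_zero not_False_eq_True simp_thms)
  have "mobius \<phi>" unfolding mobius_def tb(2) using det0 by blast
  moreover have "\<phi> (hpt u v) = hpt (cis t * (u - b * v)) (v - cnj b * u) \<and>
       (cis t * (u - b * v) ~= 0 \<or> v - cnj b * u ~= 0)" if "u ~= 0 \<or> v ~= 0" for u v
    using mob_hpt[OF det0 that] mob_nonzero[OF det0 that] by (simp add: tb(2) algebra_simps)
  ultimately show thesis using that tb(1) by blast
qed

lemma disk_aut_srefl:
  assumes "disk_aut \<phi>"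
  shows "\<phi> (srefl z) = srefl (\<phi> z)" "\<phi> z \<in> sdisk \<longleftrightarrow> z \<in> sdisk" "\<phi> z \<in> unit_circle \<longleftrightarrow> z \<in> unit_circle"
proof -
  obtain t b where b: "cmod b < 1" and mob: "mobius \<phi>"
    and \<phi>: "\<And>u v. u ~= 0 \<or> v ~= 0 ==> \<phi> (hpt u v) = hpt (cis t * (u - b * v)) (v - cnj b * u) \<and>
       (cis t * (u - b * v) ~= 0 \<or> v - cnj b * u ~= 0)" using disk_aut_cases[OF assms] by metis
  obtain u v where z: "z = hpt u v" "u ~= 0 \<or> v ~= 0" by (rule hpt_cases)
  have cz: "cnj v ~= 0 \<or> cnj u ~= 0" using z(2) by auto
  have c: "cis t * cnj (cis t) = 1" by (simp add: complex_norm_square[symmetric])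
  have "\<phi> (srefl z) = hpt (cis t * (cnj v - b * cnj u)) (cnj u - cnj b * cnj v)"
    unfolding z(1) srefl_hpt[OF z(2)] using \<phi>[OF cz] by blast
  also have "\<dots> = hpt (cis t * cnj (v - cnj b * u)) (cis t * cnj (cis t * (u - b * v)))"
    using c by (simp add: mult.assoc[symmetric])
  also have "\<dots> = hpt (cnj (v - cnj b * u)) (cnj (cis t * (u - b * v)))" by (rule hpt_scale) simp
  also have "\<dots> = srefl (\<phi> z)" unfolding z(1) using \<phi>[OF z(2)] srefl_hpt by simp
  finally show "\<phi> (srefl z) = srefl (\<phi> z)" .
  have id: "(cmod (v - cnj b * u))\<^sup>2 - (cmod (u - b * v))\<^sup>2 = (1 - (cmod b)\<^sup>2) * ((cmod v)\<^sup>2 - (cmod u)\<^sup>2)"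
    unfolding cmod_power2 by (simp add: algebra_simps power2_eq_square)
  have p: "1 - (cmod b)\<^sup>2 > 0" using sq_less_1[OF b] by simp
  have "cmod (u - b * v) < cmod (v - cnj b * u) \<longleftrightarrow> (cmod (v - cnj b * u))\<^sup>2 - (cmod (u - b * v))\<^sup>2 > 0"
    by (simp only: norm_less_iff_square) simp
  also have "\<dots> \<longleftrightarrow> (cmod v)\<^sup>2 - (cmod u)\<^sup>2 > 0" unfolding id using p by (simp add: zero_less_mult_iff)
  also have "\<dots> \<longleftrightarrow> cmod u < cmod v" by (simp only: norm_less_iff_square) simp
  finally show 1: "\<phi> z \<in> sdisk \<longleftrightarrow> z \<in> sdisk"
    unfolding z(1) conjunct1[OF \<phi>[OF z(2)]] sdisk_hpt[OF z(2)] sdisk_hpt[OF conjunct2[OF \<phi>[OF z(2)]]]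
    by (simp add: norm_mult)
  have "cmod (u - b * v) = cmod (v - cnj b * u) \<longleftrightarrow> (cmod (v - cnj b * u))\<^sup>2 - (cmod (u - b * v))\<^sup>2 = 0"
    by (simp only: norm_eq_iff_square) auto
  also have "\<dots> \<longleftrightarrow> (cmod v)\<^sup>2 - (cmod u)\<^sup>2 = 0" unfolding id using p by simp
  also have "\<dots> \<longleftrightarrow> cmod u = cmod v" by (simp only: norm_eq_iff_square) auto
  finally show "\<phi> z \<in> unit_circle \<longleftrightarrow> z \<in> unit_circle"
    unfolding z(1) conjunct1[OF \<phi>[OF z(2)]] circle_hpt[OF z(2)] circle_hpt[OF conjunct2[OF \<phi>[OF z(2)]]]
    by (simp add: norm_mult)
qed

lemma upper_map_disk_aut:
  assumes "disk_aut \<phi>" "upper_map \<psi>"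
  shows "upper_map (\<phi> \<circ> \<psi>)"
  using assms(2) disk_aut_srefl[OF assms(1)] mobius_compose disk_aut_cases[OF assms(1)]
  unfolding upper_map_def by (metis comp_apply)

lemma inv_s_srefl: "inv_s (srefl z) = srefl (inv_s z)"
proof -
  obtain u v where z: "z = hpt u v" "u ~= 0 \<or> v ~= 0" by (rule hpt_cases)
  have "cnj v ~= 0 \<or> cnj u ~= 0" "v ~= 0 \<or> u ~= 0" using z(2) by auto
  then show ?thesis using z by (simp add: srefl_hpt inv_s_hpt)
qed

lemma inv_s_inv_s [simp]: "inv_s (inv_s z) = z"
proof -
  obtain u v where z: "z = hpt u v" "u ~= 0 \<or> v ~= 0" by (rule hpt_cases)
  then show ?thesis by (auto simp: inv_s_hpt disj_commute)
qed

lemma inv_s_Some: "w ~= 0 ==> inv_s (Some w) = Some (1 / w)" and inv_s_0 [simp]: "inv_s (Some 0) = None"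
  and inv_s_None [simp]: "inv_s None = Some 0"
  using inv_s_hpt[of w 1] inv_s_hpt[of 0 1] inv_s_hpt[of 1 0] by (auto simp: hpt_def)

lemma Rhat_halves: "z \<in> Rhat \<or> z \<in> Hplus \<or> scnj z \<in> Hplus"
  and Rhat_not_Hplus: "z \<in> Hplus ==> z \<notin> Rhat" "z \<in> Hplus ==> scnj z \<notin> Hplus"
  by (cases z; auto simp: Rhat_def scnj_def complex_is_Real_iff image_iff elim!: Reals_cases)+

lemma connected_Hplus: "connected Hplus" and open_Hplus: "open Hplus"
proof -
  have "convex {w. Im w > 0}" by (rule convex_halfspace_Im_gt)
  then show "connected Hplus"
    unfolding Hplus_def by (intro connected_continuous_image continuous_on_Some convex_connected)
  show "open Hplus"
    using open_ichart_image[of "{w. Im w > 0}" "Some 0"] open_halfspace_Im_gt[of 0]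
    by (simp add: Hplus_def ichart_def)
qed

lemma half_plane_cases:
  assumes F: "ratmap d F" and inv: "\<And>z. F z \<in> Rhat \<longleftrightarrow> z \<in> Rhat"
  shows "(\<forall>z\<in>Hplus. F z \<in> Hplus) \<or> (\<forall>z\<in>Hplus. scnj (F z) \<in> Hplus)"
proof -
  let ?V = "scnj -` Hplus"
  have "connected (F ` Hplus)"
    by (rule connected_continuous_image[OF ratmap_continuous_on[OF F] connected_Hplus])
  moreover have "open ?V" by (intro open_vimage open_Hplus continuous_on_scnj)
  moreover have "Hplus \<inter> ?V \<inter> F ` Hplus = {}" using Rhat_not_Hplus by auto
  moreover have "F ` Hplus \<subseteq> Hplus \<union> ?V" using Rhat_halves Rhat_not_Hplus inv by blast
  ultimately have "Hplus \<inter> F ` Hplus = {} \<or> ?V \<inter> F ` Hplus = {}"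
    using connectedD[of "F ` Hplus" Hplus ?V] open_Hplus by blast
  then show ?thesis using \<open>F ` Hplus \<subseteq> Hplus \<union> ?V\<close> by blast
qed

text \<open>The conjugated map commutes with the reflection; its zeros lie in the disk because the
  lower half-plane is mapped to itself as well. The point \<open>z0\<close> determines which zero is
  listed last.\<close>

theorem real_map_is_blaschke:
  assumes F: "rrat d F" and pres: "\<forall>z\<in>Hplus. F z \<in> Hplus" and inv: "\<And>z. F z \<in> Rhat \<longleftrightarrow> z \<in> Rhat"
    and \<psi>: "upper_map \<psi>" and r: "\<psi> z0 = Some r" "\<psi> (F z0) = Some 0"
  shows "\<exists>s a. bdata s a d \<and> a (d - 1) = r \<and> \<psi> \<circ> F = bmap s a d \<circ> \<psi>"
proof -
  have m\<psi>: "mobius \<psi>" "\<And>z. \<psi> (scnj z) = srefl (\<psi> z)" "\<And>z. \<psi> z \<in> sdisk \<longleftrightarrow> z \<in> Hplus"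
    using \<psi> by (auto simp: upper_map_def)
  obtain \<psi>' where \<psi>': "mobius \<psi>'" "\<psi>' \<circ> \<psi> = id" "\<psi> \<circ> \<psi>' = id" by (rule mobius_inverse[OF m\<psi>(1)])
  have i: "\<psi>' (\<psi> x) = x" "\<psi> (\<psi>' x) = x" for x using \<psi>' by (simp_all add: fun_eq_iff)
  define B where "B = \<psi> \<circ> F \<circ> \<psi>'"
  have s': "\<psi>' (srefl x) = scnj (\<psi>' x)" for x
    using m\<psi>(2)[of "\<psi>' x"] i(1)[of "scnj (\<psi>' x)"] by (simp add: i)
  have "\<exists>s a. bdata s a d \<and> a (d - 1) = r \<and> B = bmap s a d"
  proof (rule symmetric_ratmap_is_blaschke)
    show "ratmap d B" unfolding B_def
      by (intro ratmap_pre_mobius ratmap_post_mobius \<psi>'(1) m\<psi>(1) rrat_ratmap[OF F])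
    show "B (srefl z) = srefl (B z)" for z
      by (simp add: B_def s' rrat_scnj[OF F] m\<psi>(2))
    show "B (Some r) = Some 0" using r i(1)[of z0] by (simp add: B_def)
    fix z assume "B z = Some 0"
    then have "F (\<psi>' z) \<in> Hplus" using m\<psi>(3)[of "F (\<psi>' z)"] by (simp add: B_def)
    moreover have "scnj (F (\<psi>' z)) \<in> Hplus" if "scnj (\<psi>' z) \<in> Hplus"
      using bspec[OF pres that] rrat_scnj[OF F, of "\<psi>' z"] by simp
    ultimately have "\<psi>' z \<in> Hplus" using Rhat_halves[of "\<psi>' z"] Rhat_not_Hplus[of "F (\<psi>' z)"] inv[of "\<psi>' z"] by blast
    then show "z \<in> sdisk" using m\<psi>(3)[of "\<psi>' z"] i by simp
  qed
  then obtain s a where sa: "bdata s a d" "a (d - 1) = r" "B = bmap s a d" by blast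
  have "\<psi> \<circ> F = B \<circ> \<psi>" by (simp add: B_def comp_assoc \<psi>'(2))
  then show ?thesis using sa by blast
qed

text \<open>Post-composition with 1/z exchanges the sides of the circle once more and leaves a map
  preserving them.\<close>

theorem real_map_is_inverse_blaschke:
  assumes F: "rrat d F" and swap: "\<forall>z\<in>Hplus. scnj (F z) \<in> Hplus" and inv: "\<And>z. F z \<in> Rhat \<longleftrightarrow> z \<in> Rhat"
    and \<psi>: "upper_map \<psi>" and r: "\<psi> z0 = Some r" "\<psi> (F z0) = None"
  shows "\<exists>s a. bdata s a d \<and> a (d - 1) = r \<and> \<psi> \<circ> F = inv_s \<circ> bmap s a d \<circ> \<psi>"
proof -
  have m\<psi>: "mobius \<psi>" "\<And>z. \<psi> (scnj z) = srefl (\<psi> z)" "\<And>z. \<psi> z \<in> sdisk \<longleftrightarrow> z \<in> Hplus"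
    using \<psi> by (auto simp: upper_map_def)
  obtain \<psi>' where \<psi>': "mobius \<psi>'" "\<psi>' \<circ> \<psi> = id" "\<psi> \<circ> \<psi>' = id" by (rule mobius_inverse[OF m\<psi>(1)])
  have i: "\<psi>' (\<psi> x) = x" "\<psi> (\<psi>' x) = x" for x using \<psi>' by (simp_all add: fun_eq_iff)
  define B where "B = inv_s \<circ> (\<psi> \<circ> F \<circ> \<psi>')"
  have s': "\<psi>' (srefl x) = scnj (\<psi>' x)" for x
    using m\<psi>(2)[of "\<psi>' x"] i(1)[of "scnj (\<psi>' x)"] by (simp add: i)
  have "\<exists>s a. bdata s a d \<and> a (d - 1) = r \<and> B = bmap s a d"
  proof (rule symmetric_ratmap_is_blaschke)
    show "ratmap d B" unfolding B_def
      by (intro ratmap_pre_mobius ratmap_post_mobius \<psi>'(1) m\<psi>(1) mobius_inv_s rrat_ratmap[OF F])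
    show "B (srefl z) = srefl (B z)" for z
      by (simp add: B_def s' rrat_scnj[OF F] m\<psi>(2) inv_s_srefl)
    show "B (Some r) = Some 0" using r i(1)[of z0] by (simp add: B_def)
    fix z assume "B z = Some 0"
    then have "\<psi> (F (\<psi>' z)) = None" using inv_s_inv_s[of "\<psi> (F (\<psi>' z))"] by (simp add: B_def)
    then have "scnj (F (\<psi>' z)) \<in> Hplus" using m\<psi>(3)[of "scnj (F (\<psi>' z))"] by (simp add: m\<psi>(2))
    moreover have "F (\<psi>' z) \<in> Hplus" if "scnj (\<psi>' z) \<in> Hplus"
      using bspec[OF swap that] by (simp add: rrat_scnj[OF F])
    ultimately have "\<psi>' z \<in> Hplus"
      using Rhat_halves[of "\<psi>' z"] Rhat_not_Hplus[of "F (\<psi>' z)"] inv[of "\<psi>' z"]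
        Rhat_not_Hplus(1)[of "scnj (F (\<psi>' z))"] by (metis Rhat_iff)
    then show "z \<in> sdisk" using m\<psi>(3)[of "\<psi>' z"] i by simp
  qed
  then obtain s a where sa: "bdata s a d" "a (d - 1) = r" "B = bmap s a d" by blast
  have "\<psi> \<circ> F = inv_s \<circ> B \<circ> \<psi>" by (simp add: B_def fun_eq_iff i)
  then show ?thesis using sa by blast
qed

section \<open>Blaschke maps and their reflections\<close>

lemma srefl_inv_s: "srefl z = inv_s (scnj z)"
proof -
  obtain u v where z: "z = hpt u v" "u ~= 0 \<or> v ~= 0" by (rule hpt_cases)
  then have "cnj u ~= 0 \<or> cnj v ~= 0" by simp
  then show ?thesis using z by (simp add: srefl_hpt inv_s_hpt scnj_hpt)
qed

lemma dist_inv_s [simp]: "dist (inv_s x) (inv_s y) = dist x y"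
proof -
  obtain u v where x: "x = hpt u v" "u ~= 0 \<or> v ~= 0" by (rule hpt_cases)
  obtain u' v' where y: "y = hpt u' v'" "u' ~= 0 \<or> v' ~= 0" by (rule hpt_cases)
  show ?thesis unfolding x(1) y(1) inv_s_hpt[OF x(2)] inv_s_hpt[OF y(2)] by (rule dist_hpt_swap[OF x(2) y(2)])
qed

lemma dist_srefl [simp]: "dist (srefl x) (srefl y) = dist x y"
  by (simp add: srefl_inv_s)

text \<open>The flag \<open>k\<close> says whether the map exchanges the two sides of the circle. In that case the
  dynamics inside the disk is that of the anti-Blaschke product, up to reflections.\<close>

definition dF :: "bool => complex => (nat => complex) => nat => sphere => sphere" where
  "dF k s a d = (if k then inv_s \<circ> bmap s a d else bmap s a d)"

definition dT :: "bool => complex => (nat => complex) => nat => complex => complex" where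
  "dT k s a d z = (if k then cnj (bprod s a d z) else bprod s a d z)"

definition refl_if :: "bool => sphere => sphere" where
  "refl_if k = (if k then srefl else id)"

lemma dist_refl_if_funpow: "dist ((refl_if k ^^ n) x) ((refl_if k ^^ n) y) = dist x y"
  by (induction n arbitrary: x y) (auto simp: refl_if_def)

lemma refl_if_circle: "z \<in> unit_circle ==> (refl_if k ^^ n) z = z"
  by (induction n) (auto simp: refl_if_def srefl_circle)

lemma ratmap_dF: "bdata s a d ==> ratmap d (dF k s a d)"
  by (simp add: dF_def ratmap_bmap ratmap_post_mobius[OF mobius_inv_s])

lemma cmod_dT:
  assumes "bdata s a d"
  shows "cmod z < 1 ==> cmod (dT k s a d z) < 1" "cmod z = 1 ==> cmod (dT k s a d z) = 1"
    "cmod z \<le> 1 ==> cmod (dT k s a d z) \<le> 1"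
proof -
  show 1: "cmod z < 1 ==> cmod (dT k s a d z) < 1"
    using cmod_bprod_less_1[of s d a z] assms by (auto simp: dT_def bdata_def)
  show 2: "cmod z = 1 ==> cmod (dT k s a d z) = 1"
    using cmod_bprod_eq_1[of s d a z] assms by (auto simp: dT_def bdata_def)
  show "cmod z \<le> 1 ==> cmod (dT k s a d z) \<le> 1" using 1 2 by fastforce
qed

lemma continuous_on_dT:
  assumes "bdata s a d"
  shows "continuous_on (cball 0 1) (dT k s a d)"
proof (cases k)
  case True
  then have "dT k s a d = (\<lambda>z. cnj (bprod s a d z))" by (simp add: dT_def fun_eq_iff)
  then show ?thesis using assms continuous_on_bprod[of d a s] by (auto simp: bdata_def intro!: continuous_on_cnj)
next
  case False
  then have "dT k s a d = bprod s a d" by (simp add: dT_def fun_eq_iff)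
  then show ?thesis using assms continuous_on_bprod[of d a s] by (simp add: bdata_def)
qed

lemma dF_Some:
  assumes "bdata s a d" "cmod z \<le> 1"
  shows "dF k s a d (Some z) = refl_if k (Some (dT k s a d z))"
  using bmap_Some[OF assms] by (simp add: dF_def dT_def refl_if_def srefl_inv_s scnj_def)

lemma dF_srefl: "bdata s a d ==> dF k s a d (srefl z) = srefl (dF k s a d z)"
  by (simp add: dF_def bmap_srefl inv_s_srefl)

lemma inv_s_circle: "inv_s z \<in> unit_circle \<longleftrightarrow> z \<in> unit_circle"
proof -
  obtain u v where z: "z = hpt u v" "u ~= 0 \<or> v ~= 0" by (rule hpt_cases)
  then have "v ~= 0 \<or> u ~= 0" by auto
  then show ?thesis using z by (auto simp: inv_s_hpt circle_hpt)
qed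

lemma dF_circle: "bdata s a d ==> dF k s a d z \<in> unit_circle \<longleftrightarrow> z \<in> unit_circle"
  by (simp add: dF_def bmap_regions inv_s_circle)

lemma dF_funpow_srefl: "bdata s a d ==> (dF k s a d ^^ n) (srefl z) = srefl ((dF k s a d ^^ n) z)"
  by (induction n) (simp_all add: dF_srefl)

lemma dF_refl_if: "bdata s a d ==> dF k s a d ((refl_if l ^^ n) z) = (refl_if l ^^ n) (dF k s a d z)"
  by (cases l; induction n) (simp_all add: refl_if_def dF_srefl)

text \<open>On the closed disk \<open>dF\<close> is \<open>dT\<close> followed by a reflection if
  \<open>k\<close> holds, and it commutes with reflections, so these collect in front. Being
  isometries, they do not affect distances between orbits, so that the dynamics of \<open>dT\<close>
  in the disk decides.\<close>

lemma dF_funpow: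
  assumes b: "bdata s a d" and z: "cmod z \<le> 1"
  shows "(dF k s a d ^^ n) (Some z) = (refl_if k ^^ n) (Some ((dT k s a d ^^ n) z))"
    and "cmod ((dT k s a d ^^ n) z) \<le> 1"
proof -
  have "(dF k s a d ^^ n) (Some z) = (refl_if k ^^ n) (Some ((dT k s a d ^^ n) z)) \<and> cmod ((dT k s a d ^^ n) z) \<le> 1"
  proof (induction n)
    case (Suc n)
    then show ?case
      using dF_Some[OF b, of "(dT k s a d ^^ n) z" k] cmod_dT(3)[OF b, of "(dT k s a d ^^ n) z" k]
      by (simp add: dF_refl_if[OF b] funpow_swap1)
  qed (use z in simp)
  then show "(dF k s a d ^^ n) (Some z) = (refl_if k ^^ n) (Some ((dT k s a d ^^ n) z))"
    "cmod ((dT k s a d ^^ n) z) \<le> 1" by auto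
qed

lemma dF_circle_funpow: "bdata s a d ==> (dF k s a d ^^ n) z \<in> unit_circle \<longleftrightarrow> z \<in> unit_circle"
  by (induction n) (simp_all add: dF_circle)

lemma julia_dF_circle:
  assumes b: "bdata s a d"
  shows "julia (dF k s a d) \<subseteq> unit_circle"
proof -
  have "- unit_circle \<subseteq> fatou (dF k s a d)"
  proof (rule omit_three_fatou[OF ratmap_dF[OF b], where m = 1 and a = "Some 1" and b = "Some (-1)" and c = "Some \<i>"])
    show "open (- unit_circle)" using closed_unit_circle by blast
    fix n x assume "x \<in> - unit_circle"
    then have "(dF k s a d ^^ (1 * n)) x \<notin> unit_circle" using dF_circle_funpow[OF b] by simp
    then show "(dF k s a d ^^ (1 * n)) x \<notin> {Some 1, Some (-1), Some \<i>}" by auto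
  qed (auto simp: complex_eq_iff)
  then show ?thesis using julia_iff by blast
qed

lemma sder_inv_s:
  assumes "w ~= 0"
  shows "sder inv_s (Some w) = - (1 / w\<^sup>2)"
proof (rule sder_Some)
  have "\<forall>\<^sub>F x in nhds w. x ~= 0" using assms by (rule t1_space_nhds)
  then show "\<forall>\<^sub>F x in nhds w. inv_s (Some x) = Some (1 / x)"
    by (rule eventually_mono) (simp add: inv_s_Some)
  show "((\<lambda>x. 1 / x) has_field_derivative - (1 / w\<^sup>2)) (at w)"
    using assms by (auto intro!: derivative_eq_intros simp: power2_eq_square)
qed

lemma isCont_eventually_ne:
  fixes f :: "'a::t2_space => 'b::t1_space"
  assumes "isCont f w" "f w ~= c"
  shows "\<forall>\<^sub>F x in nhds w. f x ~= c"
proof -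
  have "(f \<longlongrightarrow> f w) (nhds w)" using assms(1) unfolding isCont_def tendsto_at_iff_tendsto_nhds .
  then show ?thesis using assms(2) by (rule tendsto_imp_eventually_ne)
qed

lemma bmap_Some_near_circle:
  assumes b: "bdata s a d" and w: "cmod w = 1"
  shows "\<forall>\<^sub>F x in nhds w. bmap s a d (Some x) = Some (bprod s a d x)"
proof -
  have "\<forall>\<^sub>F x in nhds w. \<forall>i\<in>{..<d}. 1 - cnj (a i) * x ~= 0"
  proof (rule eventually_ball_finite[OF finite_lessThan], rule ballI)
    fix i assume "i \<in> {..<d}"
    then have "1 - cnj (a i) * w ~= 0" using bfac_denom_nonzero b w by (simp add: bdata_def)
    moreover have "isCont (\<lambda>x. 1 - cnj (a i) * x) w" by (intro continuous_intros)
    ultimately show "\<forall>\<^sub>F x in nhds w. 1 - cnj (a i) * x ~= 0"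
      by (rule isCont_eventually_ne[rotated])
  qed
  then show ?thesis
  proof (rule eventually_mono)
    fix x assume "\<forall>i\<in>{..<d}. 1 - cnj (a i) * x ~= 0"
    then have "(\<Prod>i<d. 1 - cnj (a i) * x) ~= 0" by simp
    then show "bmap s a d (Some x) = Some (bprod s a d x)"
      by (simp add: bmap_def rat_eval_def poly_bnum poly_bden bprod_def bfac_def prod_dividef)
  qed
qed

lemma cmod_sder_dF:
  assumes b: "bdata s a d" and w: "cmod w = 1"
  shows "cmod (sder (dF k s a d) (Some w)) = blam a d w"
proof -
  have a: "\<And>i. i < d ==> cmod (a i) < 1" and s: "cmod s = 1" and d: "d > 0" using b by (auto simp: bdata_def)
  have 1: "sder (bmap s a d) (Some w) = bprod s a d w * of_real (blam a d w) / w"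
    by (rule sder_Some[OF bmap_Some_near_circle[OF b w] bprod_derivative_circle[OF a w]])
  have 2: "cmod (bprod s a d w) = 1" by (rule cmod_bprod_eq_1[OF s a w])
  have pos: "blam a d w > 0" by (rule blam_pos[OF a d w])
  have 3: "cmod (sder (bmap s a d) (Some w)) = blam a d w"
    using pos by (simp add: 1 2 norm_mult norm_divide w)
  show ?thesis
  proof (cases k)
    case True
    have "sder (inv_s \<circ> bmap s a d) (Some w) = sder inv_s (bmap s a d (Some w)) * sder (bmap s a d) (Some w)"
      by (rule sdiff_compose(2)[OF ratmap_sdiff[OF ratmap_bmap[OF b]] ratmap_sdiff[OF mobius_ratmap[OF mobius_inv_s]]])
    moreover have "bmap s a d (Some w) = Some (bprod s a d w)" by (rule bmap_Some[OF b]) (simp add: w)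
    moreover have "bprod s a d w ~= 0" using 2 by auto
    ultimately show ?thesis using 3 True by (simp add: dF_def sder_inv_s norm_mult norm_divide norm_power 2)
  qed (simp add: dF_def 3)
qed

lemma not_critical_dF:
  assumes b: "bdata s a d" and c: "critical (dF k s a d) c"
  shows "c \<notin> unit_circle"
proof
  assume "c \<in> unit_circle"
  then obtain w where w: "c = Some w" "cmod w = 1" by (auto simp: unit_circle_def)
  have "blam a d w > 0" using b w by (intro blam_pos) (auto simp: bdata_def)
  then show False using c cmod_sder_dF[OF b w(2), of k] by (simp add: w critical_iff_sder)
qed

section \<open>Fixed points: the Denjoy--Wolff alternative\<close>

text \<open>\<Lambda> extends (1 - |B|^2) / (1 - |z|^2) continuously to the closed disk; its
  boundary values are the moduli of the derivative. The recursion comes from 1 - |f g|^2 = (1 -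
  |f|^2) + |f|^2 (1 - |g|^2).\<close>

lemma bprod_defect:
  assumes "\<And>i. i < d ==> cmod (a i) < 1"
  shows "\<exists>\<Lambda>. continuous_on (cball 0 1) \<Lambda> \<and> (\<forall>w. cmod w = 1 --> \<Lambda> w = blam a d w) \<and>
    (\<forall>z. cmod z \<le> 1 --> 1 - (cmod (bprod 1 a d z))\<^sup>2 = \<Lambda> z * (1 - (cmod z)\<^sup>2))"
  using assms
proof (induction d)
  case 0
  show ?case by (rule exI[of _ "\<lambda>_. 0"]) (simp add: bprod_def blam_def)
next
  case (Suc d)
  obtain \<Lambda> where \<Lambda>: "continuous_on (cball 0 1) \<Lambda>" "\<And>w. cmod w = 1 ==> \<Lambda> w = blam a d w"
    "\<And>z. cmod z \<le> 1 ==> 1 - (cmod (bprod 1 a d z))\<^sup>2 = \<Lambda> z * (1 - (cmod z)\<^sup>2)"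
    using Suc by (metis less_Suc_eq)
  let ?m = "\<lambda>z. (1 - (cmod (a d))\<^sup>2) / (cmod (1 - cnj (a d) * z))\<^sup>2"
  let ?M = "\<lambda>z. \<Lambda> z + (cmod (bprod 1 a d z))\<^sup>2 * ?m z"
  have a: "cmod (a d) < 1" "\<And>i. i < d ==> cmod (a i) < 1" using Suc.prems by auto
  have nz: "1 - cnj (a d) * z ~= 0" if "cmod z \<le> 1" for z using bfac_denom_nonzero a that by blast
  have bS: "bprod 1 a (Suc d) z = bprod 1 a d z * bfac (a d) z" for z by (simp add: bprod_def)
  have "continuous_on (cball 0 1) ?M"
    using nz by (intro continuous_intros \<Lambda>(1) continuous_on_bprod a) auto
  moreover have "?M w = blam a (Suc d) w" if w: "cmod w = 1" for w
    using cmod_bprod_eq_1[of 1 d a w] a w \<Lambda>(2)[OF w] by (simp add: blam_def cmod_denom_circle)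
  moreover have "1 - (cmod (bprod 1 a (Suc d) z))\<^sup>2 = ?M z * (1 - (cmod z)\<^sup>2)" if z: "cmod z \<le> 1" for z
  proof -
    have "1 - (cmod (bprod 1 a (Suc d) z))\<^sup>2 =
        (1 - (cmod (bprod 1 a d z))\<^sup>2) + (cmod (bprod 1 a d z))\<^sup>2 * (1 - (cmod (bfac (a d) z))\<^sup>2)"
      by (simp add: bS norm_mult power_mult_distrib algebra_simps)
    then show ?thesis unfolding \<Lambda>(3)[OF z] one_minus_sq_bfac[OF a(1) z] by (simp add: algebra_simps)
  qed
  ultimately show ?case by blast
qed

lemma cmod_bprod_1: "cmod s = 1 ==> cmod (bprod s a d z) = cmod (bprod 1 a d z)"
  by (simp add: bprod_def norm_mult)

text \<open>Brouwer's theorem gives fixed points \<open>z n\<close> of r n * T with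
  \<open>r n\<close> tending to 1. From |z n| \<le> |T (z n)| follows \<Lambda> (z n) \<le> 1, and
  this survives the limit: an accumulation point on the circle is a fixed point with derivative of
  modulus at most 1. Only moduli enter, so conjugated products are covered.\<close>

theorem denjoy_wolff:
  assumes b: "bdata s a d"
  shows "(\<exists>z. cmod z < 1 \<and> dT k s a d z = z) \<or> (\<exists>w. cmod w = 1 \<and> dT k s a d w = w \<and> blam a d w \<le> 1)"
proof -
  let ?T = "dT k s a d"
  have a: "\<And>i. i < d ==> cmod (a i) < 1" and s: "cmod s = 1" and d: "d > 0" using b by (auto simp: bdata_def)
  obtain \<Lambda> where \<Lambda>: "continuous_on (cball 0 1) \<Lambda>" "\<And>w. cmod w = 1 ==> \<Lambda> w = blam a d w"
    "\<And>z. cmod z \<le> 1 ==> 1 - (cmod (bprod 1 a d z))\<^sup>2 = \<Lambda> z * (1 - (cmod z)\<^sup>2)"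
    using bprod_defect[of d a] a by blast
  define r :: "nat => real" where "r n = 1 - inverse (real (Suc n))" for n
  have r: "0 \<le> r n" "r n < 1" for n by (auto simp: r_def field_simps)
  have "(\<lambda>n. 1 - inverse (real (Suc n))) \<longlonglongrightarrow> 1 - 0" by (intro tendsto_diff tendsto_const LIMSEQ_inverse_real_of_nat)
  then have rlim: "r \<longlonglongrightarrow> 1" by (simp add: r_def[abs_def])
  have "\<exists>z\<in>cball 0 1. of_real (r n) * ?T z = z" for n
  proof (rule brouwer[OF compact_cball convex_cball])
    show "continuous_on (cball 0 1) (\<lambda>z. of_real (r n) * ?T z)"
      by (intro continuous_intros continuous_on_dT[OF b])
    show "(\<lambda>z. of_real (r n) * ?T z) \<in> cball 0 1 \<rightarrow> cball 0 1"
    proof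
      fix z :: complex assume "z \<in> cball 0 1"
      then have "cmod (?T z) \<le> 1" using cmod_dT(3)[OF b] by simp
      then have "r n * cmod (?T z) \<le> 1 * 1" using r[of n] by (intro mult_mono) auto
      then show "of_real (r n) * ?T z \<in> cball 0 1" using r[of n] by (simp add: norm_mult)
    qed
  qed (simp, blast)
  then obtain z where z: "\<And>n. z n \<in> cball 0 1" "\<And>n. of_real (r n) * ?T (z n) = z n" by metis
  have le: "cmod (z n) < 1" "\<Lambda> (z n) \<le> 1" for n
  proof -
    have T1: "cmod (?T (z n)) \<le> 1" using cmod_dT(3)[OF b] z(1)[of n] by simp
    have eq: "cmod (z n) = r n * cmod (?T (z n))"
      using arg_cong[OF z(2)[of n], of cmod] r[of n] by (simp add: norm_mult)
    have "cmod (z n) \<le> r n * 1" unfolding eq using T1 r[of n] by (intro mult_left_mono) auto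
    then show l: "cmod (z n) < 1" using r[of n] by simp
    have "cmod (z n) \<le> 1 * cmod (?T (z n))" unfolding eq using r[of n] by (intro mult_right_mono) auto
    then have "cmod (z n) \<le> cmod (bprod 1 a d (z n))"
      using cmod_bprod_1[OF s] by (simp add: dT_def split: if_splits)
    then have "1 - (cmod (bprod 1 a d (z n)))\<^sup>2 \<le> 1 - (cmod (z n))\<^sup>2" by (simp add: power_mono)
    moreover have "1 - (cmod (z n))\<^sup>2 > 0" using sq_less_1[OF l] by simp
    ultimately show "\<Lambda> (z n) \<le> 1" using \<Lambda>(3)[of "z n"] l by (simp add: mult_le_cancel_right2)
  qed
  obtain l h where l: "l \<in> cball 0 1" "strict_mono (h :: nat => nat)" "(z \<circ> h) \<longlonglongrightarrow> l"
    using compact_cball[of "0::complex" 1] z(1) unfolding compact_def by blast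
  have lims: "(\<lambda>n. f (z (h n))) \<longlonglongrightarrow> f l" if "continuous_on (cball 0 1) f" for f :: "complex => 'b::topological_space"
    using continuous_on_tendsto_compose[OF that l(3) l(1)] z(1) by simp
  have "(\<lambda>n. of_real (r (h n)) * ?T (z (h n))) \<longlonglongrightarrow> of_real 1 * ?T l"
    using LIMSEQ_subseq_LIMSEQ[OF rlim l(2)]
    by (intro tendsto_mult tendsto_of_real lims continuous_on_dT[OF b]) (simp add: o_def)
  then have "(z \<circ> h) \<longlonglongrightarrow> ?T l" by (simp add: z(2) o_def)
  then have fix_l: "?T l = l" using LIMSEQ_unique l(3) by blast
  show ?thesis
  proof (cases "cmod l < 1")
    case False
    then have l1: "cmod l = 1" using l(1) by simp
    have "\<Lambda> l \<le> 1" by (rule LIMSEQ_le_const2[OF lims[OF \<Lambda>(1)]]) (use le in blast)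
    then show ?thesis using fix_l l1 \<Lambda>(2) by auto
  qed (use fix_l in blast)
qed

section \<open>Existence of critical points\<close>

text \<open>With m = degree p < n = degree q, the coefficient of the Wronskian in degree m + n - 1
  is m - n times the leading coefficients. It is nonzero, and m + n - 1 \<ge> 1.\<close>

lemma wronskian_root:
  fixes p q :: "complex poly"
  assumes "p ~= 0" "degree p < degree q" "degree q \<ge> 2"
  obtains x where "poly (pderiv p * q - p * pderiv q) x = 0"
proof -
  let ?W = "pderiv p * q - p * pderiv q" and ?m = "degree p" and ?n = "degree q"
  have q: "coeff q ?n ~= 0" using assms by auto
  have c1: "coeff (pderiv p * q) (?m + ?n - 1) = of_nat ?m * coeff p ?m * coeff q ?n"
  proof (cases "?m = 0")
    case True
    then have "pderiv p = 0" by (simp add: pderiv_eq_0_iff)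
    then show ?thesis using True by simp
  next
    case False
    then have "degree (pderiv p) + ?n = ?m + ?n - 1" by (simp add: degree_pderiv)
    then have "coeff (pderiv p * q) (?m + ?n - 1) = coeff (pderiv p) (?m - 1) * coeff q ?n"
      using coeff_mult_degree_sum[of "pderiv p" q] by (simp add: degree_pderiv)
    then show ?thesis using False by (simp add: coeff_pderiv)
  qed
  have "?m + degree (pderiv q) = ?m + ?n - 1" using assms by (simp add: degree_pderiv)
  then have "coeff (p * pderiv q) (?m + ?n - 1) = coeff p ?m * coeff (pderiv q) (?n - 1)"
    using coeff_mult_degree_sum[of p "pderiv q"] by (simp add: degree_pderiv)
  then have c2: "coeff (p * pderiv q) (?m + ?n - 1) = of_nat ?n * coeff p ?m * coeff q ?n"
    using assms by (simp add: coeff_pderiv)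
  have "coeff ?W (?m + ?n - 1) = (of_nat ?m - of_nat ?n) * coeff p ?m * coeff q ?n"
    by (simp only: coeff_diff c1 c2) (simp add: algebra_simps)
  also have "\<dots> ~= 0" using assms(1,2) q by simp
  finally have "?m + ?n - 1 \<le> degree ?W" by (rule le_degree)
  then have "degree ?W ~= 0" using assms by linarith
  then have "\<not> constant (poly ?W)" by (simp only: constant_degree not_False_eq_True)
  then show thesis using fundamental_theorem_of_algebra that by blast
qed

text \<open>Moving the value at infinity to 0 makes the degree of the numerator smaller than that of
  the denominator, and a root of the Wronskian is critical; at a pole the reciprocal is used.
  Without a critical point hyperbolicity would hold vacuously and say nothing about the boundary
  multiplier.\<close>

theorem critical_point_exists:
  assumes F: "ratmap d F" and d: "d \<ge> 2"
  shows "\<exists>c. critical F c"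
proof -
  obtain a b c e where M: "a * e - b * c ~= 0" "mob a b c e (F None) = Some 0" by (rule mob_to_zero)
  have mM: "mobius (mob a b c e)" using M(1) unfolding mobius_def by blast
  define G where "G = mob a b c e \<circ> F"
  have G: "ratmap d G" unfolding G_def by (rule ratmap_post_mobius[OF mM F])
  then obtain p q where pq: "ratpair p q d" "G = rat_eval p q" by (auto simp: ratmap_def)
  have G0: "G None = Some 0" by (simp add: G_def M(2))
  have nz: "poly p x ~= 0 \<or> poly q x ~= 0" for x using pq(1) unfolding ratpair_def by blast
  have top: "coeff p d ~= 0 \<or> coeff q d ~= 0" "degree p \<le> d" "degree q \<le> d"
    using pq(1) unfolding ratpair_def by blast+
  have deg: "degree p < degree q"
  proof (rule ccontr)
    assume n: "\<not> degree p < degree q"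
    then have eq: "degree p = degree q" using G0 unfolding pq(2) rat_eval_def by (simp split: if_splits)
    then have dq: "degree q = d" "degree p = d" using top by (metis coeff_eq_0 le_neq_implies_less)+
    then have "p ~= 0" "q ~= 0" using d by auto
    then have "coeff p d ~= 0" "coeff q d ~= 0" using dq leading_coeff_0_iff by metis+
    then show False using G0 by (simp add: pq(2) rat_eval_def dq)
  qed
  moreover have "degree q = d"
    using top deg by (metis coeff_eq_0 le_neq_implies_less leD order_less_le_trans)
  moreover have "p ~= 0"
  proof
    assume "p = 0"
    then have "G z = Some 0 \<or> G z = None" for z unfolding pq(2) rat_eval_def by (auto split: option.split)
    then have "Some 1 \<notin> range G" by (metis imageE option.distinct(1) option.inject zero_neq_one)
    then show False using ratmap_surj[OF G] by (metis rangeI)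
  qed
  ultimately obtain x where x: "poly (pderiv p * q - p * pderiv q) x = 0" using wronskian_root[of p q] d by auto
  have cont: "isCont (poly p) x" "isCont (poly q) x" by auto
  have ev: "\<forall>\<^sub>F y in nhds x. poly f y ~= 0" if "poly f x ~= 0" for f :: "complex poly"
    by (rule isCont_eventually_ne[OF poly_isCont that])
  have "sder G (Some x) = 0"
  proof (cases "poly q x = 0")
    case False
    have "\<forall>\<^sub>F y in nhds x. G (Some y) = Some (poly p y / poly q y)"
      using ev[OF False] by (rule eventually_mono) (simp add: pq(2) rat_eval_def)
    moreover have "((\<lambda>y. poly p y / poly q y) has_field_derivative 0) (at x)"
      using x False by (auto intro!: derivative_eq_intros)
    ultimately show ?thesis by (rule sder_Some)
  next
    case True
    have p: "poly p x ~= 0" using nz True by blast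
    have "\<forall>\<^sub>F y in nhds x. (inv_s \<circ> G) (Some y) = Some (poly q y / poly p y)"
      using ev[OF p] by (rule eventually_mono) (auto simp: pq(2) rat_eval_def inv_s_Some)
    moreover have "((\<lambda>y. poly q y / poly p y) has_field_derivative 0) (at x)"
      using x p True by (auto intro!: derivative_eq_intros)
    ultimately have "sder (inv_s \<circ> G) (Some x) = 0" by (rule sder_Some)
    then have "sder inv_s (G (Some x)) * sder G (Some x) = 0"
      using sdiff_compose(2)[OF ratmap_sdiff[OF G] ratmap_sdiff[OF mobius_ratmap[OF mobius_inv_s]]] by metis
    then show ?thesis using mobius_sder_nonzero[OF mobius_inv_s] by simp
  qed
  then have "sder (mob a b c e) (F (Some x)) * sder F (Some x) = 0"
    using sdiff_compose(2)[OF ratmap_sdiff[OF F] ratmap_sdiff[OF mobius_ratmap[OF mM]], of "Some x"] by (simp add: G_def)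
  then have "critical F (Some x)" using mobius_sder_nonzero[OF mM] by (simp add: critical_iff_sder)
  then show ?thesis ..
qed

section \<open>Dynamics of Blaschke maps\<close>

lemma sphere_outside_cases:
  assumes "z \<notin> unit_circle"
  obtains x where "cmod x < 1" "z = Some x" | x where "cmod x < 1" "z = srefl (Some x)"
proof -
  have in_disk: "\<exists>x. cmod x < 1 \<and> y = Some x" if "y \<in> sdisk" for y
    using that by (auto simp: sdisk_def)
  from region_cases[of z] assms have "z \<in> sdisk \<or> srefl z \<in> sdisk" by blast
  then show thesis
  proof
    assume "z \<in> sdisk"
    then show thesis using in_disk that(1) by blast
  next
    assume "srefl z \<in> sdisk"
    then obtain x where "cmod x < 1" "srefl z = Some x" using in_disk by blast
    then show thesis using that(2)[of x] by (metis srefl_srefl)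
  qed
qed

lemma dF_orbit_dist:
  assumes b: "bdata s a d" and x: "cmod x \<le> 1" and y: "cmod y \<le> 1"
  shows "dist ((dF k s a d ^^ n) (Some x)) ((dF k s a d ^^ n) (Some y)) =
      dist (Some ((dT k s a d ^^ n) x)) (Some ((dT k s a d ^^ n) y))"
  unfolding dF_funpow(1)[OF b x] dF_funpow(1)[OF b y] by (rule dist_refl_if_funpow)

lemma tendsto_Some: "(f \<longlongrightarrow> l) F ==> ((\<lambda>x. Some (f x) :: sphere) \<longlongrightarrow> Some l) F"
  using isCont_tendsto_compose[of l "Some :: complex => sphere" f F] continuous_on_Some[of UNIV]
  by (simp add: continuous_on_eq_continuous_at)

lemma funpow_fixed: "f x = x ==> (f ^^ n) x = x"
  by (induction n) auto

section \<open>Attracting point at the centre of the disk\<close>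

lemma cmod_deriv_0_le:
  assumes h: "h field_differentiable (at 0)" "h 0 = 0"
    and le: "\<And>x. cmod x < 1 ==> cmod (h x) \<le> cmod x * m x" and m: "(m \<longlongrightarrow> c) (at 0)"
  shows "cmod (deriv h 0) \<le> c"
proof -
  have "(h has_field_derivative deriv h 0) (at 0)" using h(1) by (simp add: DERIV_deriv_iff_field_differentiable)
  then have "((\<lambda>x. h x / x) \<longlongrightarrow> deriv h 0) (at 0)" by (simp add: has_field_derivative_iff h(2))
  then have "((\<lambda>x. cmod (h x / x)) \<longlongrightarrow> cmod (deriv h 0)) (at 0)" by (rule tendsto_norm)
  moreover have "\<forall>\<^sub>F x in at 0. cmod (h x / x) \<le> m x"
  proof -
    have "\<forall>\<^sub>F x::complex in at 0. x \<in> ball 0 1" by (intro eventually_at_in_open') auto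
    moreover have "\<forall>\<^sub>F x::complex in at 0. x ~= 0" by (rule eventually_neq_at_within)
    ultimately show ?thesis
      by eventually_elim (use le in \<open>auto simp: norm_divide divide_le_eq mult.commute\<close>)
  qed
  ultimately show ?thesis using m by (intro tendsto_le[OF _ m]) auto
qed

lemma bprod_0_factor:
  assumes "d > 0" "a (d - 1) = 0"
  shows "bprod s a d z = z * bprod s a (d - 1) z"
proof -
  obtain m where "d = Suc m" using assms(1) gr0_implies_Suc by blast
  then show ?thesis using assms(2) by (simp add: bprod_def bfac_def)
qed

text \<open>Splitting off the factor z leaves a product of d - 1 \<ge> 1 factors, of modulus below 1
  inside the disk: this is Schwarz's lemma with strict inequality.\<close>

lemma interior_fixed:
  assumes b: "bdata s a d" and d: "d \<ge> 2" and a0: "a (d - 1) = 0"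
  shows "dT k s a d 0 = 0" "cmod z < 1 ==> z ~= 0 ==> cmod (dT k s a d z) < cmod z"
    "cmod z < 1 ==> (\<lambda>n. (dT k s a d ^^ n) z) \<longlonglongrightarrow> 0"
proof -
  have s: "cmod s = 1" and a: "\<And>i. i < d - 1 ==> cmod (a i) < 1" using b by (auto simp: bdata_def)
  have fac: "cmod (dT k s a d z) = cmod z * cmod (bprod s a (d - 1) z)" for z
    using bprod_0_factor[of d a s z] d a0 by (simp add: dT_def norm_mult)
  show T0: "dT k s a d 0 = 0" using fac[of 0] by simp
  show less: "cmod z < 1 ==> z ~= 0 ==> cmod (dT k s a d z) < cmod z" for z
    unfolding fac using cmod_bprod_less_1[of s "d - 1" a z] s a d by simp
  show "cmod z < 1 ==> (\<lambda>n. (dT k s a d ^^ n) z) \<longlonglongrightarrow> 0"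
    by (rule origin_attracts[OF continuous_on_dT[OF b] less T0])
qed

text \<open>When the sides are exchanged, 0 and infinity form a cycle of length 2, so the second
  iterate is used in all cases. Near 0 it is T after T; in the chart at infinity it is the same map
  conjugated by \<sigma>, complex conjugation. Both are bounded by |x| times a product of modulus
  below 1 at the centre.\<close>

lemma interior_multiplier:
  assumes b: "bdata s a d" and d: "d \<ge> 2" and a0: "a (d - 1) = 0" and p: "p \<in> {Some 0, None}"
  shows "(dF k s a d ^^ 2) p = p" "cmod (sder (dF k s a d ^^ 2) p) < 1"
proof -
  let ?F = "dF k s a d" and ?T = "dT k s a d"
  note T = interior_fixed[OF b d a0, where k = k]
  have s: "cmod s = 1" and a: "\<And>i. i < d - 1 ==> cmod (a i) < 1" using b by (auto simp: bdata_def)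
  have F2: "(?F ^^ 2) (Some x) = Some (?T (?T x))" if "cmod x \<le> 1" for x
    using dF_funpow(1)[OF b that, where k = k and n = 2] by (simp add: numeral_2_eq_2 refl_if_def)
  have F2': "(?F ^^ 2) (srefl (Some x)) = srefl (Some (?T (?T x)))" if "cmod x \<le> 1" for x
    using F2[OF that] dF_funpow_srefl[OF b, where k = k and n = 2] by simp
  show fix_p: "(?F ^^ 2) p = p" using p F2[of 0] F2'[of 0] T(1) by auto
  have TT: "cmod (?T (?T x)) \<le> cmod x * cmod (bprod s a (d - 1) x)" if x: "cmod x < 1" for x
  proof -
    have "cmod (?T y) \<le> cmod y" if "cmod y < 1" for y using T(1) T(2)[OF that] by (cases "y = 0") auto
    then have "cmod (?T (?T x)) \<le> cmod (?T x)" using cmod_dT(1)[OF b x] by blast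
    also have "\<dots> = cmod x * cmod (bprod s a (d - 1) x)"
      using bprod_0_factor[of d a s x] d a0 by (simp add: dT_def norm_mult)
    finally show ?thesis .
  qed
  define \<sigma> where "\<sigma> x = (if p = None then cnj x else x)" for x :: complex
  define h where "h = local_rep (?F ^^ 2) p"
  have h: "h x = \<sigma> (?T (?T (\<sigma> x)))" if x: "cmod x < 1" for x
  proof (cases "p = None")
    case True
    have "ichart None x = srefl (Some (cnj x))" by (cases "x = 0") (auto simp: ichart_def srefl_Some inverse_eq_divide)
    then have "h x = chart None (srefl (Some (?T (?T (cnj x)))))"
      using True fix_p F2'[of "cnj x"] x by (simp add: h_def local_rep_def)
    also have "\<dots> = cnj (?T (?T (cnj x)))"
      by (cases "?T (?T (cnj x)) = 0") (auto simp: chart_def srefl_Some inverse_eq_divide)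
    finally show ?thesis using True by (simp add: \<sigma>_def)
  next
    case False
    then have "p = Some 0" using p by blast
    then show ?thesis using F2[of x] fix_p x by (simp add: h_def local_rep_def \<sigma>_def chart_def ichart_def)
  qed
  have ch: "chart p p = 0" using p by (auto simp: chart_def)
  have hd: "h field_differentiable (at 0)"
  proof -
    have "sdiff (?F ^^ 2) p" by (rule sdiff_funpow[OF ratmap_dF[OF b]])
    then show ?thesis unfolding sdiff_def ch h_def by blast
  qed
  have c\<sigma>: "cmod (\<sigma> x) = cmod x" "\<sigma> 0 = 0" for x by (simp_all add: \<sigma>_def)
  have "isCont (bprod s a (d - 1)) 0"
    using continuous_on_interior[OF continuous_on_bprod[of "d - 1" a s], of 0] a by auto
  then have cb: "isCont (bprod s a (d - 1)) (\<sigma> 0)" by (simp only: c\<sigma>(2))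
  have c1: "isCont \<sigma> 0" unfolding \<sigma>_def by (cases "p = None") (auto intro!: continuous_intros)
  have "isCont (\<lambda>x. bprod s a (d - 1) (\<sigma> x)) 0" by (rule isCont_o2[OF c1 cb])
  then have "((\<lambda>x. bprod s a (d - 1) (\<sigma> x)) \<longlongrightarrow> bprod s a (d - 1) 0) (at 0)" by (simp only: isCont_def c\<sigma>(2))
  then have m: "((\<lambda>x. cmod (bprod s a (d - 1) (\<sigma> x))) \<longlongrightarrow> cmod (bprod s a (d - 1) 0)) (at 0)"
    by (rule tendsto_norm)
  have "cmod (deriv h 0) \<le> cmod (bprod s a (d - 1) 0)"
  proof (rule cmod_deriv_0_le[OF hd _ _ m])
    show "h 0 = 0" using h[of 0] T(1) c\<sigma>(2) by simp
    show "cmod (h x) \<le> cmod x * cmod (bprod s a (d - 1) (\<sigma> x))" if x: "cmod x < 1" for x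
      using TT[of "\<sigma> x"] x by (simp add: h c\<sigma>)
  qed
  also have "\<dots> < 1" using cmod_bprod_less_1[of s "d - 1" a 0] s a d by simp
  finally show "cmod (sder (?F ^^ 2) p) < 1" by (simp add: sder_def h_def ch)
qed

lemma dist_circle_Some_0: "cmod v = 1 ==> dist (Some v :: sphere) (Some 0) \<ge> 1"
proof -
  assume v: "cmod v = 1"
  have "dist (Some v :: sphere) (Some 0) = 2 * cmod v / sqrt (1 + (cmod v)\<^sup>2)"
    using dist_Some_Some[of v 0] by simp
  moreover have "sqrt 2 \<le> 2" using real_le_lsqrt[of 2 2] by simp
  ultimately show ?thesis using v by (simp add: le_divide_eq)
qed

text \<open>Orbits on the circle stay there, at chordal distance at least 1 from the centre, while
  orbits starting inside the disk tend to the centre up to reflections; so equicontinuity fails at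
  every point of the circle.\<close>

theorem interior_julia:
  assumes b: "bdata s a d" and d: "d \<ge> 2" and a0: "a (d - 1) = 0"
  shows "julia (dF k s a d) = unit_circle"
proof
  let ?F = "dF k s a d" and ?T = "dT k s a d"
  show "julia ?F \<subseteq> unit_circle" by (rule julia_dF_circle[OF b])
  show "unit_circle \<subseteq> julia ?F"
  proof
    fix p assume "p \<in> unit_circle"
    then obtain w where w: "p = Some w" "cmod w = 1" by (auto simp: unit_circle_def)
    have "\<not> eqc ?F p"
    proof
      assume "eqc ?F p"
      then obtain \<delta> where \<delta>: "\<delta> > 0" "\<And>y n. dist p y < \<delta> ==> dist ((?F ^^ n) p) ((?F ^^ n) y) < 1/2"
        unfolding eqc_def by (metis half_gt_zero_iff zero_less_one)
      have "(\<lambda>n. of_real (1 - inverse (real (Suc n))) * w) \<longlonglongrightarrow> of_real (1 - 0) * w"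
        by (intro tendsto_mult tendsto_of_real tendsto_diff tendsto_const LIMSEQ_inverse_real_of_nat)
      then have "(\<lambda>n. Some (of_real (1 - inverse (real (Suc n))) * w) :: sphere) \<longlonglongrightarrow> p"
        using tendsto_Some w(1) by fastforce
      then obtain n0 where "dist (Some (of_real (1 - inverse (real (Suc n0))) * w)) p < \<delta>"
        using \<delta>(1) unfolding lim_sequentially by blast
      moreover define x where "x = of_real (1 - inverse (real (Suc n0))) * w"
      ultimately have xd: "dist p (Some x) < \<delta>" by (simp add: dist_commute)
      have "cmod x = \<bar>1 - inverse (real (Suc n0))\<bar>" unfolding x_def norm_mult norm_of_real w(2) by simp
      moreover have "0 \<le> 1 - inverse (real (Suc n0))" "1 - inverse (real (Suc n0)) < 1"
        by (simp_all add: inverse_le_1_iff)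
      ultimately have x: "cmod x < 1" by linarith
      have "(\<lambda>n. Some ((?T ^^ n) x) :: sphere) \<longlonglongrightarrow> Some 0"
        by (intro tendsto_Some interior_fixed(3)[OF b d a0 x])
      then obtain n where n: "dist (Some ((?T ^^ n) x) :: sphere) (Some 0) < 1/2"
        unfolding lim_sequentially by (metis half_gt_zero_iff order_refl zero_less_one)
      have "dist (Some ((?T ^^ n) w) :: sphere) (Some ((?T ^^ n) x)) < 1/2"
        using \<delta>(2)[OF xd, of n] dF_orbit_dist[OF b, of w x, where k = k and n = n] w x by simp
      then have "dist (Some ((?T ^^ n) w) :: sphere) (Some 0) < 1"
        using n dist_triangle[of "Some ((?T ^^ n) w) :: sphere" "Some 0" "Some ((?T ^^ n) x)"] by simp
      moreover have "cmod ((?T ^^ n) w) = 1"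
        by (induction n) (simp_all add: w cmod_dT(2)[OF b])
      ultimately show False using dist_circle_Some_0[of "(?T ^^ n) w"] by simp
    qed
    then show "p \<in> julia ?F"
      unfolding julia_iff fatou_iff_eqc[OF ratmap_isCont[OF ratmap_dF[OF b]]] by blast
  qed
qed

lemma interior_orbit:
  assumes b: "bdata s a d" and d: "d \<ge> 2" and a0: "a (d - 1) = 0" and c: "c \<notin> unit_circle"
  shows "\<exists>p\<in>{Some 0, None}. orbit_conv (dF k s a d) c p"
proof -
  let ?F = "dF k s a d" and ?T = "dT k s a d"
  have conv: "\<exists>N. \<forall>n\<ge>N. dist ((?F ^^ n) (Some x)) ((?F ^^ n) (Some 0)) < e" if x: "cmod x < 1" and e: "e > 0" for x e
  proof -
    have "(\<lambda>n. Some ((?T ^^ n) x) :: sphere) \<longlonglongrightarrow> Some 0"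
      by (intro tendsto_Some interior_fixed(3)[OF b d a0 x])
    moreover have "(?T ^^ n) 0 = 0" for n by (rule funpow_fixed) (rule interior_fixed(1)[OF b d a0])
    ultimately show ?thesis using e dF_orbit_dist[OF b, of x 0, where k = k] x unfolding lim_sequentially by simp
  qed
  show ?thesis using c
  proof (cases rule: sphere_outside_cases)
    case (1 x)
    have "orbit_conv ?F c (Some 0)" unfolding orbit_conv_def 1(2) using conv[OF 1(1)] by blast
    then show ?thesis by blast
  next
    case (2 x)
    have "None = srefl (Some 0)" by simp
    then have "dist ((?F ^^ n) c) ((?F ^^ n) None) = dist ((?F ^^ n) (Some x)) ((?F ^^ n) (Some 0))" for n
      unfolding 2(2) dF_funpow_srefl[OF b] by (metis dF_funpow_srefl[OF b] dist_srefl)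
    then have "orbit_conv ?F c None" unfolding orbit_conv_def using conv[OF 2(1)] by metis
    then show ?thesis by blast
  qed
qed

theorem interior_hyperbolic:
  assumes b: "bdata s a d" and d: "d \<ge> 2" and a0: "a (d - 1) = 0"
  shows "hyperbolic (dF k s a d)"
  unfolding hyperbolic_iff
proof (intro allI impI)
  let ?F = "dF k s a d"
  fix c assume "sder ?F c = 0"
  then have "c \<notin> unit_circle" using not_critical_dF[OF b] critical_iff_sder by blast
  then obtain p where p: "p \<in> {Some 0, None}" "orbit_conv ?F c p" using interior_orbit[OF b d a0] by blast
  show "\<exists>z n. n > 0 \<and> (?F ^^ n) z = z \<and> cmod (sder (?F ^^ n) z) < 1 \<and> orbit_conv ?F c z"
    using interior_multiplier[OF b d a0 p(1)] p(2) by (intro exI[of _ p] exI[of _ 2]) auto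
qed

section \<open>Attracting point on the circle\<close>

lemma horo_cnj: "horo w (cnj z) = horo (cnj w) z"
proof -
  have "cmod (w - cnj z) = cmod (cnj (cnj w - z))" by simp
  then show ?thesis unfolding horo_def complex_mod_cnj by simp
qed

theorem boundary_orbits:
  assumes b: "bdata s a d" and d: "d \<ge> 2" and w: "cmod w = 1" "dT k s a d w = w" "blam a d w \<le> 1"
    and z: "z \<notin> unit_circle"
  shows "(\<lambda>n. (dF k s a d ^^ n) z) \<longlonglongrightarrow> Some w"
proof -
  let ?F = "dF k s a d" and ?T = "dT k s a d"
  have s: "cmod s = 1" and a: "\<And>i. i < d ==> cmod (a i) < 1" using b by (auto simp: bdata_def)
  have "horo w (?T x) < horo w x" if "cmod x < 1" for x
  proof -
    \<comment> \<open>In the exchanging case T w = w reads B w = cnj w, and conjugation moves from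
      the argument of \<open>horo\<close> to its base point.\<close>
    have "horo w (?T x) = horo (bprod s a d w) (bprod s a d x)"
    proof (cases k)
      case True
      then have "cnj w = bprod s a d w" using w(2) by (metis complex_cnj_cnj dT_def)
      then show ?thesis using True by (simp add: dT_def horo_cnj)
    qed (use w(2) in \<open>simp add: dT_def\<close>)
    then show ?thesis using horo_bprod_less[of s d a w x] s a d w(1,3) that by simp
  qed
  note less = this
  have T: "(\<lambda>n. (?T ^^ n) x) \<longlonglongrightarrow> w" if "cmod x < 1" for x
    by (rule boundary_attracts[OF continuous_on_dT[OF b] cmod_dT(1)[OF b] w(1) less that])
  have Fw: "(?F ^^ n) (Some w) = Some w" for n
    by (rule funpow_fixed) (use dF_Some[OF b, of w k] refl_if_circle[of "Some w" 1 k] w in simp)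
  have conv: "(\<lambda>n. (?F ^^ n) (Some x)) \<longlonglongrightarrow> Some w" if x: "cmod x < 1" for x
  proof -
    have "dist ((?F ^^ n) (Some x)) (Some w) = dist (Some ((?T ^^ n) x) :: sphere) (Some w)" for n
      using dF_orbit_dist[OF b, of x w, where k = k and n = n] x w funpow_fixed[of ?T w n] by (simp add: Fw)
    moreover have "(\<lambda>n. dist (Some ((?T ^^ n) x) :: sphere) (Some w)) \<longlonglongrightarrow> 0"
      using tendsto_Some[OF T[OF x]] by (rule tendsto_dist_iff[THEN iffD1])
    ultimately show ?thesis by (subst tendsto_dist_iff) simp
  qed
  show ?thesis using z
  proof (cases rule: sphere_outside_cases)
    case (1 x)
    then show ?thesis using conv by simp
  next
    case (2 x)
    have "srefl (Some w) = Some w" using w(1) by (intro srefl_circle) simp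
    then have "dist ((?F ^^ n) z) (Some w) = dist ((?F ^^ n) (Some x)) (Some w)" for n
      unfolding 2(2) dF_funpow_srefl[OF b] by (metis dist_srefl)
    then show ?thesis using conv[OF 2(1)] by (subst tendsto_dist_iff) (simp add: tendsto_dist_iff[symmetric])
  qed
qed

lemma dF_boundary_fixed:
  assumes "bdata s a d" "cmod w = 1" "dT k s a d w = w"
  shows "dF k s a d (Some w) = Some w"
  using dF_Some[OF assms(1), of w k] refl_if_circle[of "Some w" 1 k] assms by simp

lemma orbit_conv_fixed:
  assumes "F p = p"
  shows "orbit_conv F c p \<longleftrightarrow> (\<lambda>n. (F ^^ n) c) \<longlonglongrightarrow> p"
  unfolding orbit_conv_def lim_sequentially by (simp add: funpow_fixed[of F p, OF assms])

text \<open>A critical point exists, lies off the circle and is attracted by \<open>w\<close>. If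
  the map is hyperbolic, its orbit also approaches an attracting cycle; being finite, this cycle
  contains \<open>w\<close> and reduces to that fixed point. Then a power of the multiplier is below
  1 in modulus, hence so is the multiplier.\<close>

theorem boundary_hyperbolic:
  assumes b: "bdata s a d" and d: "d \<ge> 2" and w: "cmod w = 1" "dT k s a d w = w" "blam a d w \<le> 1"
  shows "hyperbolic (dF k s a d) \<longleftrightarrow> blam a d w < 1"
proof
  let ?F = "dF k s a d"
  have fix_w: "?F (Some w) = Some w" by (rule dF_boundary_fixed[OF b w(1,2)])
  have orb: "(\<lambda>n. (?F ^^ n) c) \<longlonglongrightarrow> Some w" if "sder ?F c = 0" for c
    using not_critical_dF[OF b, of k c] that boundary_orbits[OF b d w] critical_iff_sder by blast
  show "hyperbolic ?F" if "blam a d w < 1"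
    unfolding hyperbolic_iff
  proof (intro allI impI exI conjI)
    fix c assume "sder ?F c = 0"
    then show "orbit_conv ?F c (Some w)" using orb orbit_conv_fixed[of ?F "Some w" c] fix_w by simp
    show "(?F ^^ 1) (Some w) = Some w" "cmod (sder (?F ^^ 1) (Some w)) < 1" "1 > (0::nat)"
      using fix_w cmod_sder_dF[OF b w(1), of k] that by simp_all
  qed
  show "blam a d w < 1" if hyp: "hyperbolic ?F"
  proof -
    obtain c where "critical ?F c" using critical_point_exists[OF ratmap_dF[OF b] d] by blast
    then have c: "sder ?F c = 0" by (simp add: critical_iff_sder)
    then obtain z n where zn: "n > 0" "(?F ^^ n) z = z" "cmod (sder (?F ^^ n) z) < 1" "orbit_conv ?F c z"
      using hyp unfolding hyperbolic_iff by blast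
    have "\<exists>j. (?F ^^ j) z = Some w"
    proof (rule ccontr)
      assume none: "\<nexists>j. (?F ^^ j) z = Some w"
      let ?D = "(\<lambda>j. dist (Some w) ((?F ^^ j) z)) ` {..<n}"
      have per: "(?F ^^ j) z \<in> (\<lambda>j. (?F ^^ j) z) ` {..<n}" for j
      proof -
        have "(?F ^^ (j mod n)) z = (?F ^^ j) z"
          using funpow_mod_eq[OF zn(2), of j] .
        then show ?thesis using zn(1) by (metis image_eqI lessThan_iff mod_less_divisor)
      qed
      define e where "e = Min ?D"
      have "e \<in> ?D" unfolding e_def using zn(1) by (intro Min_in) auto
      then obtain i where "e = dist (Some w) ((?F ^^ i) z)" by blast
      then have e: "e > 0" using none by (simp add: zero_less_dist_iff) metis
      have far: "e \<le> dist (Some w) ((?F ^^ j) z)" for j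
      proof -
        obtain i where "i < n" "(?F ^^ j) z = (?F ^^ i) z" using per[of j] by auto
        then show ?thesis unfolding e_def by (intro Min_le) auto
      qed
      obtain N where N: "\<forall>k'\<ge>N. \<exists>j. dist ((?F ^^ k') c) ((?F ^^ j) z) < e / 2"
        using zn(4) e unfolding orbit_conv_def by (meson half_gt_zero)
      obtain N' where N': "\<forall>k'\<ge>N'. dist ((?F ^^ k') c) (Some w) < e / 2"
        using orb[OF c] e unfolding lim_sequentially by (meson half_gt_zero)
      obtain j where "dist ((?F ^^ (max N N')) c) ((?F ^^ j) z) < e / 2" using N by (meson max.cobounded1)
      moreover have "dist ((?F ^^ (max N N')) c) (Some w) < e / 2" using N' by (meson max.cobounded2)
      ultimately show False
        using far[of j] dist_triangle3[of "Some w" "(?F ^^ j) z" "(?F ^^ (max N N')) c"] by simp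
    qed
    then obtain j where j: "(?F ^^ j) z = Some w" by blast
    \<comment> \<open>\<open>n * Suc j\<close> is a multiple of the period that is at least
      \<open>j\<close>, so the orbit is back at \<open>z\<close> after having passed through the
      fixed point.\<close>
    have "(?F ^^ (n * Suc j)) z = z" using zn(2) by (simp only: funpow_mult[symmetric] funpow_fixed)
    moreover have "(?F ^^ (n * Suc j)) z = (?F ^^ (n * Suc j - j)) ((?F ^^ j) z)"
    proof -
      have "j \<le> n * Suc j" using zn(1) by (cases n) auto
      then have "n * Suc j = (n * Suc j - j) + j" by simp
      then show ?thesis by (metis comp_apply funpow_add)
    qed
    ultimately have "z = Some w" using j funpow_fixed[of ?F "Some w", OF fix_w] by metis
    then have "cmod (sder ?F (Some w)) ^ n < 1"
      using zn(3) sder_funpow_fixed[OF ratmap_dF[OF b] fix_w, of n] by (simp add: norm_power)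
    then have "cmod (sder ?F (Some w)) < 1" by (metis linorder_not_less one_le_power)
    then show ?thesis using cmod_sder_dF[OF b w(1)] by simp
  qed
qed

section \<open>Blaschke products with Cantor Julia sets\<close>

lemma upper_map_circle:
  assumes "upper_map \<psi>"
  shows "\<psi> z \<in> unit_circle \<longleftrightarrow> z \<in> Rhat"
proof -
  have "\<psi> z \<in> sdisk \<longleftrightarrow> z \<in> Hplus" "srefl (\<psi> z) \<in> sdisk \<longleftrightarrow> scnj z \<in> Hplus"
    using assms unfolding upper_map_def by metis+
  then show ?thesis
    using region_cases[of "\<psi> z"] region_disjoint[of "\<psi> z"] Rhat_halves[of z] Rhat_not_Hplus[of z]
      Rhat_not_Hplus(1)[of "scnj z"] by (metis Rhat_iff)
qed

lemma arclike_mobius_image: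
  assumes X: "arclike X" and \<psi>: "mobius \<psi>"
  shows "arclike (\<psi> ` X)"
  unfolding arclike_def
proof
  fix y assume y: "y \<in> \<psi> ` X"
  obtain \<psi>' where \<psi>': "mobius \<psi>'" "\<psi>' \<circ> \<psi> = id" "\<psi> \<circ> \<psi>' = id" by (rule mobius_inverse[OF \<psi>])
  have i: "\<psi>' (\<psi> x) = x" "\<psi> (\<psi>' x) = x" for x using \<psi>' by (simp_all add: fun_eq_iff)
  have y': "\<psi>' y \<in> X" using y i by auto
  then obtain h :: "sphere => real" where h: "continuous_on (X - {\<psi>' y}) h" "inj_on h (X - {\<psi>' y})"
    using X unfolding arclike_def by blast
  have im: "\<psi>' ` (\<psi> ` X - {y}) = X - {\<psi>' y}"
  proof (intro equalityI subsetI)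
    fix x assume "x \<in> \<psi>' ` (\<psi> ` X - {y})"
    then obtain x' where x': "x = \<psi>' (\<psi> x')" "x' \<in> X" "\<psi> x' ~= y" by blast
    then have "x = x'" "x' ~= \<psi>' y" using i by auto
    then show "x \<in> X - {\<psi>' y}" using x' by blast
  next
    fix x assume x: "x \<in> X - {\<psi>' y}"
    then have "\<psi> x \<in> \<psi> ` X - {y}" using i by auto
    then have "\<psi>' (\<psi> x) \<in> \<psi>' ` (\<psi> ` X - {y})" by (rule imageI)
    then show "x \<in> \<psi>' ` (\<psi> ` X - {y})" by (simp add: i)
  qed
  have "continuous_on (\<psi> ` X - {y}) (h \<circ> \<psi>')"
    by (intro continuous_on_compose ratmap_continuous_on[OF mobius_ratmap[OF \<psi>'(1)]]) (simp add: im h)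
  moreover have "inj_on (h \<circ> \<psi>') (\<psi> ` X - {y})"
    by (intro comp_inj_on) (use mobius_eq_iff[OF \<psi>'(1)] h im in \<open>auto simp: inj_on_def\<close>)
  ultimately show "\<exists>h::sphere => real. continuous_on (\<psi> ` X - {y}) h \<and> inj_on h (\<psi> ` X - {y})" by blast
qed

lemma upper_map_image_Rhat:
  assumes "upper_map \<psi>"
  shows "\<psi> ` Rhat = unit_circle"
proof -
  have "mobius \<psi>" using assms by (simp add: upper_map_def)
  then obtain \<psi>' where "\<psi> \<circ> \<psi>' = id" using mobius_inverse by blast
  then have i: "\<psi> (\<psi>' x) = x" for x by (simp add: fun_eq_iff)
  show ?thesis
  proof (intro equalityI subsetI)
    fix x assume "x \<in> unit_circle"
    then have "\<psi>' x \<in> Rhat" using upper_map_circle[OF assms, of "\<psi>' x"] by (simp add: i)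
    then show "x \<in> \<psi> ` Rhat" using i[of x] by (metis imageI)
  qed (use upper_map_circle[OF assms] in blast)
qed

lemma arclike_circle: "arclike unit_circle"
  using arclike_mobius_image[OF arclike_Rhat mobius_cayley] by (simp add: upper_map_image_Rhat[OF upper_map_cayley])

definition daut :: "real => complex => sphere => sphere" where
  "daut t b = mob (cis t) (- cis t * b) (- cnj b) 1"

lemma disk_aut_daut: "cmod b < 1 ==> disk_aut (daut t b)"
  unfolding disk_aut_def daut_def mob_def by blast

lemma daut_det:
  assumes "cmod b < 1"
  shows "cis t * 1 - (- cis t * b) * (- cnj b) ~= 0"
proof -
  have "cis t * 1 - (- cis t * b) * (- cnj b) = cis t * of_real (1 - (cmod b)\<^sup>2)"
    using complex_norm_square[of b] by (simp add: algebra_simps)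
  moreover have "1 - (cmod b)\<^sup>2 ~= 0" using sq_less_1[OF assms] by simp
  ultimately show ?thesis by (simp only: mult_eq_0_iff of_real_eq_0_iff cis_neq_zero not_False_eq_True simp_thms)
qed

lemma daut_hpt:
  assumes "cmod b < 1" "u ~= 0 \<or> v ~= 0"
  shows "daut t b (hpt u v) = hpt (cis t * (u - b * v)) (v - cnj b * u)"
  unfolding daut_def mob_hpt[OF daut_det[OF assms(1)] assms(2)] by (simp add: algebra_simps)

lemma daut_zero: "cmod b < 1 ==> daut t b (Some b) = Some 0"
  using daut_hpt[of b b 1 t] daut_det[of b t] by (auto simp: hpt_def mult.commute split: if_splits)

lemma disk_conj_is_blaschke:
  assumes b: "bdata s a d" and \<phi>: "disk_aut \<phi>" and z0: "\<phi> (Some z0) = Some 0" "bmap s a d (Some z0) = Some z0"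
  shows "\<exists>s' a'. bdata s' a' d \<and> a' (d - 1) = 0 \<and> \<phi> \<circ> bmap s a d = bmap s' a' d \<circ> \<phi>"
proof -
  let ?B = "bmap s a d"
  have m: "mobius \<phi>" using disk_aut_cases[OF \<phi>] by blast
  obtain \<phi>' where \<phi>': "mobius \<phi>'" "\<phi>' \<circ> \<phi> = id" "\<phi> \<circ> \<phi>' = id" by (rule mobius_inverse[OF m])
  have i: "\<phi>' (\<phi> x) = x" "\<phi> (\<phi>' x) = x" for x using \<phi>' by (simp_all add: fun_eq_iff)
  have s': "\<phi>' (srefl x) = srefl (\<phi>' x)" for x
    using disk_aut_srefl(1)[OF \<phi>, of "\<phi>' x"] i by metis
  define C where "C = \<phi> \<circ> ?B \<circ> \<phi>'"
  have "\<exists>s' a'. bdata s' a' d \<and> a' (d - 1) = 0 \<and> C = bmap s' a' d"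
  proof (rule symmetric_ratmap_is_blaschke)
    show "ratmap d C" unfolding C_def by (intro ratmap_pre_mobius ratmap_post_mobius m \<phi>'(1) ratmap_bmap b)
    show "C (srefl z) = srefl (C z)" for z by (simp add: C_def s' bmap_srefl[OF b] disk_aut_srefl(1)[OF \<phi>])
    have "\<phi>' (Some 0) = Some z0" using i(1)[of "Some z0"] z0(1) by simp
    then show "C (Some 0) = Some 0" by (simp add: C_def z0)
    fix z assume "C z = Some 0"
    then have "\<phi> (?B (\<phi>' z)) \<in> sdisk" by (simp add: C_def)
    then have "\<phi>' z \<in> sdisk" using disk_aut_srefl(2)[OF \<phi>] bmap_regions(1)[OF b] by blast
    then show "z \<in> sdisk" using disk_aut_srefl(2)[OF \<phi>, of "\<phi>' z"] i by simp
  qed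
  moreover have "\<phi> \<circ> ?B = C \<circ> \<phi>" by (simp add: C_def fun_eq_iff i)
  ultimately show ?thesis by metis
qed

section \<open>Fixed points on the circle in terms of angles\<close>

lemma cis_eq_iff_Ints: "cis x = cis y \<longleftrightarrow> (x - y) / (2 * pi) \<in> \<int>"
proof -
  have "cis x = cis y \<longleftrightarrow> (\<exists>n::int. x = y + 2 * pi * of_int n)"
    using sin_cos_eq_iff[of x y] by (auto simp: complex_eq_iff)
  also have "\<dots> \<longleftrightarrow> (\<exists>n::int. (x - y) / (2 * pi) = of_int n)" by (simp add: field_simps)
  finally show ?thesis by (auto elim!: Ints_cases)
qed

text \<open>With u = cis t - a the factor is u / (cis t * cnj u), and dividing a number by its
  conjugate doubles its argument.\<close>

lemma bfac_circle:
  assumes "cmod a < 1"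
  shows "bfac a (cis t) = cis (2 * Arg (cis t - a) - t)"
proof -
  let ?w = "cis t - a"
  have "?w ~= 0" using assms by (metis norm_cis order_less_irrefl right_minus_eq)
  have "cis t * cnj (cis t) = 1" by (simp add: cis_cnj cis_mult)
  then have "1 - cnj a * cis t = cis t * cnj ?w" by (simp add: algebra_simps)
  then have "bfac a (cis t) = ?w / (cis t * cnj ?w)" by (simp add: bfac_def)
  also have "?w = of_real (cmod ?w) * cis (Arg ?w)" using rcis_cmod_Arg[of ?w] by (simp add: rcis_def)
  also have "of_real (cmod ?w) * cis (Arg ?w) / (cis t * cnj (of_real (cmod ?w) * cis (Arg ?w))) = cis (2 * Arg ?w - t)"
    using \<open>?w ~= 0\<close> by (simp add: cis_divide cis_mult flip: cis_cnj) (simp add: cis_cnj cis_mult cis_divide algebra_simps)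
  finally show ?thesis .
qed

lemma bprod_circle:
  assumes "\<And>i. i < d ==> cmod (a i) < 1"
  shows "bprod (cis x) a d (cis t) = cis (x + 2 * (\<Sum>i<d. Arg (cis t - a i)) - real d * t)"
proof -
  have "(\<Prod>i<d. bfac (a i) (cis t)) = (\<Prod>i<d. cis (2 * Arg (cis t - a i) - t))"
    using assms by (intro prod.cong refl bfac_circle) auto
  also have "\<dots> = cis (\<Sum>i<d. 2 * Arg (cis t - a i) - t)" by (induction d) (simp_all add: cis_mult add.commute)
  also have "(\<Sum>i<d. 2 * Arg (cis t - a i) - t) = 2 * (\<Sum>i<d. Arg (cis t - a i)) - real d * t"
    by (simp add: sum_subtractf sum_distrib_left)
  finally show ?thesis by (simp add: bprod_def cis_mult algebra_simps)
qed

text \<open>The congruence in (i) is the equation B w = w on the circle, taken in angles and divided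
  by 2 pi. The coefficient d + 1 collects one angle from each of the \<open>d\<close> factors and
  one from the right side.\<close>

lemma bprod_circle_fixed_iff:
  assumes "\<And>i. i < d ==> cmod (a i) < 1"
  shows "bprod (cis (2 * pi * c)) a d (cis (2 * pi * \<theta>)) = cis (2 * pi * \<theta>) \<longleftrightarrow>
    c - ((real d + 1) * \<theta> - (1 / pi) * (\<Sum>i<d. Arg (cis (2 * pi * \<theta>) - a i))) \<in> \<int>"
proof -
  let ?S = "\<Sum>i<d. Arg (cis (2 * pi * \<theta>) - a i)"
  have "(2 * pi * c + 2 * ?S - real d * (2 * pi * \<theta>) - 2 * pi * \<theta>) / (2 * pi) = c - ((real d + 1) * \<theta> - (1 / pi) * ?S)"
    by (simp add: field_simps)
  moreover have "bprod (cis (2 * pi * c)) a d (cis (2 * pi * \<theta>)) = cis (2 * pi * c + 2 * ?S - real d * (2 * pi * \<theta>))"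
    by (rule bprod_circle) (rule assms)
  ultimately show ?thesis unfolding cis_eq_iff_Ints by (simp only: cis_eq_iff_Ints)
qed

text \<open>An attracting fixed point on the circle lies in the Fatou set, so the Julia set is a
  proper subset of the completely invariant circle and hence totally disconnected. Conversely, a
  fixed point in the disk would make the Julia set the whole circle, so the Denjoy-Wolff point lies
  on the circle, and hyperbolicity makes its multiplier smaller than 1.\<close>

theorem blaschke_cantor_iff:
  assumes b: "bdata s a d" and d: "d \<ge> 2"
  shows "hyperbolic (bmap s a d) \<and> julia (bmap s a d) \<subseteq> unit_circle \<and> scantor (julia (bmap s a d)) \<longleftrightarrow>
    (\<exists>w. cmod w = 1 \<and> bprod s a d w = w \<and> blam a d w < 1)"
proof
  let ?B = "bmap s a d"
  have BF: "?B = dF False s a d" and BT: "dT False s a d = bprod s a d" by (simp_all add: dF_def dT_def fun_eq_iff)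
  note R = ratmap_bmap[OF b]
  have sub: "julia ?B \<subseteq> unit_circle" using julia_dF_circle[OF b, of False] by (simp add: BF)
  assume "\<exists>w. cmod w = 1 \<and> bprod s a d w = w \<and> blam a d w < 1"
  then obtain w where w: "cmod w = 1" "bprod s a d w = w" "blam a d w < 1" by blast
  have "hyperbolic ?B" using boundary_hyperbolic[OF b d w(1), of False] w by (simp add: BF BT)
  moreover have "scantor (julia ?B)" unfolding scantor_iff cantor_set_def
  proof (intro conjI ballI allI impI)
    show "compact (julia ?B)" by (rule compact_julia)
    show "julia ?B ~= {}" by (rule julia_nonempty[OF R d])
    show "x islimpt julia ?B" if "x \<in> julia ?B" for x by (rule julia_perfect[OF R d that])
    have "?B (Some w) = Some w" using bmap_Some[OF b, of w] w by simp
    moreover have "cmod (sder ?B (Some w)) < 1" using cmod_sder_dF[OF b w(1), of False] w by (simp add: BF)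
    ultimately have "Some w \<notin> julia ?B" by (rule attracting_fixed_point_fatou[OF R])
    then have ne: "julia ?B ~= unit_circle" using w(1) by (metis Some_circle)
    show "\<exists>a. C \<subseteq> {a}" if "C \<subseteq> julia ?B" "connected C" for C
      by (rule julia_totally_disconnected_on_arc[OF R d arclike_circle connected_unit_circle sub ne bmap_regions(2)[OF b] that])
  qed
  ultimately show "hyperbolic ?B \<and> julia ?B \<subseteq> unit_circle \<and> scantor (julia ?B)" using sub by blast
next
  let ?B = "bmap s a d"
  have BF: "?B = dF False s a d" and BT: "dT False s a d = bprod s a d" by (simp_all add: dF_def dT_def fun_eq_iff)
  assume hyp: "hyperbolic ?B \<and> julia ?B \<subseteq> unit_circle \<and> scantor (julia ?B)"
  from denjoy_wolff[OF b, of False] show "\<exists>w. cmod w = 1 \<and> bprod s a d w = w \<and> blam a d w < 1"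
  proof
    assume "\<exists>z. cmod z < 1 \<and> dT False s a d z = z"
    then obtain z where z: "cmod z < 1" "bprod s a d z = z" by (auto simp: BT)
    have \<phi>: "disk_aut (daut 0 z)" by (rule disk_aut_daut[OF z(1)])
    have "?B (Some z) = Some z" using bmap_Some[OF b, of z] z by simp
    then obtain s' a' where sa: "bdata s' a' d" "a' (d - 1) = 0" "daut 0 z \<circ> ?B = bmap s' a' d \<circ> daut 0 z"
      using disk_conj_is_blaschke[OF b \<phi> daut_zero[OF z(1)]] by blast
    have m: "mobius (daut 0 z)" using disk_aut_cases[OF \<phi>] by blast
    have "julia (bmap s' a' d) = unit_circle" using interior_julia[OF sa(1) d sa(2), of False] by (simp add: dF_def)
    then have "x \<in> julia ?B \<longleftrightarrow> x \<in> unit_circle" for x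
      using julia_mobius_conj(2)[OF m ratmap_bmap[OF b] ratmap_bmap[OF sa(1)] sa(3), of x] disk_aut_srefl(3)[OF \<phi>, of x] by simp
    then have "unit_circle \<subseteq> julia ?B" by blast
    then obtain p where "unit_circle \<subseteq> {p}"
      using hyp connected_unit_circle unfolding scantor_iff cantor_set_def by blast
    moreover have "Some 1 \<in> unit_circle" "Some (-1) \<in> unit_circle" by simp_all
    ultimately have "Some (1::complex) = Some (-1)" by (metis singletonD subsetD)
    then show ?thesis by simp
  next
    assume "\<exists>w. cmod w = 1 \<and> dT False s a d w = w \<and> blam a d w \<le> 1"
    then obtain w where w: "cmod w = 1" "dT False s a d w = w" "blam a d w \<le> 1" by blast
    then have "blam a d w < 1" using boundary_hyperbolic[OF b d w] hyp by (simp add: BF)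
    then show ?thesis using w by (auto simp: BT)
  qed
qed

theorem blaschke_cantor_angle_iff:
  assumes a: "\<forall>i<d. cmod (a i) < 1" and d: "d \<ge> 2"
  shows "hyperbolic (blaschke c a d) \<and> julia (blaschke c a d) \<subseteq> unit_circle \<and> scantor (julia (blaschke c a d)) \<longleftrightarrow>
    (\<exists>\<theta>0. (\<Sum>i<d. (1 - (cmod (a i))\<^sup>2) / (cmod (cis (2 * pi * \<theta>0) - a i))\<^sup>2) < 1 \<and>
      c - ((real d + 1) * \<theta>0 - (1 / pi) * (\<Sum>i<d. Arg (cis (2 * pi * \<theta>0) - a i))) \<in> \<int>)"
proof -
  have b: "bdata (cis (2 * pi * c)) a d" using a d by (simp add: bdata_def)
  have ex: "(\<exists>w. cmod w = 1 \<and> P w) \<longleftrightarrow> (\<exists>\<theta>. P (cis (2 * pi * \<theta>)))" for P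
  proof
    assume "\<exists>w. cmod w = 1 \<and> P w"
    then obtain w where w: "cmod w = 1" "P w" by blast
    have "w = cis (2 * pi * (Arg w / (2 * pi)))" using w(1) rcis_cmod_Arg[of w] by (simp add: rcis_def)
    then show "\<exists>\<theta>. P (cis (2 * pi * \<theta>))" using w(2) by metis
  qed (metis norm_cis)
  show ?thesis
    unfolding blaschke_bmap blaschke_cantor_iff[OF b d] ex blam_def
    using bprod_circle_fixed_iff[of d a c] a by (simp add: conj_commute)
qed

section \<open>Real maps preserving the pair of half-planes\<close>

definition sides :: "bool => (sphere => sphere) => bool" where
  "sides k F \<longleftrightarrow> (\<forall>z\<in>Hplus. (if k then scnj (F z) else F z) \<in> Hplus)"

lemma sides_exists:
  assumes "ratmap d F" "\<And>z. F z \<in> Rhat \<longleftrightarrow> z \<in> Rhat"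
  obtains k where "sides k F"
proof -
  have "sides False F \<or> sides True F" using half_plane_cases[OF assms] by (simp add: sides_def)
  then show thesis using that by blast
qed

lemma sides_iff:
  assumes F: "rrat d F" and inv: "\<And>z. F z \<in> Rhat \<longleftrightarrow> z \<in> Rhat" and k: "sides k F"
  shows "(if k then scnj (F z) else F z) \<in> Hplus \<longleftrightarrow> z \<in> Hplus"
proof
  assume l: "(if k then scnj (F z) else F z) \<in> Hplus"
  show "z \<in> Hplus"
  proof (rule ccontr)
    assume n: "z \<notin> Hplus"
    have "scnj w \<in> Rhat \<longleftrightarrow> w \<in> Rhat" for w unfolding Rhat_iff by (metis scnj_scnj)
    then have "F z \<notin> Rhat" using l Rhat_not_Hplus(1) by (metis (full_types))
    then have "scnj z \<in> Hplus" using inv Rhat_halves[of z] n by blast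
    then have "(if k then scnj (F (scnj z)) else F (scnj z)) \<in> Hplus" using k by (simp add: sides_def)
    then show False using l Rhat_not_Hplus(2) by (cases k) (auto simp: rrat_scnj[OF F])
  qed
qed (use k in \<open>simp add: sides_def\<close>)

lemma real_conj:
  assumes F: "rrat d F" and inv: "\<And>z. F z \<in> Rhat \<longleftrightarrow> z \<in> Rhat" and k: "sides k F"
    and \<psi>: "upper_map \<psi>" "\<psi> z0 = Some r" "\<psi> (F z0) = (if k then None else Some 0)"
  shows "\<exists>s a. bdata s a d \<and> a (d - 1) = r \<and> \<psi> \<circ> F = dF k s a d \<circ> \<psi>"
proof (cases k)
  case True
  have "\<forall>z\<in>Hplus. scnj (F z) \<in> Hplus" using k True by (simp add: sides_def)
  then show ?thesis
    using real_map_is_inverse_blaschke[OF F _ inv \<psi>(1,2)] \<psi>(3) True by (simp add: dF_def)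
next
  case False
  have "\<forall>z\<in>Hplus. F z \<in> Hplus" using k False by (simp add: sides_def)
  then show ?thesis
    using real_map_is_blaschke[OF F _ inv \<psi>(1,2)] \<psi>(3) False by (simp add: dF_def)
qed

lemma upper_map_inverse:
  assumes "upper_map \<psi>"
  obtains \<psi>' where "mobius \<psi>'" "\<And>x. \<psi>' (\<psi> x) = x" "\<And>x. \<psi> (\<psi>' x) = x"
proof -
  have "mobius \<psi>" using assms by (simp add: upper_map_def)
  then obtain \<psi>' where "mobius \<psi>'" "\<psi>' \<circ> \<psi> = id" "\<psi> \<circ> \<psi>' = id" by (rule mobius_inverse)
  then show thesis using that[of \<psi>'] by (simp add: fun_eq_iff)
qed

lemma real_conj_exists:
  assumes F: "rrat d F" and inv: "\<And>z. F z \<in> Rhat \<longleftrightarrow> z \<in> Rhat" and k: "sides k F" and \<psi>: "upper_map \<psi>"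
  obtains s a where "bdata s a d" "\<psi> \<circ> F = dF k s a d \<circ> \<psi>"
proof -
  obtain \<psi>' where i: "mobius \<psi>'" "\<And>x. \<psi>' (\<psi> x) = x" "\<And>x. \<psi> (\<psi>' x) = x" by (rule upper_map_inverse[OF \<psi>]) blast
  obtain z0 where z0: "F z0 = \<psi>' (if k then None else Some 0)"
    using ratmap_surj[OF rrat_ratmap[OF F]] by blast
  have \<psi>z: "\<psi> (F z0) = (if k then None else Some 0)" by (simp add: z0 i)
  have sd: "\<And>z. \<psi> z \<in> sdisk \<longleftrightarrow> z \<in> Hplus" "\<And>z. \<psi> (scnj z) = srefl (\<psi> z)" using \<psi> by (simp_all add: upper_map_def)
  have "(if k then scnj (F z0) else F z0) \<in> Hplus"
    using sd(1)[of "if k then scnj (F z0) else F z0"] \<psi>z by (cases k) (simp_all add: sd(2))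
  then have "\<psi> z0 \<in> sdisk" using sides_iff[OF F inv k] sd(1) by blast
  then obtain r where "\<psi> z0 = Some r" by (auto simp: sdisk_def)
  then show thesis using real_conj[OF F inv k \<psi> _ \<psi>z] that by blast
qed

lemma upper_to_zero:
  assumes "z \<in> Hplus"
  obtains z1 where "cmod z1 < 1" "cayley z = Some z1" "\<And>t. upper_map (daut t z1 \<circ> cayley)"
    "\<And>t. (daut t z1 \<circ> cayley) z = Some 0"
proof -
  have "cayley z \<in> sdisk" using upper_map_cayley assms by (simp add: upper_map_def)
  then obtain z1 where z1: "cmod z1 < 1" "cayley z = Some z1" by (auto simp: sdisk_def)
  then show thesis
    using that[of z1] upper_map_disk_aut[OF disk_aut_daut upper_map_cayley] daut_zero by simp
qed

lemma interior_conj_julia: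
  assumes F: "ratmap d F" and \<psi>: "upper_map \<psi>" and b: "bdata s a d" "a (d - 1) = 0" and d: "d \<ge> 2"
    and conj: "\<psi> \<circ> F = dF k s a d \<circ> \<psi>"
  shows "hyperbolic F" "julia F = Rhat"
proof -
  have m: "mobius \<psi>" using \<psi> by (simp add: upper_map_def)
  show "hyperbolic F"
    using hyperbolic_mobius_conj[OF m F ratmap_dF[OF b(1)] conj] interior_hyperbolic[OF b(1) d b(2)] by simp
  have "z \<in> julia F \<longleftrightarrow> z \<in> Rhat" for z
    using julia_mobius_conj(2)[OF m F ratmap_dF[OF b(1)] conj, of z] interior_julia[OF b(1) d b(2), of k]
      upper_map_circle[OF \<psi>, of z] by simp
  then show "julia F = Rhat" by blast
qed

lemma fixed_conj:
  assumes F: "rrat d F" and inv: "\<And>z. F z \<in> Rhat \<longleftrightarrow> z \<in> Rhat" and k: "sides k F"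
    and \<psi>: "upper_map \<psi>" "\<psi> z = Some 0" and fixed: "F z = (if k then scnj z else z)"
  obtains s a where "bdata s a d" "a (d - 1) = 0" "\<psi> \<circ> F = dF k s a d \<circ> \<psi>"
proof -
  have "\<psi> (scnj z) = srefl (\<psi> z)" using \<psi>(1) by (simp add: upper_map_def)
  then have "\<psi> (F z) = (if k then None else Some 0)" using \<psi>(2) fixed by simp
  then show thesis using real_conj[OF F inv k \<psi>] that by blast
qed

text \<open>Serves as a uniqueness statement: a second fixed point in the upper half-plane would be
  a constant orbit converging to the first.\<close>

lemma interior_fixed_orbits:
  assumes F: "rrat d F" and d: "d \<ge> 2" and inv: "\<And>z. F z \<in> Rhat \<longleftrightarrow> z \<in> Rhat" and k: "sides False F"
    and z: "z \<in> Hplus" "F z = z" and y: "y \<in> Hplus"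
  shows "(\<lambda>n. (F ^^ n) y) \<longlonglongrightarrow> z"
proof -
  obtain z1 where u: "upper_map (daut 0 z1 \<circ> cayley)" "(daut 0 z1 \<circ> cayley) z = Some 0"
    using upper_to_zero[OF z(1)] by metis
  define \<psi> where "\<psi> = daut 0 z1 \<circ> cayley"
  have \<psi>: "upper_map \<psi>" "\<psi> z = Some 0" using u by (simp_all add: \<psi>_def)
  have "F z = (if False then scnj z else z)" using z(2) by simp
  then obtain s a where sa: "bdata s a d" "a (d - 1) = 0" "\<psi> \<circ> F = dF False s a d \<circ> \<psi>"
    by (rule fixed_conj[OF F inv k \<psi>])
  obtain \<psi>' where i: "mobius \<psi>'" "\<And>x. \<psi>' (\<psi> x) = x" "\<And>x. \<psi> (\<psi>' x) = x" by (rule upper_map_inverse[OF \<psi>(1)]) blast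
  have "\<psi> y \<in> sdisk" using \<psi>(1) y by (simp add: upper_map_def)
  then obtain x where x: "cmod x < 1" "\<psi> y = Some x" by (auto simp: sdisk_def)
  have "(\<lambda>n. Some ((dT False s a d ^^ n) x) :: sphere) \<longlonglongrightarrow> Some 0"
    by (intro tendsto_Some interior_fixed(3)[OF sa(1) d sa(2) x(1)])
  moreover have "Some ((dT False s a d ^^ n) x) = \<psi> ((F ^^ n) y)" for n
    using funpow_conj[OF sa(3), of n y] dF_funpow(1)[OF sa(1), of x, where k = False and n = n] x
      funpow_fixed[of id] by (simp add: refl_if_def)
  ultimately have "(\<lambda>n. \<psi>' (\<psi> ((F ^^ n) y))) \<longlonglongrightarrow> \<psi>' (Some 0)"
    using isCont_tendsto_compose[OF ratmap_isCont[OF mobius_ratmap[OF i(1)]]] by simp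
  then show ?thesis using i(2)[of z] \<psi>(2) by (simp add: i)
qed

text \<open>If the sides are exchanged, the interior alternative amounts to a cycle of length 2
  formed by \<open>z\<close> and its mirror image.\<close>

theorem real_denjoy_wolff:
  assumes F: "rrat d F" and d: "d \<ge> 2" and inv: "\<And>z. F z \<in> Rhat \<longleftrightarrow> z \<in> Rhat" and k: "sides k F"
  obtains (interior) z where "z \<in> Hplus" "F z = (if k then scnj z else z)"
  | (boundary) p where "p \<in> Rhat" "F p = p" "cmod (sder F p) \<le> 1" "\<And>z. z \<notin> Rhat ==> (\<lambda>n. (F ^^ n) z) \<longlonglongrightarrow> p"
      "hyperbolic F \<longleftrightarrow> cmod (sder F p) < 1"
proof -
  note U = upper_map_cayley
  obtain s a where sa: "bdata s a d" "cayley \<circ> F = dF k s a d \<circ> cayley" by (rule real_conj_exists[OF F inv k U])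
  have c: "cayley (F z) = dF k s a d (cayley z)" for z using sa(2) by (metis comp_apply)
  obtain \<psi>' where i: "mobius \<psi>'" "\<And>x. \<psi>' (cayley x) = x" "\<And>x. cayley (\<psi>' x) = x" by (rule upper_map_inverse[OF U]) blast
  have up: "\<And>z. cayley z \<in> sdisk \<longleftrightarrow> z \<in> Hplus" "\<And>z. cayley (scnj z) = srefl (cayley z)" using U by (simp_all add: upper_map_def)
  from denjoy_wolff[OF sa(1), of k] show thesis
  proof
    assume "\<exists>z. cmod z < 1 \<and> dT k s a d z = z"
    then obtain x where x: "cmod x < 1" "dT k s a d x = x" by blast
    have "cayley (F (\<psi>' (Some x))) = refl_if k (Some x)" using dF_Some[OF sa(1), of x k] x by (simp add: c i)
    also have "\<dots> = cayley (if k then scnj (\<psi>' (Some x)) else \<psi>' (Some x))" by (simp add: refl_if_def up i)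
    finally have "F (\<psi>' (Some x)) = (if k then scnj (\<psi>' (Some x)) else \<psi>' (Some x))"
      using mobius_eq_iff[OF mobius_cayley] by blast
    moreover have "\<psi>' (Some x) \<in> Hplus" using up(1)[of "\<psi>' (Some x)"] x by (simp add: i)
    ultimately show thesis by (rule interior[rotated])
  next
    assume "\<exists>w. cmod w = 1 \<and> dT k s a d w = w \<and> blam a d w \<le> 1"
    then obtain w where w: "cmod w = 1" "dT k s a d w = w" "blam a d w \<le> 1" by blast
    define p where "p = \<psi>' (Some w)"
    have cp: "cayley p = Some w" by (simp add: p_def i)
    have pR: "p \<in> Rhat" using upper_map_circle[OF U, of p] w by (simp add: cp)
    have "cayley (F p) = cayley p" using dF_boundary_fixed[OF sa(1) w(1,2)] by (simp add: c cp)
    then have Fp: "F p = p" using mobius_eq_iff[OF mobius_cayley] by blast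
    have "sder (dF k s a d) (Some w) = sder F p"
      using sder_mobius_conj(1)[OF mobius_cayley rrat_ratmap[OF F] ratmap_dF[OF sa(1)] sa(2), of p]
        mobius_sder_nonzero[OF mobius_cayley, of p] by (simp add: Fp cp)
    then have sd: "cmod (sder F p) = blam a d w" using cmod_sder_dF[OF sa(1) w(1), of k] by simp
    have "(\<lambda>n. (F ^^ n) z) \<longlonglongrightarrow> p" if "z \<notin> Rhat" for z
    proof -
      have "cayley z \<notin> unit_circle" using upper_map_circle[OF U] that by blast
      then have "(\<lambda>n. (dF k s a d ^^ n) (cayley z)) \<longlonglongrightarrow> Some w" by (rule boundary_orbits[OF sa(1) d w])
      then have "(\<lambda>n. \<psi>' ((dF k s a d ^^ n) (cayley z))) \<longlonglongrightarrow> \<psi>' (Some w)"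
        using isCont_tendsto_compose[OF ratmap_isCont[OF mobius_ratmap[OF i(1)]]] by blast
      then show ?thesis by (simp add: p_def funpow_conj[OF sa(2), symmetric] i)
    qed
    moreover have "hyperbolic F \<longleftrightarrow> cmod (sder F p) < 1"
      using hyperbolic_mobius_conj[OF mobius_cayley rrat_ratmap[OF F] ratmap_dF[OF sa(1)] sa(2)]
        boundary_hyperbolic[OF sa(1) d w] sd by simp
    moreover have "cmod (sder F p) \<le> 1" using sd w by simp
    ultimately show thesis using boundary[of p] pR Fp by blast
  qed
qed

lemma critical_not_real:
  assumes F: "rrat d F" and inv: "\<And>z. F z \<in> Rhat \<longleftrightarrow> z \<in> Rhat" and c: "critical F c"
  shows "c \<notin> Rhat"
proof -
  obtain k where k: "sides k F" using sides_exists[OF rrat_ratmap[OF F] inv] by blast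
  obtain s a where sa: "bdata s a d" "cayley \<circ> F = dF k s a d \<circ> cayley"
    by (rule real_conj_exists[OF F inv k upper_map_cayley])
  have "critical (dF k s a d) (cayley c)"
    using critical_mobius_conj[OF mobius_cayley rrat_ratmap[OF F] ratmap_dF[OF sa(1)] sa(2)] c by simp
  then have "cayley c \<notin> unit_circle" by (rule not_critical_dF[OF sa(1)])
  then show ?thesis using upper_map_circle[OF upper_map_cayley] by blast
qed

section \<open>Hyperbolic maps whose Julia set is the circle\<close>

lemma interior_fixed_julia:
  assumes F: "rrat d F" and d: "d \<ge> 2" and inv: "\<And>z. F z \<in> Rhat \<longleftrightarrow> z \<in> Rhat" and k: "sides k F"
    and z: "z \<in> Hplus" "F z = (if k then scnj z else z)"
  shows "hyperbolic F" "julia F = Rhat"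
proof -
  obtain z1 where u: "upper_map (daut 0 z1 \<circ> cayley)" "(daut 0 z1 \<circ> cayley) z = Some 0"
    using upper_to_zero[OF z(1)] by metis
  obtain s a where "bdata s a d" "a (d - 1) = 0" "(daut 0 z1 \<circ> cayley) \<circ> F = dF k s a d \<circ> (daut 0 z1 \<circ> cayley)"
    by (rule fixed_conj[OF F inv k u z(2)])
  from interior_conj_julia[OF rrat_ratmap[OF F] u(1) this(1,2) d this(3)]
  show "hyperbolic F" "julia F = Rhat" .
qed

text \<open>Conjugation by the rotation \<tau> multiplies the zeros by \<tau> and the leading
  constant by \<tau>^(1 - d), or by \<tau>^(-1 - d) if the sides are exchanged; the equation for
  \<tau> says that the new constant is 1.\<close>

lemma rotate_dF:
  assumes b: "bdata \<sigma> a d" and \<tau>: "cmod \<tau> = 1" "\<tau> ^ d * (if k then \<tau> else 1) = \<sigma> * (if k then 1 else \<tau>)"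
  shows "mob \<tau> 0 0 1 \<circ> dF k \<sigma> a d = dF k 1 (\<lambda>i. \<tau> * a i) d \<circ> mob \<tau> 0 0 1"
proof
  fix z :: sphere
  obtain u v where z: "z = hpt u v" "u ~= 0 \<or> v ~= 0" by (rule hpt_cases)
  have \<tau>0: "\<tau> ~= 0" using \<tau>(1) by auto
  then have det: "\<tau> * 1 - 0 * 0 ~= 0" by simp
  have R: "mob \<tau> 0 0 1 (hpt x y) = hpt (\<tau> * x) y" if "x ~= 0 \<or> y ~= 0" for x y
    using mob_hpt[OF det that] by simp
  have \<tau>\<tau>: "\<tau> * cnj \<tau> = 1" using \<tau>(1) by (simp add: complex_norm_square[symmetric])
  have b': "bdata 1 (\<lambda>i. \<tau> * a i) d" using b \<tau> by (simp add: bdata_def norm_mult)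
  define N where "N = (\<Prod>i<d. u - a i * v)"
  define D where "D = (\<Prod>i<d. v - cnj (a i) * u)"
  have \<sigma>: "\<sigma> ~= 0" using b by (auto simp: bdata_def)
  have B: "bmap \<sigma> a d z = hpt (\<sigma> * N) D" and ND: "\<sigma> * N ~= 0 \<or> D ~= 0"
    using bmap_hpt[OF b z(2)] unfolding z(1) N_def D_def by blast+
  have nz: "\<tau> * u ~= 0 \<or> v ~= 0" using z(2) \<tau>0 by simp
  have "(\<Prod>i<d. \<tau> * u - \<tau> * a i * v) = \<tau> ^ d * N"
    unfolding N_def by (simp add: mult.assoc prod.distrib flip: right_diff_distrib)
  moreover have "(\<Prod>i<d. v - cnj (\<tau> * a i) * (\<tau> * u)) = D"
  proof -
    have "cnj (\<tau> * x) * (\<tau> * u) = (\<tau> * cnj \<tau>) * (cnj x * u)" for x by simp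
    then show ?thesis by (simp only: \<tau>\<tau> mult_1 D_def)
  qed
  ultimately have B': "bmap 1 (\<lambda>i. \<tau> * a i) d (mob \<tau> 0 0 1 z) = hpt (\<tau> ^ d * N) D" and nz': "\<tau> ^ d * N ~= 0 \<or> D ~= 0"
    using bmap_hpt[OF b' nz] unfolding z(1) R[OF z(2)] by (simp_all add: mult.assoc)
  show "(mob \<tau> 0 0 1 \<circ> dF k \<sigma> a d) z = (dF k 1 (\<lambda>i. \<tau> * a i) d \<circ> mob \<tau> 0 0 1) z"
  proof (cases k)
    case False
    then have "\<tau> ^ d = \<sigma> * \<tau>" using \<tau>(2) by simp
    then have "\<tau> ^ d * N = \<tau> * (\<sigma> * N)" by (simp only: mult_ac)
    then show ?thesis using False by (simp only: dF_def B B' R[OF ND] if_False comp_apply simp_thms)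
  next
    case True
    then have "\<tau> ^ d * \<tau> = \<sigma>" using \<tau>(2) by simp
    then have "\<tau> * (\<tau> ^ d * N) = \<sigma> * N" by (metis mult.assoc mult.commute)
    then have h: "hpt (\<tau> * D) (\<sigma> * N) = hpt D (\<tau> ^ d * N)" using hpt_scale[OF \<tau>0, of D "\<tau> ^ d * N"] by (simp only:)
    have "mob \<tau> 0 0 1 (hpt D (\<sigma> * N)) = hpt (\<tau> * D) (\<sigma> * N)" by (rule R) (use ND in blast)
    then show ?thesis
      using True by (simp only: dF_def B B' inv_s_hpt[OF ND] inv_s_hpt[OF nz'] if_True comp_apply h)
  qed
qed

lemma cis_root:
  assumes "cmod \<sigma> = 1" "m > 0"
  obtains t where "cis t ^ m = \<sigma>"
proof -
  have "cis (Arg \<sigma> / real m) ^ m = cis (Arg \<sigma>)" unfolding Complex.DeMoivre using assms(2) by simp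
  also have "\<dots> = \<sigma>" using assms(1) rcis_cmod_Arg[of \<sigma>] by (simp add: rcis_def)
  finally show thesis using that by blast
qed

lemma rotate_daut:
  assumes "cmod b < 1"
  shows "mob (cis t) 0 0 1 \<circ> daut 0 b = daut t b"
proof
  fix z :: sphere
  obtain u v where z: "z = hpt u v" "u ~= 0 \<or> v ~= 0" by (rule hpt_cases)
  have "u - b * v ~= 0 \<or> v - cnj b * u ~= 0"
    using mob_nonzero[OF daut_det[OF assms, of 0] z(2)] by (simp add: algebra_simps)
  then show "(mob (cis t) 0 0 1 \<circ> daut 0 b) z = daut t b z"
    using mob_hpt[of "cis t" 1 0 0] by (simp add: z(1) daut_hpt[OF assms z(2)])
qed

text \<open>A real attracting fixed point would be off the Julia set, so for hyperbolic maps with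
  full Julia set only the interior alternative remains. The disk automorphism sending that point to
  0 is free up to a rotation, which is spent on making the leading constant 1 by extracting a root
  of order d - 1, or d + 1 in the exchanging case.\<close>

theorem hyperbolic_full_julia_iff:
  assumes F: "rrat d F" and d: "d \<ge> 2"
  shows "hyperbolic F \<and> julia F = Rhat \<longleftrightarrow>
    (\<exists>\<phi> (a :: nat => complex). disk_aut \<phi> \<and> (\<forall>i<d-1. cmod (a i) < 1) \<and>
       (\<phi> \<circ> cayley \<circ> F = zblaschke 1 a d \<circ> \<phi> \<circ> cayley \<or> \<phi> \<circ> cayley \<circ> F = inv_s \<circ> zblaschke 1 a d \<circ> \<phi> \<circ> cayley))"
    (is "?L \<longleftrightarrow> ?R")
proof
  assume ?R
  then obtain \<phi> a where \<phi>: "disk_aut \<phi>" and a: "\<forall>i<d-1. cmod (a i) < 1"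
    and conj: "\<phi> \<circ> cayley \<circ> F = zblaschke 1 a d \<circ> \<phi> \<circ> cayley \<or> \<phi> \<circ> cayley \<circ> F = inv_s \<circ> zblaschke 1 a d \<circ> \<phi> \<circ> cayley"
    by blast
  define a' where "a' = a(d - 1 := 0)"
  have b: "bdata 1 a' d" "a' (d - 1) = 0" using a d by (auto simp: bdata_def a'_def)
  have z: "zblaschke 1 a d = bmap 1 a' d" unfolding a'_def using d by (intro zblaschke_bmap') simp
  have "\<exists>k. (\<phi> \<circ> cayley) \<circ> F = dF k 1 a' d \<circ> (\<phi> \<circ> cayley)" using conj
  proof
    assume "\<phi> \<circ> cayley \<circ> F = zblaschke 1 a d \<circ> \<phi> \<circ> cayley"
    then show ?thesis by (intro exI[of _ False]) (simp add: dF_def z comp_assoc)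
  next
    assume "\<phi> \<circ> cayley \<circ> F = inv_s \<circ> zblaschke 1 a d \<circ> \<phi> \<circ> cayley"
    then show ?thesis by (intro exI[of _ True]) (simp add: dF_def z comp_assoc)
  qed
  then obtain k where "(\<phi> \<circ> cayley) \<circ> F = dF k 1 a' d \<circ> (\<phi> \<circ> cayley)" by blast
  from interior_conj_julia[OF rrat_ratmap[OF F] upper_map_disk_aut[OF \<phi> upper_map_cayley] b d this]
  show ?L by blast
next
  assume L: ?L
  have inv: "F z \<in> Rhat \<longleftrightarrow> z \<in> Rhat" for z using julia_invariant[OF rrat_ratmap[OF F]] L by metis
  obtain k where k: "sides k F" using sides_exists[OF rrat_ratmap[OF F] inv] by blast
  show ?R
  proof (rule real_denjoy_wolff[OF F d inv k])
    fix p assume p: "p \<in> Rhat" "F p = p" "hyperbolic F \<longleftrightarrow> cmod (sder F p) < 1"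
    then have "p \<notin> julia F" using attracting_fixed_point_fatou[OF rrat_ratmap[OF F]] L by blast
    then show ?R using p L by blast
  next
    fix z assume z: "z \<in> Hplus" "F z = (if k then scnj z else z)"
    obtain z1 where z1: "cmod z1 < 1" and u: "\<And>t. upper_map (daut t z1 \<circ> cayley)" "\<And>t. (daut t z1 \<circ> cayley) z = Some 0"
      using upper_to_zero[OF z(1)] by metis
    obtain \<sigma> a where sa: "bdata \<sigma> a d" "a (d - 1) = 0" and c: "(daut 0 z1 \<circ> cayley) \<circ> F = dF k \<sigma> a d \<circ> (daut 0 z1 \<circ> cayley)"
      by (rule fixed_conj[OF F inv k u z(2)])
    have \<sigma>: "cmod \<sigma> = 1" using sa(1) by (simp add: bdata_def)
    have "\<exists>t. cis t ^ d * (if k then cis t else 1) = \<sigma> * (if k then 1 else cis t)"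
    proof (cases k)
      case True
      obtain t where "cis t ^ Suc d = \<sigma>" using cis_root[OF \<sigma>, of "Suc d"] by auto
      then show ?thesis using True by (auto simp: mult.commute)
    next
      case False
      obtain t where t: "cis t ^ (d - 1) = \<sigma>" using cis_root[OF \<sigma>, of "d - 1"] d by auto
      have "cis t ^ d = cis t ^ (d - 1) * cis t" using d by (metis power_minus_mult less_le_trans pos2)
      then show ?thesis using False t by auto
    qed
    then obtain t where t: "cis t ^ d * (if k then cis t else 1) = \<sigma> * (if k then 1 else cis t)" by blast
    let ?rot = "mob (cis t) 0 0 1"
    have rot: "?rot \<circ> dF k \<sigma> a d = dF k 1 (\<lambda>i. cis t * a i) d \<circ> ?rot" by (rule rotate_dF[OF sa(1) norm_cis t])
    have rd: "daut t z1 = ?rot \<circ> daut 0 z1" by (simp only: rotate_daut[OF z1])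
    have "daut t z1 \<circ> cayley \<circ> F = ?rot \<circ> ((daut 0 z1 \<circ> cayley) \<circ> F)"
      by (simp only: rd comp_assoc)
    also have "\<dots> = (?rot \<circ> dF k \<sigma> a d) \<circ> (daut 0 z1 \<circ> cayley)" unfolding c by (rule comp_assoc[symmetric])
    also have "\<dots> = dF k 1 (\<lambda>i. cis t * a i) d \<circ> daut t z1 \<circ> cayley"
      unfolding rot by (simp only: rd comp_assoc)
    finally have eq: "daut t z1 \<circ> cayley \<circ> F = dF k 1 (\<lambda>i. cis t * a i) d \<circ> daut t z1 \<circ> cayley" .
    have zb: "zblaschke 1 (\<lambda>i. cis t * a i) d = bmap 1 (\<lambda>i. cis t * a i) d"
      using sa(2) d by (intro zblaschke_bmap) auto
    show ?R
    proof (intro exI[of _ "daut t z1"] exI[of _ "\<lambda>i. cis t * a i"] conjI)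
      show "disk_aut (daut t z1)" by (rule disk_aut_daut[OF z1])
      show "\<forall>i<d-1. cmod (cis t * a i) < 1" using sa(1) by (auto simp: bdata_def norm_mult)
      show "daut t z1 \<circ> cayley \<circ> F = zblaschke 1 (\<lambda>i. cis t * a i) d \<circ> daut t z1 \<circ> cayley \<or>
          daut t z1 \<circ> cayley \<circ> F = inv_s \<circ> zblaschke 1 (\<lambda>i. cis t * a i) d \<circ> daut t z1 \<circ> cayley"
        unfolding zb using eq by (cases k) (simp_all add: dF_def)
    qed
  qed
qed

section \<open>Non-hyperbolic maps and maps fixing infinity\<close>

lemma poly_csharp_real:
  assumes "real_coeffs q"
  shows "poly (csharp d q) z = hpoly q d 1 z"
  using hpoly_cnj[OF assms, of d 1 "cnj z"] by (simp add: poly_csharp)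

lemma coeff_csharp: "j \<le> d ==> coeff (csharp d q) j = cnj (coeff q (d - j))"
proof -
  assume j: "j \<le> d"
  have "coeff (csharp d q) j = (\<Sum>i\<le>d. if d - i = j then cnj (coeff q i) else 0)"
    by (simp add: csharp_def coeff_sum)
  also have "\<dots> = (\<Sum>i\<le>d. if i = d - j then cnj (coeff q i) else 0)"
    using j by (intro sum.cong) auto
  finally show ?thesis by simp
qed

text \<open>In the coordinate 1/z the map is the quotient of the polynomials with reversed
  coefficients, and its derivative at 0 is read off from their lowest terms.\<close>

lemma sder_at_infinity:
  assumes pq: "ratpair (cpoly p) (cpoly q) d" and fix_inf: "rat_eval (cpoly p) (cpoly q) None = None"
  shows "coeff q d = 0" "coeff p d ~= 0"
    "sder (rat_eval (cpoly p) (cpoly q)) None = of_real (coeff q (d - 1) / coeff p d)"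
proof -
  let ?G = "rat_eval (cpoly p) (cpoly q)"
  let ?A = "csharp d (cpoly p)" and ?B = "csharp d (cpoly q)"
  have d: "d > 0" using pq by (simp add: ratpair_def)
  have top: "coeff p d ~= 0 \<or> coeff q d ~= 0" "degree p \<le> d" "degree q \<le> d"
    using pq by (auto simp: ratpair_def)
  have dg: "degree q < degree p" using fix_inf by (simp add: rat_eval_def split: if_splits)
  then show q: "coeff q d = 0" using top by (intro coeff_eq_0) simp
  then show p: "coeff p d ~= 0" using top by blast
  have ev: "?G (hpt 1 x) = hpt (poly ?A x) (poly ?B x)" for x
    using rat_eval_hpt[OF pq, of 1 x] by (simp add: poly_csharp_real real_coeffs_cpoly)
  have A0: "poly ?A 0 = of_real (coeff p d)" and B0: "poly ?B 0 = 0"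
    and B1: "poly (pderiv ?B) 0 = of_real (coeff q (d - 1))"
    using d q by (simp_all add: poly_0_coeff_0 coeff_csharp coeff_pderiv)
  have G: "ratmap d ?G" using pq unfolding ratmap_def by blast
  define H where "H = inv_s \<circ> ?G \<circ> inv_s"
  have H: "ratmap d H" unfolding H_def by (intro ratmap_pre_mobius ratmap_post_mobius mobius_inv_s G)
  have "inv_s \<circ> ?G = H \<circ> inv_s" by (simp add: H_def fun_eq_iff)
  from sder_mobius_conj(1)[OF mobius_inv_s G H this, of None]
  have eq: "sder H (Some 0) = sder ?G None"
    using mobius_sder_nonzero[OF mobius_inv_s, of None] fix_inf by simp
  have "sder H (Some 0) = of_real (coeff q (d - 1)) / of_real (coeff p d)"
  proof (rule sder_Some)
    have "\<forall>\<^sub>F x in nhds 0. poly ?A x ~= 0" by (rule isCont_eventually_ne) (simp_all add: A0 p)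
    then show "\<forall>\<^sub>F x in nhds 0. H (Some x) = Some (poly ?B x / poly ?A x)"
    proof (rule eventually_mono)
      fix x assume x: "poly ?A x ~= 0"
      have "inv_s (Some x) = hpt 1 x" using inv_s_hpt[of x 1] by (simp add: hpt_def)
      then have "H (Some x) = inv_s (hpt (poly ?A x) (poly ?B x))" by (simp add: H_def ev)
      then show "H (Some x) = Some (poly ?B x / poly ?A x)" using x by (subst (asm) inv_s_hpt) (auto simp: hpt_def)
    qed
    show "((\<lambda>x. poly ?B x / poly ?A x) has_field_derivative of_real (coeff q (d - 1)) / of_real (coeff p d)) (at 0)"
      using p by (auto intro!: derivative_eq_intros simp: A0 B0 B1)
  qed
  then show "sder ?G None = of_real (coeff q (d - 1) / coeff p d)" using eq by simp
qed

text \<open>Being real, a multiplier of modulus 1 at infinity is a sign \<epsilon>, and it is the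
  ratio of the coefficient of \<open>q\<close> in degree d - 1 to that of \<open>p\<close> in degree
  \<open>d\<close>. This is what cancels the term of degree \<open>d\<close> in
  \<open>P\<close>.\<close>

theorem infinity_form:
  assumes pq: "ratpair (cpoly p) (cpoly q) d" "G = rat_eval (cpoly p) (cpoly q)"
    and G: "G None = None" "cmod (sder G None) = 1"
  obtains \<epsilon> P where "\<epsilon> \<in> {1, -1}" "P = smult \<epsilon> p - [:0, 1:] * q" "coprime P q" "degree q = d - 1"
    "degree P \<le> d - 1" "G = gmap \<epsilon> P q"
proof -
  have d: "d > 0" using pq(1) by (simp add: ratpair_def)
  note s = sder_at_infinity[OF pq(1) G(1)[unfolded pq(2)]]
  define \<epsilon> where "\<epsilon> = coeff q (d - 1) / coeff p d"
  have "cmod (of_real \<epsilon>) = 1" using G(2) s(3) unfolding pq(2) \<epsilon>_def by simp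
  then have \<epsilon>: "\<epsilon> = 1 \<or> \<epsilon> = -1" unfolding norm_of_real by linarith
  then have \<epsilon>\<epsilon>: "\<epsilon> * \<epsilon> = 1" by auto
  have qd: "coeff q (d - 1) = \<epsilon> * coeff p d" using s(2) by (simp add: \<epsilon>_def)
  have cop: "coprime p q" and mx: "max (degree p) (degree q) = d" using pq(1) ratpair_cpoly_iff[OF d] by blast+
  have "coeff q (d - 1) ~= 0" using qd s(2) \<epsilon> by auto
  then have "d - 1 \<le> degree q" by (rule le_degree)
  moreover have "degree q ~= d" using s(1) d by (metis degree_0 leading_coeff_0_iff less_irrefl)
  ultimately have dq: "degree q = d - 1" using mx by linarith
  define P where "P = smult \<epsilon> p - [:0, 1:] * q"
  have pe: "smult \<epsilon> ([:0, 1:] * q + P) = p" by (simp add: P_def \<epsilon>\<epsilon>)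
  have "degree P \<le> d - 1"
  proof (rule degree_le, intro allI impI)
    fix i assume i: "d - 1 < i"
    then have "coeff P i = \<epsilon> * coeff p i - coeff q (i - 1)" by (cases i) (simp_all add: P_def)
    moreover have "coeff q (i - 1) = \<epsilon> * coeff p i"
    proof (cases "i = d")
      case False
      then have "d < i" using i by linarith
      then have "degree p < i" "degree q < i - 1" using mx dq d by linarith+
      then have "coeff p i = 0" "coeff q (i - 1) = 0" by (auto intro: coeff_eq_0)
      then show ?thesis by simp
    qed (use qd in simp)
    ultimately show "coeff P i = 0" by simp
  qed
  moreover have "coprime P q"
  proof (rule coprimeI)
    fix c assume c: "c dvd P" "c dvd q"
    then have "c dvd smult \<epsilon> ([:0, 1:] * q + P)" by (intro dvd_smult dvd_add dvd_mult)
    then show "is_unit c" using coprime_common_divisor[OF cop, of c] c(2) by (simp only: pe)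
  qed
  moreover have "G = gmap \<epsilon> P q" unfolding gmap_def pe pq(2) ..
  ultimately show thesis using that[of \<epsilon> P] \<epsilon> dq P_def by blast
qed

text \<open>For equal degrees the map is z + \<beta> + o(1) near infinity, so it sends a half-plane
  far out in the direction of \<beta> into itself. This half-plane is in the Fatou set and contains
  real points, which is why a full Julia set forces the strict degree bound when \<epsilon> =
  1.\<close>

lemma gmap_translation_fatou:
  assumes G: "ratmap d (gmap 1 P Q)" and P: "degree P = degree Q" "P ~= 0" "Q ~= 0"
  shows "\<exists>x. Some (of_real x) \<notin> julia (gmap 1 P Q)"
proof -
  define \<beta> where "\<beta> = lead_coeff P / lead_coeff Q"
  have \<beta>: "\<beta> ~= 0" unfolding \<beta>_def divide_eq_0_iff leading_coeff_0_iff using P by blast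
  define \<sigma> where "\<sigma> = sgn \<beta>"
  have \<sigma>: "\<sigma> * \<beta> = \<bar>\<beta>\<bar>" "\<bar>\<sigma>\<bar> = 1" "\<sigma> * \<sigma> = 1" using \<beta> by (auto simp: \<sigma>_def sgn_if)
  have l: "((\<lambda>z. poly (cpoly f) z / z ^ degree f) \<longlongrightarrow> of_real (lead_coeff f)) at_infinity" for f
    using poly_divide_tendsto_aux[of "cpoly f"] by simp
  have "((\<lambda>z. (poly (cpoly P) z / z ^ degree P) / (poly (cpoly Q) z / z ^ degree Q)) \<longlongrightarrow>
      of_real (lead_coeff P) / of_real (lead_coeff Q)) at_infinity"
    using P by (intro tendsto_divide l) simp
  then have "\<forall>\<^sub>F z in at_infinity. dist ((poly (cpoly P) z / z ^ degree P) / (poly (cpoly Q) z / z ^ degree Q)) (of_real \<beta>) < \<bar>\<beta>\<bar>"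
    using \<beta> by (intro tendstoD) (simp_all add: \<beta>_def)
  then obtain R where R: "\<And>z. R \<le> cmod z ==>
      dist ((poly (cpoly P) z / z ^ degree P) / (poly (cpoly Q) z / z ^ degree Q)) (of_real \<beta>) < \<bar>\<beta>\<bar>"
    unfolding eventually_at_infinity by blast
  \<comment> \<open>Positivity keeps 0 and i outside the half-plane, so that they can serve as
    omitted points.\<close>
  define R' where "R' = max R 1"
  define U where "U = Some ` {z. \<sigma> * Re z > R'}"
  have step: "poly (cpoly Q) z ~= 0 \<and> \<sigma> * Re (z + poly (cpoly P) z / poly (cpoly Q) z) > \<sigma> * Re z"
    if z: "\<sigma> * Re z > R'" for z
  proof -
    have "\<sigma> * Re z \<le> \<bar>Re z\<bar>" using \<sigma>(2) by (metis abs_ge_self abs_mult mult_1)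
    then have "R' < cmod z" using z abs_Re_le_cmod[of z] by linarith
    then have z1: "R \<le> cmod z" "z ~= 0" unfolding R'_def by auto
    have "(poly (cpoly P) z / z ^ degree P) / (poly (cpoly Q) z / z ^ degree Q) = poly (cpoly P) z / poly (cpoly Q) z"
      using z1(2) P(1) by simp
    then have n: "cmod (poly (cpoly P) z / poly (cpoly Q) z - of_real \<beta>) < \<bar>\<beta>\<bar>" using R[OF z1(1)] by (simp add: dist_norm)
    define w where "w = poly (cpoly P) z / poly (cpoly Q) z - of_real \<beta>"
    have "\<bar>\<sigma> * Re w\<bar> = \<bar>Re w\<bar>" by (simp add: abs_mult \<sigma>)
    also have "\<dots> < \<sigma> * \<beta>" using n abs_Re_le_cmod[of w] \<sigma>(1) unfolding w_def by linarith
    finally have "\<sigma> * Re w + \<sigma> * \<beta> > 0" by linarith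
    then have "\<sigma> * Re (poly (cpoly P) z / poly (cpoly Q) z) > 0" by (simp add: w_def algebra_simps)
    moreover have "poly (cpoly Q) z ~= 0"
    proof
      assume "poly (cpoly Q) z = 0"
      then show False using n by simp
    qed
    ultimately show ?thesis by (simp add: algebra_simps)
  qed
  have "U \<subseteq> fatou (gmap 1 P Q)"
  proof (rule omit_three_fatou'[OF G, of U None "Some 0" "Some \<i>"])
    have "open {z. \<sigma> * Re z > R'}" by (intro open_Collect_less continuous_intros)
    then show "open U" using open_ichart_image[of _ "Some 0"] unfolding U_def by (simp add: ichart_def)
    show "gmap 1 P Q ` U \<subseteq> U"
    proof
      fix y assume "y \<in> gmap 1 P Q ` U"
      then obtain z where z: "\<sigma> * Re z > R'" "y = gmap 1 P Q (Some z)" by (auto simp: U_def)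
      note st = step[OF z(1)]
      have "y = Some (z + poly (cpoly P) z / poly (cpoly Q) z)"
        using st by (simp add: z(2) gmap_def rat_eval_def cpoly_add cpoly_mult cpoly_pCons cpoly_0 cpoly_smult add_divide_distrib)
      moreover have "z + poly (cpoly P) z / poly (cpoly Q) z \<in> {z. \<sigma> * Re z > R'}"
        using conjunct2[OF st] z(1) by (simp only: mem_Collect_eq)
      ultimately show "y \<in> U" unfolding U_def by blast
    qed
    show "None \<notin> U" "Some 0 \<notin> U" "Some \<i> \<notin> U" by (auto simp: U_def R'_def)
  qed (auto simp: complex_eq_iff)
  moreover have "Some (of_real (\<sigma> * (R' + 1))) \<in> U"
    unfolding U_def by (intro imageI) (simp add: \<sigma> mult.assoc[symmetric])
  ultimately show ?thesis using julia_iff by blast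
qed

text \<open>Failure of hyperbolicity excludes the interior alternative and a multiplier smaller than
  1, so there is a real fixed point with multiplier of modulus 1; it is moved to infinity.\<close>

theorem nonhyperbolic_full_julia_form:
  assumes F: "rrat d F" and d: "d \<ge> 2" and nh: "\<not> hyperbolic F" and J: "julia F = Rhat"
  shows "\<exists>M \<epsilon> P Q. real_mobius M \<and> gform d \<epsilon> P Q \<and> M \<circ> F = gmap \<epsilon> P Q \<circ> M"
proof -
  have inv: "F z \<in> Rhat \<longleftrightarrow> z \<in> Rhat" for z using julia_invariant[OF rrat_ratmap[OF F]] J by metis
  obtain k where k: "sides k F" using sides_exists[OF rrat_ratmap[OF F] inv] by blast
  obtain p where p: "p \<in> Rhat" "F p = p" "cmod (sder F p) = 1"
  proof (rule real_denjoy_wolff[OF F d inv k])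
    fix z assume "z \<in> Hplus" "F z = (if k then scnj z else z)"
    then show thesis using interior_fixed_julia(1)[OF F d inv k] nh by blast
  next
    fix p assume "p \<in> Rhat" "F p = p" "cmod (sder F p) \<le> 1" "hyperbolic F \<longleftrightarrow> cmod (sder F p) < 1"
    then show thesis using nh that[of p] by simp
  qed
  obtain a b c e where M: "a * e - b * c ~= 0" "rmob a b c e p = None" by (rule rmob_to_infinity[OF p(1)])
  define M where "M = rmob a b c e"
  define M' where "M' = rmob e (-b) (-c) a"
  have i: "M' \<circ> M = id" "M \<circ> M' = id" using rmob_inverse[OF M(1)] by (simp_all add: M_def M'_def)
  have mM: "mobius M" unfolding M_def by (rule rmob_mobius[OF M(1)])
  define G where "G = M \<circ> F \<circ> M'"
  have G: "rrat d G" unfolding G_def M_def M'_def by (rule rrat_conj[OF F M(1)])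
  have conj: "M \<circ> F = G \<circ> M" by (simp add: G_def comp_assoc i)
  have MR: "M z \<in> Rhat \<longleftrightarrow> z \<in> Rhat" for z unfolding M_def by (rule rmob_Rhat_iff[OF M(1)])
  have JG: "julia G = Rhat"
  proof -
    have "julia G = M ` Rhat" using julia_mobius_conj(1)[OF mM rrat_ratmap[OF F] rrat_ratmap[OF G] conj] J by simp
    moreover have "M (M' z) = z" for z using i by (simp add: fun_eq_iff)
    ultimately show ?thesis using MR by (auto simp: image_iff) metis
  qed
  have invG: "G z \<in> Rhat \<longleftrightarrow> z \<in> Rhat" for z using julia_invariant[OF rrat_ratmap[OF G]] JG by metis
  have Mp: "M p = None" using M(2) by (simp add: M_def)
  have "G (M p) = M (F p)" using conj by (metis comp_apply)
  then have G0: "G None = None" using p(2) Mp by simp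
  have "sder G None = sder F p"
    using sder_mobius_conj(1)[OF mM rrat_ratmap[OF F] rrat_ratmap[OF G] conj, of p] mobius_sder_nonzero[OF mM, of p] Mp p(2)
    by simp
  then have sG: "cmod (sder G None) = 1" using p(3) by simp
  obtain g Q where gQ: "ratpair (cpoly g) (cpoly Q) d" "G = rat_eval (cpoly g) (cpoly Q)"
    by (rule rrat_real_polys[OF G])
  obtain \<epsilon> P where PQ: "\<epsilon> \<in> {1, -1}" "coprime P Q" "degree Q = d - 1" "degree P \<le> d - 1" "G = gmap \<epsilon> P Q"
    by (rule infinity_form[OF gQ G0 sG]) blast
  have "degree P ~= d - 1" if e1: "\<epsilon> = 1"
  proof
    assume dP: "degree P = d - 1"
    then have "P ~= 0" "Q ~= 0" using PQ(3) d by auto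
    moreover have "ratmap d (gmap 1 P Q)" using rrat_ratmap[OF G] PQ(5) e1 by simp
    ultimately obtain x where "Some (of_real x) \<notin> julia (gmap 1 P Q)"
      using gmap_translation_fatou[of d P Q] PQ(3) dP by auto
    then show False using JG Some_Rhat_iff PQ(5) e1 by simp
  qed
  then have "gform d \<epsilon> P Q"
    unfolding gform_def using PQ critical_not_real[OF G invG] by (auto simp: le_neq_implies_less)
  moreover have "real_mobius M" unfolding M_def by (rule real_mobius_rmob[OF M(1)])
  ultimately show ?thesis using conj PQ(5) by blast
qed

section \<open>Lifting a map through the squaring map\<close>

lemma sign_change_root:
  fixes f :: "real poly"
  assumes "\<And>x. (x - r) * poly f x \<ge> 0"
  shows "poly f r = 0"
proof -
  have t: "(poly f \<longlongrightarrow> poly f r) (at r within S)" for S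
    by (rule tendsto_within_subset[OF _ subset_UNIV]) (use poly_isCont[of r f] in \<open>simp add: isCont_def\<close>)
  have pos: "0 \<le> poly f x" if "r < x" for x using assms[of x] that by (simp add: zero_le_mult_iff)
  have neg: "poly f x \<le> 0" if "x < r" for x using assms[of x] that by (simp add: zero_le_mult_iff)
  have "\<forall>\<^sub>F x in at_right r. 0 \<le> poly f x"
    by (rule eventually_at_rightI[of r "r + 1"]) (use pos in auto)
  then have "0 \<le> poly f r" by (intro tendsto_lowerbound[OF t]) auto
  moreover have "\<forall>\<^sub>F x in at_left r. poly f x \<le> 0"
    by (rule eventually_at_leftI[of "r - 1"]) (use neg in auto)
  then have "poly f r \<le> 0" by (intro tendsto_upperbound[OF t]) auto
  ultimately show ?thesis by simp
qed

lemma nonneg_off_point: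
  fixes f :: "real poly"
  assumes "\<And>x. x ~= r ==> poly f x \<ge> 0"
  shows "poly f x \<ge> 0"
proof (cases "x = r")
  case True
  have "(poly f \<longlongrightarrow> poly f r) (at r)" using poly_isCont[of r f] by (simp add: isCont_def)
  moreover have "\<forall>\<^sub>F y in at r. 0 \<le> poly f y"
    by (rule eventually_mono[OF eventually_neq_at_within[of r]]) (use assms in blast)
  ultimately show ?thesis unfolding True by (rule tendsto_lowerbound) simp
qed (use assms in blast)

text \<open>A sign change at \<open>r\<close> would make the product negative on one side, so after
  one linear factor is removed the cofactor vanishes at \<open>r\<close> again. The sign condition
  that remains extends to \<open>r\<close> by continuity.\<close>

lemma double_root:
  fixes u v :: "real poly"
  assumes pos: "\<And>x. poly u x * poly v x \<ge> 0" and r: "poly u r = 0" "poly v r ~= 0"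
  obtains w where "u = [:- r, 1:]\<^sup>2 * w" "\<And>x. poly w x * poly v x \<ge> 0"
proof -
  obtain u1 where u1: "u = [:- r, 1:] * u1" using r(1) unfolding poly_eq_0_iff_dvd by (elim dvdE)
  have "poly (u1 * v) r = 0"
  proof (rule sign_change_root)
    show "(x - r) * poly (u1 * v) x \<ge> 0" for x using pos[of x] by (simp add: u1 algebra_simps)
  qed
  then have "poly u1 r = 0" using r by simp
  then obtain w where w: "u1 = [:- r, 1:] * w" unfolding poly_eq_0_iff_dvd by (elim dvdE)
  have uw: "u = [:- r, 1:]\<^sup>2 * w" unfolding u1 w power2_eq_square by (simp only: mult.assoc)
  have "poly (w * v) x \<ge> 0" for x
  proof (rule nonneg_off_point)
    fix x assume "x ~= r"
    then have "(x - r)\<^sup>2 > 0" by simp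
    moreover have "(x - r)\<^sup>2 * poly (w * v) x \<ge> 0" using pos[of x] unfolding uw by (simp add: mult.assoc)
    ultimately show "poly (w * v) x \<ge> 0" by (simp add: zero_le_mult_iff)
  qed
  then show thesis using that[OF uw] by simp
qed

lemma cpoly_square_factor: "poly (cpoly ([:- r, 1:]\<^sup>2 * w)) z = (z - of_real r)\<^sup>2 * poly (cpoly w) z"
  unfolding power2_eq_square cpoly_mult poly_mult by (simp add: cpoly_pCons cpoly_0)

lemma degree_square_factor: "w ~= 0 ==> degree ([:- r, 1:]\<^sup>2 * w) = degree (w :: real poly) + 2"
  by (subst degree_mult_eq) (simp_all add: degree_power_eq)

text \<open>Roots are real, not shared, and of even multiplicity because the product keeps its sign.
  Removing double roots one by one leaves two constants of equal sign, and this sign is the common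
  factor \<kappa>.\<close>

theorem nonneg_ratio_squares:
  fixes u v :: "real poly"
  assumes "\<And>x. poly u x * poly v x \<ge> 0"
    and "\<And>z. poly (cpoly u) z = 0 \<or> poly (cpoly v) z = 0 ==> z \<in> \<real>"
    and "\<And>z. poly (cpoly u) z ~= 0 \<or> poly (cpoly v) z ~= 0"
  shows "\<exists>\<kappa> g h. \<kappa> ~= 0 \<and> u = smult \<kappa> (g\<^sup>2) \<and> v = smult \<kappa> (h\<^sup>2)"
  using assms
proof (induction "degree u + degree v" arbitrary: u v rule: less_induct)
  case less
  note pos = less.prems(1) and rt = less.prems(2) and cop = less.prems(3)
  have nR: "\<i> \<notin> \<real>" by (simp add: complex_is_Real_iff)
  have u0: "u ~= 0" using rt[of \<i>] nR by (auto simp: cpoly_0)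
  have v0: "v ~= 0" using rt[of \<i>] nR by (auto simp: cpoly_0)
  have reduce: ?case if red: "(u' = u \<and> v' = v) \<or> (u' = v \<and> v' = u)" and r: "poly u' r = 0" for u' v' :: "real poly" and r
  proof -
    have sym: "degree u + degree v = degree u' + degree v'" using red by auto
    have p': "\<And>x. poly u' x * poly v' x \<ge> 0" using pos red by (auto simp: mult.commute)
    have rt': "z \<in> \<real>" if "poly (cpoly u') z = 0 \<or> poly (cpoly v') z = 0" for z using rt that red by blast
    have cop': "poly (cpoly u') z ~= 0 \<or> poly (cpoly v') z ~= 0" for z using cop red by blast
    have "poly v' r ~= 0" using cop'[of "of_real r"] r by (simp add: poly_cpoly_of_real)
    then obtain w where w: "u' = [:- r, 1:]\<^sup>2 * w" "\<And>x. poly w x * poly v' x \<ge> 0" using double_root[OF p' r] by blast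
    have "u' ~= 0" using red u0 v0 by auto
    then have "w ~= 0" using w(1) by auto
    then have "degree w + degree v' < degree u + degree v" using degree_square_factor[of w r] w(1) sym by simp
    moreover have "z \<in> \<real>" if "poly (cpoly w) z = 0 \<or> poly (cpoly v') z = 0" for z
      using rt'[of z] that unfolding w(1) cpoly_square_factor by auto
    moreover have "poly (cpoly w) z ~= 0 \<or> poly (cpoly v') z ~= 0" for z
      using cop'[of z] unfolding w(1) cpoly_square_factor by auto
    ultimately obtain \<kappa> g h where kgh: "\<kappa> ~= 0" "w = smult \<kappa> (g\<^sup>2)" "v' = smult \<kappa> (h\<^sup>2)"
      using less.hyps[of w v'] w(2) by blast
    have "u' = smult \<kappa> (([:- r, 1:] * g)\<^sup>2)" unfolding w(1) kgh(2) by (simp only: power_mult_distrib mult_smult_right)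
    then show ?thesis using kgh(1,3) red by metis
  qed
  show ?case
  proof (cases "degree u = 0 \<and> degree v = 0")
    case False
    then have "degree (cpoly u) ~= 0 \<or> degree (cpoly v) ~= 0" by simp
    then obtain z where z: "poly (cpoly u) z = 0 \<or> poly (cpoly v) z = 0"
      using fundamental_theorem_of_algebra by (metis constant_degree)
    then obtain r where "z = of_real r" using rt[OF z] by (auto elim: Reals_cases)
    then have "poly u r = 0 \<or> poly v r = 0" using z by (simp add: poly_cpoly_of_real)
    then show ?thesis using reduce by blast
  next
    case True
    then obtain c c' where c: "u = [:c:]" "v = [:c':]" by (metis degree_eq_zeroE)
    have nz: "c ~= 0" "c' ~= 0" "c * c' \<ge> 0" using u0 v0 c pos[of 0] by auto
    have "u = smult (sgn c) ([:sqrt \<bar>c\<bar>:]\<^sup>2)" using nz by (simp add: c power2_eq_square sgn_mult_abs)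
    moreover have "sgn c = sgn c'" using nz by (auto simp: zero_le_mult_iff sgn_if)
    then have "v = smult (sgn c) ([:sqrt \<bar>c'\<bar>:]\<^sup>2)" using nz by (simp add: c power2_eq_square sgn_mult_abs)
    ultimately show ?thesis using nz(1) by (intro exI[of _ "sgn c"]) (auto simp: sgn_zero_iff)
  qed
qed

section \<open>The ray and the squaring map\<close>

definition Ray :: "sphere set" where
  "Ray = insert None ((\<lambda>x. Some (of_real x)) ` {0..})"

lemma Some_Ray: "Some w \<in> Ray \<longleftrightarrow> w \<in> \<real> \<and> Re w \<ge> 0"
proof
  assume "w \<in> \<real> \<and> Re w \<ge> 0"
  then have "Some w = Some (of_real (Re w)) \<and> Re w \<in> {0..}" by (auto elim: Reals_cases)
  then show "Some w \<in> Ray" unfolding Ray_def by (metis imageI insertCI)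
qed (auto simp: Ray_def)

lemma None_Ray [simp]: "None \<in> Ray"
  by (simp add: Ray_def)

lemma quot_neg_simps [simp]: "quot_neg (Some z) = Some (z\<^sup>2)" "quot_neg None = None"
  by (simp_all add: quot_neg_def rat_eval_def power2_eq_square)

lemma square_nonneg_real_iff: "z\<^sup>2 \<in> \<real> \<and> Re (z\<^sup>2) \<ge> 0 \<longleftrightarrow> z \<in> \<real>"
proof
  assume h: "z\<^sup>2 \<in> \<real> \<and> Re (z\<^sup>2) \<ge> 0"
  then have "Re z * Im z = 0" "(Re z)\<^sup>2 \<ge> (Im z)\<^sup>2" by (auto simp: complex_is_Real_iff power2_eq_square)
  then have "Im z = 0" by (cases "Im z = 0") simp_all
  then show "z \<in> \<real>" by (simp add: complex_is_Real_iff)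
qed (auto elim!: Reals_cases simp flip: of_real_power)

lemma quot_neg_Ray: "quot_neg z \<in> Ray \<longleftrightarrow> z \<in> Rhat"
proof (cases z)
  case (Some w)
  then show ?thesis by (simp only: quot_neg_simps Some_Ray square_nonneg_real_iff Some_Rhat_iff)
qed simp

lemma ratmap_quot_neg: "ratmap 2 quot_neg"
proof -
  have "ratpair [:0, 0, 1:] 1 2" by (simp add: ratpair_def numeral_2_eq_2)
  then show ?thesis unfolding ratmap_def quot_neg_def by blast
qed

lemma cpoly_pcompose_sq: "poly (cpoly (pcompose p [:0, 0, 1:])) z = poly (cpoly p) (z\<^sup>2)"
  by (induction p) (simp_all add: pcompose_pCons cpoly_0 cpoly_add cpoly_mult cpoly_pCons power2_eq_square algebra_simps)

text \<open>The square of \<open>g\<close> is even, being a function of x^2 up to a constant; so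
  (g(-x) - g(x)) (g(-x) + g(x)) vanishes and one of the factors is the zero polynomial.\<close>

lemma poly_reflection_square:
  fixes g :: "real poly"
  assumes "pcompose p [:0, 0, 1:] = smult \<kappa> (g\<^sup>2)" "\<kappa> ~= 0"
  obtains c where "c = 1 \<or> c = -1" "\<And>x. poly g (- x) = c * poly g x"
proof -
  let ?g = "pcompose g [:0, -1:]"
  have val: "\<kappa> * (poly g x)\<^sup>2 = poly p (x\<^sup>2)" for x
    using arg_cong[OF assms(1), of "\<lambda>f. poly f x"] by (simp add: poly_pcompose power2_eq_square)
  have "(poly ?g x)\<^sup>2 = (poly g x)\<^sup>2" for x
  proof -
    have "\<kappa> * (poly g (- x))\<^sup>2 = \<kappa> * (poly g x)\<^sup>2" using val[of x] val[of "- x"] by simp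
    then show ?thesis unfolding mult_cancel_left using assms(2) by (simp add: poly_pcompose)
  qed
  then have "poly ((?g - g) * (?g + g)) x = 0" for x by (simp add: power2_eq_square algebra_simps)
  then have "(?g - g) * (?g + g) = 0" by (intro poly_all_0_iff_0[THEN iffD1] allI)
  then have "?g = g \<or> ?g = - g" by (metis add_eq_0_iff2 eq_iff_diff_eq_0 mult_eq_0_iff)
  moreover have pg: "poly ?g x = poly g (- x)" for x by (simp add: poly_pcompose)
  ultimately show thesis
  proof (elim disjE)
    assume h: "?g = g"
    have "poly g (- x) = 1 * poly g x" for x using pg[of x] unfolding h by simp
    then show thesis using that by blast
  next
    assume h: "?g = - g"
    have "poly g (- x) = -1 * poly g x" for x using pg[of x] unfolding h by simp
    then show thesis using that by blast
  qed
qed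

text \<open>The ray is completely invariant and contains 0 and infinity, so zeros and poles of
  F(z^2) are real, and F(x^2) is nonnegative or infinite for real x. By
  \<open>nonneg_ratio_squares\<close>, F(z^2) is the square of a real rational map of the same
  degree as \<open>F\<close>.\<close>

theorem lift_through_square:
  assumes F: "rrat d F" and J: "julia F = Ray"
  obtains g h c e where "ratpair (cpoly g) (cpoly h) d" "quot_neg \<circ> rat_eval (cpoly g) (cpoly h) = F \<circ> quot_neg"
    "c = 1 \<or> c = -1" "\<And>x. poly g (- x) = c * poly g x" "e = 1 \<or> e = -1" "\<And>x. poly h (- x) = e * poly h x"
proof -
  obtain p q where pq: "ratpair (cpoly p) (cpoly q) d" "F = rat_eval (cpoly p) (cpoly q)"
    by (rule rrat_real_polys[OF F])
  have d: "d > 0" using pq(1) by (simp add: ratpair_def)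
  have cop: "poly (cpoly p) z ~= 0 \<or> poly (cpoly q) z ~= 0" for z using pq(1) by (simp add: ratpair_def)
  have inv: "F z \<in> Ray \<longleftrightarrow> z \<in> Ray" for z using julia_invariant[OF rrat_ratmap[OF F], of z] J by simp
  let ?s = "\<lambda>f. pcompose f [:0, 0, 1:] :: real poly"
  have "\<exists>\<kappa> g h. \<kappa> ~= 0 \<and> ?s p = smult \<kappa> (g\<^sup>2) \<and> ?s q = smult \<kappa> (h\<^sup>2)"
  proof (rule nonneg_ratio_squares)
    show "poly (cpoly (?s p)) z ~= 0 \<or> poly (cpoly (?s q)) z ~= 0" for z
      unfolding cpoly_pcompose_sq by (rule cop)
    show "z \<in> \<real>" if "poly (cpoly (?s p)) z = 0 \<or> poly (cpoly (?s q)) z = 0" for z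
    proof -
      have "F (Some (z\<^sup>2)) = Some 0 \<or> F (Some (z\<^sup>2)) = None"
        using that unfolding cpoly_pcompose_sq pq(2) rat_eval_def by auto
      then have "F (quot_neg (Some z)) \<in> Ray" by (auto simp: Some_Ray)
      then show ?thesis using inv quot_neg_Ray Some_Rhat_iff by blast
    qed
    fix x :: real
    have "F (quot_neg (Some (of_real x))) \<in> Ray" using inv quot_neg_Ray Some_Rhat_iff Reals_of_real by blast
    then have "poly q (x\<^sup>2) = 0 \<or> poly p (x\<^sup>2) / poly q (x\<^sup>2) \<ge> 0"
      unfolding pq(2) by (auto simp: rat_eval_def poly_cpoly_of_real Some_Ray simp flip: of_real_power of_real_divide split: if_splits)
    then show "poly (?s p) x * poly (?s q) x \<ge> 0"
      by (auto simp: poly_pcompose power2_eq_square zero_le_divide_iff zero_le_mult_iff)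
  qed
  then obtain \<kappa> g h where kgh: "\<kappa> ~= 0" "?s p = smult \<kappa> (g\<^sup>2)" "?s q = smult \<kappa> (h\<^sup>2)" by blast
  have pz: "poly (cpoly p) (z\<^sup>2) = of_real \<kappa> * (poly (cpoly g) z)\<^sup>2" and qz: "poly (cpoly q) (z\<^sup>2) = of_real \<kappa> * (poly (cpoly h) z)\<^sup>2" for z
    using arg_cong[OF kgh(2), of "\<lambda>f. poly (cpoly f) z"] arg_cong[OF kgh(3), of "\<lambda>f. poly (cpoly f) z"]
    by (simp_all only: cpoly_pcompose_sq cpoly_smult power2_eq_square cpoly_mult poly_smult poly_mult)
  have deg: "degree p = degree g \<and> lead_coeff p = \<kappa> * (lead_coeff g)\<^sup>2" if e: "?s p = smult \<kappa> (g\<^sup>2)" for p g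
  proof -
    have "degree (?s p) = degree p * 2" by (simp add: degree_pcompose)
    moreover have "degree (g\<^sup>2) = 2 * degree g" by (cases "g = 0") (simp_all add: degree_power_eq)
    moreover have "lead_coeff (?s p) = lead_coeff p" using lead_coeff_comp[of "[:0, 0, 1::real:]" p] by simp
    moreover have "lead_coeff (smult \<kappa> (g\<^sup>2)) = \<kappa> * (lead_coeff g)\<^sup>2" unfolding lead_coeff_smult lead_coeff_power ..
    ultimately show ?thesis using e kgh(1) by simp
  qed
  note dp = deg[OF kgh(2)] and dq = deg[OF kgh(3)]
  have gh: "ratpair (cpoly g) (cpoly h) d" unfolding ratpair_def
  proof (intro conjI allI d)
    have m: "max (degree g) (degree h) = d" using pq(1) ratpair_cpoly_iff[OF d] dp dq by metis
    then show "degree (cpoly g) \<le> d" "degree (cpoly h) \<le> d" by auto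
    have "coeff p d ~= 0 \<or> coeff q d ~= 0" using pq(1) by (auto simp: ratpair_def)
    then have "g ~= 0 \<and> degree g = d \<or> h ~= 0 \<and> degree h = d"
    proof
      assume c: "coeff p d ~= 0"
      then have "degree p = d" using le_degree[OF c] m dp by simp
      then show ?thesis using c dp kgh(1) by (metis leading_coeff_0_iff mult_zero_right power_zero_numeral)
    next
      assume c: "coeff q d ~= 0"
      then have "degree q = d" using le_degree[OF c] m dq by simp
      then show ?thesis using c dq kgh(1) by (metis leading_coeff_0_iff mult_zero_right power_zero_numeral)
    qed
    then show "coeff (cpoly g) d ~= 0 \<or> coeff (cpoly h) d ~= 0" unfolding coeff_cpoly of_real_eq_0_iff using leading_coeff_0_iff by metis
    show "poly (cpoly g) z ~= 0 \<or> poly (cpoly h) z ~= 0" for z using cop[of "z\<^sup>2"] unfolding pz qz by auto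
  qed
  have "quot_neg (rat_eval (cpoly g) (cpoly h) z) = F (quot_neg z)" for z
  proof (cases z)
    case (Some w)
    then show ?thesis using kgh(1) by (simp add: pq(2) rat_eval_def pz qz power_divide)
  next
    case None
    show ?thesis
    proof (cases "degree g = degree h")
      case True
      have "coeff p (degree h) = \<kappa> * (coeff g (degree h))\<^sup>2" "coeff q (degree h) = \<kappa> * (lead_coeff h)\<^sup>2"
        using dp dq True by metis+
      then show ?thesis using kgh(1) dp dq True by (simp add: None pq(2) rat_eval_def power_divide)
    qed (use dp dq in \<open>simp add: None pq(2) rat_eval_def\<close>)
  qed
  then have conj: "quot_neg \<circ> rat_eval (cpoly g) (cpoly h) = F \<circ> quot_neg" by (simp add: fun_eq_iff)
  obtain c where c: "c = 1 \<or> c = -1" "\<And>x. poly g (- x) = c * poly g x" by (rule poly_reflection_square[OF kgh(2,1)]) blast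
  obtain e where e: "e = 1 \<or> e = -1" "\<And>x. poly h (- x) = e * poly h x" by (rule poly_reflection_square[OF kgh(3,1)]) blast
  show thesis by (rule that[OF gh conj c e])
qed

text \<open>The argument of \<open>julia_forward\<close> with an open semiconjugacy in place of
  \<open>F\<close>; uniform continuity of \<open>S\<close> carries the estimates along whole
  orbits.\<close>

lemma semiconj_fatou:
  assumes S: "ratmap m S" and G: "ratmap d G" and F: "ratmap d' F" and conj: "S \<circ> G = F \<circ> S" and x: "x \<in> fatou G"
  shows "S x \<in> fatou F"
proof -
  obtain U where U: "open U" "x \<in> U" "\<And>y. y \<in> U ==> eqc G y"
    using x unfolding fatou_iff_eqc[OF ratmap_isCont[OF G]] by blast
  have "eqc F (S y)" if y: "y \<in> U" for y
    unfolding eqc_def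
  proof (intro allI impI)
    fix e :: real assume e: "e > 0"
    have "uniformly_continuous_on UNIV S"
      by (rule compact_uniformly_continuous[OF ratmap_continuous_on[OF S] compact_sphere_UNIV])
    then obtain \<delta>1 where \<delta>1: "\<delta>1 > 0" "\<And>v w. dist v w < \<delta>1 ==> dist (S v) (S w) < e"
      using e unfolding uniformly_continuous_on_def by (metis UNIV_I dist_commute)
    obtain \<delta>2 where \<delta>2: "\<delta>2 > 0" "\<And>w n. dist y w < \<delta>2 ==> dist ((G ^^ n) y) ((G ^^ n) w) < \<delta>1"
      using U(3)[OF y] \<delta>1(1) unfolding eqc_def by blast
    have "open (S ` ball y \<delta>2)" by (rule ratmap_open_map[OF S open_ball])
    moreover have "S y \<in> S ` ball y \<delta>2" using \<delta>2(1) by simp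
    ultimately obtain \<delta>3 where \<delta>3: "\<delta>3 > 0" "ball (S y) \<delta>3 \<subseteq> S ` ball y \<delta>2"
      unfolding open_contains_ball by blast
    have "dist ((F ^^ n) (S y)) ((F ^^ n) w) < e" if w: "dist (S y) w < \<delta>3" for w n
    proof -
      have "w \<in> S ` ball y \<delta>2" using \<delta>3(2) w by auto
      then obtain w' where w': "w = S w'" "dist y w' < \<delta>2" by auto
      show ?thesis unfolding w'(1) funpow_conj[OF conj, symmetric] by (rule \<delta>1(2)[OF \<delta>2(2)[OF w'(2)]])
    qed
    then show "\<exists>\<delta>>0. \<forall>w n. dist (S y) w < \<delta> --> dist ((F ^^ n) (S y)) ((F ^^ n) w) < e" using \<delta>3(1) by blast
  qed
  then have "\<forall>z\<in>S ` U. eqc F z" by blast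
  then show ?thesis
    unfolding fatou_iff_eqc[OF ratmap_isCont[OF F]] using ratmap_open_map[OF S U(1)] U(2) by blast
qed

text \<open>If a Blaschke map commutes with complex conjugation, comparing the zeros inside and outside the disk
  in the identity \<open>B(z) = cnj (B (cnj z))\<close> shows that the zeros are symmetric; evaluating at \<open>1\<close>
  then shows that the leading constant is real.\<close>

lemma conj_symmetric_blaschke:
  assumes b: "bdata s a d" and sym: "\<And>w. cmod w < 1 ==> bmap s a d (Some (cnj w)) = scnj (bmap s a d (Some w))"
  shows "s \<in> {1, -1}" "a ` {..<d} = cnj ` a ` {..<d}"
proof -
  have a: "\<And>i. i < d ==> cmod (a i) < 1" and s: "cmod s = 1" using b by (auto simp: bdata_def)
  let ?A = "\<lambda>a. \<Prod>i<d. [:- a i, 1 :: complex:]" and ?D = "\<lambda>a. \<Prod>i<d. [:1 :: complex, - cnj (a i):]"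
  let ?c = "\<lambda>i. cnj (a i)"
  have vA: "poly (?A f) z = (\<Prod>i<d. z - f i)" for f z by (simp add: poly_prod)
  have vD: "poly (?D f) z = (\<Prod>i<d. 1 - cnj (f i) * z)" for f z by (simp add: poly_prod mult.commute)
  have bp: "bprod s f d z = s * poly (?A f) z / poly (?D f) z" for s f z
    by (simp add: bprod_def bfac_def prod_dividef vA vD)
  have D0: "poly (?D f) z ~= 0" if "\<And>i. i < d ==> cmod (f i) < 1" "cmod z < 1" for f z
    using bfac_denom_nonzero[of "f _" z] that by (auto simp: vD)
  have eq: "s * poly (?A a) z * poly (?D ?c) z = cnj s * poly (?A ?c) z * poly (?D a) z" if z: "cmod z < 1" for z
  proof -
    have "bmap s a d (Some z) = scnj (bmap s a d (Some (cnj z)))" using sym[of "cnj z"] z by simp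
    then have "bprod s a d z = cnj (bprod s a d (cnj z))"
      using bmap_Some[OF b, of z] bmap_Some[OF b, of "cnj z"] z by (simp add: scnj_def)
    also have "\<dots> = bprod (cnj s) ?c d z" by (simp add: bprod_def bfac_def)
    finally have "s * poly (?A a) z / poly (?D a) z = cnj s * poly (?A ?c) z / poly (?D ?c) z" by (simp only: bp)
    moreover have "poly (?D a) z ~= 0" by (rule D0) (use a z in simp_all)
    moreover have "poly (?D ?c) z ~= 0" by (rule D0) (use a z in simp_all)
    ultimately show ?thesis by (simp add: frac_eq_eq mult_ac)
  qed
  have peq: "smult s (?A a * ?D ?c) = smult (cnj s) (?A ?c * ?D a)"
  proof (rule ccontr)
    let ?P = "smult s (?A a * ?D ?c) - smult (cnj s) (?A ?c * ?D a)"
    assume "smult s (?A a * ?D ?c) ~= smult (cnj s) (?A ?c * ?D a)"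
    then have "finite {z. poly ?P z = 0}" by (intro poly_roots_finite) simp
    moreover have "ball 0 1 \<subseteq> {z. poly ?P z = 0}" using eq by (auto simp: mult.assoc)
    ultimately have "finite (ball (0::complex) 1)" by (rule finite_subset[rotated])
    then show False using uncountable_ball[of 1 "0::complex"] countable_finite[of "ball (0::complex) 1"] by simp
  qed
  have s0: "s ~= 0" using s by auto
  have "?A a dvd ?A ?c"
  proof (rule prod_linear_dvd_cancel)
    have "?A a dvd smult s (?A a * ?D ?c)" by (intro dvd_smult dvd_triv_left)
    then have "?A a dvd smult (cnj s) (?A ?c * ?D a)" by (simp only: peq)
    then show "?A a dvd ?D a * ?A ?c" using s0 by (simp add: dvd_smult_iff mult.commute)
    show "poly (?D a) (a i) ~= 0" if "i < d" for i using D0[of a "a i"] a that by blast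
  qed
  then obtain r where r: "?A ?c = ?A a * r" by (elim dvdE)
  have monic: "lead_coeff (?A f) = 1" for f by (simp add: lead_coeff_prod)
  then have nz: "?A f ~= 0" for f by (metis leading_coeff_0_iff zero_neq_one)
  have deg: "degree (?A f) = d" for f by (subst degree_prod_eq_sum_degree) auto
  have "r ~= 0" using r nz[of ?c] by auto
  then have "degree r = 0" using degree_mult_eq[OF nz[of a], of r] deg[of a] deg[of ?c] r by simp
  then obtain r0 where r0: "r = [:r0:]" by (metis degree_eq_zeroE)
  have "lead_coeff (?A ?c) = lead_coeff (?A a) * lead_coeff r" unfolding r by (rule lead_coeff_mult)
  then have "lead_coeff r = 1" unfolding monic by simp
  then have "r = 1" by (simp add: r0 one_pCons)
  then have A: "?A ?c = ?A a" using r by simp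
  show "a ` {..<d} = cnj ` a ` {..<d}"
  proof -
    have roots: "{z. poly (?A f) z = 0} = f ` {..<d}" for f by (auto simp: vA)
    show ?thesis using roots[of a] roots[of ?c] A by (simp add: image_image)
  qed
  define X where "X = poly (?A a) 1"
  have "X ~= 0"
  proof -
    have "1 - a i ~= 0" if "i < d" for i using a[OF that] by auto
    then show ?thesis by (simp add: X_def vA)
  qed
  have D1: "poly (?D ?c) 1 = X" by (simp add: X_def poly_prod)
  have D2: "poly (?D a) 1 = poly (?A ?c) 1" by (simp add: poly_prod)
  have "s * (X * X) = cnj s * (X * X)"
    using arg_cong[OF peq, of "\<lambda>p. poly p 1"] by (simp only: poly_smult poly_mult D1 D2 A X_def[symmetric])
  then have "cnj s = s" using \<open>X ~= 0\<close> by simp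
  then have "s \<in> \<real>" by (simp add: Reals_cnj_iff)
  then obtain x where x: "s = of_real x" by (auto elim: Reals_cases)
  then have "x = 1 \<or> x = -1" using s by auto
  then show "s \<in> {1, -1}" using x by auto
qed

definition quotient_form :: "nat => (sphere => sphere) => (sphere => sphere) => bool" where
  "quotient_form d F M \<longleftrightarrow>
    (\<exists>(s :: complex) (a :: nat => complex). s \<in> {1, -1} \<and> (\<forall>i<d-1. cmod (a i) < 1) \<and>
       a ` {..<d-1} = cnj ` a ` {..<d-1} \<and> F \<circ> (M \<circ> quot_inv) = (M \<circ> quot_inv) \<circ> zblaschke s a d)
   \<or> (\<exists>\<epsilon> P Q. gform d \<epsilon> P Q \<and> ((odd_poly P \<and> even_poly Q) \<or> (even_poly P \<and> odd_poly Q)) \<and>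
       F \<circ> (M \<circ> quot_neg) = (M \<circ> quot_neg) \<circ> gmap \<epsilon> P Q)"

lemma quotient_form_conj:
  assumes Q: "quotient_form d F0 M" and N: "N' \<circ> F0 = F \<circ> N'"
  shows "quotient_form d F (N' \<circ> M)"
proof -
  have step: "F \<circ> (N' \<circ> M \<circ> q) = N' \<circ> M \<circ> q \<circ> Z" if "F0 \<circ> (M \<circ> q) = M \<circ> q \<circ> Z" for q Z :: "sphere => sphere"
  proof -
    have "F \<circ> (N' \<circ> M \<circ> q) = N' \<circ> (F0 \<circ> (M \<circ> q))" by (simp add: comp_assoc[symmetric] N)
    then show ?thesis unfolding that by (simp only: comp_assoc)
  qed
  show ?thesis using Q unfolding quotient_form_def by (meson step)
qed

lemma cpoly_minus: "cpoly (- p) = - cpoly p"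
  using cpoly_diff[of 0 p] by (simp add: cpoly_0)

lemma poly_cpoly_reflect:
  assumes "\<And>x. poly g (- x) = c * poly g x"
  shows "poly (cpoly g) (- z) = of_real c * poly (cpoly g) z" "g ~= 0 ==> c = (- 1) ^ degree g"
proof -
  have eq: "pcompose g [:0, -1:] = smult c g"
    by (simp add: poly_eq_poly_eq_iff[symmetric] fun_eq_iff poly_pcompose assms)
  have "poly (cpoly (pcompose p [:0, -1:])) z = poly (cpoly p) (- z)" for p
    by (induction p) (simp_all add: pcompose_pCons cpoly_0 cpoly_add cpoly_mult cpoly_pCons cpoly_minus)
  then show "poly (cpoly g) (- z) = of_real c * poly (cpoly g) z" by (metis eq cpoly_smult poly_smult)
  assume "g ~= 0"
  moreover have "lead_coeff (pcompose g [:0, -1:]) = lead_coeff g * (-1) ^ degree g"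
    using lead_coeff_comp[of "[:0, -1::real:]" g] by simp
  then have "c * lead_coeff g = lead_coeff g * (-1) ^ degree g" unfolding eq lead_coeff_smult .
  ultimately show "c = (- 1) ^ degree g" by simp
qed

section \<open>Maps whose Julia set is a ray\<close>

definition sneg :: "sphere => sphere" where
  "sneg = mob (-1) 0 0 1"

lemma sneg_hpt: "u ~= 0 \<or> v ~= 0 ==> sneg (hpt u v) = hpt (- u) v"
  using mob_hpt[of "-1" 1 0 0 u v] by (simp add: sneg_def)

lemma sneg_simps [simp]: "sneg (Some w) = Some (- w)" "sneg None = None"
  using sneg_hpt[of w 1] sneg_hpt[of 1 0] by (auto simp: hpt_def)

lemma mobius_sneg: "mobius sneg"
proof -
  have "(-1) * (1::complex) - 0 * 0 ~= 0" by simp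
  then show ?thesis unfolding mobius_def sneg_def by blast
qed

definition axis_refl :: "sphere => sphere" where
  "axis_refl z = scnj (sneg z)"

lemma axis_refl_simps [simp]: "axis_refl (Some w) = Some (- cnj w)" "axis_refl None = None"
  by (simp_all add: axis_refl_def scnj_def)

lemma axis_refl_Hplus: "z \<in> Hplus ==> axis_refl z \<in> Hplus"
  by (cases z) auto

lemma axis_refl_tendsto:
  assumes "(f \<longlongrightarrow> p) F"
  shows "((\<lambda>x. axis_refl (f x)) \<longlongrightarrow> axis_refl p) F"
proof -
  have "isCont scnj q" for q using continuous_on_scnj[of UNIV] by (simp add: continuous_on_eq_continuous_at)
  then show ?thesis unfolding axis_refl_def
    using isCont_tendsto_compose[OF _ isCont_tendsto_compose[OF ratmap_isCont[OF mobius_ratmap[OF mobius_sneg]] assms]] by blast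
qed

lemma Hplus_cases:
  assumes "z \<in> Hplus" obtains w where "z = Some w" "Im w > 0"
  using assms by (auto simp: Hplus_def)

text \<open>The lift \<open>G\<close> is normalised to preserve the upper half-plane; since it is odd or even up to sign and
  \<open>G(-i) = cnj (G i)\<close>, it must be odd.\<close>

lemma normalised_lift:
  assumes F: "rrat d F" and J: "julia F = Ray"
  obtains g h c where "ratpair (cpoly g) (cpoly h) d" "quot_neg \<circ> rat_eval (cpoly g) (cpoly h) = F \<circ> quot_neg"
    "c = 1 \<or> c = -1" "\<And>x. poly g (- x) = c * poly g x" "\<And>x. poly h (- x) = - c * poly h x"
    "rrat d (rat_eval (cpoly g) (cpoly h))" "\<And>z. rat_eval (cpoly g) (cpoly h) z \<in> Rhat \<longleftrightarrow> z \<in> Rhat"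
    "sides False (rat_eval (cpoly g) (cpoly h))"
    "\<And>z. z \<in> Hplus ==> rat_eval (cpoly g) (cpoly h) (axis_refl z) = axis_refl (rat_eval (cpoly g) (cpoly h) z)"
proof -
  obtain g0 h c e where gh: "ratpair (cpoly g0) (cpoly h) d" and conj: "quot_neg \<circ> rat_eval (cpoly g0) (cpoly h) = F \<circ> quot_neg"
    and c: "c = 1 \<or> c = -1" "\<And>x. poly g0 (- x) = c * poly g0 x" and e: "e = 1 \<or> e = -1" "\<And>x. poly h (- x) = e * poly h x"
    by (rule lift_through_square[OF F J]) blast
  have invF: "F z \<in> Ray \<longleftrightarrow> z \<in> Ray" for z using julia_invariant[OF rrat_ratmap[OF F], of z] J by simp
  have inv: "rat_eval (cpoly g) (cpoly h) z \<in> Rhat \<longleftrightarrow> z \<in> Rhat"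
    if "quot_neg \<circ> rat_eval (cpoly g) (cpoly h) = F \<circ> quot_neg" for g z
    using fun_cong[OF that, of z] invF[of "quot_neg z"] quot_neg_Ray by (metis comp_apply)
  have rr: "rrat d (rat_eval (cpoly g) (cpoly h))" if "ratpair (cpoly g) (cpoly h) d" for g
    unfolding rrat_def using that real_coeffs_cpoly by blast
  define G0 where "G0 = rat_eval (cpoly g0) (cpoly h)"
  have R0: "rrat d G0" unfolding G0_def by (rule rr[OF gh])
  obtain k where k: "sides k G0" using sides_exists[OF rrat_ratmap[OF R0]] inv[OF conj] unfolding G0_def by blast
  define g where "g = (if k then - g0 else g0)"
  define G where "G = rat_eval (cpoly g) (cpoly h)"
  have Gz: "G z = (if k then sneg (G0 z) else G0 z)" for z
    by (cases z) (auto simp: G_def G0_def g_def cpoly_minus rat_eval_def)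
  have rp: "ratpair (cpoly g) (cpoly h) d" using gh by (auto simp: g_def cpoly_minus ratpair_def)
  have qs: "quot_neg (sneg z) = quot_neg z" for z by (cases z) auto
  have cG: "quot_neg \<circ> rat_eval (cpoly g) (cpoly h) = F \<circ> quot_neg"
    using fun_cong[OF conj] Gz qs by (auto simp: fun_eq_iff G_def G0_def)
  have R: "rrat d G" unfolding G_def by (rule rr[OF rp])
  have sd: "sides False G" unfolding sides_def
  proof
    fix z assume "z \<in> Hplus"
    then have "(if k then scnj (G0 z) else G0 z) \<in> Hplus" using k by (simp add: sides_def)
    then show "(if False then scnj (G z) else G z) \<in> Hplus" unfolding Gz
      by (cases "G0 z"; cases k) (auto simp: scnj_def)
  qed
  then have GH: "G z \<in> Hplus" if "z \<in> Hplus" for z using that by (simp add: sides_def)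
  have cg: "poly g (- x) = c * poly g x" for x using c(2)[of x] by (simp add: g_def)
  have refl: "poly (cpoly g) (- z) = of_real c * poly (cpoly g) z" "poly (cpoly h) (- z) = of_real e * poly (cpoly h) z" for z
    using poly_cpoly_reflect(1)[of g c z] poly_cpoly_reflect(1)[of h e z] cg e(2) by blast+
  have GS: "G (Some (- w)) = (if c = e then G (Some w) else sneg (G (Some w)))" for w
    using c(1) e(1) by (auto simp: G_def rat_eval_def refl)
  have "c ~= e"
  proof
    assume "c = e"
    then have "G (Some (- \<i>)) = G (Some \<i>)" by (simp add: GS)
    moreover have "G (Some (- \<i>)) = scnj (G (Some \<i>))" using rrat_scnj[OF R, of "Some \<i>"] by (simp add: scnj_def)
    moreover have "G (Some \<i>) \<in> Hplus" by (rule GH) simp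
    ultimately show False using Rhat_not_Hplus(1) Rhat_iff by metis
  qed
  then have ec: "e = - c" using c(1) e(1) by auto
  have ax: "G (axis_refl z) = axis_refl (G z)" if zH: "z \<in> Hplus" for z
  proof -
    obtain w where w: "z = Some w" using zH by (auto simp: Hplus_def)
    have "axis_refl z = scnj (Some (- w))" by (simp add: w scnj_def)
    then have "G (axis_refl z) = scnj (G (Some (- w)))" using rrat_scnj[OF R] by simp
    then show ?thesis using \<open>c ~= e\<close> by (simp add: GS axis_refl_def w)
  qed
  have hc: "poly h (- x) = - c * poly h x" for x using e(2)[of x] ec by simp
  show thesis
    by (rule that[OF rp cG c(1) cg hc R[unfolded G_def] inv[OF cG] sd[unfolded G_def] ax[unfolded G_def]])
qed

section \<open>Comparing the quotients by sign change and by inversion\<close>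

lemma upper_map_scale:
  assumes "y > 0"
  shows "upper_map (cayley \<circ> rmob 1 0 0 y)"
proof -
  have det: "1 * y - 0 * 0 ~= (0::real)" using assms by simp
  let ?S = "rmob 1 0 0 y"
  have "?S z \<in> Hplus \<longleftrightarrow> z \<in> Hplus" for z
  proof -
    obtain u v where z: "z = hpt u v" "u ~= 0 \<or> v ~= 0" by (rule hpt_cases)
    have nz: "u ~= 0 \<or> of_real y * v ~= 0" using z(2) assms by auto
    have "?S z = hpt u (of_real y * v)" unfolding z(1) using rmob_hpt[OF det z(2)] by simp
    moreover have "Im (u * cnj (of_real y * v)) = y * Im (u * cnj v)" by (simp add: algebra_simps)
    ultimately show ?thesis using assms by (simp add: z(1) Hplus_hpt[OF nz] Hplus_hpt[OF z(2)] zero_less_mult_iff)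
  qed
  then show ?thesis
    using upper_map_cayley mobius_compose[OF mobius_cayley rmob_mobius[OF det]] rrat_scnj[OF rrat_rmob[OF det]]
    unfolding upper_map_def by simp
qed

lemma quot_hpt:
  assumes "u ~= 0 \<or> v ~= 0"
  shows "quot_neg (hpt u v) = hpt (u\<^sup>2) (v\<^sup>2)" "quot_inv (hpt u v) = hpt (u\<^sup>2 + v\<^sup>2) (u * v)"
    "u\<^sup>2 + v\<^sup>2 ~= 0 \<or> u * v ~= 0"
proof -
  have 1: "ratpair [:0, 0, 1:] 1 2" by (simp add: ratpair_def numeral_2_eq_2)
  have "poly [:1, 0, 1:] z ~= 0 \<or> poly [:0, 1:] z ~= 0" for z :: complex by (cases "z = 0") simp_all
  then have "\<forall>z::complex. poly [:1, 0, 1:] z ~= 0 \<or> poly [:0, 1:] z ~= 0" by blast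
  moreover have "degree [:1::complex, 0, 1:] \<le> 2" "degree [:0::complex, 1:] \<le> 2" "coeff [:1::complex, 0, 1:] 2 ~= 0"
    by (simp_all add: numeral_2_eq_2)
  ultimately have 2: "ratpair [:1, 0, 1:] [:0, 1:] 2" unfolding ratpair_def by (intro conjI) (assumption | rule pos2 | rule disjI1)+
  have h: "hpoly [:0, 0, 1:] 2 u v = u\<^sup>2" "hpoly 1 2 u v = v\<^sup>2" "hpoly [:1, 0, 1:] 2 u v = u\<^sup>2 + v\<^sup>2" "hpoly [:0, 1:] 2 u v = u * v"
    by (simp_all add: hpoly_def numeral_2_eq_2 one_pCons)
  show "quot_neg (hpt u v) = hpt (u\<^sup>2) (v\<^sup>2)" unfolding quot_neg_def rat_eval_hpt[OF 1 assms] h ..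
  show "quot_inv (hpt u v) = hpt (u\<^sup>2 + v\<^sup>2) (u * v)" unfolding quot_inv_def rat_eval_hpt[OF 2 assms] h ..
  show "u\<^sup>2 + v\<^sup>2 ~= 0 \<or> u * v ~= 0" using ratpair_hpoly_nonzero[OF 2 assms] unfolding h .
qed

text \<open>For w = (z - i y) / (z + i y), changing the sign of z replaces w by 1/w, so w + 1/w is a
  function of z^2, namely 2 (z^2 - y^2) / (z^2 + y^2).\<close>

lemma quot_inv_scale:
  assumes "y > 0"
  shows "quot_inv ((cayley \<circ> rmob 1 0 0 y) z) = rmob 2 (-2 * y\<^sup>2) 1 (y\<^sup>2) (quot_neg z)"
proof -
  have det: "1 * y - 0 * 0 ~= (0::real)" using assms by simp
  have det': "2 * y\<^sup>2 - (-2 * y\<^sup>2) * 1 ~= (0::real)" using assms by simp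
  obtain u v where z: "z = hpt u v" "u ~= 0 \<or> v ~= 0" by (rule hpt_cases)
  define t where "t = of_real y * v"
  have nz: "u ~= 0 \<or> t ~= 0" using z(2) assms by (auto simp: t_def)
  have sq: "u\<^sup>2 ~= 0 \<or> v\<^sup>2 ~= 0" using z(2) by simp
  have "(cayley \<circ> rmob 1 0 0 y) z = hpt (u - \<i> * t) (u + \<i> * t)"
    unfolding z(1) using rmob_hpt[OF det z(2)] cayley_hpt[OF nz] by (simp add: t_def)
  then have "quot_inv ((cayley \<circ> rmob 1 0 0 y) z) = hpt ((u - \<i> * t)\<^sup>2 + (u + \<i> * t)\<^sup>2) ((u - \<i> * t) * (u + \<i> * t))"
    using quot_hpt(2)[OF cayley_nonzero[OF nz]] by simp
  also have "(u - \<i> * t)\<^sup>2 + (u + \<i> * t)\<^sup>2 = of_real 2 * u\<^sup>2 + of_real (-2 * y\<^sup>2) * v\<^sup>2"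
    by (simp add: t_def power2_eq_square algebra_simps)
  also have "(u - \<i> * t) * (u + \<i> * t) = of_real 1 * u\<^sup>2 + of_real (y\<^sup>2) * v\<^sup>2"
    by (simp add: t_def power2_eq_square algebra_simps)
  also have "hpt (of_real 2 * u\<^sup>2 + of_real (-2 * y\<^sup>2) * v\<^sup>2) (of_real 1 * u\<^sup>2 + of_real (y\<^sup>2) * v\<^sup>2) =
      rmob 2 (-2 * y\<^sup>2) 1 (y\<^sup>2) (quot_neg z)"
    unfolding z(1) quot_hpt(1)[OF z(2)] by (rule rmob_hpt[OF det' sq, symmetric])
  finally show ?thesis .
qed

lemma scale_axis_refl:
  assumes "y > 0" "z \<in> Hplus"
  shows "(cayley \<circ> rmob 1 0 0 y) (axis_refl z) = scnj ((cayley \<circ> rmob 1 0 0 y) z)"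
proof -
  have det: "1 * y - 0 * 0 ~= (0::real)" using assms by simp
  obtain w where w: "z = Some w" using Hplus_cases[OF assms(2)] by blast
  have v: "(cayley \<circ> rmob 1 0 0 y) (Some x) = hpt (x - \<i> * of_real y) (x + \<i> * of_real y)" for x
    using rmob_hpt[OF det, of x 1] cayley_hpt[of x "of_real y"] assms(1) by (simp add: hpt_def)
  have "(cayley \<circ> rmob 1 0 0 y) (axis_refl z) = hpt ((-1) * cnj (w - \<i> * of_real y)) ((-1) * cnj (w + \<i> * of_real y))"
    unfolding w axis_refl_simps v by (simp add: algebra_simps)
  also have "\<dots> = hpt (cnj (w - \<i> * of_real y)) (cnj (w + \<i> * of_real y))" by (rule hpt_scale) simp
  finally show ?thesis unfolding w v scnj_hpt .
qed

text \<open>A fixed point of the lift in the upper half-plane attracts its mirror image in the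
  imaginary axis, which is fixed too; hence it is i y. Scaled Cayley coordinates at i y turn the
  axis reflection into complex conjugation, so the zeros of the Blaschke product are symmetric. In
  the boundary case the orbit of i stays on the axis, so its limit is 0 or infinity. Infinity yields
  the polynomial form; for 0 only the convergence of the orbit of -1 = i^2 is recorded, to be
  excluded by a change of coordinate.\<close>

theorem ray_quotient_form:
  assumes F: "rrat d F" and d: "d \<ge> 2" and J: "julia F = Ray"
  shows "(\<exists>a b c e. a * e - b * c ~= 0 \<and> quotient_form d F (rmob a b c e)) \<or>
    (\<lambda>n. (F ^^ n) (Some (-1))) \<longlonglongrightarrow> Some 0"
proof -
  obtain g h c where gh: "ratpair (cpoly g) (cpoly h) d" "quot_neg \<circ> rat_eval (cpoly g) (cpoly h) = F \<circ> quot_neg"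
    and c: "c = 1 \<or> c = -1" and cg: "\<And>x. poly g (- x) = c * poly g x" and ch: "\<And>x. poly h (- x) = - c * poly h x"
    and R': "rrat d (rat_eval (cpoly g) (cpoly h))" "\<And>z. rat_eval (cpoly g) (cpoly h) z \<in> Rhat \<longleftrightarrow> z \<in> Rhat"
      "sides False (rat_eval (cpoly g) (cpoly h))"
      "\<And>z. z \<in> Hplus ==> rat_eval (cpoly g) (cpoly h) (axis_refl z) = axis_refl (rat_eval (cpoly g) (cpoly h) z)"
    by (rule normalised_lift[OF F J]) blast
  define G where "G = rat_eval (cpoly g) (cpoly h)"
  note R = R'[folded G_def] and conj = gh(2)[folded G_def]
  have cj: "F (quot_neg z) = quot_neg (G z)" for z using conj by (metis comp_apply)
  have GH: "G z \<in> Hplus" if "z \<in> Hplus" for z using R(3) that by (simp add: sides_def)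
  have JG: "z \<in> julia G" if "z \<in> Rhat" for z
  proof (rule ccontr)
    assume "z \<notin> julia G"
    then have "quot_neg z \<in> fatou F"
      using semiconj_fatou[OF ratmap_quot_neg rrat_ratmap[OF R(1)] rrat_ratmap[OF F] conj] julia_iff by blast
    then show False using quot_neg_Ray that J julia_iff by blast
  qed
  show ?thesis
  proof (rule real_denjoy_wolff[OF R(1) d R(2,3)])
    fix z assume z: "z \<in> Hplus" "G z = (if False then scnj z else z)"
    then have Gz: "G z = z" by simp
    have "G (axis_refl z) = axis_refl z" using R(4)[OF z(1)] Gz by simp
    then have "(G ^^ n) (axis_refl z) = axis_refl z" for n by (rule funpow_fixed)
    then have "(\<lambda>n. axis_refl z) \<longlonglongrightarrow> z"
      using interior_fixed_orbits[OF R(1) d R(2,3) z(1) Gz axis_refl_Hplus[OF z(1)]] by simp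
    then have az: "axis_refl z = z" by (simp add: LIMSEQ_const_iff)
    obtain w where w: "z = Some w" "Im w > 0" using Hplus_cases[OF z(1)] by blast
    define y where "y = Im w"
    have y: "y > 0" using w by (simp add: y_def)
    have "Re w = 0" using az by (simp add: w complex_eq_iff)
    then have wy: "w = \<i> * of_real y" by (simp add: complex_eq_iff y_def)
    define \<psi> where "\<psi> = cayley \<circ> rmob 1 0 0 y"
    have U: "upper_map \<psi>" unfolding \<psi>_def by (rule upper_map_scale[OF y])
    have det: "1 * y - 0 * 0 ~= (0::real)" using y by simp
    have "\<psi> z = hpt (w - \<i> * of_real y) (w + \<i> * of_real y)"
      using rmob_hpt[OF det, of w 1] cayley_hpt[of w "of_real y"] y by (simp add: \<psi>_def w hpt_def)
    then have \<psi>z: "\<psi> z = Some 0" using y by (simp add: wy hpt_def)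
    obtain s a where sa: "bdata s a d" "a (d - 1) = 0" "\<psi> \<circ> G = dF False s a d \<circ> \<psi>"
      by (rule fixed_conj[OF R(1,2,3) U \<psi>z z(2)])
    have \<psi>G: "\<psi> (G x) = bmap s a d (\<psi> x)" for x using sa(3) by (metis comp_apply dF_def)
    obtain \<psi>' where i: "mobius \<psi>'" "\<And>x. \<psi>' (\<psi> x) = x" "\<And>x. \<psi> (\<psi>' x) = x" by (rule upper_map_inverse[OF U]) blast
    have sym: "bmap s a d (Some (cnj x)) = scnj (bmap s a d (Some x))" if x: "cmod x < 1" for x
    proof -
      define z' where "z' = \<psi>' (Some x)"
      have \<psi>z': "\<psi> z' = Some x" by (simp add: z'_def i)
      have "\<psi> z' \<in> sdisk" using x by (simp add: \<psi>z')
      then have z': "z' \<in> Hplus" using U by (simp add: upper_map_def)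
      have "bmap s a d (Some (cnj x)) = bmap s a d (\<psi> (axis_refl z'))"
        using scale_axis_refl[OF y z'] \<psi>z' by (simp add: \<psi>_def scnj_def)
      also have "\<dots> = \<psi> (axis_refl (G z'))" by (simp add: \<psi>G[symmetric] R(4)[OF z'])
      also have "\<dots> = scnj (\<psi> (G z'))" unfolding \<psi>_def by (rule scale_axis_refl[OF y GH[OF z']])
      finally show ?thesis by (simp add: \<psi>G \<psi>z')
    qed
    have cs: "s \<in> {1, -1}" "a ` {..<d} = cnj ` a ` {..<d}" using conj_symmetric_blaschke[OF sa(1) sym] by blast+
    have split: "f ` {..<d} = insert (f (d - 1)) (f ` {..<d-1})" for f :: "nat => complex"
      using d by (metis Suc_diff_1 image_insert lessThan_Suc less_le_trans pos2)
    have set: "a ` {..<d-1} = cnj ` a ` {..<d-1}"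
    proof -
      have eq: "insert 0 (a ` {..<d-1}) = insert 0 (cnj ` a ` {..<d-1})"
        using cs(2) split[of a] split[of "cnj \<circ> a"] sa(2) by (simp add: image_comp)
      have "0 \<in> a ` {..<d-1} \<longleftrightarrow> 0 \<in> cnj ` a ` {..<d-1}" by force
      then show ?thesis using eq by (metis insert_absorb insert_eq_iff)
    qed
    \<comment> \<open>The adjugate matrix, giving the inverse of the Moebius map in
      \<open>quot_inv_scale\<close>.\<close>
    define M where "M = rmob (y\<^sup>2) (2 * y\<^sup>2) (-1) 2"
    have det2: "2 * y\<^sup>2 - (-2 * y\<^sup>2) * 1 ~= (0::real)" using y by simp
    have Mm: "M (rmob 2 (-2 * y\<^sup>2) 1 (y\<^sup>2) x) = x" for x
      using fun_cong[OF rmob_inverse(1)[OF det2], of x] by (simp add: M_def)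
    have Mq: "M (quot_inv (\<psi> x)) = quot_neg x" for x unfolding \<psi>_def quot_inv_scale[OF y] by (rule Mm)
    have zb: "zblaschke s a d = bmap s a d" using d sa(2) by (intro zblaschke_bmap) simp_all
    have "F \<circ> (M \<circ> quot_inv) = (M \<circ> quot_inv) \<circ> zblaschke s a d"
    proof
      fix x
      have "F (M (quot_inv (\<psi> (\<psi>' x)))) = M (quot_inv (bmap s a d (\<psi> (\<psi>' x))))"
        unfolding Mq cj \<psi>G[symmetric] ..
      then show "(F \<circ> (M \<circ> quot_inv)) x = ((M \<circ> quot_inv) \<circ> zblaschke s a d) x" by (simp add: i zb)
    qed
    moreover have "\<forall>i<d-1. cmod (a i) < 1" using sa(1) by (simp add: bdata_def)
    ultimately have "quotient_form d F M" unfolding quotient_form_def using cs(1) set by blast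
    moreover have "y\<^sup>2 * 2 - (2 * y\<^sup>2) * (-1) ~= (0::real)" using y by simp
    ultimately show ?thesis unfolding M_def by blast
  next
    fix p assume p: "p \<in> Rhat" "G p = p" "cmod (sder G p) \<le> 1" "\<And>z. z \<notin> Rhat ==> (\<lambda>n. (G ^^ n) z) \<longlonglongrightarrow> p"
    have "\<not> cmod (sder G p) < 1" using attracting_fixed_point_fatou[OF rrat_ratmap[OF R(1)] p(2)] JG[OF p(1)] by blast
    then have sd: "cmod (sder G p) = 1" using p(3) by simp
    have orb: "(G ^^ n) (Some \<i>) \<in> Hplus \<and> axis_refl ((G ^^ n) (Some \<i>)) = (G ^^ n) (Some \<i>)" for n
      by (induction n) (auto simp: GH R(4)[symmetric])
    have lim: "(\<lambda>n. (G ^^ n) (Some \<i>)) \<longlonglongrightarrow> p" by (rule p(4)) (simp add: Some_Rhat_iff complex_is_Real_iff)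
    have "axis_refl p = p" using axis_refl_tendsto[OF lim] lim orb LIMSEQ_unique by simp
    then consider "p = Some 0" | "p = None"
      using p(1) by (cases p) (auto simp: Some_Rhat_iff complex_is_Real_iff complex_eq_iff)
    then show ?thesis
    proof cases
      case 1
      have "(\<lambda>n. quot_neg ((G ^^ n) (Some \<i>))) \<longlonglongrightarrow> quot_neg p"
        using isCont_tendsto_compose[OF ratmap_isCont[OF ratmap_quot_neg] lim] .
      then show ?thesis by (simp add: 1 funpow_conj[OF conj])
    next
      case 2
      obtain \<epsilon> P where P: "\<epsilon> \<in> {1, -1}" "P = smult \<epsilon> g - [:0, 1:] * h" "coprime P h" "degree h = d - 1"
        "degree P \<le> d - 1" "G = gmap \<epsilon> P h"
        using infinity_form[OF gh(1) G_def] p(2) sd unfolding 2 by metis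
      have cP: "poly P (- x) = c * poly P x" for x by (simp add: P(2) cg ch algebra_simps)
      \<comment> \<open>\<open>P\<close> and \<open>h\<close> have opposite parities, so
        \<open>P\<close> cannot share the degree d - 1 of \<open>h\<close>; this gives the strict
        bound for both signs \<epsilon>.\<close>
      have "degree P ~= d - 1"
      proof
        assume e: "degree P = d - 1"
        then have nz: "P ~= 0" "h ~= 0" using P(4) d by auto
        have "c = (-1) ^ (d - 1)" using poly_cpoly_reflect(2)[of P c, OF cP nz(1)] e by simp
        moreover have "- c = (-1) ^ (d - 1)" using poly_cpoly_reflect(2)[of h "- c", OF ch nz(2)] P(4) by simp
        ultimately show False using c by auto
      qed
      then have q1: "gform d \<epsilon> P h"
        unfolding gform_def using P critical_not_real[OF R(1,2)] by (auto simp: le_neq_implies_less)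
      have q2: "(odd_poly P \<and> even_poly h) \<or> (even_poly P \<and> odd_poly h)"
        using c cP ch by (auto simp: odd_poly_def even_poly_def)
      have idr: "rmob 1 0 0 1 = id"
      proof
        fix z
        obtain u v where z: "z = hpt u v" "u ~= 0 \<or> v ~= 0" by (rule hpt_cases)
        show "rmob 1 0 0 1 z = id z" unfolding z(1) using rmob_hpt[of 1 1 0 0, OF _ z(2)] by simp
      qed
      have q3: "F \<circ> (rmob 1 0 0 1 \<circ> quot_neg) = (rmob 1 0 0 1 \<circ> quot_neg) \<circ> gmap \<epsilon> P h"
        by (simp only: idr id_comp conj P(6)[symmetric])
      have "quotient_form d F (rmob 1 0 0 1)" unfolding quotient_form_def
        by (rule disjI2, rule exI[of _ \<epsilon>], rule exI[of _ P], rule exI[of _ h], intro conjI) (fact q1 q2 q3)+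
      moreover have "1 * 1 - 0 * 0 ~= (0::real)" by simp
      ultimately show ?thesis by blast
    qed
  qed
qed

section \<open>Julia sets that are intervals\<close>

text \<open>A real point off \<open>J\<close> is sent to infinity, which leaves a compact interval
  [\<alpha>, \<beta>]; then (x - \<alpha>) / (\<beta> - x) takes it to [0, infinity].\<close>

lemma real_interval_normal:
  assumes J: "J \<subseteq> Rhat" "J ~= Rhat" "compact J" "connected J" "infinite J"
  obtains a b c e where "a * e - b * c ~= 0" "rmob a b c e ` J = Ray"
proof -
  obtain y where y: "y \<in> Rhat" "y \<notin> J" using J(1,2) by blast
  obtain a b c e where det: "a * e - b * c ~= 0" and N0y: "rmob a b c e y = None" by (rule rmob_to_infinity[OF y(1)])
  define N0 where "N0 = rmob a b c e"
  have m: "mobius N0" unfolding N0_def by (rule rmob_mobius[OF det])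
  define K0 where "K0 = N0 ` J"
  have cN: "continuous_on S N0" for S by (rule ratmap_continuous_on[OF mobius_ratmap[OF m]])
  have "None \<notin> K0"
  proof
    assume "None \<in> K0"
    then obtain x where "x \<in> J" "N0 x = N0 y" using N0y by (auto simp: K0_def N0_def)
    then show False using mobius_eq_iff[OF m] y(2) by metis
  qed
  moreover have "K0 \<subseteq> Rhat" using J(1) rmob_Rhat_iff[OF det] by (auto simp: K0_def N0_def)
  ultimately have K0: "\<exists>x. z = Some (of_real x)" if zK: "z \<in> K0" for z
  proof -
    have zR: "z \<in> Rhat" using \<open>K0 \<subseteq> Rhat\<close> zK by (rule subsetD)
    obtain w where w: "z = Some w" using \<open>None \<notin> K0\<close> zK by (cases z) simp_all
    then have "w \<in> \<real>" using zR Some_Rhat_iff by simp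
    then show ?thesis using w by (auto elim: Reals_cases)
  qed
  define \<pi> where "\<pi> z = Re (chart (Some 0) z)" for z :: sphere
  have \<pi>: "\<pi> (Some (of_real x)) = x" for x by (simp add: \<pi>_def chart_def)
  have c\<pi>: "continuous_on K0 \<pi>"
  proof -
    have "isCont (chart (Some 0)) z" if "z \<in> K0" for z using K0[OF that] isCont_chart[of z "Some 0"] by (auto simp: antip_def)
    then show ?thesis unfolding \<pi>_def by (intro continuous_on_Re continuous_at_imp_continuous_on) blast
  qed
  have "compact (\<pi> ` K0)" "connected (\<pi> ` K0)"
    using J(3,4) cN c\<pi> by (auto simp: K0_def intro!: compact_continuous_image connected_continuous_image)
  then obtain \<alpha> \<beta> where ab: "\<pi> ` K0 = {\<alpha>..\<beta>}" using connected_compact_interval_1[of "\<pi> ` K0"] by auto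
  have K0eq: "K0 = (\<lambda>x. Some (of_real x)) ` {\<alpha>..\<beta>}"
  proof -
    have "Some (of_real (\<pi> z)) = z" if zK: "z \<in> K0" for z
      using K0[OF zK] \<pi> by (elim exE) simp
    then have "(\<lambda>z. Some (of_real (\<pi> z))) ` K0 = (\<lambda>z. z) ` K0" by (intro image_cong refl)
    then show ?thesis unfolding ab[symmetric] image_image by simp
  qed
  have "infinite K0" unfolding K0_def
    using J(5) finite_imageD[of N0 J] mobius_eq_iff[OF m] by (metis inj_onI)
  then have "infinite {\<alpha>..\<beta>}" unfolding K0eq using finite_imageI by blast
  then have lt: "\<alpha> < \<beta>" by (meson infinite_Icc_iff)
  have det1: "1 * \<beta> - (- \<alpha>) * (- 1) ~= (0::real)" using lt by simp
  define N1 where "N1 = rmob 1 (- \<alpha>) (- 1) \<beta>"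
  have N1: "N1 (Some (of_real x)) = (if x = \<beta> then None else Some (of_real ((x - \<alpha>) / (\<beta> - x))))" for x
    using rmob_hpt[OF det1, of "of_real x" 1] by (simp add: N1_def hpt_def flip: of_real_diff)
  have "N1 ` K0 = Ray"
  proof (intro equalityI subsetI)
    fix z assume "z \<in> N1 ` K0"
    then obtain x where x: "\<alpha> \<le> x" "x \<le> \<beta>" "z = N1 (Some (of_real x))" by (auto simp: K0eq)
    show "z \<in> Ray"
    proof (cases "x = \<beta>")
      case False
      then have "(x - \<alpha>) / (\<beta> - x) \<ge> 0" using x by simp
      then show ?thesis unfolding x(3) N1 if_not_P[OF False] Ray_def by blast
    qed (simp add: x(3) N1)
  next
    fix z assume "z \<in> Ray"
    then consider "z = None" | t where "t \<ge> 0" "z = Some (of_real t)" by (auto simp: Ray_def)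
    then show "z \<in> N1 ` K0"
    proof cases
      case 1
      have "Some (of_real \<beta>) \<in> K0" using lt by (auto simp: K0eq)
      moreover have "z = N1 (Some (of_real \<beta>))" unfolding N1 1 by simp
      ultimately show ?thesis by blast
    next
      case 2
      define x where "x = (\<beta> * t + \<alpha>) / (1 + t)"
      have t1: "1 + t > 0" using 2 by simp
      have xb: "\<beta> - x = (\<beta> - \<alpha>) / (1 + t)" and xa: "x - \<alpha> = t * (\<beta> - \<alpha>) / (1 + t)"
        using t1 by (simp_all add: x_def field_simps)
      have "\<beta> - x > 0" "x - \<alpha> \<ge> 0" unfolding xb xa using t1 lt 2 by simp_all
      then have "Some (of_real x) \<in> K0" "x ~= \<beta>" by (auto simp: K0eq)
      moreover have "(x - \<alpha>) / (\<beta> - x) = t" unfolding xa xb using t1 lt by simp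
      ultimately have "N1 (Some (of_real x)) = z" by (simp add: N1 2)
      then show ?thesis using \<open>Some (of_real x) \<in> K0\<close> by blast
    qed
  qed
  then have "(N1 \<circ> N0) ` J = Ray" by (simp add: K0_def image_comp)
  then show thesis using that rmob_compose[OF det1 det] unfolding N1_def N0_def by metis
qed

section \<open>Exchanging the two ends of the ray\<close>

lemma inversion_simps:
  "rmob 0 1 1 0 (Some (-1)) = Some (-1)" "rmob 0 1 1 0 (Some 0) = None" "rmob 0 1 1 0 None = Some 0"
  "x ~= 0 ==> rmob 0 1 1 0 (Some (of_real x)) = Some (of_real (1 / x))"
proof -
  have det: "0 * 0 - 1 * 1 ~= (0::real)" by simp
  show "rmob 0 1 1 0 (Some (-1)) = Some (-1)" "rmob 0 1 1 0 (Some 0) = None" "rmob 0 1 1 0 None = Some 0"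
    "x ~= 0 ==> rmob 0 1 1 0 (Some (of_real x)) = Some (of_real (1 / x))"
    using rmob_hpt[OF det, of "-1" 1] rmob_hpt[OF det, of 0 1] rmob_hpt[OF det, of 1 0] rmob_hpt[OF det, of "of_real x" 1]
    by (simp_all add: hpt_def)
qed

lemma inversion_Ray: "rmob 0 1 1 0 ` Ray = Ray"
proof -
  have det: "0 * 0 - 1 * 1 ~= (0::real)" by simp
  have in_Ray: "rmob 0 1 1 0 z \<in> Ray" if z: "z \<in> Ray" for z
  proof (cases z)
    case (Some w)
    then obtain t where t: "t \<ge> 0" "w = of_real t" using z by (auto simp: Ray_def)
    have "rmob 0 1 1 0 z = (if t = 0 then None else Some (of_real (1 / t)))"
      using inversion_simps(2) inversion_simps(4)[of t] by (simp add: Some t)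
    then show ?thesis using t(1) by (simp add: Some_Ray del: of_real_divide)
  qed (simp add: inversion_simps Some_Ray)
  have invol: "rmob 0 1 1 0 (rmob 0 1 1 0 z) = z" for z
  proof -
    obtain u v where z: "z = hpt u v" "u ~= 0 \<or> v ~= 0" by (rule hpt_cases)
    have "v ~= 0 \<or> u ~= 0" using z(2) by blast
    then show ?thesis using rmob_hpt[OF det z(2)] rmob_hpt[OF det, of v u] by (simp add: z(1))
  qed
  show ?thesis
  proof (intro equalityI subsetI)
    fix z assume "z \<in> Ray"
    then show "z \<in> rmob 0 1 1 0 ` Ray" using in_Ray[of z] invol[of z] by (metis imageI)
  qed (use in_Ray in blast)
qed

lemma ray_chart_quotient_form:
  assumes F: "rrat d F" and d: "d \<ge> 2" and N: "a * e - b * c ~= 0" "rmob a b c e ` julia F = Ray"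
  shows "(\<exists>M. real_mobius M \<and> quotient_form d F M) \<or>
    (\<lambda>n. ((rmob a b c e \<circ> F \<circ> rmob e (-b) (-c) a) ^^ n) (Some (-1))) \<longlonglongrightarrow> Some 0"
proof -
  define N N' where "N = rmob a b c e" and "N' = rmob e (-b) (-c) a"
  have i: "N' \<circ> N = id" "N \<circ> N' = id" using rmob_inverse[OF N(1)] by (simp_all add: N_def N'_def)
  define F0 where "F0 = N \<circ> F \<circ> N'"
  have F0: "rrat d F0" unfolding F0_def N_def N'_def by (rule rrat_conj[OF F N(1)])
  have conj: "N \<circ> F = F0 \<circ> N" by (simp add: F0_def comp_assoc i)
  have "mobius N" unfolding N_def by (rule rmob_mobius[OF N(1)])
  then have J0: "julia F0 = Ray"
    using julia_mobius_conj(1)[OF _ rrat_ratmap[OF F] rrat_ratmap[OF F0] conj] N(2) by (simp add: N_def)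
  have conj': "N' \<circ> F0 = F \<circ> N'" by (rule conj_swap(1)[OF i conj])
  from ray_quotient_form[OF F0 d J0] show ?thesis
  proof
    assume "\<exists>a b c e. a * e - b * c ~= 0 \<and> quotient_form d F0 (rmob a b c e)"
    then obtain \<alpha> \<beta> \<gamma> \<delta> where m: "\<alpha> * \<delta> - \<beta> * \<gamma> ~= 0" "quotient_form d F0 (rmob \<alpha> \<beta> \<gamma> \<delta>)" by blast
    have "quotient_form d F (N' \<circ> rmob \<alpha> \<beta> \<gamma> \<delta>)" by (rule quotient_form_conj[OF m(2) conj'])
    moreover have "real_mobius (N' \<circ> rmob \<alpha> \<beta> \<gamma> \<delta>)"
      unfolding N'_def rmob_compose(1)[OF rmob_det_inverse[OF N(1)] m(1)]
      by (rule real_mobius_rmob[OF rmob_compose(2)[OF rmob_det_inverse[OF N(1)] m(1)]])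
    ultimately show ?thesis by blast
  next
    assume "(\<lambda>n. (F0 ^^ n) (Some (-1))) \<longlonglongrightarrow> Some 0"
    then show ?thesis unfolding F0_def N_def N'_def by blast
  qed
qed

text \<open>The two ends of the interval can be put at infinity in turn; the two coordinates differ
  by inversion, which fixes -1. If neither gave a quotient form, the orbit of -1 would converge to 0
  in both, that is, to both ends of the interval.\<close>

theorem interval_julia_quotient:
  assumes F: "rrat d F" and d: "d \<ge> 2" and J: "julia F \<subseteq> Rhat" "julia F ~= Rhat" "connected (julia F)"
  shows "\<exists>M. real_mobius M \<and> quotient_form d F M"
proof (rule ccontr)
  assume none: "\<not> (\<exists>M. real_mobius M \<and> quotient_form d F M)"
  obtain a b c e where N: "a * e - b * c ~= 0" "rmob a b c e ` julia F = Ray"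
    by (rule real_interval_normal[OF J(1,2) compact_julia J(3) infinite_julia[OF rrat_ratmap[OF F] d]])
  have det: "0 * 0 - 1 * 1 ~= (0::real)" by simp
  let ?i = "rmob 0 1 1 0"
  define F0 where "F0 = rmob a b c e \<circ> F \<circ> rmob e (-b) (-c) a"
  define F1 where "F1 = rmob c e a b \<circ> F \<circ> rmob b (-e) (-a) c"
  have iN: "?i \<circ> rmob a b c e = rmob c e a b" using rmob_compose(1)[OF det N(1)] by simp
  have det': "c * b - e * a ~= 0" using rmob_compose(2)[OF det N(1)] by simp
  have "rmob c e a b ` julia F = ?i ` (rmob a b c e ` julia F)" unfolding iN[symmetric] by (simp add: image_comp)
  then have N2: "rmob c e a b ` julia F = Ray" by (simp only: N(2) inversion_Ray)
  have l0: "(\<lambda>n. (F0 ^^ n) (Some (-1))) \<longlonglongrightarrow> Some 0"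
    using ray_chart_quotient_form[OF F d N] none unfolding F0_def by blast
  have l1: "(\<lambda>n. (F1 ^^ n) (Some (-1))) \<longlonglongrightarrow> Some 0"
    using ray_chart_quotient_form[OF F d det' N2] none unfolding F1_def by blast
  have inv: "rmob e (-b) (-c) a \<circ> rmob a b c e = id" "rmob b (-e) (-a) c \<circ> rmob c e a b = id" "rmob c e a b \<circ> rmob b (-e) (-a) c = id"
    "rmob a b c e \<circ> rmob e (-b) (-c) a = id"
    using rmob_inverse[OF N(1)] rmob_inverse[OF det'] by simp_all
  have "?i \<circ> F0 = rmob c e a b \<circ> F \<circ> rmob e (-b) (-c) a" unfolding F0_def iN[symmetric] by (simp only: comp_assoc)
  also have "\<dots> = F1 \<circ> rmob c e a b \<circ> rmob e (-b) (-c) a" unfolding F1_def by (simp add: comp_assoc inv)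
  also have "\<dots> = F1 \<circ> ?i" unfolding iN[symmetric] by (simp add: comp_assoc inv)
  finally have conj: "?i \<circ> F0 = F1 \<circ> ?i" .
  have "(\<lambda>n. ?i ((F0 ^^ n) (Some (-1)))) \<longlonglongrightarrow> ?i (Some 0)"
    using isCont_tendsto_compose[OF ratmap_isCont[OF rrat_ratmap[OF rrat_rmob[OF det]]] l0] .
  then have "(\<lambda>n. (F1 ^^ n) (Some (-1))) \<longlonglongrightarrow> None" by (simp add: funpow_conj[OF conj] inversion_simps)
  then show False using LIMSEQ_unique[OF l1] by blast
qed

theorem theorem1p3:
  fixes d :: nat
  assumes "d \<ge> 2"
  shows
   "(\<forall>F. real_rational_map F d \<and> htop F Rhat = ereal (ln (real d)) \<longrightarrow>
        julia F \<subseteq> Rhat \<and>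
        (julia F = Rhat \<or> (sconnected (julia F) \<and> julia F \<noteq> Rhat) \<or> scantor (julia F)))
  \<and> (\<forall>(a :: nat \<Rightarrow> complex) (c :: real). (\<forall>i<d. cmod (a i) < 1) \<longrightarrow>
        ((hyperbolic (blaschke c a d) \<and> julia (blaschke c a d) \<subseteq> unit_circle
            \<and> scantor (julia (blaschke c a d)))
         \<longleftrightarrow> (\<exists>\<theta>0 :: real.
               (\<Sum>i<d. (1 - (cmod (a i))\<^sup>2) / (cmod (cis (2 * pi * \<theta>0) - a i))\<^sup>2) < 1 \<and>
               c - ((real d + 1) * \<theta>0 - (1 / pi) * (\<Sum>i<d. Arg (cis (2 * pi * \<theta>0) - a i))) \<in> \<int>)))
  \<and> (\<forall>F. real_rational_map F d \<longrightarrow>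
        ((hyperbolic F \<and> julia F = Rhat) \<longleftrightarrow>
         (\<exists>\<phi> (a :: nat \<Rightarrow> complex). disk_aut \<phi> \<and> (\<forall>i<d-1. cmod (a i) < 1) \<and>
            (\<phi> \<circ> cayley \<circ> F = zblaschke 1 a d \<circ> \<phi> \<circ> cayley \<or>
             \<phi> \<circ> cayley \<circ> F = inv_s \<circ> zblaschke 1 a d \<circ> \<phi> \<circ> cayley))))
  \<and> (\<forall>F. real_rational_map F d \<and> \<not> hyperbolic F \<and> julia F = Rhat \<longrightarrow>
        (\<exists>M \<epsilon> P Q. real_mobius M \<and> gform d \<epsilon> P Q \<and> M \<circ> F = gmap \<epsilon> P Q \<circ> M))
  \<and> (\<forall>F. real_rational_map F d \<and> julia F \<subseteq> Rhat \<and> julia F \<noteq> Rhat \<and> sconnected (julia F) \<longrightarrow>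
        (\<exists>M. real_mobius M \<and>
          ((\<exists>(s :: complex) (a :: nat \<Rightarrow> complex). s \<in> {1, -1} \<and> (\<forall>i<d-1. cmod (a i) < 1) \<and>
              a ` {..<d-1} = cnj ` a ` {..<d-1} \<and>
              F \<circ> (M \<circ> quot_inv) = (M \<circ> quot_inv) \<circ> zblaschke s a d)
           \<or> (\<exists>\<epsilon> P Q. gform d \<epsilon> P Q \<and>
              ((odd_poly P \<and> even_poly Q) \<or> (even_poly P \<and> odd_poly Q)) \<and>
              F \<circ> (M \<circ> quot_neg) = (M \<circ> quot_neg) \<circ> gmap \<epsilon> P Q))))"
proof (intro conjI allI impI)
  have d0: "d > 0" using assms by simp
  note rr = real_rational_map_rrat[OF _ d0]
  {
    fix F assume F: "real_rational_map F d \<and> htop F Rhat = ereal (ln (real d))"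
    have "julia F \<subseteq> Rhat \<and> (julia F = Rhat \<or> (sconnected (julia F) \<and> julia F \<noteq> Rhat) \<or> scantor (julia F))"
      by (rule max_entropy_trichotomy[OF rr assms]) (use F in blast)+
    then show "julia F \<subseteq> Rhat"
      "julia F = Rhat \<or> (sconnected (julia F) \<and> julia F \<noteq> Rhat) \<or> scantor (julia F)" by blast+
  next
    fix a :: "nat \<Rightarrow> complex" and c :: real
    assume "\<forall>i<d. cmod (a i) < 1"
    then show "(hyperbolic (blaschke c a d) \<and> julia (blaschke c a d) \<subseteq> unit_circle \<and> scantor (julia (blaschke c a d)))
         \<longleftrightarrow> (\<exists>\<theta>0 :: real.
               (\<Sum>i<d. (1 - (cmod (a i))\<^sup>2) / (cmod (cis (2 * pi * \<theta>0) - a i))\<^sup>2) < 1 \<and>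
               c - ((real d + 1) * \<theta>0 - (1 / pi) * (\<Sum>i<d. Arg (cis (2 * pi * \<theta>0) - a i))) \<in> \<int>)"
      by (rule blaschke_cantor_angle_iff[OF _ assms])
  next
    fix F assume "real_rational_map F d"
    then show "(hyperbolic F \<and> julia F = Rhat) \<longleftrightarrow>
         (\<exists>\<phi> (a :: nat \<Rightarrow> complex). disk_aut \<phi> \<and> (\<forall>i<d-1. cmod (a i) < 1) \<and>
            (\<phi> \<circ> cayley \<circ> F = zblaschke 1 a d \<circ> \<phi> \<circ> cayley \<or>
             \<phi> \<circ> cayley \<circ> F = inv_s \<circ> zblaschke 1 a d \<circ> \<phi> \<circ> cayley))"
      by (rule hyperbolic_full_julia_iff[OF rr assms])
  next
    fix F assume F: "real_rational_map F d \<and> \<not> hyperbolic F \<and> julia F = Rhat"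
    show "\<exists>M \<epsilon> P Q. real_mobius M \<and> gform d \<epsilon> P Q \<and> M \<circ> F = gmap \<epsilon> P Q \<circ> M"
      by (rule nonhyperbolic_full_julia_form[OF rr assms]) (use F in blast)+
  next
    fix F assume F: "real_rational_map F d \<and> julia F \<subseteq> Rhat \<and> julia F \<noteq> Rhat \<and> sconnected (julia F)"
    then have "connected (julia F)" by (simp add: sconnected_iff_connected)
    with F show "\<exists>M. real_mobius M \<and>
          ((\<exists>(s :: complex) (a :: nat \<Rightarrow> complex). s \<in> {1, -1} \<and> (\<forall>i<d-1. cmod (a i) < 1) \<and>
              a ` {..<d-1} = cnj ` a ` {..<d-1} \<and>
              F \<circ> (M \<circ> quot_inv) = (M \<circ> quot_inv) \<circ> zblaschke s a d)
           \<or> (\<exists>\<epsilon> P Q. gform d \<epsilon> P Q \<and>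
              ((odd_poly P \<and> even_poly Q) \<or> (even_poly P \<and> odd_poly Q)) \<and>
              F \<circ> (M \<circ> quot_neg) = (M \<circ> quot_neg) \<circ> gmap \<epsilon> P Q))"
      using interval_julia_quotient[OF rr assms, of F] unfolding quotient_form_def by blast
  }
qed

end
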